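(* Let $d\ge 2$, let $\Delta$ be a $G_\delta$-subset of $P(\mathbb R^d)$ and let $D$ be a countable subset of $\Delta$. Then there is a Poisson action $V=(V_g)_{g\in\mathbb R^d}$ of $\mathbb R^d$ of $0$ entropy such that for each nonzero $g\in\mathbb R^d$ with $g\notin\bigcup_{\theta\in\Delta}\theta$, the transformation $V_g$ is Bernoulli and of infinite entropy, and for each $g\in\bigcup_{\theta\in D}\theta$, the transformation $V_g$ is rigid (and hence of $0$ entropy).
   Context: $P(\mathbb R^d)$ is the set of lines (1-dimensional linear subspaces) in $\mathbb R^d$ with the usual topology of projective space; each $\theta\in P(\mathbb R^d)$ is regarded as a subset of $\mathbb R^d$. For an infinite $\sigma$-finite non-atomic standard measure space $(X,\mu)$, the Poisson suspension $(X^\bullet,\mu^\bullet)$ is the standard probability space of countable point configurations (counting measures) on $X$, where $\mu^\bullet$ is the unique probability such that for every measurable $A\subset X$ with $0<\mu(A)<\infty$ the random variable $N_A(\omega)=\omega(A)$ is Poisson distributed with parameter $\mu(A)$, and $N_{A_1},\dots,N_{A_k}$ are independent for pairwise disjoint $A_1,\dots,A_k$. A $\mu$-preserving invertible transformation $R$ of $X$ induces the $\mu^\bullet$-preserving transformation $R^\bullet$ of $X^\bullet$ (push-forward of configurations by $R$), and a measure preserving action of a group on $(X,\mu)$ induces in this way an action on $(X^\bullet,\mu^\bullet)$, called its Poisson suspension. A probability preserving action of a group is called Poisson if it is isomorphic to the Poisson suspension of an infinite measure preserving action of this group. The entropy of a probability preserving $\mathbb R^d$-action is the Kolmogorov–Sinai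 entropy of its restriction to $\mathbb Z^d$. A transformation is Bernoulli if it is isomorphic to a Bernoulli shift (possibly with a non-atomic or infinite-entropy base). A probability preserving transformation $S$ of $(Y,\nu)$ is rigid if there are integers $n_k\to\infty$ with $\nu(B\cap S^{n_k}B)\to\nu(B)$ for every measurable $B$. *)

theory Defs
  imports "HOL-Probability.Probability"
begin

section \<open>Projective space\<close>

definition lines :: "'a::euclidean_space set set" where
  "lines = {L. subspace L \<and> dim L = 1}"

text \<open>The quotient topology with respect to the map \<open>x \<mapsto> span {x}\<close> from the nonzero vectors
  onto the set of lines.\<close>

definition projective_space :: "'a::euclidean_space set topology" where
  "projective_space =
    topology (\<lambda>U. U \<subseteq> lines \<and> openin (top_of_set (- {0})) {x \<in> - {0}. span {x} \<in> U})"

lemma openin_projective_space: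
  "openin (projective_space :: 'a::euclidean_space set topology) U \<longleftrightarrow>
    U \<subseteq> lines \<and> openin (top_of_set (- {0})) {x \<in> - {0 :: 'a}. span {x} \<in> U}"
proof -
  have 1: "{x \<in> - {0 :: 'a}. span {x} \<in> U \<inter> V} =
      {x \<in> - {0}. span {x} \<in> U} \<inter> {x \<in> - {0}. span {x} \<in> V}" for U V
    by auto
  have 2: "{x \<in> - {0 :: 'a}. span {x} \<in> \<Union>K} = (\<Union>U\<in>K. {x \<in> - {0}. span {x} \<in> U})" for K
    by auto
  have "istopology (\<lambda>U. U \<subseteq> lines \<and>
      openin (top_of_set (- {0})) {x \<in> - {0 :: 'a}. span {x} \<in> U})"
    unfolding istopology_def
  proof (intro conjI allI impI)
    fix K :: "'a set set set"
    assume K: "\<forall>U\<in>K. U \<subseteq> lines \<and> openin (top_of_set (- {0})) {x \<in> - {0}. span {x} \<in> U}"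
    show "openin (top_of_set (- {0})) {x \<in> - {0}. span {x} \<in> \<Union>K}"
      unfolding 2 using K by (intro openin_Union) auto
  next
    fix S T :: "'a set set"
    assume "S \<subseteq> lines \<and> openin (top_of_set (- {0})) {x \<in> - {0}. span {x} \<in> S}"
      and "T \<subseteq> lines \<and> openin (top_of_set (- {0})) {x \<in> - {0}. span {x} \<in> T}"
    then show "openin (top_of_set (- {0})) {x \<in> - {0}. span {x} \<in> S \<inter> T}"
      unfolding 1 by (intro openin_Int) auto
  qed auto
  then show ?thesis
    by (simp add: projective_space_def)
qed

lemma topspace_projective_space: "topspace (projective_space :: 'a::euclidean_space set topology) = lines"
proof -
  have "span {x} \<in> lines" if "x \<noteq> 0" for x :: 'a
    using that by (simp add: lines_def dim_span dim_singleton)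
  then have "{x \<in> - {0 :: 'a}. span {x} \<in> lines} = - {0}"
    by auto
  then have "openin (projective_space :: 'a set topology) lines"
    by (simp add: openin_projective_space)
  then show ?thesis
    by (metis openin_projective_space openin_subset openin_topspace subset_antisym)
qed

section \<open>Standard spaces and measure preserving actions\<close>

text \<open>The Polish topology is not tied to any topology on the type \<open>'a\<close>.  A standard Borel space has at
  most continuum many points, so each one is isomorphic to one whose underlying set is a set of
  reals; existential quantification over \<open>real measure\<close> below therefore ranges over all standard
  spaces up to isomorphism.\<close>

definition standard_borel :: "'a measure \<Rightarrow> bool" where
  "standard_borel M \<longleftrightarrow>
    (\<exists>X. completely_metrizable_space X \<and> second_countable X \<and> topspace X = space M \<and>
         sets M = sigma_sets (topspace X) {U. openin X U})"

definition nonatomic :: "'a measure \<Rightarrow> bool" where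
  "nonatomic M \<longleftrightarrow>
    (\<forall>A\<in>sets M. 0 < emeasure M A \<longrightarrow>
      (\<exists>B\<in>sets M. B \<subseteq> A \<and> 0 < emeasure M B \<and> emeasure M B < emeasure M A))"

definition mp_action :: "'a measure \<Rightarrow> (real^'n \<Rightarrow> 'a \<Rightarrow> 'a) \<Rightarrow> bool" where
  "mp_action M T \<longleftrightarrow>
    (\<lambda>(g, x). T g x) \<in> borel \<Otimes>\<^sub>M M \<rightarrow>\<^sub>M M \<and>
    (\<forall>x\<in>space M. T 0 x = x) \<and>
    (\<forall>g h. \<forall>x\<in>space M. T (g + h) x = T g (T h x)) \<and>
    (\<forall>g. distr M M (T g) = M)"

text \<open>Isomorphism modulo null sets of two systems of transformations with a common index set: an
  invertible measure preserving map between conull sets that intertwines, for each index,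
  the corresponding transformations almost everywhere.\<close>

definition isomorphic_systems ::
  "'a measure \<Rightarrow> ('i \<Rightarrow> 'a \<Rightarrow> 'a) \<Rightarrow> 'b measure \<Rightarrow> ('i \<Rightarrow> 'b \<Rightarrow> 'b) \<Rightarrow> bool" where
  "isomorphic_systems M T N S \<longleftrightarrow>
    (\<exists>\<phi> A B. A \<in> sets M \<and> B \<in> sets N \<and>
      emeasure M (space M - A) = 0 \<and> emeasure N (space N - B) = 0 \<and>
      bij_betw \<phi> A B \<and>
      \<phi> \<in> restrict_space M A \<rightarrow>\<^sub>M restrict_space N B \<and>
      the_inv_into A \<phi> \<in> restrict_space N B \<rightarrow>\<^sub>M restrict_space M A \<and>
      distr (restrict_space M A) (restrict_space N B) \<phi> = restrict_space N B \<and>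
      (\<forall>i. AE x in M. \<phi> (T i x) = S i (\<phi> x)))"

section \<open>Poisson suspensions\<close>

text \<open>The push-forward of the counting measure on \<open>I\<close> under \<open>x\<close> is the sum of the point masses at
  \<open>x i\<close> for \<open>i \<in> I\<close>.\<close>

definition configurations :: "'a measure \<Rightarrow> 'a measure set" where
  "configurations M = {distr (count_space I) M x |(I :: nat set) x. x \<in> I \<rightarrow> space M}"

text \<open>The \<open>\<sigma>\<close>-algebra generated by the counting variables \<open>\<omega> \<mapsto> \<omega>(A)\<close>; only its space and its sets
  are used.  It becomes standard on restriction to the configurations that are finite on each member
  of a countable cover by sets of finite measure, which form a conull set for the Poisson measure.\<close>

definition configuration_algebra :: "'a measure \<Rightarrow> 'a measure measure" where
  "configuration_algebra M =
    (SUP A\<in>sets M. vimage_algebra (configurations M) (\<lambda>\<omega>. emeasure \<omega> A) borel)"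

lemma space_configuration_algebra: "space (configuration_algebra M) = configurations M"
  unfolding configuration_algebra_def by (subst space_Sup_eq_UN) auto

definition poisson_measure :: "'a measure \<Rightarrow> 'a measure measure \<Rightarrow> bool" where
  "poisson_measure M P \<longleftrightarrow>
    sets P = sets (configuration_algebra M) \<and> prob_space P \<and>
    (\<forall>A\<in>sets M. 0 < emeasure M A \<and> emeasure M A < \<infinity> \<longrightarrow>
      (\<forall>k::nat. measure P {\<omega> \<in> space P. emeasure \<omega> A = of_nat k} =
        pmf (poisson_pmf (measure M A)) k)) \<and>
    (\<forall>(A :: nat \<Rightarrow> 'a set) k. A ` {..<k} \<subseteq> sets M \<and> disjoint_family_on A {..<k} \<longrightarrow>
      prob_space.indep_vars P (\<lambda>_. borel) (\<lambda>i \<omega>. emeasure \<omega> (A i)) {..<k})"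

definition suspended_transformation :: "'a measure \<Rightarrow> ('a \<Rightarrow> 'a) \<Rightarrow> 'a measure \<Rightarrow> 'a measure" where
  "suspended_transformation M R = (\<lambda>\<omega>. distr \<omega> M R)"

definition poisson_action :: "'a measure \<Rightarrow> (real^'n \<Rightarrow> 'a \<Rightarrow> 'a) \<Rightarrow> bool" where
  "poisson_action N V \<longleftrightarrow>
    standard_borel N \<and> prob_space N \<and> mp_action N V \<and>
    (\<exists>(M :: real measure) T P.
      standard_borel M \<and> sigma_finite_measure M \<and> emeasure M (space M) = \<infinity> \<and> nonatomic M \<and>
      mp_action M T \<and> poisson_measure M P \<and>
      isomorphic_systems N V P (\<lambda>g. suspended_transformation M (T g)))"

section \<open>Entropy\<close>

text \<open>Finite measurable partitions are given by simple functions \<open>X\<close> with values in \<open>\<nat>\<close>; the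
  restricted function \<open>\<lambda>g\<in>F n. X (T g y)\<close> encodes the join of the partitions translated by \<open>F n\<close>.
  For the exhaustions \<open>F\<close> used below the upper limit is a limit, by subadditivity.  Entropies are in
  nats.\<close>

definition ks_entropy :: "'a measure \<Rightarrow> ('i \<Rightarrow> 'a \<Rightarrow> 'a) \<Rightarrow> (nat \<Rightarrow> 'i set) \<Rightarrow> ereal" where
  "ks_entropy M T F =
    (SUP X \<in> {X :: 'a \<Rightarrow> nat. simple_function M X}.
      limsup (\<lambda>n.
        let J = (\<lambda>y. \<lambda>g\<in>F n. X (T g y))
        in ereal (prob_space.entropy M (exp 1) (count_space (J ` space M)) J / real (card (F n)))))"

definition transformation_entropy :: "'a measure \<Rightarrow> ('a \<Rightarrow> 'a) \<Rightarrow> ereal" where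
  "transformation_entropy M S = ks_entropy M (\<lambda>i::nat. S ^^ i) (\<lambda>n. {..<n})"

text \<open>Entropy of the restriction of an action of \<open>\<real>\<^sup>d\<close> to \<open>\<int>\<^sup>d\<close>, computed along the boxes
  \<open>{0, \<dots>, n - 1}\<^sup>d\<close>.\<close>

definition action_entropy :: "'a measure \<Rightarrow> (real^'n \<Rightarrow> 'a \<Rightarrow> 'a) \<Rightarrow> ereal" where
  "action_entropy M T = ks_entropy M T (\<lambda>n. {v. \<forall>i. v $ i \<in> real ` {..<n}})"

section \<open>Bernoulli and rigid transformations\<close>

definition bernoulli :: "'a measure \<Rightarrow> ('a \<Rightarrow> 'a) \<Rightarrow> bool" where
  "bernoulli M S \<longleftrightarrow>
    (\<exists>K :: real measure. standard_borel K \<and> prob_space K \<and>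
      isomorphic_systems M (\<lambda>_::unit. S)
        (\<Pi>\<^sub>M i\<in>(UNIV :: int set). K) (\<lambda>_ x i. x (i + 1)))"

definition rigid :: "'a measure \<Rightarrow> ('a \<Rightarrow> 'a) \<Rightarrow> bool" where
  "rigid M S \<longleftrightarrow>
    (\<exists>n :: nat \<Rightarrow> nat. filterlim n at_top sequentially \<and>
      (\<forall>B\<in>sets M. (\<lambda>k. measure M (B \<inter> (S ^^ n k) ` B)) \<longlonglongrightarrow> measure M B))"

end

theory Submission
  imports Defs "HOL-Analysis.Kronecker_Approximation_Theorem" "HOL-Real_Asymp.Real_Asymp"
begin

text \<open>The space \<open>X\<close> is a restricted infinite product: a line and circles of length \<open>L m\<close>, with
  almost all coordinates close to the unit interval around \<open>0\<close>, and \<open>g\<close> translates the coordinate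
  \<open>(m, b)\<close> by \<open>perp (e m) g $ b / r m\<close>.  The unit vectors \<open>e m\<close> lie in decreasing open cones whose
  intersection is \<open>\<Union>\<Delta>\<close> without the origin, and they span each line of \<open>D\<close> infinitely often.  If \<open>g\<close> is outside \<open>\<Union>\<Delta>\<close>,
  then \<open>perp (e m) g\<close> is not too short for large \<open>m\<close>, and when the lengths \<open>L m\<close> grow fast enough, every
  large multiple of \<open>g\<close> moves some coordinate far away.  Hence \<open>g\<close> acts on \<open>X\<close> with a fundamental domain,
  which has infinite measure because of the line, and its suspension is a Bernoulli shift whose base
  carries independent events of probability bounded away from \<open>0\<close> and \<open>1\<close> in any number.  If \<open>g\<close> is on
  the line spanned by \<open>e m\<close>, the coordinates of index \<open>m\<close> do not move, by Dirichlet's theorem some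
  multiple of \<open>g\<close> almost fixes the earlier ones, and the later ones hardly move since \<open>r\<close> grows fast; such
  returns pass to the suspension and give rigidity.  The same argument yields integer vectors along
  which the whole action returns.  A return in the group forces entropy \<open>0\<close>: along its orbits each value of
  a partition determines the next one up to an error of small entropy.\<close>

section \<open>Borel sets as standard spaces\<close>

text \<open>The scales carry the proof, and they conflict. Returns want circles, to which
  Dirichlet's theorem applies, and large \<open>r j\<close>; dispersion wants circles so long that a
  displacement is not wrapped around before the next scale takes over. The order of choice resolves
  this: \<open>r m\<close>, then a bound \<open>H m\<close> for the return vectors of level
  \<open>m\<close>, then \<open>r (Suc m)\<close> of size at least
  \<open>2 ^ Suc m * Suc m * H m\<close>, and only then \<open>L m\<close>, at least of order
  \<open>r (Suc m) / r m\<close>. A return of level \<open>m\<close> therefore relies on circles of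
  index below \<open>m\<close> only; index \<open>m\<close> is served by the direction
  \<open>e m\<close> itself. All components of \<open>perp (e m) g\<close> serve as coordinates, as
  it depends on \<open>g\<close> which of them is large. The tubes exceed the unit cells by
  multiples of \<open>(1/2) ^ m\<close>; summability gives them finite measure and lets a
  translation change the cell of almost every point in finitely many coordinates only. Since the
  notions used ask for measures on the reals, both the space \<open>X\<close> and the space of
  locally finite point sets are coded into the reals by Borel injections with Borel left
  inverses.\<close>

text \<open>A closed graph over \<open>A\<close> is a Polish space with the same Borel sets as \<open>A\<close>.  The property is stable
  under countable intersections and disjoint countable unions, so every Borel set has it.\<close>

definition closed_graph_set :: "real set \<Rightarrow> bool" where
  "closed_graph_set A \<longleftrightarrow>
    (\<exists>\<sigma> :: real \<Rightarrow> nat \<Rightarrow> real. \<sigma> \<in> borel_measurable borel \<and> closed ((\<lambda>x. (x, \<sigma> x)) ` A))"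

lemma closed_graph_set_closed:
  assumes "closed A"
  shows "closed_graph_set A"
proof -
  have "(\<lambda>x. (x, \<lambda>_. 0)) ` A = A \<times> {\<lambda>_::nat. 0::real}"
    by auto
  then have "closed ((\<lambda>x. (x, \<lambda>_::nat. 0::real)) ` A)"
    using assms by (simp add: closed_Times)
  then show ?thesis
    unfolding closed_graph_set_def by (intro exI[of _ "\<lambda>_ _. 0"]) auto
qed

text \<open>Points of \<open>A\<close> that approach the boundary must not converge in the graph:
  with \<open>h\<close> the distance to the complement, the graph of \<open>1 / h\<close> is the
  solution set of \<open>t * h x = 1\<close>, hence closed. The case \<open>A = UNIV\<close> is
  separate because \<open>infdist\<close> to the empty set is 0.\<close>

lemma closed_graph_set_open:
  assumes "open (A :: real set)"
  shows "closed_graph_set A"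
proof (cases "A = UNIV")
  case True
  then show ?thesis by (simp add: closed_graph_set_closed)
next
  case False
  define h where "h x = infdist x (- A)" for x
  have h: "h x = 0 \<longleftrightarrow> x \<notin> A" for x
    using in_closed_iff_infdist_zero[of "- A" x] assms False
    by (auto simp: h_def closed_Compl)
  have cont: "continuous_on UNIV h"
    unfolding h_def by (intro continuous_intros)
  have "(\<lambda>x. (x, \<lambda>_. 1 / h x)) ` A = {p :: real \<times> (nat \<Rightarrow> real). \<forall>n. snd p n * h (fst p) = 1}"
  proof (intro equalityI subsetI)
    fix p :: "real \<times> (nat \<Rightarrow> real)"
    assume p: "p \<in> {p. \<forall>n. snd p n * h (fst p) = 1}"
    then have nz: "h (fst p) \<noteq> 0" by auto
    then have "snd p = (\<lambda>_. 1 / h (fst p))"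
      using p by (auto simp: field_simps fun_eq_iff)
    then show "p \<in> (\<lambda>x. (x, \<lambda>_. 1 / h x)) ` A"
      using nz h[of "fst p"] by (intro image_eqI[of _ _ "fst p"]) (auto simp: prod_eq_iff)
  next
    fix p :: "real \<times> (nat \<Rightarrow> real)"
    assume "p \<in> (\<lambda>x. (x, \<lambda>_. 1 / h x)) ` A"
    then obtain x where "x \<in> A" "p = (x, \<lambda>_. 1 / h x)" by blast
    then show "p \<in> {p. \<forall>n. snd p n * h (fst p) = 1}"
      using h[of x] by simp
  qed
  moreover have "closed {p :: real \<times> (nat \<Rightarrow> real). \<forall>n. snd p n * h (fst p) = 1}"
  proof (intro closed_Collect_all closed_Collect_eq continuous_intros)
    fix n
    show "continuous_on UNIV (\<lambda>p :: real \<times> (nat \<Rightarrow> real). snd p n)"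
      by (rule continuous_on_compose2[OF continuous_on_product_coordinates[of n], of _ snd])
        (auto intro: continuous_intros)
    show "continuous_on UNIV (\<lambda>p :: real \<times> (nat \<Rightarrow> real). h (fst p))"
      by (rule continuous_on_compose2[OF cont, of UNIV fst]) (auto intro: continuous_intros)
  qed
  moreover have "(\<lambda>x. \<lambda>_::nat. 1 / h x) \<in> borel_measurable borel"
    using borel_measurable_continuous_onI[OF cont]
    by (intro measurable_coordinatewise_then_product) (auto simp del: borel_measurable_const)
  ultimately show ?thesis
    unfolding closed_graph_set_def by (intro exI[of _ "\<lambda>x _. 1 / h x"]) auto
qed

lemma continuous_on_fun_comp:
  fixes g :: "'b \<Rightarrow> 'c"
  shows "continuous_on UNIV (\<lambda>f :: 'c \<Rightarrow> real. \<lambda>n. f (g n))"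
  by (intro continuous_on_coordinatewise_then_product continuous_on_product_coordinates)

text \<open>The sequences attached to the \<open>A n\<close> are interleaved into one along
  \<open>prod_decode\<close>. The graph over the intersection is then cut out by the conditions that
  each subsequence, extracted by the continuous map \<open>\<pi> n\<close>, lies in the closed graph
  over \<open>A n\<close>.\<close>

lemma closed_graph_set_INT:
  assumes "\<And>n::nat. closed_graph_set (A n)"
  shows "closed_graph_set (\<Inter>n. A n)"
proof -
  obtain \<sigma> :: "nat \<Rightarrow> real \<Rightarrow> nat \<Rightarrow> real" where
    \<sigma>: "\<And>n. \<sigma> n \<in> borel_measurable borel" "\<And>n. closed ((\<lambda>x. (x, \<sigma> n x)) ` A n)"
    using assms unfolding closed_graph_set_def by metis
  define \<tau> where "\<tau> x k = \<sigma> (fst (prod_decode k)) x (snd (prod_decode k))" for x k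
  define \<pi> where "\<pi> n p = (fst p, \<lambda>k. snd p (prod_encode (n, k)))"
    for n and p :: "real \<times> (nat \<Rightarrow> real)"
  have "(\<lambda>x. (x, \<tau> x)) ` (\<Inter>n. A n) = (\<Inter>n. \<pi> n -` ((\<lambda>x. (x, \<sigma> n x)) ` A n))"
  proof (intro equalityI subsetI)
    fix p assume p: "p \<in> (\<Inter>n. \<pi> n -` ((\<lambda>x. (x, \<sigma> n x)) ` A n))"
    then have "\<pi> n p \<in> (\<lambda>x. (x, \<sigma> n x)) ` A n" for n by auto
    then have q: "fst p \<in> A n \<and> (\<forall>k. snd p (prod_encode (n, k)) = \<sigma> n (fst p) k)" for n
      unfolding \<pi>_def by (force simp: fun_eq_iff)
    have "snd p k = \<tau> (fst p) k" for k
      using q[of "fst (prod_decode k)"] unfolding \<tau>_def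
      by (metis prod.collapse prod_decode_inverse)
    then show "p \<in> (\<lambda>x. (x, \<tau> x)) ` (\<Inter>n. A n)"
      using q by (intro image_eqI[of _ _ "fst p"]) (auto simp: prod_eq_iff)
  qed (auto simp: \<pi>_def \<tau>_def)
  moreover have "continuous_on UNIV (\<pi> n)" for n
    unfolding \<pi>_def
    by (intro continuous_intros continuous_on_compose2[OF continuous_on_fun_comp, of _ snd]) auto
  then have "closed (\<Inter>n. \<pi> n -` ((\<lambda>x. (x, \<sigma> n x)) ` A n))"
    using \<sigma>(2) by (auto intro!: closed_INT continuous_closed_vimage simp: continuous_on_eq_continuous_at)
  moreover have "\<tau> \<in> borel_measurable borel"
    unfolding \<tau>_def by (rule measurable_coordinatewise_then_product, rule measurable_product_then_coordinatewise, rule \<sigma>(1))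
  ultimately show ?thesis
    unfolding closed_graph_set_def by (intro exI[of _ \<tau>]) auto
qed

text \<open>Coordinate 0 stores the index of the piece, a natural number. Along a convergent
  sequence in the union it is eventually constant, so the limit stays in one of the closed sets
  \<open>F n\<close>. Disjointness makes the index a function of the point.\<close>

lemma closed_graph_set_disjoint_UN:
  fixes A :: "nat \<Rightarrow> real set"
  assumes "\<And>n. closed_graph_set (A n)" "\<And>n. A n \<in> sets borel" "disjoint_family A"
  shows "closed_graph_set (\<Union>n. A n)"
proof -
  obtain \<sigma> :: "nat \<Rightarrow> real \<Rightarrow> nat \<Rightarrow> real" where
    \<sigma>: "\<And>n. \<sigma> n \<in> borel_measurable borel" "\<And>n. closed ((\<lambda>x. (x, \<sigma> n x)) ` A n)"
    using assms(1) unfolding closed_graph_set_def by metis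
  define ix where "ix x = (if \<exists>n. x \<in> A n then (LEAST n. x \<in> A n) else 0)" for x
  have ix: "ix x = n" if "x \<in> A n" for x n
  proof -
    have "m = n" if "x \<in> A m" for m
      using that \<open>x \<in> A n\<close> assms(3) by (auto simp: disjoint_family_on_def)
    then have "(LEAST n. x \<in> A n) = n"
      using \<open>x \<in> A n\<close> by (metis LeastI)
    then show ?thesis
      using \<open>x \<in> A n\<close> by (auto simp: ix_def)
  qed
  have mix: "ix \<in> borel \<rightarrow>\<^sub>M count_space UNIV"
  proof -
    have "(\<lambda>x. x \<in> A n) \<in> borel \<rightarrow>\<^sub>M count_space UNIV" for n
      using assms(2) by simp
    note [measurable] = this
    show ?thesis unfolding ix_def by measurable
  qed
  define \<tau> where "\<tau> x k = (if k = 0 then real (ix x) else \<sigma> (ix x) x (k - 1))" for x k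
  define \<pi> where "\<pi> p = (fst p, \<lambda>k. snd p (Suc k))" for p :: "real \<times> (nat \<Rightarrow> real)"
  have c0: "continuous_on UNIV (\<lambda>p :: real \<times> (nat \<Rightarrow> real). snd p 0)"
    by (rule continuous_on_compose2[OF continuous_on_product_coordinates[of 0], of _ snd])
      (auto intro: continuous_intros)
  have c1: "continuous_on UNIV \<pi>"
    unfolding \<pi>_def
    by (intro continuous_intros continuous_on_compose2[OF continuous_on_fun_comp, of _ snd]) auto
  define F where "F n = {p :: real \<times> (nat \<Rightarrow> real). snd p 0 = real n} \<inter>
    \<pi> -` ((\<lambda>x. (x, \<sigma> n x)) ` A n)" for n
  have "(\<lambda>x. (x, \<tau> x)) ` (\<Union>n. A n) = (\<Union>n. F n)"
  proof (intro equalityI subsetI)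
    fix p assume "p \<in> (\<Union>n. F n)"
    then obtain n x where n: "snd p 0 = real n" "\<pi> p = (x, \<sigma> n x)" "x \<in> A n"
      by (auto simp: F_def)
    then have "fst p = x" "\<And>k. snd p (Suc k) = \<sigma> n x k"
      by (auto simp: \<pi>_def fun_eq_iff)
    then have "snd p k = \<tau> x k" for k
      using n ix[of x n] by (cases k) (auto simp: \<tau>_def)
    with n \<open>fst p = x\<close> show "p \<in> (\<lambda>x. (x, \<tau> x)) ` (\<Union>n. A n)"
      by (intro image_eqI[of _ _ x]) (auto simp: prod_eq_iff)
  qed (auto simp: \<pi>_def \<tau>_def F_def ix)
  moreover have "closed (\<Union>n. F n)"
  proof -
    have cF: "closed (F n)" for n
      unfolding F_def using \<sigma>(2) c0 c1
      by (intro closed_Int closed_Collect_eq continuous_closed_vimage)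
        (auto intro: continuous_intros simp: continuous_on_eq_continuous_at)
    show ?thesis
    proof (unfold closed_sequential_limits, intro allI impI)
      fix s l assume s: "(\<forall>k. s k \<in> (\<Union>n. F n)) \<and> s \<longlonglongrightarrow> l"
      have "(\<lambda>k. snd (s k) 0) \<longlonglongrightarrow> snd l 0"
        using s c0 continuous_on_tendsto_compose[of UNIV "\<lambda>p. snd p 0" s l] by simp
      then have "\<forall>\<^sub>F k in sequentially. dist (snd (s k) 0) (snd l 0) < 1/2"
        by (rule tendstoD) simp
      then obtain N where N: "\<And>k. k \<ge> N \<Longrightarrow> dist (snd (s k) 0) (snd l 0) < 1/2"
        by (auto simp: eventually_sequentially)
      obtain n where n: "s N \<in> F n" using s by blast
      have "s (k + N) \<in> F n" for k
      proof -
        obtain m where m: "s (k + N) \<in> F m" using s by blast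
        have "\<bar>real m - real n\<bar> < 1"
        proof -
          have "snd (s (k + N)) 0 = real m" "snd (s N) 0 = real n"
            using m n by (auto simp: F_def)
          then have "\<bar>real m - snd l 0\<bar> < 1/2" "\<bar>real n - snd l 0\<bar> < 1/2"
            using N[of "k + N"] N[of N] by (simp_all add: dist_real_def)
          then show ?thesis by linarith
        qed
        then have "m = n" by linarith
        then show ?thesis using m by simp
      qed
      moreover have "(\<lambda>k. s (k + N)) \<longlonglongrightarrow> l"
        using s by (simp add: LIMSEQ_ignore_initial_segment)
      ultimately have "l \<in> F n"
        using cF[of n] closed_sequentially[of "F n" "\<lambda>k. s (k + N)" l] by simp
      then show "l \<in> (\<Union>n. F n)" by blast
    qed
  qed
  moreover have "\<tau> \<in> borel_measurable borel"
  proof (rule measurable_coordinatewise_then_product)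
    fix k
    note [measurable] = mix
    have [measurable]: "(\<lambda>x. \<sigma> (ix x) x (k - 1)) \<in> borel_measurable borel"
      by (rule measurable_compose_countable[OF measurable_product_then_coordinatewise[OF \<sigma>(1)] mix])
     show "(\<lambda>x. \<tau> x k) \<in> borel_measurable borel"
      unfolding \<tau>_def by measurable
  qed
  ultimately show ?thesis
    unfolding closed_graph_set_def by (intro exI[of _ \<tau>]) auto
qed

text \<open>The claim for the complement is carried along because a countable union is handled
  through \<open>disjointed\<close>: each disjoint piece is the intersection of one
  \<open>S n\<close> with the complements of earlier sets.\<close>

lemma closed_graph_set_borel:
  assumes "A \<in> sets (borel :: real measure)"
  shows "closed_graph_set A \<and> closed_graph_set (- A)"
proof -
  have "A \<in> sigma_sets UNIV {S :: real set. open S}"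
    using assms by (simp add: sets_borel)
  then show ?thesis
  proof induction
    case (Basic S)
    then show ?case
      by (auto intro: closed_graph_set_open closed_graph_set_closed)
  next
    case Empty
    then show ?case
      by (auto intro: closed_graph_set_open)
  next
    case (Compl S)
    then show ?case
      by (simp add: Compl_eq_Diff_UNIV[symmetric])
  next
    case (Union S)
    have S: "S n \<in> sets borel" for n
      using Union(1)[of n] by (simp add: sets_borel)
    \<comment> \<open>Index 0 holds \<open>S n\<close>, index \<open>Suc k\<close> the complement of
      \<open>S k\<close> for \<open>k < n\<close>; the rest is padding by
      \<open>UNIV\<close>.\<close>
    define B where "B n k = (if k = 0 then S n else if k \<le> n then - S (k - 1) else UNIV)" for n k :: nat
    have "closed_graph_set (B n k)" for n k
      using Union(2) by (auto simp: B_def closed_graph_set_closed)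
    then have "closed_graph_set (\<Inter>k. B n k)" for n
      by (rule closed_graph_set_INT)
    moreover have "(\<Inter>k. B n k) = disjointed S n" for n
    proof (intro equalityI subsetI)
      fix x assume x: "x \<in> (\<Inter>k. B n k)"
      have "x \<notin> S k" if "k < n" for k
        using x that INT_D[OF x, of "Suc k"] by (auto simp: B_def)
      moreover have "x \<in> S n" using INT_D[OF x, of 0] by (auto simp: B_def)
      ultimately show "x \<in> disjointed S n"
        by (auto simp: disjointed_def)
    qed (auto simp: B_def disjointed_def)
    ultimately have "closed_graph_set (disjointed S n)" for n
      by simp
    moreover have "disjointed S n \<in> sets borel" for n
      using sets.range_disjointed_sets[of S borel] S by auto
    ultimately have "closed_graph_set (\<Union>n. disjointed S n)"
      by (intro closed_graph_set_disjoint_UN) (auto simp: disjoint_family_disjointed)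
    moreover have "closed_graph_set (\<Inter>n. - S n)"
      using Union(2) by (intro closed_graph_set_INT) auto
    ultimately show ?case
      by (simp add: UN_disjointed_eq)
  qed
qed

text \<open>The topology of the closed graph over \<open>space M\<close>, pulled back along
  \<open>x \<mapsto> (x, \<sigma> x)\<close>, is Polish. It refines the usual one, and its open sets
  are Borel because \<open>\<sigma>\<close> is Borel measurable, so both topologies generate the
  same sigma-algebra.\<close>

lemma standard_borel_subset_real:
  fixes M :: "real measure"
  assumes "space M \<in> sets borel" and "sets M = sets (restrict_space borel (space M))"
  shows "standard_borel M"
proof -
  define A where "A = space M"
  obtain \<sigma> :: "real \<Rightarrow> nat \<Rightarrow> real" where
    m: "\<sigma> \<in> borel_measurable borel" and cl: "closed ((\<lambda>x. (x, \<sigma> x)) ` A)"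
    using closed_graph_set_borel[OF assms(1)] unfolding closed_graph_set_def A_def by auto
  define f where "f x = (x, \<sigma> x)" for x
  define G where "G = f ` A"
  define X where "X = pullback_topology A f euclidean"
  have top: "topspace X = A"
    by (simp add: X_def topspace_pullback_topology)
  have op: "openin X U \<longleftrightarrow> (\<exists>T. open T \<and> U = f -` T \<inter> A)" for U
    by (auto simp: X_def openin_pullback_topology)
  have homeo: "homeomorphic_map X (top_of_set G) f"
  proof (rule bijective_open_imp_homeomorphic_map)
    show "continuous_map X (top_of_set G) f"
      unfolding continuous_map
    proof (intro conjI allI impI)
      show "f ` topspace X \<subseteq> topspace (top_of_set G)" by (simp add: top G_def)
      fix U assume "openin (top_of_set G) U"
      then obtain T where "open T" "U = G \<inter> T" by (auto simp: openin_open)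
      then show "openin X {x \<in> topspace X. f x \<in> U}"
        unfolding op by (intro exI[of _ T]) (auto simp: top G_def)
    qed
    show "open_map X (top_of_set G) f"
      unfolding open_map_def
    proof (intro allI impI)
      fix U assume "openin X U"
      then obtain T where "open T" "U = f -` T \<inter> A" by (auto simp: op)
      then show "openin (top_of_set G) (f ` U)"
        unfolding openin_open by (intro exI[of _ T]) (auto simp: G_def)
    qed
    show "f ` topspace X = topspace (top_of_set G)" by (simp add: top G_def)
    show "inj_on f (topspace X)" by (auto simp: f_def inj_on_def)
  qed
  then have hs: "X homeomorphic_space top_of_set G"
    by (rule homeomorphic_map_imp_homeomorphic_space)
  have "completely_metrizable_space (top_of_set G)"
    using cl unfolding G_def f_def
    by (intro completely_metrizable_space_closedin completely_metrizable_space_euclidean) simp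
  then have 1: "completely_metrizable_space X"
    using homeomorphic_completely_metrizable_space[OF hs] by simp
  obtain B :: "(real \<times> (nat \<Rightarrow> real)) set set" where B: "countable B" "topological_basis B"
    using ex_countable_basis by auto
  have 2: "second_countable X"
    unfolding second_countable_def
  proof (intro exI[of _ "(\<lambda>T. f -` T \<inter> A) ` B"] conjI ballI allI impI)
    show "countable ((\<lambda>T. f -` T \<inter> A) ` B)" using B by simp
    show "openin X V" if "V \<in> (\<lambda>T. f -` T \<inter> A) ` B" for V
      using that B(2) topological_basis_open[of B] unfolding op by blast
    fix U x assume "openin X U \<and> x \<in> U"
    then obtain T where T: "open T" "U = f -` T \<inter> A" "x \<in> U" by (auto simp: op)
    then have "f x \<in> T" by simp
    with T(1) obtain V where V: "V \<in> B" "f x \<in> V" "V \<subseteq> T"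
      using topological_basisE[OF B(2)] by metis
    show "\<exists>V\<in>(\<lambda>T. f -` T \<inter> A) ` B. x \<in> V \<and> V \<subseteq> U"
      using V T by (intro bexI[of _ "f -` V \<inter> A"]) auto
  qed
  have fm: "f \<in> borel_measurable borel"
    unfolding f_def using m by (simp add: borel_prod[symmetric])
  have "sets M = sigma_sets A {U. openin X U}"
  proof (intro equalityI subsetI)
    fix E assume "E \<in> sets M"
    then obtain C where C: "C \<in> sets borel" "E = A \<inter> C"
      unfolding assms(2) sets_restrict_space A_def by blast
    have "C \<in> sigma_sets UNIV {S. open S}"
      using C by (simp add: sets_borel)
    then have "A \<inter> C \<in> sigma_sets A {U. openin X U}"
    proof induction
      case (Basic S)
      then have "open (S \<times> (UNIV :: (nat \<Rightarrow> real) set))" by (simp add: open_Times)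
      moreover have "A \<inter> S = f -` (S \<times> UNIV) \<inter> A" by (auto simp: f_def)
      ultimately show ?case
        by (intro sigma_sets.Basic) (auto simp: op)
    next
      case (Compl S)
      have "A \<inter> (UNIV - S) = A - A \<inter> S" by auto
      with Compl show ?case by (simp add: sigma_sets.Compl)
    next
      case (Union S)
      then show ?case unfolding Int_UN_distrib by (intro sigma_sets.Union)
    qed (auto intro: sigma_sets.Empty)
    with C show "E \<in> sigma_sets A {U. openin X U}" by simp
  next
    fix E assume "E \<in> sigma_sets A {U. openin X U}"
    moreover have "sigma_sets A {U. openin X U} \<subseteq> sets M"
      unfolding A_def
    proof (rule sets.sigma_sets_subset, safe)
      fix U assume "openin X U"
      then obtain T where T: "open T" "U = f -` T \<inter> A" by (auto simp: op)
      have "f -` T \<in> sets borel"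
        using measurable_sets[OF fm, of T] T(1) by simp
      then show "U \<in> sets M"
        unfolding T(2) assms(2) A_def by (auto simp: sets_restrict_space)
    qed
    ultimately show "E \<in> sets M" by auto
  qed
  with 1 2 top show ?thesis
    unfolding standard_borel_def A_def by auto
qed

section \<open>Coding countably many reals by one real\<close>

primrec ternary_remainder :: "nat \<Rightarrow> real \<Rightarrow> real" where
  "ternary_remainder 0 r = r"
| "ternary_remainder (Suc k) r =
    3 * (ternary_remainder k r - (if 1 \<le> ternary_remainder k r then 1 else 0))"

lemma measurable_ternary_remainder [measurable]: "ternary_remainder k \<in> borel_measurable borel"
proof (induction k)
  case 0
  have "ternary_remainder 0 = (\<lambda>r. r)" by (simp add: fun_eq_iff)
  then show ?case by simp
next
  case (Suc k)
  note [measurable] = Suc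
  have "ternary_remainder (Suc k) =
      (\<lambda>r. 3 * (ternary_remainder k r - (if 1 \<le> ternary_remainder k r then 1 else 0)))"
    by (simp add: fun_eq_iff)
  then show ?case by simp
qed

text \<open>Digits 0 and 1 in base 3 avoid double expansions: all tails are at most
  \<open>3 / 2\<close>, so a tail with leading digit 0 is at most \<open>1 / 2\<close>, and
  comparison with 1 reads the digit off.\<close>

lemma ternary_remainder_suminf:
  fixes b :: "nat \<Rightarrow> bool"
  defines "c k \<equiv> (\<Sum>j. of_bool (b (j + k)) / 3 ^ j :: real)"
  shows "ternary_remainder k (c 0) = c k" and "1 \<le> ternary_remainder k (c 0) \<longleftrightarrow> b k"
proof -
  have sg: "summable (\<lambda>j. 1 / 3 ^ j :: real)"
    using summable_geometric[of "1/3 :: real"] by (simp add: power_one_over)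
  have sm: "summable (\<lambda>j. of_bool (b (j + k)) / 3 ^ j :: real)" for k
    by (rule summable_comparison_test'[OF sg]) auto
  have split: "c k = of_bool (b k) + c (Suc k) / 3" for k
  proof -
    have "c k = of_bool (b k) + (\<Sum>j. of_bool (b (Suc j + k)) / 3 ^ Suc j)"
      unfolding c_def using suminf_split_head[OF sm[of k]] by simp
    also have "(\<Sum>j. of_bool (b (Suc j + k)) / 3 ^ Suc j :: real) = c (Suc k) / 3"
      unfolding c_def using suminf_divide[OF sm[of "Suc k"], of 3] by (simp add: field_simps)
    finally show ?thesis .
  qed
  have nn: "0 \<le> c k" for k
    unfolding c_def by (rule suminf_nonneg[OF sm]) simp
  have "c k \<le> (\<Sum>j. 1 / 3 ^ j)" for k
    unfolding c_def by (rule suminf_le[OF _ sm sg]) simp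
  moreover have "(\<Sum>j. 1 / 3 ^ j :: real) = 3 / 2"
    using suminf_geometric[of "1/3 :: real"] by (simp add: power_one_over)
  ultimately have le: "c k \<le> 3 / 2" for k by simp
  have dig: "1 \<le> c k \<longleftrightarrow> b k" for k
  proof (cases "b k")
    case True
    then have "c k = 1 + c (Suc k) / 3" using split[of k] by simp
    then have "1 \<le> c k" using nn[of "Suc k"] by linarith
    with True show ?thesis by blast
  next
    case False
    then have "c k = c (Suc k) / 3" using split[of k] by simp
    then have "\<not> 1 \<le> c k" using le[of "Suc k"] by linarith
    with False show ?thesis by blast
  qed
  show *: "ternary_remainder k (c 0) = c k" for k
  proof (induction k)
    case (Suc k)
    have "ternary_remainder (Suc k) (c 0) = 3 * (c k - of_bool (b k))"
      by (simp add: Suc dig)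
    also have "\<dots> = c (Suc k)" by (subst split[of k]) simp
    finally show ?case .
  qed simp
  show "1 \<le> ternary_remainder k (c 0) \<longleftrightarrow> b k"
    using dig * by simp
qed

lemma real_INF_rat_greater:
  fixes x :: real
  shows "(INF q::rat. if x < of_rat q then ereal (of_rat q) else \<infinity>) = ereal x"
proof (rule antisym)
  show "ereal x \<le> (INF q::rat. if x < of_rat q then ereal (of_rat q) else \<infinity>)"
    by (intro INF_greatest) auto
  show "(INF q::rat. if x < of_rat q then ereal (of_rat q) else \<infinity>) \<le> ereal x"
  proof (rule ereal_le_epsilon2)
    fix e :: real assume "0 < e"
    then obtain q where q: "x < of_rat q" "of_rat q < x + e"
      using of_rat_dense[of x "x + e"] by auto
    have "(INF q::rat. if x < of_rat q then ereal (of_rat q) else \<infinity>) \<le> ereal (of_rat q)"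
      using q by (intro INF_lower2[of q]) auto
    also have "\<dots> \<le> ereal x + ereal e" using q by simp
    finally show "(INF q::rat. if x < of_rat q then ereal (of_rat q) else \<infinity>) \<le> ereal x + ereal e" .
  qed
qed

text \<open>A family of reals is determined by the countably many bits \<open>x i < q\<close> with
  \<open>q\<close> rational. They are packed as ternary digits into one real, and \<open>x i\<close>
  comes back as the infimum of the rationals above it.\<close>

lemma real_coding_exists:
  obtains u :: "('i::countable \<Rightarrow> real) \<Rightarrow> real" and w :: "real \<Rightarrow> 'i \<Rightarrow> real"
  where "u \<in> borel_measurable borel" "w \<in> borel_measurable borel" "\<And>x. w (u x) = x"
proof -
  define b where "b x k = (case from_nat k of (i :: 'i, q :: rat) \<Rightarrow> x i < of_rat q)"
    for x :: "'i \<Rightarrow> real" and k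
  define u where "u x = (\<Sum>k. of_bool (b x (k + 0)) / 3 ^ k :: real)" for x
  define w where "w r i = real_of_ereal (INF q::rat.
    if 1 \<le> ternary_remainder (to_nat (i, q)) r then ereal (of_rat q) else \<infinity>)" for r and i :: 'i
  have [measurable]: "(\<lambda>x. x i) \<in> borel_measurable (borel :: ('i \<Rightarrow> real) measure)" for i
    by (rule measurable_product_then_coordinatewise) simp
  have [measurable]: "Measurable.pred borel (\<lambda>x. b x k)" for k
    unfolding b_def by (cases "from_nat k :: 'i \<times> rat") simp
  have 1: "u \<in> borel_measurable borel"
    unfolding u_def by (intro borel_measurable_suminf) measurable
  have 2: "w \<in> borel_measurable borel"
  proof (rule measurable_coordinatewise_then_product)
    show "(\<lambda>r. w r i) \<in> borel_measurable borel" for i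
      unfolding w_def by (intro borel_measurable_real_of_ereal borel_measurable_INF) auto
  qed
  have "w (u x) i = x i" for x i
  proof -
    have "1 \<le> ternary_remainder (to_nat (i, q)) (u x) \<longleftrightarrow> x i < of_rat q" for q
      unfolding u_def ternary_remainder_suminf(2) by (simp add: b_def)
    then have "w (u x) i = real_of_ereal (INF q::rat. if x i < of_rat q then ereal (of_rat q) else \<infinity>)"
      unfolding w_def by presburger
    then show ?thesis
      unfolding real_INF_rat_greater by simp
  qed
  with 1 2 show ?thesis by (intro that) auto
qed

section \<open>Copies of measure spaces inside the reals\<close>

locale real_coding =
  fixes M :: "'a measure" and f :: "'a \<Rightarrow> real" and w :: "real \<Rightarrow> 'a"
  assumes f_measurable: "f \<in> borel_measurable M"
    and w_measurable: "w \<in> borel \<rightarrow>\<^sub>M M"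
    and w_f: "x \<in> space M \<Longrightarrow> w (f x) = x"
begin

text \<open>This is the image of \<open>f\<close>: as \<open>w\<close> takes all its values in the
  space, the fixed points of \<open>f \<circ> w\<close> are exactly the codes of points, and in this
  form the set is visibly Borel.\<close>

definition codes :: "real set" where
  "codes = {r. f (w r) = r}"

definition copy :: "real measure" where
  "copy = distr M (restrict_space borel codes) f"

lemma w_space: "w r \<in> space M"
  using measurable_space[OF w_measurable] by simp

lemma codes_borel: "codes \<in> sets borel"
proof -
  have [measurable]: "(\<lambda>r. f (w r)) \<in> borel_measurable borel"
    using measurable_compose[OF w_measurable f_measurable] .
  have "{r \<in> space borel. f (w r) = r} \<in> sets borel" by measurable
  then show ?thesis by (simp add: codes_def)
qed

lemma f_codes: "x \<in> space M \<Longrightarrow> f x \<in> codes"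
  by (simp add: codes_def w_f)

lemma space_copy: "space copy = codes"
  by (simp add: copy_def space_restrict_space)

lemma sets_copy: "sets copy = sets (restrict_space borel codes)"
  by (simp add: copy_def)

lemma f_copy [measurable]: "f \<in> M \<rightarrow>\<^sub>M copy"
  unfolding copy_def using f_measurable f_codes
  by (auto intro!: measurable_restrict_space2)

lemma w_copy [measurable]: "w \<in> copy \<rightarrow>\<^sub>M M"
  unfolding measurable_cong_sets[OF sets_copy refl]
  by (rule measurable_restrict_space1[OF w_measurable])

lemma f_w: "r \<in> space copy \<Longrightarrow> f (w r) = r"
  by (simp add: space_copy codes_def)

lemma emeasure_copy: "A \<in> sets copy \<Longrightarrow> emeasure copy A = emeasure M (f -` A \<inter> space M)"
  unfolding copy_def by (rule emeasure_distr) (use f_copy in \<open>auto simp: copy_def\<close>)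

lemma distr_f: "distr M copy f = copy"
  unfolding copy_def by (rule distr_cong) auto

lemma distr_w: "distr copy M w = M"
proof -
  have "distr (distr M copy f) M w = distr M M (w \<circ> f)"
    by (rule distr_distr) simp_all
  also have "\<dots> = M"
    using distr_cong[of M M M M "w \<circ> f" "\<lambda>x. x"] by (simp add: w_f distr_id)
  finally show ?thesis by (simp add: distr_f)
qed

lemma standard_borel_copy: "standard_borel copy"
  using codes_borel sets_copy space_copy by (intro standard_borel_subset_real) auto

lemma prob_space_copy: "prob_space M \<Longrightarrow> prob_space copy"
  using prob_space.prob_space_distr[OF _ f_copy] distr_f by simp

text \<open>Within the codes, taking images under \<open>f\<close> is taking preimages under the
  measurable map \<open>w\<close>.\<close>

lemma f_image_sets:
  assumes "A \<in> sets M"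
  shows "f ` A \<in> sets copy" "emeasure copy (f ` A) = emeasure M A"
proof -
  have "f ` A = w -` A \<inter> space copy"
  proof (intro equalityI subsetI)
    fix r assume "r \<in> f ` A"
    then obtain x where "x \<in> A" "r = f x" by blast
    then show "r \<in> w -` A \<inter> space copy"
      using sets.sets_into_space[OF assms] w_f[of x] f_codes[of x] by (auto simp: space_copy)
  next
    fix r assume "r \<in> w -` A \<inter> space copy"
    then show "r \<in> f ` A"
      using f_w[of r] by (intro image_eqI[of _ _ "w r"]) auto
  qed
  then show *: "f ` A \<in> sets copy"
    using measurable_sets[OF w_copy assms] by simp
  have "f -` f ` A \<inter> space M = A"
  proof (intro equalityI subsetI)
    fix x assume "x \<in> f -` f ` A \<inter> space M"
    then obtain y where "y \<in> A" "f x = f y" "x \<in> space M" by blast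
    then show "x \<in> A"
      using sets.sets_into_space[OF assms] w_f[of x] w_f[of y] by auto
  qed (use sets.sets_into_space[OF assms] in auto)
  then show "emeasure copy (f ` A) = emeasure M A"
    using emeasure_copy[OF *] by simp
qed

lemma mp_action_copy:
  assumes "mp_action M T"
  shows "mp_action copy (\<lambda>g r. f (T g (w r)))"
proof -
  note T = assms[unfolded mp_action_def]
  have [measurable]: "(\<lambda>(g, x). T g x) \<in> borel \<Otimes>\<^sub>M M \<rightarrow>\<^sub>M M"
    using T by blast
  have Tg: "T g \<in> M \<rightarrow>\<^sub>M M" for g
  proof -
    have "(\<lambda>x. case (g, x) of (g, x) \<Rightarrow> T g x) \<in> M \<rightarrow>\<^sub>M M" by measurable
    then show ?thesis by simp
  qed
  have Tsp: "T g x \<in> space M" if "x \<in> space M" for g x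
    using measurable_space[OF Tg that] .
  have "(\<lambda>(g, r). f (T g (w r))) = (\<lambda>p. f (case (fst p, w (snd p)) of (g, x) \<Rightarrow> T g x))"
    by auto
  also have "\<dots> \<in> borel \<Otimes>\<^sub>M copy \<rightarrow>\<^sub>M copy" by measurable
  finally have 1: "(\<lambda>(g, r). f (T g (w r))) \<in> borel \<Otimes>\<^sub>M copy \<rightarrow>\<^sub>M copy" .
  have 2: "distr copy copy (\<lambda>r. f (T g (w r))) = copy" for g
  proof -
    have "distr copy copy (\<lambda>r. f (T g (w r))) = distr (distr (distr copy M w) M (T g)) copy f"
      using Tg by (subst distr_distr, simp_all add: comp_def)+
    also have "\<dots> = copy"
      using T by (simp add: distr_w distr_f)
    finally show ?thesis .
  qed
  show ?thesis
    unfolding mp_action_def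
    using 1 2 T w_space by (auto simp: f_w w_f Tsp)
qed

end

section \<open>Entropy of returning and of independent partitions\<close>

definition neg_entr :: "real \<Rightarrow> real" where
  "neg_entr p = - (p * ln p)"

lemma neg_entr_nonneg: "0 \<le> p \<Longrightarrow> p \<le> 1 \<Longrightarrow> 0 \<le> neg_entr p"
  by (cases "p = 0") (auto simp: neg_entr_def mult_nonneg_nonpos ln_le_zero_iff)

lemma neg_entr_tendsto_0:
  fixes p :: "nat \<Rightarrow> real"
  assumes "p \<longlonglongrightarrow> 0" "\<And>k. 0 \<le> p k"
  shows "(\<lambda>k. neg_entr (p k)) \<longlonglongrightarrow> 0"
proof -
  have lim: "((\<lambda>x::real. x * ln x) \<longlongrightarrow> 0) (at_right 0)"
    by real_asymp
  show ?thesis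
  proof (rule tendstoI)
    fix e :: real assume "0 < e"
    then have "\<forall>\<^sub>F x in at_right (0::real). dist (x * ln x) 0 < e"
      by (rule tendstoD[OF lim])
    then obtain b :: real where "b > 0 \<and> (\<forall>y>0. y < b \<longrightarrow> dist (y * ln y) 0 < e)"
      unfolding eventually_at_right_field by (elim exE) auto
    then have b: "0 < b" "\<And>x. 0 < x \<Longrightarrow> x < b \<Longrightarrow> dist (x * ln x) 0 < e" by auto
    have "\<forall>\<^sub>F k in sequentially. p k < b"
      using assms(1) b(1) by (auto dest: order_tendstoD)
    then show "\<forall>\<^sub>F k in sequentially. dist (neg_entr (p k)) 0 < e"
    proof eventually_elim
      case (elim k)
      show ?case
        using b(2)[of "p k"] elim assms(2)[of k] \<open>0 < e\<close>
        by (cases "p k = 0") (auto simp: neg_entr_def)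
    qed
  qed
qed

lemma neg_entr_tendsto_1:
  fixes p :: "nat \<Rightarrow> real"
  assumes "p \<longlonglongrightarrow> 1"
  shows "(\<lambda>k. neg_entr (p k)) \<longlonglongrightarrow> 0"
  unfolding neg_entr_def using assms by (auto intro!: tendsto_eq_intros)

context prob_space
begin

abbreviation simple_entropy :: "('a \<Rightarrow> 'b) \<Rightarrow> real" where
  "simple_entropy X \<equiv> entropy (exp 1) (count_space (X ` space M)) X"

lemma information_space_exp: "information_space M (exp 1)"
  by unfold_locales simp

text \<open>Values outside the range contribute \<open>neg_entr 0 = 0\<close>. With a larger
  \<open>A\<close>, functions with different ranges can be treated by sums over one index set, as
  the limits below require.\<close>

lemma simple_entropy_sum:
  assumes "simple_function M X" "X ` space M \<subseteq> A" "finite A"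
  shows "simple_entropy X = (\<Sum>x\<in>A. neg_entr (prob (X -` {x} \<inter> space M)))"
proof -
  interpret information_space M "exp 1" by (rule information_space_exp)
  have "simple_entropy X = - (\<Sum>x\<in>X ` space M. prob (X -` {x} \<inter> space M) * log (exp 1) (prob (X -` {x} \<inter> space M)))"
    by (rule entropy_simple_distributed, rule simple_distributedI[OF assms(1)]) auto
  also have "\<dots> = (\<Sum>x\<in>X ` space M. neg_entr (prob (X -` {x} \<inter> space M)))"
    by (simp add: neg_entr_def log_def sum_negf)
  also have "\<dots> = (\<Sum>x\<in>A. neg_entr (prob (X -` {x} \<inter> space M)))"
  proof (rule sum.mono_neutral_left)
    show "\<forall>i\<in>A - X ` space M. neg_entr (prob (X -` {i} \<inter> space M)) = 0"
    proof
      fix i assume "i \<in> A - X ` space M"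
      then have "X -` {i} \<inter> space M = {}" by auto
      then show "neg_entr (prob (X -` {i} \<inter> space M)) = 0" by (simp add: neg_entr_def)
    qed
  qed (use assms in auto)
  finally show ?thesis .
qed

lemma simple_entropy_nonneg:
  assumes "simple_function M X"
  shows "0 \<le> simple_entropy X"
  using simple_entropy_sum[OF assms subset_refl simple_functionD(1)[OF assms]]
  by (simp add: sum_nonneg neg_entr_nonneg)

lemma simple_entropy_comp_le:
  assumes "simple_function M X"
  shows "simple_entropy (\<lambda>y. f (X y)) \<le> simple_entropy X"
proof -
  interpret information_space M "exp 1" by (rule information_space_exp)
  show ?thesis using entropy_data_processing[OF assms, of f] by (simp add: comp_def)
qed

text \<open>\<open>Y\<close> factors through \<open>X\<close> by choosing a representative in each
  fibre; the rest is data processing. The hypothesis speaks of pairs of points, which suits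
  functions whose dependence is shown by induction.\<close>

lemma simple_entropy_determined_le:
  assumes "simple_function M X" and "\<And>y z. y \<in> space M \<Longrightarrow> z \<in> space M \<Longrightarrow> X y = X z \<Longrightarrow> Y y = Y z"
  shows "simple_function M Y" "simple_entropy Y \<le> simple_entropy X"
proof -
  define f where "f v = Y (SOME y. y \<in> space M \<and> X y = v)" for v
  have f: "f (X y) = Y y" if "y \<in> space M" for y
  proof -
    have "\<exists>z. z \<in> space M \<and> X z = X y" using that by blast
    then have "(SOME z. z \<in> space M \<and> X z = X y) \<in> space M \<and> X (SOME z. z \<in> space M \<and> X z = X y) = X y"
      by (rule someI_ex)
    then show ?thesis
      unfolding f_def using assms(2) that by blast
  qed
  have cong: "simple_function M Y \<longleftrightarrow> simple_function M (\<lambda>y. f (X y))"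
    by (rule simple_function_cong) (simp add: f)
  show sY: "simple_function M Y"
    unfolding cong by (rule simple_function_compose1[OF assms(1)])
  have im: "Y ` space M = (\<lambda>y. f (X y)) ` space M"
    by (rule image_cong) (simp_all add: f)
  have "distr M (count_space (Y ` space M)) Y = distr M (count_space (Y ` space M)) (\<lambda>y. f (X y))"
    by (rule distr_cong) (simp_all add: f)
  then have "simple_entropy Y = simple_entropy (\<lambda>y. f (X y))"
    unfolding entropy_def im by simp
  then show "simple_entropy Y \<le> simple_entropy X"
    using simple_entropy_comp_le[OF assms(1), of f] by simp
qed

lemma simple_entropy_Pair_le:
  assumes "simple_function M X" "simple_function M Y"
  shows "simple_entropy (\<lambda>y. (X y, Y y)) \<le> simple_entropy X + simple_entropy Y"
proof -
  interpret information_space M "exp 1" by (rule information_space_exp)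
  show ?thesis
    using entropy_chain_rule[OF assms] conditional_entropy_less_eq_entropy[OF assms(2) assms(1)] by simp
qed

text \<open>Subadditivity of joint entropy, by induction through pairs. The form with
  \<open>restrict\<close> is the one in which \<open>ks_entropy\<close> encodes joins.\<close>

lemma simple_entropy_restrict_le:
  assumes "finite F" "\<And>i. i \<in> F \<Longrightarrow> simple_function M (Z i)"
  shows "simple_function M (\<lambda>y. \<lambda>i\<in>F. Z i y)
    \<and> simple_entropy (\<lambda>y. \<lambda>i\<in>F. Z i y) \<le> (\<Sum>i\<in>F. simple_entropy (Z i))"
  using assms
proof (induction F)
  case empty
  have s: "simple_function M (\<lambda>y. \<lambda>i\<in>{}. Z i y)"
    unfolding restrict_def by simp
  have "simple_entropy (\<lambda>y. \<lambda>i\<in>{}. Z i y) = (\<Sum>x\<in>{\<lambda>_. undefined}.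
      neg_entr (prob ((\<lambda>y. \<lambda>i\<in>{}. Z i y) -` {x} \<inter> space M)))"
    by (rule simple_entropy_sum[OF s]) (auto simp: restrict_def)
  also have "\<dots> = 0"
    by (simp add: restrict_def prob_space neg_entr_def)
  finally have "simple_entropy (\<lambda>y. \<lambda>i\<in>{}. Z i y) = 0" .
  then have "simple_entropy (\<lambda>y. \<lambda>i\<in>{}. Z i y) \<le> (\<Sum>i\<in>{}. simple_entropy (Z i))"
    unfolding sum.empty by (rule eq_refl)
  with s show ?case by (rule conjI)
next
  case (insert j F)
  have IH: "simple_function M (\<lambda>y. \<lambda>i\<in>F. Z i y)"
      "simple_entropy (\<lambda>y. \<lambda>i\<in>F. Z i y) \<le> (\<Sum>i\<in>F. simple_entropy (Z i))"
    using insert.IH insert.prems by blast+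
  have j: "simple_function M (Z j)"
    using insert.prems by blast
  have P: "simple_function M (\<lambda>y. (Z j y, \<lambda>i\<in>F. Z i y))"
    by (rule simple_function_Pair[OF j IH(1)])
  have det: "(\<lambda>i\<in>insert j F. Z i y) = (\<lambda>i\<in>insert j F. Z i z)"
    if eq: "(Z j y, \<lambda>i\<in>F. Z i y) = (Z j z, \<lambda>i\<in>F. Z i z)" for y z
  proof
    fix i
    show "(\<lambda>i\<in>insert j F. Z i y) i = (\<lambda>i\<in>insert j F. Z i z) i"
      using eq by (cases "i = j") (auto simp: restrict_def fun_eq_iff split: if_splits)
  qed
  note D = simple_entropy_determined_le[OF P, of "\<lambda>y. \<lambda>i\<in>insert j F. Z i y"]
  have "simple_function M (\<lambda>y. \<lambda>i\<in>insert j F. Z i y)"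
    by (rule D(1)) (rule det)
  moreover have "simple_entropy (\<lambda>y. \<lambda>i\<in>insert j F. Z i y) \<le> simple_entropy (\<lambda>y. (Z j y, \<lambda>i\<in>F. Z i y))"
    by (rule D(2)) (rule det)
  moreover have "(\<Sum>i\<in>insert j F. simple_entropy (Z i)) = simple_entropy (Z j) + (\<Sum>i\<in>F. simple_entropy (Z i))"
    using insert.hyps by (rule sum.insert)
  ultimately show ?case
    using simple_entropy_Pair_le[OF j IH(1)] IH(2) by (intro conjI) linarith+
qed

text \<open>Entropy is the mean of \<open>- ln p\<close> over the atoms, and every atom has
  \<open>p \<le> c\<close>.\<close>

lemma simple_entropy_ge:
  assumes "simple_function M X" "0 < c" "\<And>x. prob (X -` {x} \<inter> space M) \<le> c"
  shows "- ln c \<le> simple_entropy X"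
proof -
  have fin: "finite (X ` space M)" using simple_functionD(1)[OF assms(1)] .
  have meas: "X -` {x} \<inter> space M \<in> events" for x
    using simple_functionD(2)[OF assms(1)] .
  have "(\<Sum>x\<in>X ` space M. prob (X -` {x} \<inter> space M)) = prob (\<Union>x\<in>X ` space M. X -` {x} \<inter> space M)"
    by (rule finite_measure_finite_Union[symmetric]) (use fin meas in \<open>auto simp: disjoint_family_on_def\<close>)
  also have "(\<Union>x\<in>X ` space M. X -` {x} \<inter> space M) = space M" by auto
  finally have one: "(\<Sum>x\<in>X ` space M. prob (X -` {x} \<inter> space M)) = 1" by (simp add: prob_space)
  have "- ln c = (\<Sum>x\<in>X ` space M. prob (X -` {x} \<inter> space M) * - ln c)"
    by (simp only: sum_distrib_right[symmetric] one)
  also have "\<dots> \<le> (\<Sum>x\<in>X ` space M. neg_entr (prob (X -` {x} \<inter> space M)))"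
  proof (rule sum_mono)
    fix x
    let ?p = "prob (X -` {x} \<inter> space M)"
    show "?p * - ln c \<le> neg_entr ?p"
    proof (cases "?p = 0")
      case False
      then have "0 < ?p" using measure_nonneg[of M] by (simp add: less_le)
      then have "ln ?p \<le> ln c" using assms by simp
      then show ?thesis
        using \<open>0 < ?p\<close> by (simp add: neg_entr_def)
    qed (simp add: neg_entr_def)
  qed
  also have "\<dots> = simple_entropy X"
    by (rule simple_entropy_sum[symmetric]) (use assms fin in auto)
  finally show ?thesis .
qed

lemma simple_function_comp_measurable:
  assumes "simple_function M X" "S \<in> M \<rightarrow>\<^sub>M M"
  shows "simple_function M (\<lambda>y. X (S y))"
proof -
  have m: "(\<lambda>y. X (S y)) -` {x} \<inter> space M = S -` (X -` {x} \<inter> space M) \<inter> space M" for x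
    using measurable_space[OF assms(2)] by auto
  have sub: "(\<lambda>y. X (S y)) ` space M \<subseteq> X ` space M"
    using measurable_space[OF assms(2)] by auto
  show ?thesis
    unfolding simple_function_def m
    using finite_subset[OF sub simple_functionD(1)[OF assms(1)]]
      measurable_sets[OF assms(2) simple_functionD(2)[OF assms(1)]] by auto
qed

lemma simple_entropy_mp:
  assumes "simple_function M X" "S \<in> M \<rightarrow>\<^sub>M M" "distr M M S = M"
  shows "simple_function M (\<lambda>y. X (S y))" "simple_entropy (\<lambda>y. X (S y)) = simple_entropy X"
proof -
  have m: "(\<lambda>y. X (S y)) -` {x} \<inter> space M = S -` (X -` {x} \<inter> space M) \<inter> space M" for x
    using measurable_space[OF assms(2)] by auto
  have meas: "X -` {x} \<inter> space M \<in> events" for x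
    using simple_functionD(2)[OF assms(1)] .
  have fin: "finite (X ` space M)" using simple_functionD(1)[OF assms(1)] .
  have sub: "(\<lambda>y. X (S y)) ` space M \<subseteq> X ` space M"
    using measurable_space[OF assms(2)] by auto
  show s: "simple_function M (\<lambda>y. X (S y))"
    by (rule simple_function_comp_measurable[OF assms(1,2)])
  have "prob ((\<lambda>y. X (S y)) -` {x} \<inter> space M) = prob (X -` {x} \<inter> space M)" for x
    unfolding m using measure_distr[OF assms(2) meas[of x]] assms(3) by simp
  then show "simple_entropy (\<lambda>y. X (S y)) = simple_entropy X"
    using simple_entropy_sum[OF s sub fin] simple_entropy_sum[OF assms(1) subset_refl fin] by simp
qed

text \<open>Along a chain \<open>\<dots>, p (p i), p i, i\<close> the values of \<open>X\<close> are recovered from the first one and the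
  variables \<open>D\<close>, which record the changes of \<open>X\<close> along the chain.\<close>

lemma simple_entropy_join_le:
  fixes T :: "'i \<Rightarrow> 'a \<Rightarrow> 'a" and X :: "'a \<Rightarrow> nat" and rank :: "'i \<Rightarrow> real"
  assumes X: "simple_function M X"
    and T: "\<And>i. T i \<in> M \<rightarrow>\<^sub>M M" "\<And>i. distr M M (T i) = M"
    and F: "finite F"
    and p: "\<And>i y. i \<in> F \<Longrightarrow> i \<in> B \<Longrightarrow> p i \<in> F \<Longrightarrow> y \<in> space M \<Longrightarrow> T i y = T h (T (p i) y)"
    and rank: "\<And>i. i \<in> F \<Longrightarrow> i \<in> B \<Longrightarrow> p i \<in> F \<Longrightarrow> rank (p i) < rank i"
  defines "D \<equiv> \<lambda>y. if X (T h y) = X y then 0 else Suc (X (T h y))"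
    and "E \<equiv> {i \<in> F. \<not> (i \<in> B \<and> p i \<in> F)}"
  shows "simple_function M (\<lambda>y. \<lambda>i\<in>F. X (T i y))"
    and "simple_entropy (\<lambda>y. \<lambda>i\<in>F. X (T i y))
      \<le> real (card E) * simple_entropy X + real (card F) * simple_entropy D"
proof -
  have D: "simple_function M D"
    unfolding D_def
    by (rule simple_entropy_determined_le(1)[OF simple_function_Pair[OF simple_entropy_mp(1)[OF X T, of h] X]]) simp
  define Z where "Z i y = (if i \<in> E then X (T i y) else D (T (p i) y))" for i y
  have Z: "simple_function M (Z i)" for i
    unfolding Z_def using simple_entropy_mp(1)[OF X T] simple_entropy_mp(1)[OF D T] by (cases "i \<in> E") auto
  have HZ: "simple_entropy (Z i) = (if i \<in> E then simple_entropy X else simple_entropy D)" for i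
    unfolding Z_def using simple_entropy_mp(2)[OF X T] simple_entropy_mp(2)[OF D T] by auto
  note K = simple_entropy_restrict_le[OF F Z]
  have det: "(\<lambda>i\<in>F. X (T i y)) = (\<lambda>i\<in>F. X (T i z))"
    if yz: "y \<in> space M" "z \<in> space M" and eq: "(\<lambda>i\<in>F. Z i y) = (\<lambda>i\<in>F. Z i z)" for y z
  proof -
    have Zeq: "Z i y = Z i z" if "i \<in> F" for i
      using fun_cong[OF eq, of i] that by simp
    \<comment> \<open>The order of the reals is not well-founded, so the induction runs over the
      number of elements of \<open>F\<close> whose rank is smaller than that of
      \<open>i\<close>.\<close>
    have "i \<in> F \<longrightarrow> X (T i y) = X (T i z)" for i
    proof (induction i rule: measure_induct_rule[where f = "\<lambda>i. card {j \<in> F. rank j < rank i}"])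
      case (less i)
      show ?case
      proof (cases "i \<in> F - E")
        case True
        then have i: "i \<in> F" "i \<in> B" "p i \<in> F" by (auto simp: E_def)
        have "card {j \<in> F. rank j < rank (p i)} < card {j \<in> F. rank j < rank i}"
          using rank[OF i] i F by (intro psubset_card_mono) auto
        then have IH: "X (T (p i) y) = X (T (p i) z)" using less i by blast
        \<comment> \<open>\<open>D\<close> is 0 when \<open>X\<close> is unchanged and otherwise
          names the new value, so together with the old value it yields the new one.\<close>
        have "D (T (p i) y) = D (T (p i) z)"
          using Zeq[OF i(1)] True by (simp add: Z_def)
        then have "X (T h (T (p i) y)) = X (T h (T (p i) z))"
          using IH unfolding D_def by (auto split: if_splits)
        then show ?thesis using p[OF i] yz by simp
      next
        case False
        then show ?thesis using Zeq[of i] by (cases "i \<in> E") (auto simp: Z_def E_def)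
      qed
    qed
    then show ?thesis by (auto simp: restrict_def)
  qed
  show "simple_function M (\<lambda>y. \<lambda>i\<in>F. X (T i y))"
    by (rule simple_entropy_determined_le(1)[OF conjunct1[OF K] det])
  have "simple_entropy (\<lambda>y. \<lambda>i\<in>F. X (T i y)) \<le> simple_entropy (\<lambda>y. \<lambda>i\<in>F. Z i y)"
    by (rule simple_entropy_determined_le(2)[OF conjunct1[OF K] det])
  also have "\<dots> \<le> (\<Sum>i\<in>F. simple_entropy (Z i))" using K by simp
  also have "\<dots> \<le> (\<Sum>i\<in>F. (if i \<in> E then simple_entropy X else 0) + simple_entropy D)"
    using simple_entropy_nonneg[OF D] simple_entropy_nonneg[OF X] by (intro sum_mono) (auto simp: HZ)
  also have "\<dots> = real (card E) * simple_entropy X + real (card F) * simple_entropy D"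
  proof -
    have "(\<Sum>i\<in>F. if i \<in> E then simple_entropy X else 0) = (\<Sum>i\<in>E. simple_entropy X)"
      using F by (intro sum.mono_neutral_cong_right) (auto simp: E_def)
    then show ?thesis by (simp add: sum.distrib)
  qed
  finally show "simple_entropy (\<lambda>y. \<lambda>i\<in>F. X (T i y))
      \<le> real (card E) * simple_entropy X + real (card F) * simple_entropy D" .
qed

text \<open>The change variables take their values in one finite set for all \<open>k\<close>, and
  the value 0, meaning no change, has probability tending to 1. Their entropy is a fixed finite sum
  of terms that vanish as the probabilities tend to 0 or 1.\<close>

lemma simple_entropy_change_tendsto_0:
  fixes X :: "'a \<Rightarrow> nat"
  assumes X: "simple_function M X"
    and S: "\<And>k. S k \<in> M \<rightarrow>\<^sub>M M"
    and lim: "\<And>B. B \<in> events \<Longrightarrow> (\<lambda>k. prob (B - (S k -` B \<inter> space M))) \<longlonglongrightarrow> 0"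
  shows "(\<lambda>k. simple_entropy (\<lambda>y. if X (S k y) = X y then 0 else Suc (X (S k y)))) \<longlonglongrightarrow> 0"
proof -
  define D where "D k y = (if X (S k y) = X y then 0 else Suc (X (S k y)))" for k y
  define A where "A = X ` space M"
  have fin: "finite A" unfolding A_def using simple_functionD(1)[OF X] .
  have ev: "X -` {x} \<inter> space M \<in> events" for x
    using simple_functionD(2)[OF X] .
  have sub: "D k ` space M \<subseteq> insert 0 (Suc ` A)" for k
    using measurable_space[OF S] by (auto simp: D_def A_def)
  have DS: "simple_function M (D k)" for k
    unfolding D_def
    by (rule simple_entropy_determined_le(1)[OF simple_function_Pair[OF simple_function_comp_measurable[OF X S[of k]] X]]) simp
  have D0: "{y \<in> space M. X (S k y) \<noteq> X y} = space M - (D k -` {0} \<inter> space M)" for k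
    by (auto simp: D_def split: if_splits)
  have chg_ev: "{y \<in> space M. X (S k y) \<noteq> X y} \<in> events" for k
    unfolding D0 using simple_functionD(2)[OF DS] by blast
  let ?C = "\<lambda>k. (\<Sum>x\<in>A. prob ((X -` {x} \<inter> space M) - (S k -` (X -` {x} \<inter> space M) \<inter> space M)))"
  have C0: "?C \<longlonglongrightarrow> 0"
    using tendsto_sum[of A, OF lim[OF ev]] by simp
  \<comment> \<open>A point at which \<open>X\<close> changes has left the level set of its old
    value.\<close>
  have chg: "prob {y \<in> space M. X (S k y) \<noteq> X y} \<le> ?C k" for k
  proof -
    have "prob {y \<in> space M. X (S k y) \<noteq> X y} \<le>
        prob (\<Union>x\<in>A. (X -` {x} \<inter> space M) - (S k -` (X -` {x} \<inter> space M) \<inter> space M))"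
      using fin ev measurable_sets[OF S ev]
      by (intro finite_measure_mono sets.finite_UN sets.Diff) (auto simp: A_def)
    also have "\<dots> \<le> ?C k"
      using fin ev measurable_sets[OF S ev]
      by (intro finite_measure_subadditive_finite) auto
    finally show ?thesis .
  qed
  have p0: "(\<lambda>k. prob (D k -` {Suc x} \<inter> space M)) \<longlonglongrightarrow> 0" for x
  proof (rule tendsto_sandwich[OF _ _ tendsto_const C0])
    have "prob (D k -` {Suc x} \<inter> space M) \<le> prob {y \<in> space M. X (S k y) \<noteq> X y}" for k
      by (intro finite_measure_mono chg_ev) (auto simp: D_def split: if_splits)
    then show "\<forall>\<^sub>F k in sequentially. prob (D k -` {Suc x} \<inter> space M) \<le> ?C k"
      using chg order_trans by (intro always_eventually) blast
  qed auto
  have p1: "(\<lambda>k. prob (D k -` {0} \<inter> space M)) \<longlonglongrightarrow> 1"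
  proof (rule tendsto_sandwich[OF _ _ _ tendsto_const])
    have "prob (D k -` {0} \<inter> space M) = 1 - prob {y \<in> space M. X (S k y) \<noteq> X y}" for k
      unfolding D0 using simple_functionD(2)[OF DS] by (subst prob_compl) auto
    note compl = this
    have "1 - ?C k \<le> prob (D k -` {0} \<inter> space M)" for k
      unfolding compl[of k] using chg[of k] by (rule diff_left_mono)
    then show "\<forall>\<^sub>F k in sequentially. 1 - ?C k \<le> prob (D k -` {0} \<inter> space M)"
      by (intro always_eventually allI)
    show "(\<lambda>k. 1 - ?C k) \<longlonglongrightarrow> 1"
      using tendsto_diff[OF tendsto_const C0, of 1] by simp
  qed auto
  have "simple_entropy (D k) = neg_entr (prob (D k -` {0} \<inter> space M)) +
      (\<Sum>x\<in>A. neg_entr (prob (D k -` {Suc x} \<inter> space M)))" for k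
  proof -
    have "simple_entropy (D k) = (\<Sum>x\<in>insert 0 (Suc ` A). neg_entr (prob (D k -` {x} \<inter> space M)))"
      by (rule simple_entropy_sum[OF DS sub]) (use fin in auto)
    then show ?thesis
      using fin by (subst (asm) sum.insert) (auto simp: sum.reindex)
  qed
  then have "(\<lambda>k. simple_entropy (D k)) = (\<lambda>k. neg_entr (prob (D k -` {0} \<inter> space M)) +
      (\<Sum>x\<in>A. neg_entr (prob (D k -` {Suc x} \<inter> space M))))" by (simp add: fun_eq_iff)
  also have "\<dots> \<longlonglongrightarrow> 0 + (\<Sum>x\<in>A. 0)"
    by (intro tendsto_add tendsto_sum neg_entr_tendsto_0 neg_entr_tendsto_1 p0 p1) simp
  finally show ?thesis by (simp add: D_def[abs_def])
qed

lemma ks_entropy_nonneg: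
  assumes "\<And>i. T i \<in> M \<rightarrow>\<^sub>M M" "\<And>n. finite (F n)"
  shows "0 \<le> ks_entropy M T F"
proof -
  let ?X = "\<lambda>_::'a. 0::nat"
  have J: "simple_function M (\<lambda>y. \<lambda>i\<in>F n. ?X (T i y))" for n
    using simple_entropy_restrict_le[OF assms(2), of n "\<lambda>_ _. 0"] by simp
  have "0 \<le> limsup (\<lambda>n. let J = (\<lambda>y. \<lambda>g\<in>F n. ?X (T g y)) in
      ereal (entropy (exp 1) (count_space (J ` space M)) J / real (card (F n))))"
    unfolding Let_def
    by (rule le_Limsup) (auto intro!: always_eventually divide_nonneg_nonneg simple_entropy_nonneg[OF J])
  also have "\<dots> \<le> ks_entropy M T F"
    unfolding ks_entropy_def by (rule SUP_upper) simp
  finally show ?thesis .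
qed

text \<open>By \<open>simple_entropy_join_le\<close> the entropy per element of \<open>F n\<close>
  is at most the proportion of chain starts times the entropy of \<open>X\<close>, plus the entropy
  of the change variable for \<open>h k\<close>. First \<open>k\<close> is fixed so that the second
  term is small; then the first one vanishes as \<open>n\<close> grows. Initial segments and boxes
  are both covered.\<close>

lemma ks_entropy_eq_0:
  fixes T :: "'i \<Rightarrow> 'a \<Rightarrow> 'a" and rank :: "nat \<Rightarrow> 'i \<Rightarrow> real"
  assumes T: "\<And>i. T i \<in> M \<rightarrow>\<^sub>M M" "\<And>i. distr M M (T i) = M"
    and F: "\<And>n. finite (F n)"
    and p: "\<And>k i y. i \<in> B k \<Longrightarrow> y \<in> space M \<Longrightarrow> T i y = T (h k) (T (p k i) y)"
    and rank: "\<And>k i. i \<in> B k \<Longrightarrow> rank k (p k i) < rank k i"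
    and lim: "\<And>A. A \<in> events \<Longrightarrow> (\<lambda>k. prob (A - (T (h k) -` A \<inter> space M))) \<longlonglongrightarrow> 0"
    and card: "\<And>k. (\<lambda>n. real (card {i \<in> F n. \<not> (i \<in> B k \<and> p k i \<in> F n)}) / real (card (F n))) \<longlonglongrightarrow> 0"
  shows "ks_entropy M T F = 0"
proof (rule antisym)
  show "0 \<le> ks_entropy M T F" by (rule ks_entropy_nonneg[OF T(1) F])
  show "ks_entropy M T F \<le> 0"
    unfolding ks_entropy_def
  proof (rule SUP_least)
    fix X :: "'a \<Rightarrow> nat" assume "X \<in> {X. simple_function M X}"
    then have X: "simple_function M X" by simp
    show "limsup (\<lambda>n. let J = (\<lambda>y. \<lambda>g\<in>F n. X (T g y)) in
      ereal (entropy (exp 1) (count_space (J ` space M)) J / real (card (F n)))) \<le> 0"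
      unfolding Let_def
    proof (rule ereal_le_epsilon2)
      fix e :: real assume e: "0 < e"
      define D where "D k y = (if X (T (h k) y) = X y then 0 else Suc (X (T (h k) y)))" for k y
      have "(\<lambda>k. simple_entropy (D k)) \<longlonglongrightarrow> 0"
        unfolding D_def[abs_def] by (rule simple_entropy_change_tendsto_0[OF X T(1) lim])
      then have "\<forall>\<^sub>F k in sequentially. simple_entropy (D k) < e / 2"
        using e by (intro order_tendstoD(2)[where y = 0]) auto
      then obtain k where k: "simple_entropy (D k) < e / 2"
        by (auto simp: eventually_sequentially)
      let ?r = "\<lambda>n. real (card {i \<in> F n. \<not> (i \<in> B k \<and> p k i \<in> F n)}) / real (card (F n))"
      have "(\<lambda>n. ?r n * simple_entropy X) \<longlonglongrightarrow> 0"
        using tendsto_mult_right[OF card[of k], of "simple_entropy X"] by simp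
      then have "\<forall>\<^sub>F n in sequentially. ?r n * simple_entropy X < e / 2"
        using e by (intro order_tendstoD(2)[where y = 0]) auto
      then have "\<forall>\<^sub>F n in sequentially.
          ereal (simple_entropy (\<lambda>y. \<lambda>g\<in>F n. X (T g y)) / real (card (F n))) \<le> 0 + ereal e"
      proof eventually_elim
        case (elim n)
        show ?case
        proof (cases "card (F n) = 0")
          case True
          then show ?thesis using e by simp
        next
          case False
          have "simple_entropy (\<lambda>y. \<lambda>i\<in>F n. X (T i y))
            \<le> real (card {i \<in> F n. \<not> (i \<in> B k \<and> p k i \<in> F n)}) * simple_entropy X
              + real (card (F n)) * simple_entropy (D k)"
            unfolding D_def
            by (rule simple_entropy_join_le(2)[where rank = "rank k"]) (fact X T F | rule p rank, assumption+)+
          then have "simple_entropy (\<lambda>y. \<lambda>i\<in>F n. X (T i y)) / real (card (F n))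
            \<le> ?r n * simple_entropy X + simple_entropy (D k)"
            using False by (simp add: field_simps del: restrict_apply)
          then have "simple_entropy (\<lambda>y. \<lambda>i\<in>F n. X (T i y)) / real (card (F n)) \<le> e"
            using elim k by linarith
          then show ?thesis unfolding add_0 ereal_less_eq .
        qed
      qed
      then show "limsup (\<lambda>n. ereal (simple_entropy (\<lambda>y. \<lambda>g\<in>F n. X (T g y)) / real (card (F n)))) \<le> 0 + ereal e"
        by (rule Limsup_bounded)
    qed
  qed
qed

text \<open>If every atom of the \<open>n\<close>-fold join has probability at most
  \<open>q ^ n\<close>, the join has entropy at least \<open>- n * ln q\<close>, and
  \<open>q\<close> may be as small as desired.\<close>

lemma transformation_entropy_infinite:
  assumes "\<And>i. S ^^ i \<in> M \<rightarrow>\<^sub>M M"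
    and "\<And>c::real. \<exists>q>0. c \<le> - ln q \<and> (\<exists>X :: 'a \<Rightarrow> nat. simple_function M X \<and>
      (\<forall>n v. prob {y \<in> space M. \<forall>i<n. X ((S ^^ i) y) = v i} \<le> q ^ n))"
  shows "transformation_entropy M S = \<infinity>"
proof (rule ereal_top)
  fix c :: real
  obtain q and X :: "'a \<Rightarrow> nat" where q: "0 < q" "c \<le> - ln q" and X: "simple_function M X"
    and at: "\<And>n v. prob {y \<in> space M. \<forall>i<n. X ((S ^^ i) y) = v i} \<le> q ^ n"
    using assms(2)[of c] by blast
  have Xi: "simple_function M (\<lambda>y. X ((S ^^ i) y))" for i
    by (rule simple_function_comp_measurable[OF X assms(1)])
  have J: "simple_function M (\<lambda>y. \<lambda>i\<in>{..<n}. X ((S ^^ i) y))" for n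
    using simple_entropy_restrict_le[OF _ Xi, of "{..<n}"] by simp
  have "ereal c \<le> ereal (simple_entropy (\<lambda>y. \<lambda>i\<in>{..<n}. X ((S ^^ i) y)) / real (card {..<n}))"
    if "0 < n" for n
  proof -
    have "- ln (q ^ n) \<le> simple_entropy (\<lambda>y. \<lambda>i\<in>{..<n}. X ((S ^^ i) y))"
    proof (rule simple_entropy_ge[OF J])
      fix v
      have "prob ((\<lambda>y. \<lambda>i\<in>{..<n}. X ((S ^^ i) y)) -` {v} \<inter> space M)
        \<le> prob {y \<in> space M. \<forall>i<n. X ((S ^^ i) y) = v i}"
      proof (rule finite_measure_mono)
        have "{y \<in> space M. X ((S ^^ i) y) = v i} \<in> events" for i
          using simple_functionD(2)[OF Xi, of i "{v i}"] by (simp add: vimage_def Int_def conj_commute)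
        then show "{y \<in> space M. \<forall>i<n. X ((S ^^ i) y) = v i} \<in> events"
          using sets.sets_Collect_finite_All[of "{..<n}" M "\<lambda>i y. X ((S ^^ i) y) = v i"] by (auto simp: Ball_def)
      qed (auto simp: restrict_def fun_eq_iff)
      then show "prob ((\<lambda>y. \<lambda>i\<in>{..<n}. X ((S ^^ i) y)) -` {v} \<inter> space M) \<le> q ^ n"
        using at[of n v] by simp
    qed (use q in simp)
    then have "real n * c \<le> simple_entropy (\<lambda>y. \<lambda>i\<in>{..<n}. X ((S ^^ i) y))"
      using q that mult_left_mono[of c "- ln q" "real n"] by (simp add: ln_realpow)
    then show ?thesis using that by (simp add: field_simps)
  qed
  then have "ereal c \<le> limsup (\<lambda>n. ereal (simple_entropy (\<lambda>y. \<lambda>i\<in>{..<n}. X ((S ^^ i) y)) / real (card {..<n})))"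
    by (intro le_Limsup) (auto simp: eventually_sequentially intro!: exI[of _ 1])
  also have "\<dots> \<le> transformation_entropy M S"
    unfolding transformation_entropy_def ks_entropy_def Let_def by (rule SUP_upper2[of X]) (use X in auto)
  finally show "ereal c \<le> transformation_entropy M S" .
qed

end

section \<open>Poisson point processes\<close>

text \<open>A predicate is used instead of a comparison with \<open>card\<close>, which is 0 on
  infinite sets; an infinite set satisfies it for every \<open>k\<close>.\<close>

definition at_least :: "nat \<Rightarrow> 'a set \<Rightarrow> bool" where
  "at_least k S \<longleftrightarrow> (\<exists>F\<subseteq>S. finite F \<and> card F = k)"

lemma at_least_finite: "finite S \<Longrightarrow> at_least k S \<longleftrightarrow> k \<le> card S"
  unfolding at_least_def by (metis card_mono obtain_subset_with_card_n)

lemma at_least_infinite: "infinite S \<Longrightarrow> at_least k S"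
  unfolding at_least_def by (metis infinite_arbitrarily_large)

definition num :: "'a set \<Rightarrow> ennreal" where
  "num S = emeasure (count_space UNIV) S"

text \<open>Reduces the measurability of a count to that of the events
  \<open>at_least k\<close>.\<close>

lemma num_eq_SUP: "num S = (SUP k. if at_least k S then of_nat k else 0)"
proof (cases "finite S")
  case True
  show ?thesis
  proof (rule antisym)
    show "num S \<le> (SUP k. if at_least k S then of_nat k else 0)"
      using True by (intro SUP_upper2[of "card S"]) (auto simp: num_def at_least_finite)
    show "(SUP k. if at_least k S then of_nat k else 0) \<le> num S"
      using True by (intro SUP_least) (auto simp: num_def at_least_finite)
  qed
next
  case False
  then have "(SUP k. if at_least k S then of_nat k else 0) = (SUP k. of_nat k :: ennreal)"
    by (simp add: at_least_infinite)
  then have top: "(SUP k. if at_least k S then of_nat k else 0) = (top :: ennreal)"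
    unfolding ennreal_SUP_of_nat_eq_top .
  have "num S = top" using False by (simp add: num_def)
  from this top show ?thesis by (rule trans[OF _ sym])
qed

lemma num_finite: "finite S \<Longrightarrow> num S = of_nat (card S)"
  by (simp add: num_def)

lemma num_eq_of_nat_iff: "num S = of_nat k \<longleftrightarrow> finite S \<and> card S = k"
  by (cases "finite S") (auto simp: num_def)

definition cell :: "nat \<Rightarrow> int \<Rightarrow> real set" where
  "cell m z = {x. \<lfloor>x * 2 ^ m\<rfloor> = z}"

lemma cell_borel [measurable]: "cell m z \<in> sets borel"
proof -
  have "cell m z = {x \<in> space borel. \<lfloor>x * 2 ^ m\<rfloor> = z}" by (simp add: cell_def)
  also have "\<dots> \<in> sets borel" by measurable
  finally show ?thesis .
qed

text \<open>Once \<open>2 ^ m\<close> times the smallest distance is at least 1, no two points share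
  a dyadic interval of level \<open>m\<close>.\<close>

lemma finite_cells_separate:
  fixes F :: "real set"
  assumes "finite F"
  obtains m where "inj_on (\<lambda>x. \<lfloor>x * 2 ^ m\<rfloor>) F"
proof -
  have ev: "\<forall>\<^sub>F m in sequentially. \<forall>x\<in>F. \<forall>y\<in>F. x \<noteq> y \<longrightarrow> \<lfloor>x * 2 ^ m\<rfloor> \<noteq> \<lfloor>y * 2 ^ m\<rfloor>"
  proof (intro eventually_ball_finite assms ballI)
    fix x y :: real
    show "\<forall>\<^sub>F m in sequentially. x \<noteq> y \<longrightarrow> \<lfloor>x * 2 ^ m\<rfloor> \<noteq> \<lfloor>y * 2 ^ m\<rfloor>"
    proof (cases "x = y")
      case False
      have "filterlim (\<lambda>m. 2 ^ m :: real) at_top sequentially" by real_asymp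
      then have "filterlim (\<lambda>m. \<bar>x - y\<bar> * 2 ^ m :: real) at_top sequentially"
        using False by (intro filterlim_tendsto_pos_mult_at_top[OF tendsto_const]) auto
      then have "\<forall>\<^sub>F m in sequentially. 1 \<le> \<bar>x - y\<bar> * 2 ^ m"
        by (simp add: filterlim_at_top)
      then show ?thesis
      proof eventually_elim
        case (elim m)
        have "\<bar>x - y\<bar> * 2 ^ m = \<bar>x * 2 ^ m - y * 2 ^ m\<bar>"
          by (simp add: abs_mult left_diff_distrib[symmetric])
        with elim show ?case by linarith
      qed
    qed simp
  qed
  then show ?thesis
    using that unfolding eventually_sequentially inj_on_def by blast
qed

lemma countable_finite_int_sets: "countable {Z :: int set. finite Z \<and> card Z = k}"
  by (rule countable_subset[OF _ countable_Collect_finite]) auto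

text \<open>Turns a statement about the order statistics of a finite set into one about counts,
  whose measurability is known. Lists are indexed from 0, hence \<open>Suc k\<close>.\<close>

lemma sorted_list_nth_le_iff:
  fixes S :: "real set"
  assumes "finite S" "k < card S"
  shows "sorted_list_of_set S ! k \<le> t \<longleftrightarrow> Suc k \<le> card (S \<inter> {..t})"
proof -
  let ?l = "sorted_list_of_set S"
  have l: "sorted ?l" "distinct ?l" "set ?l = S" "length ?l = card S"
    using assms by auto
  have inj: "inj_on (\<lambda>i. ?l ! i) {..<length ?l}"
    using l(2) by (auto simp: inj_on_def nth_eq_iff_index_eq)
  show ?thesis
  proof
    assume le: "?l ! k \<le> t"
    have "(\<lambda>i. ?l ! i) ` {..k} \<subseteq> S \<inter> {..t}"
    proof (rule image_subsetI)
      fix i assume "i \<in> {..k}"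
      then have "i \<le> k" by simp
      then have "?l ! i \<le> ?l ! k" using l assms by (intro sorted_nth_mono) auto
      moreover have "?l ! i \<in> set ?l" using \<open>i \<le> k\<close> l assms by (intro nth_mem) simp
      ultimately show "?l ! i \<in> S \<inter> {..t}" using le l by auto
    qed
    then have "card ((\<lambda>i. ?l ! i) ` {..k}) \<le> card (S \<inter> {..t})"
      using assms by (intro card_mono) auto
    moreover have "card ((\<lambda>i. ?l ! i) ` {..k}) = Suc k"
      using inj_on_subset[OF inj, of "{..k}"] assms l(4) by (subst card_image) (auto simp: subset_iff)
    ultimately show "Suc k \<le> card (S \<inter> {..t})" by simp
  next
    assume le: "Suc k \<le> card (S \<inter> {..t})"
    show "?l ! k \<le> t"
    proof (rule ccontr)
      assume nle: "\<not> ?l ! k \<le> t"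
      have "S \<inter> {..t} \<subseteq> (\<lambda>i. ?l ! i) ` {..<k}"
      proof
        fix x assume x: "x \<in> S \<inter> {..t}"
        then obtain i where i: "i < length ?l" "?l ! i = x"
          using l(3) by (metis IntE in_set_conv_nth)
        have "i < k"
        proof (rule ccontr)
          assume "\<not> i < k"
          then have "?l ! k \<le> ?l ! i" using l i by (intro sorted_nth_mono) auto
          then show False using nle i x by auto
        qed
        then show "x \<in> (\<lambda>i. ?l ! i) ` {..<k}" using i by auto
      qed
      then have "card (S \<inter> {..t}) \<le> card ((\<lambda>i. ?l ! i) ` {..<k})" by (intro card_mono) auto
      also have "\<dots> \<le> k" using card_image_le[of "{..<k}"] by simp
      finally show False using le by simp
    qed
  qed
qed

text \<open>The increasing sets \<open>X K\<close> of finite measure play the part of bounded sets: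
  configurations are to be finite on each of them. Fixing the exhaustion gives a space of point sets
  that the actions considered later map into itself.\<close>

locale bounded_space =
  fixes M :: "real measure" and X :: "nat \<Rightarrow> real set"
  assumes space_borel: "space M \<in> sets borel"
    and sets_M: "sets M = sets (restrict_space borel (space M))"
    and X_sets [measurable]: "X K \<in> sets M"
    and X_mono: "incseq X"
    and X_UN: "(\<Union>K. X K) = space M"
    and X_fin: "emeasure M (X K) < \<infinity>"
    and points_null: "x \<in> space M \<Longrightarrow> emeasure M {x} = 0"
begin

definition bdd :: "real set \<Rightarrow> bool" where
  "bdd A \<longleftrightarrow> A \<in> sets M \<and> (\<exists>K. A \<subseteq> X K)"

text \<open>A diffuse Poisson process has no multiple points, so that configurations may be represented by sets.
  Their law is then determined by the probabilities of the events \<open>void A\<close>, which are stable under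
  finite intersections.\<close>

definition locfin :: "real set set" where
  "locfin = {c. c \<subseteq> space M \<and> (\<forall>K. finite (c \<inter> X K))}"

definition void :: "real set \<Rightarrow> real set set" where
  "void A = {c \<in> locfin. c \<inter> A = {}}"

definition voids :: "real set \<Rightarrow> real set set set" where
  "voids A = {void B | B. bdd B \<and> B \<subseteq> A}"

definition point_sets :: "real set measure" where
  "point_sets = sigma locfin (voids (space M))"

definition poisson_law :: "real set measure \<Rightarrow> bool" where
  "poisson_law P \<longleftrightarrow> sets P = sets point_sets \<and> prob_space P \<and>
    (\<forall>A. bdd A \<longrightarrow> measure P (void A) = exp (- measure M A))"

lemma M_subset_borel: "A \<in> sets M \<Longrightarrow> A \<in> sets borel"
proof -
  assume "A \<in> sets M"
  then obtain B where "B \<in> sets borel" "A = space M \<inter> B"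
    unfolding sets_M sets_restrict_space by blast
  then show "A \<in> sets borel" using space_borel by auto
qed

lemma Int_borel_M [measurable]: "A \<in> sets M \<Longrightarrow> B \<in> sets borel \<Longrightarrow> A \<inter> B \<in> sets M"
proof -
  assume A: "A \<in> sets M" and B: "B \<in> sets borel"
  have "A \<inter> B = space M \<inter> (A \<inter> B)" using sets.sets_into_space[OF A] by auto
  then show ?thesis
    using M_subset_borel[OF A] B unfolding sets_M sets_restrict_space by blast
qed

lemma id_borel_measurable: "(\<lambda>x. x) \<in> borel_measurable M"
  unfolding measurable_cong_sets[OF sets_M refl] by (rule measurable_restrict_space1) simp

lemma bdd_sets: "bdd A \<Longrightarrow> A \<in> sets M"
  by (simp add: bdd_def)

lemma bdd_subset: "bdd A \<Longrightarrow> B \<in> sets M \<Longrightarrow> B \<subseteq> A \<Longrightarrow> bdd B"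
  by (auto simp: bdd_def)

lemma bdd_empty: "bdd {}"
  by (auto simp: bdd_def)

lemma bdd_Un: "bdd A \<Longrightarrow> bdd B \<Longrightarrow> bdd (A \<union> B)"
proof -
  assume "bdd A" "bdd B"
  then obtain K L where "A \<in> sets M" "B \<in> sets M" "A \<subseteq> X K" "B \<subseteq> X L" by (auto simp: bdd_def)
  moreover have "X K \<subseteq> X (max K L)" "X L \<subseteq> X (max K L)"
    using incseqD[OF X_mono] by (simp_all add: max_def)
  ultimately show ?thesis
    unfolding bdd_def by (intro conjI exI[of _ "max K L"]) auto
qed

lemma bdd_finite_UN: "finite J \<Longrightarrow> (\<And>j. j \<in> J \<Longrightarrow> bdd (A j)) \<Longrightarrow> bdd (\<Union>j\<in>J. A j)"
  by (induction J rule: finite_induct) (auto intro: bdd_empty bdd_Un)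

lemma bdd_finite: "bdd A \<Longrightarrow> emeasure M A < \<infinity>"
  unfolding bdd_def using X_fin emeasure_mono[of A _ M] X_sets by (meson le_less_trans)

lemma finite_subset_X:
  assumes "finite F" "F \<subseteq> space M"
  shows "\<exists>K. F \<subseteq> X K"
  using assms
proof (induction F)
  case (insert x F)
  then obtain K where "F \<subseteq> X K" by auto
  moreover obtain L where "x \<in> X L" using insert X_UN by blast
  moreover have "X K \<subseteq> X (max K L)" "X L \<subseteq> X (max K L)"
    using incseqD[OF X_mono] by (simp_all add: max_def)
  ultimately show ?case by (intro exI[of _ "max K L"]) auto
qed simp

lemma voids_subset: "voids A \<subseteq> Pow locfin"
  by (auto simp: voids_def void_def)

lemma space_point_sets: "space point_sets = locfin"
  unfolding point_sets_def using voids_subset by (rule space_measure_of)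

lemma sets_point_sets: "sets point_sets = sigma_sets locfin (voids (space M))"
  unfolding point_sets_def using voids_subset by (rule sets_measure_of)

lemma void_in_voids: "bdd B \<Longrightarrow> void B \<in> voids (space M)"
  unfolding voids_def using sets.sets_into_space by (auto simp: bdd_def)

lemma void_sets: "bdd B \<Longrightarrow> void B \<in> sets point_sets"
  unfolding sets_point_sets by (intro sigma_sets.Basic void_in_voids)

lemma void_Int: "void A \<inter> void B = void (A \<union> B)"
  by (auto simp: void_def)

lemma Int_stable_voids: "Int_stable (voids A)"
proof (rule Int_stableI)
  fix a b assume "a \<in> voids A" "b \<in> voids A"
  then obtain B C where "a = void B" "b = void C" "bdd B" "bdd C" "B \<subseteq> A" "C \<subseteq> A"
    by (auto simp: voids_def)
  then show "a \<inter> b \<in> voids A"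
    unfolding voids_def by (intro CollectI exI[of _ "B \<union> C"]) (auto simp: void_Int bdd_Un)
qed

lemma sigma_voids_mono: "A \<subseteq> B \<Longrightarrow> sigma_sets locfin (voids A) \<subseteq> sigma_sets locfin (voids B)"
  by (intro sigma_sets_mono') (auto simp: voids_def)

lemma sigma_voids_subset:
  "A \<subseteq> space M \<Longrightarrow> sigma_sets locfin (voids A) \<subseteq> sets point_sets"
  unfolding sets_point_sets by (rule sigma_voids_mono)

text \<open>At least \<open>k\<close> points lie in \<open>A\<close> iff, for some \<open>K\<close>
  and some dyadic level, \<open>k\<close> different cells of \<open>A \<inter> X K\<close> are
  occupied, and occupation is the complement of a void event. Only void events of subsets of
  \<open>A\<close> occur, which is what independence over disjoint sets requires later.\<close>

lemma at_least_sigma_voids: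
  assumes "A \<in> sets M"
  shows "{c \<in> locfin. at_least k (c \<inter> A)} \<in> sigma_sets locfin (voids A)"
proof -
  interpret S: sigma_algebra locfin "sigma_sets locfin (voids A)"
    by (rule sigma_algebra_sigma_sets[OF voids_subset])
  have A: "A \<subseteq> space M" using sets.sets_into_space[OF assms] .
  define H where "H K m z = {c \<in> locfin. c \<inter> (A \<inter> X K \<inter> cell m z) \<noteq> {}}" for K m z
  have H: "H K m z \<in> sigma_sets locfin (voids A)" for K m z
  proof -
    have "bdd (A \<inter> X K \<inter> cell m z)"
      unfolding bdd_def using assms by auto
    then have "void (A \<inter> X K \<inter> cell m z) \<in> voids A"
      unfolding voids_def by blast
    then have "locfin - void (A \<inter> X K \<inter> cell m z) \<in> sigma_sets locfin (voids A)"
      by (intro S.compl_sets sigma_sets.Basic)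
    also have "locfin - void (A \<inter> X K \<inter> cell m z) = H K m z"
      by (auto simp: H_def void_def)
    finally show ?thesis .
  qed
  have "{c \<in> locfin. at_least k (c \<inter> A)} =
    (\<Union>K. \<Union>m. \<Union>Z\<in>{Z. finite Z \<and> card Z = k}. locfin \<inter> (\<Inter>z\<in>Z. H K m z))" (is "?L = ?R")
  proof (intro equalityI subsetI)
    fix c assume "c \<in> ?L"
    then obtain F where c: "c \<in> locfin" and F: "F \<subseteq> c \<inter> A" "finite F" "card F = k"
      by (auto simp: at_least_def)
    obtain K where K: "F \<subseteq> X K" using finite_subset_X F A by (metis le_infE order_trans)
    obtain m where m: "inj_on (\<lambda>x. \<lfloor>x * 2 ^ m\<rfloor>) F" using finite_cells_separate[OF F(2)] .
    let ?Z = "(\<lambda>x. \<lfloor>x * 2 ^ m\<rfloor>) ` F"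
    have "finite ?Z" "card ?Z = k" using F m by (auto simp: card_image)
    moreover have "c \<in> H K m z" if "z \<in> ?Z" for z
      using that c F K by (auto simp: H_def cell_def)
    ultimately show "c \<in> ?R" using c by blast
  next
    fix c assume "c \<in> ?R"
    then obtain K m Z where c: "c \<in> locfin" and Z: "finite Z" "card Z = k" "\<And>z. z \<in> Z \<Longrightarrow> c \<in> H K m z"
      by blast
    then have "\<forall>z\<in>Z. \<exists>x. x \<in> c \<inter> A \<and> x \<in> cell m z" by (auto simp: H_def)
    then obtain f where f: "\<And>z. z \<in> Z \<Longrightarrow> f z \<in> c \<inter> A \<and> f z \<in> cell m z" by metis
    have "inj_on f Z"
    proof (rule inj_onI)
      fix x y assume "x \<in> Z" "y \<in> Z" "f x = f y"
      then show "x = y" using f[of x] f[of y] by (auto simp: cell_def)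
    qed
    then have "at_least k (c \<inter> A)"
      unfolding at_least_def using f Z by (intro exI[of _ "f ` Z"]) (auto simp: card_image)
    with c show "c \<in> ?L" by simp
  qed
  moreover have "?R \<in> sigma_sets locfin (voids A)"
  proof (intro S.countable_UN'' countable_finite_int_sets countableI_type)
    fix K m Z assume "Z \<in> {Z :: int set. finite Z \<and> card Z = k}"
    then have "finite Z" by simp
    then show "locfin \<inter> (\<Inter>z\<in>Z. H K m z) \<in> sigma_sets locfin (voids A)"
    proof (induction Z)
      case (insert z Z)
      have "locfin \<inter> (\<Inter>z\<in>insert z Z. H K m z) = H K m z \<inter> (locfin \<inter> (\<Inter>z\<in>Z. H K m z))" by auto
      then show ?case using S.Int[OF H insert.IH] by simp
    qed (use S.top in simp)
  qed
  ultimately show ?thesis by simp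
qed

lemma num_measurable_sigma_voids:
  assumes "A \<in> sets M"
  shows "(\<lambda>c. num (c \<inter> A)) \<in> borel_measurable (sigma locfin (voids A))"
proof -
  have [measurable]: "Measurable.pred (sigma locfin (voids A)) (\<lambda>c. at_least k (c \<inter> A))" for k
    using at_least_sigma_voids[OF assms, of k] voids_subset[of A]
    by (simp add: pred_def space_measure_of sets_measure_of)
  show ?thesis
    unfolding num_eq_SUP by measurable
qed

lemma num_measurable [measurable]:
  assumes "A \<in> sets M"
  shows "(\<lambda>c. num (c \<inter> A)) \<in> borel_measurable point_sets"
proof -
  have [measurable]: "Measurable.pred point_sets (\<lambda>c. at_least k (c \<inter> A))" for k
    using at_least_sigma_voids[OF assms, of k] sigma_voids_subset[OF sets.sets_into_space[OF assms]]
    by (auto simp: pred_def space_point_sets)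
  show ?thesis
    unfolding num_eq_SUP by measurable
qed

lemma finite_int_bdd: "c \<in> locfin \<Longrightarrow> bdd A \<Longrightarrow> finite (c \<inter> A)"
  unfolding bdd_def locfin_def by (metis (mono_tags, lifting) Int_mono finite_subset mem_Collect_eq order_refl)

lemma measurable_point_setsI:
  assumes "\<And>x. x \<in> space N \<Longrightarrow> f x \<in> locfin"
    and "\<And>A. bdd A \<Longrightarrow> {x \<in> space N. f x \<inter> A = {}} \<in> sets N"
  shows "f \<in> N \<rightarrow>\<^sub>M point_sets"
  unfolding point_sets_def
proof (rule measurable_measure_of[OF voids_subset])
  show "f \<in> space N \<rightarrow> locfin" using assms(1) by auto
  fix Y assume "Y \<in> voids (space M)"
  then obtain B where B: "bdd B" "Y = void B" by (auto simp: voids_def)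
  have "f -` Y \<inter> space N = {x \<in> space N. f x \<inter> B = {}}"
    using assms(1) B by (auto simp: void_def)
  then show "f -` Y \<inter> space N \<in> sets N" using assms(2)[OF B(1)] by simp
qed

text \<open>Void events form a generator stable under intersections; this is Renyi's
  characterization of a simple Poisson process by its void probabilities.\<close>

lemma poisson_law_unique:
  assumes P: "poisson_law P" and Q: "poisson_law Q"
  shows "P = Q"
proof -
  interpret P: prob_space P using P by (simp add: poisson_law_def)
  interpret Q: prob_space Q using Q by (simp add: poisson_law_def)
  show ?thesis
  proof (rule measure_eqI_generator_eq[OF Int_stable_voids voids_subset])
    show "sets P = sigma_sets locfin (voids (space M))" "sets Q = sigma_sets locfin (voids (space M))"
      using P Q by (auto simp: poisson_law_def sets_point_sets)
    show "emeasure P Y = emeasure Q Y" if Y: "Y \<in> voids (space M)" for Y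
    proof -
      obtain B where "bdd B" "Y = void B" using Y unfolding voids_def by blast
      then show ?thesis using P Q by (simp add: poisson_law_def P.emeasure_eq_measure Q.emeasure_eq_measure)
    qed
    show "range (\<lambda>_::nat. void {}) \<subseteq> voids (space M)"
      using void_in_voids[OF bdd_empty] by auto
    show "(\<Union>i::nat. void {}) = locfin" by (auto simp: void_def)
  qed simp
qed

text \<open>The exponential turns the measure of a disjoint union into a product, so the
  intersection-stable families \<open>voids (A i)\<close> are independent, and independence passes
  to the sigma-algebras that they generate.\<close>

lemma poisson_law_indep:
  assumes P: "poisson_law P" and A: "\<And>i. i \<in> I \<Longrightarrow> A i \<in> sets M" "disjoint_family_on A I"
  shows "prob_space.indep_sets P (\<lambda>i. sigma_sets locfin (voids (A i))) I"
proof -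
  interpret P: prob_space P using P by (simp add: poisson_law_def)
  have sets: "sets P = sets point_sets" and sp: "space P = locfin"
    using P sets_eq_imp_space_eq[of P point_sets] by (auto simp: poisson_law_def space_point_sets)
  have "P.indep_sets (\<lambda>i. voids (A i)) I"
  proof (rule P.indep_setsI)
    fix i assume "i \<in> I"
    show "voids (A i) \<subseteq> P.events"
      unfolding sets by (auto simp: voids_def void_sets)
  next
    fix Y J assume J: "J \<noteq> {}" "J \<subseteq> I" "finite J" "\<forall>j\<in>J. Y j \<in> voids (A j)"
    then have "\<forall>j\<in>J. \<exists>B. bdd B \<and> B \<subseteq> A j \<and> Y j = void B" by (auto simp: voids_def)
    then obtain B where B: "\<And>j. j \<in> J \<Longrightarrow> bdd (B j) \<and> B j \<subseteq> A j \<and> Y j = void (B j)" by metis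
    have "(\<Inter>j\<in>J. Y j) = void (\<Union>j\<in>J. B j)"
      using B J(1) by (auto simp: void_def)
    moreover have "bdd (\<Union>j\<in>J. B j)" using B J by (intro bdd_finite_UN) auto
    ultimately have "P.prob (\<Inter>j\<in>J. Y j) = exp (- measure M (\<Union>j\<in>J. B j))"
      using P by (simp add: poisson_law_def)
    also have "measure M (\<Union>j\<in>J. B j) = (\<Sum>j\<in>J. measure M (B j))"
    proof (rule measure_finite_Union)
      show "B ` J \<subseteq> sets M" using B bdd_sets by auto
      show "disjoint_family_on B J"
        unfolding disjoint_family_on_def
      proof (intro ballI impI)
        fix i j assume ij: "i \<in> J" "j \<in> J" "i \<noteq> j"
        then have "A i \<inter> A j = {}" using A(2) J(2) by (auto simp: disjoint_family_on_def)
        then show "B i \<inter> B j = {}" using B[OF ij(1)] B[OF ij(2)] by blast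
      qed
      show "emeasure M (B i) \<noteq> \<infinity>" if "i \<in> J" for i
        using bdd_finite[of "B i"] B[OF that] by auto
    qed (use J in auto)
    also have "exp (- (\<Sum>j\<in>J. measure M (B j))) = (\<Prod>j\<in>J. P.prob (Y j))"
      using B P by (simp add: exp_sum sum_negf[symmetric] J(3) poisson_law_def)
    finally show "P.prob (\<Inter>j\<in>J. Y j) = (\<Prod>j\<in>J. P.prob (Y j))" .
  qed
  then show ?thesis
    unfolding sp[symmetric] by (rule P.indep_sets_sigma) (rule Int_stable_voids)
qed

end

section \<open>Construction of a Poisson process from independent samples\<close>

lemma poisson_pgf:
  fixes l r :: real
  assumes "0 < l" "0 \<le> r" "r \<le> 1"
  shows "(\<integral>\<^sup>+n. ennreal ((1 - r) ^ n) \<partial>measure_pmf (poisson_pmf l)) = ennreal (exp (- (l * r)))"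
proof -
  have s: "(\<lambda>n. (l * (1 - r)) ^ n / fact n) sums exp (l * (1 - r))"
    using exp_converges[of "l * (1 - r)"] by (simp add: divide_inverse mult.commute)
  have "(\<integral>\<^sup>+n. ennreal ((1 - r) ^ n) \<partial>measure_pmf (poisson_pmf l)) =
      (\<integral>\<^sup>+n. ennreal (pmf (poisson_pmf l) n) * ennreal ((1 - r) ^ n) \<partial>count_space UNIV)"
    by (rule nn_integral_measure_pmf)
  also have "\<dots> = (\<integral>\<^sup>+n. ennreal (exp (- l) * ((l * (1 - r)) ^ n / fact n)) \<partial>count_space UNIV)"
    using assms
    by (intro nn_integral_cong)
      (simp add: ennreal_mult'[symmetric] power_mult_distrib divide_simps mult_ac del: right_diff_distrib)
  also have "\<dots> = (\<Sum>n. ennreal (exp (- l) * ((l * (1 - r)) ^ n / fact n)))"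
    by (rule nn_integral_count_space_nat)
  also have "\<dots> = ennreal (exp (- l) * exp (l * (1 - r)))"
    using assms by (intro suminf_ennreal_eq sums_mult s) simp
  also have "exp (- l) * exp (l * (1 - r)) = exp (- (l * r))"
    by (simp add: mult_exp_exp algebra_simps)
  finally show ?thesis .
qed

text \<open>By independence the pair of coordinates has law
  \<open>\<rho> \<Otimes>\<^sub>M \<rho>\<close>, and by Fubini the diagonal is null when points are
  null. This excludes multiple points among the samples.\<close>

lemma PiM_coordinates_distinct:
  fixes \<rho> :: "real measure"
  assumes "prob_space \<rho>" "sets \<rho> = sets borel" "\<And>x. emeasure \<rho> {x} = 0" "a \<noteq> b"
  shows "AE x in PiM (UNIV :: nat set) (\<lambda>_. \<rho>). x a \<noteq> x b"
proof -
  interpret R: prob_space \<rho> by fact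
  define P where "P = PiM (UNIV :: nat set) (\<lambda>_. \<rho>)"
  interpret P: prob_space P unfolding P_def by (intro prob_space_PiM assms)
  have comp: "(\<lambda>x. x i) \<in> P \<rightarrow>\<^sub>M \<rho>" for i
    unfolding P_def by (rule measurable_component_singleton) simp
  have law: "distr P \<rho> (\<lambda>x. x i) = \<rho>" for i
    unfolding P_def using assms(1) by (rule distr_PiM_component) simp
  have "P.indep_vars (\<lambda>_. \<rho>) (\<lambda>i x. x i) UNIV"
  proof (subst P.indep_vars_iff_distr_eq_PiM)
    have "distr P (PiM UNIV (\<lambda>_. \<rho>)) (\<lambda>x. \<lambda>i\<in>UNIV. x i) = distr P P (\<lambda>x. x)"
      by (rule distr_cong) (simp_all add: P_def restrict_def fun_eq_iff)
    also have "\<dots> = PiM UNIV (\<lambda>i. distr P \<rho> (\<lambda>x. x i))"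
      unfolding law by (simp add: distr_id P_def[symmetric])
    finally show "distr P (PiM UNIV (\<lambda>_. \<rho>)) (\<lambda>x. \<lambda>i\<in>UNIV. x i) = PiM UNIV (\<lambda>i. distr P \<rho> (\<lambda>x. x i))" .
  qed (use comp in auto)
  then have "P.indep_var (PiM {a} (\<lambda>_. \<rho>)) (\<lambda>x. restrict x {a}) (PiM {b} (\<lambda>_. \<rho>)) (\<lambda>x. restrict x {b})"
    using assms(4) by (intro P.indep_var_restrict[where I = UNIV and X = "\<lambda>i x. x i" and M' = "\<lambda>_. \<rho>"]) auto
  then have "P.indep_var \<rho> ((\<lambda>f. f a) \<circ> (\<lambda>x. restrict x {a})) \<rho> ((\<lambda>f. f b) \<circ> (\<lambda>x. restrict x {b}))"
    by (rule P.indep_var_compose) (simp_all add: measurable_component_singleton)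
  then have "P.indep_var \<rho> (\<lambda>x. x a) \<rho> (\<lambda>x. x b)"
    by (simp add: comp_def)
  then have "distr P (\<rho> \<Otimes>\<^sub>M \<rho>) (\<lambda>x. (x a, x b)) = \<rho> \<Otimes>\<^sub>M \<rho>"
    using P.indep_var_distribution_eq[of \<rho> "\<lambda>x. x a" \<rho> "\<lambda>x. x b"] by (simp add: law)
  moreover have "AE p in \<rho> \<Otimes>\<^sub>M \<rho>. fst p \<noteq> snd p"
  proof -
    have [measurable]: "(\<lambda>x. x) \<in> \<rho> \<rightarrow>\<^sub>M borel" using assms(2) by (simp cong: measurable_cong_sets)
    have "AE x in \<rho>. AE y in \<rho>. x \<noteq> y"
    proof (rule AE_I2)
      fix x
      have "{x} \<in> null_sets \<rho>" using assms(2,3) by (intro null_setsI) auto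
      then have "AE y in \<rho>. y \<notin> {x}" by (rule AE_not_in)
      then show "AE y in \<rho>. x \<noteq> y" by eventually_elim auto
    qed
    moreover have "{p \<in> space (\<rho> \<Otimes>\<^sub>M \<rho>). fst p \<noteq> snd p} \<in> sets (\<rho> \<Otimes>\<^sub>M \<rho>)"
    proof -
      have [measurable]: "fst \<in> borel_measurable (\<rho> \<Otimes>\<^sub>M \<rho>)" "snd \<in> borel_measurable (\<rho> \<Otimes>\<^sub>M \<rho>)"
        using measurable_fst[of \<rho> \<rho>] measurable_snd[of \<rho> \<rho>] unfolding measurable_cong_sets[OF refl assms(2)] by auto
      show ?thesis by measurable
    qed
    ultimately show ?thesis
      using pair_sigma_finite.AE_pair_iff[of \<rho> \<rho> "\<lambda>x y. x \<noteq> y"] prob_space_imp_sigma_finite[OF assms(1)]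
      by (auto simp: pair_sigma_finite_def)
  qed
  ultimately have "AE p in distr P (\<rho> \<Otimes>\<^sub>M \<rho>) (\<lambda>x. (x a, x b)). fst p \<noteq> snd p" by (rule ssubst)
  then have "AE x in P. fst (x a, x b) \<noteq> snd (x a, x b)"
    using comp by (intro AE_distrD[where f = "\<lambda>x. (x a, x b)"]) auto
  then show ?thesis unfolding P_def[symmetric] by simp
qed

context bounded_space
begin

definition shell :: "nat \<Rightarrow> real set" where
  "shell = disjointed X"

lemma shell_subset: "shell j \<subseteq> X j"
  by (simp add: shell_def disjointed_subset)

lemma shell_bdd: "bdd (shell j)"
  using sets.range_disjointed_sets[of X M] shell_subset X_sets unfolding bdd_def shell_def by blast

lemma shell_sets [measurable]: "shell j \<in> sets M"
  using shell_bdd by (rule bdd_sets)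

lemma shell_UN: "(\<Union>j. shell j) = space M"
  unfolding shell_def UN_disjointed_eq by (rule X_UN)

lemma shell_disjoint: "i \<noteq> j \<Longrightarrow> shell i \<inter> shell j = {}"
  using disjoint_family_disjointed[of X] by (auto simp: shell_def disjoint_family_on_def)

lemma X_shell: "X K \<inter> shell j \<noteq> {} \<Longrightarrow> j \<le> K"
proof (rule ccontr)
  assume "X K \<inter> shell j \<noteq> {}" "\<not> j \<le> K"
  then show False by (auto simp: shell_def disjointed_def)
qed

text \<open>A null shell receives the point mass at 0 as a default; \<open>count_law\<close> is then
  concentrated on 0, so the default is almost surely not sampled.\<close>

definition shell_law :: "nat \<Rightarrow> real measure" where
  "shell_law j = (if measure M (shell j) = 0 then return borel 0
     else distr (uniform_measure M (shell j)) borel (\<lambda>x. x))"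

definition count_law :: "nat \<Rightarrow> nat pmf" where
  "count_law j = (if measure M (shell j) = 0 then return_pmf 0 else poisson_pmf (measure M (shell j)))"

definition sample_law :: "nat \<Rightarrow> (nat \<times> (nat \<Rightarrow> real)) measure" where
  "sample_law j = measure_pmf (count_law j) \<Otimes>\<^sub>M PiM UNIV (\<lambda>_. shell_law j)"

text \<open>The intersection with \<open>shell j\<close> drops stray samples, which occur with
  probability 0, so that the result is locally finite for every outcome and not only for almost
  every one.\<close>

definition sample_points :: "(nat \<Rightarrow> nat \<times> (nat \<Rightarrow> real)) \<Rightarrow> real set" where
  "sample_points \<omega> = (\<Union>j. \<Union>i\<in>{..<fst (\<omega> j)}. {snd (\<omega> j) i} \<inter> shell j)"

lemma shell_emeasure: "emeasure M (shell j) = ennreal (measure M (shell j))"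
  using bdd_finite[OF shell_bdd[of j]] by (intro emeasure_eq_ennreal_measure) auto

lemma prob_space_shell_law: "prob_space (shell_law j)"
proof (cases "measure M (shell j) = 0")
  case False
  then have "prob_space (uniform_measure M (shell j))"
    using bdd_finite[OF shell_bdd[of j]] by (intro prob_space_uniform_measure) (auto simp: shell_emeasure)
  then show ?thesis
    unfolding shell_law_def using False id_borel_measurable
    by (auto intro!: prob_space.prob_space_distr simp: measurable_def)
qed (simp add: shell_law_def prob_space_return)

lemma sets_shell_law: "sets (shell_law j) = sets borel"
  by (simp add: shell_law_def)

lemma shell_law_measure:
  assumes "A \<in> sets M" "A \<subseteq> shell j"
  shows "measure M (shell j) * measure (shell_law j) A = measure M A"
proof (cases "measure M (shell j) = 0")
  case True
  then have "emeasure M A \<le> 0" using emeasure_mono[OF assms(2), of M] shell_emeasure[of j] by simp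
  then show ?thesis using True by (simp add: measure_def)
next
  case False
  have "measure (shell_law j) A = measure (uniform_measure M (shell j)) ((\<lambda>x. x) -` A \<inter> space M)"
    unfolding shell_law_def using False id_borel_measurable M_subset_borel[OF assms(1)]
    by (simp add: measure_distr measurable_def)
  also have "(\<lambda>x. x) -` A \<inter> space M = A" using sets.sets_into_space[OF assms(1)] by auto
  also have "measure (uniform_measure M (shell j)) A = measure M A / measure M (shell j)"
    using assms False shell_emeasure[of j] bdd_finite[OF shell_bdd[of j]]
    by (subst measure_uniform_measure) (auto simp: Int_absorb1)
  finally show ?thesis using False by simp
qed

lemma shell_law_point: "0 < measure M (shell j) \<Longrightarrow> emeasure (shell_law j) {x} = 0"
proof -
  assume pos: "0 < measure M (shell j)"
  have "emeasure (shell_law j) {x} = emeasure (uniform_measure M (shell j)) ({x} \<inter> space M)"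
    unfolding shell_law_def using pos id_borel_measurable
    by (simp add: emeasure_distr measurable_def vimage_def Int_def conj_commute cong: conj_cong)
  also have "\<dots> = emeasure M (shell j \<inter> ({x} \<inter> space M)) / emeasure M (shell j)"
    by (rule emeasure_uniform_measure) (auto simp: Int_commute)
  also have "emeasure M (shell j \<inter> ({x} \<inter> space M)) = 0"
  proof (cases "x \<in> space M")
    case True
    have "emeasure M (shell j \<inter> ({x} \<inter> space M)) \<le> emeasure M {x}"
      using Int_borel_M[OF sets.top, of "{x}"] True by (intro emeasure_mono) (auto simp: Int_absorb1)
    then show ?thesis using points_null[OF True] by simp
  qed simp
  finally show "emeasure (shell_law j) {x} = 0" by simp
qed

lemma prob_space_sample_law: "prob_space (sample_law j)"
  unfolding sample_law_def
  by (intro prob_space_pair measure_pmf.prob_space_axioms prob_space_PiM prob_space_shell_law)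

lemma sample_law_void_measurable:
  assumes "A \<in> sets borel"
  shows "{p \<in> space (sample_law j). \<forall>i<fst p. snd p i \<notin> A} \<in> sets (sample_law j)"
proof -
  have comp: "(\<lambda>x. x i) \<in> borel_measurable (PiM (UNIV :: nat set) (\<lambda>_. shell_law j))" for i
    using measurable_component_singleton[of i UNIV "\<lambda>_. shell_law j"]
    unfolding measurable_cong_sets[OF refl sets_shell_law] by simp
  have [measurable]: "(\<lambda>p. snd p i) \<in> borel_measurable (sample_law j)" for i
    unfolding sample_law_def using measurable_compose[OF measurable_snd comp] .
  have [measurable]: "fst \<in> sample_law j \<rightarrow>\<^sub>M count_space UNIV"
    unfolding sample_law_def using measurable_fst by (simp cong: measurable_cong_sets)
  note [measurable] = assms
  show ?thesis by measurable
qed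

text \<open>Given \<open>n\<close> points, all of them miss \<open>A\<close> with probability
  \<open>(1 - r) ^ n\<close>, where \<open>r\<close> is the share of \<open>A\<close> in the shell;
  averaging over the Poisson number \<open>n\<close> gives the generating function of
  \<open>poisson_pgf\<close>.\<close>

lemma sample_law_void:
  assumes "A \<in> sets M" "A \<subseteq> shell j"
  shows "emeasure (sample_law j) {p \<in> space (sample_law j). \<forall>i<fst p. snd p i \<notin> A} =
    ennreal (exp (- measure M A))"
proof -
  interpret R: prob_space "shell_law j" by (rule prob_space_shell_law)
  interpret RR: product_prob_space "\<lambda>_. shell_law j" "UNIV :: nat set"
    by unfold_locales
  define r where "r = measure (shell_law j) A"
  have A: "A \<in> sets borel" using M_subset_borel[OF assms(1)] .
  have slice: "emeasure (PiM UNIV (\<lambda>_. shell_law j))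
      {x \<in> space (PiM UNIV (\<lambda>_. shell_law j)). \<forall>i\<in>{..<n}. x i \<in> space (shell_law j) - A} = ennreal ((1 - r) ^ n)" for n
  proof -
    have "emeasure (shell_law j) (space (shell_law j) - A) = ennreal (1 - r)"
      using A sets_shell_law R.prob_compl[of A] by (simp add: R.emeasure_eq_measure r_def)
    moreover have "space (shell_law j) - A \<in> sets (shell_law j)"
      using A sets_shell_law[of j] by (intro sets.compl_sets) simp
    ultimately show ?thesis
      using RR.emeasure_PiM_Collect[of "{..<n}" "\<lambda>_. space (shell_law j) - A"] R.prob_le_1[of A]
      by (simp add: r_def ennreal_power del: Diff_iff)
  qed
  have "emeasure (sample_law j) {p \<in> space (sample_law j). \<forall>i<fst p. snd p i \<notin> A} =
    (\<integral>\<^sup>+n. emeasure (PiM UNIV (\<lambda>_. shell_law j)) (Pair n -` {p \<in> space (sample_law j). \<forall>i<fst p. snd p i \<notin> A}) \<partial>measure_pmf (count_law j))"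
    unfolding sample_law_def
    by (rule sigma_finite_measure.emeasure_pair_measure_alt[OF prob_space_imp_sigma_finite[OF prob_space_PiM[OF prob_space_shell_law]]]) (rule sample_law_void_measurable[OF A, unfolded sample_law_def])
  also have "\<dots> = (\<integral>\<^sup>+n. ennreal ((1 - r) ^ n) \<partial>measure_pmf (count_law j))"
  proof (rule nn_integral_cong)
    fix n
    have "Pair n -` {p \<in> space (sample_law j). \<forall>i<fst p. snd p i \<notin> A} =
        {x \<in> space (PiM UNIV (\<lambda>_. shell_law j)). \<forall>i\<in>{..<n}. x i \<in> space (shell_law j) - A}"
      by (auto simp: sample_law_def space_pair_measure space_PiM)
    then show "emeasure (PiM UNIV (\<lambda>_. shell_law j)) (Pair n -` {p \<in> space (sample_law j). \<forall>i<fst p. snd p i \<notin> A})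
      = ennreal ((1 - r) ^ n)" using slice by simp
  qed
  also have "\<dots> = ennreal (exp (- (measure M (shell j) * r)))"
  proof (cases "measure M (shell j) = 0")
    case True
    then show ?thesis by (simp add: count_law_def)
  next
    case False
    then show ?thesis
      using poisson_pgf[of "measure M (shell j)" r] measure_nonneg[of M "shell j"] R.prob_le_1[of A]
      by (simp add: count_law_def r_def)
  qed
  also have "measure M (shell j) * r = measure M A"
    unfolding r_def by (rule shell_law_measure[OF assms])
  finally show ?thesis .
qed

lemma sample_points_locfin: "sample_points \<omega> \<in> locfin"
proof -
  have "finite (sample_points \<omega> \<inter> X K)" for K
  proof (rule finite_subset)
    show "sample_points \<omega> \<inter> X K \<subseteq> (\<Union>j\<in>{..K}. \<Union>i\<in>{..<fst (\<omega> j)}. {snd (\<omega> j) i})"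
    proof
      fix x assume "x \<in> sample_points \<omega> \<inter> X K"
      then obtain j i where "i < fst (\<omega> j)" "x = snd (\<omega> j) i" "x \<in> shell j" "x \<in> X K"
        by (auto simp: sample_points_def)
      moreover then have "j \<le> K" using X_shell[of K j] by blast
      ultimately show "x \<in> (\<Union>j\<in>{..K}. \<Union>i\<in>{..<fst (\<omega> j)}. {snd (\<omega> j) i})" by auto
    qed
  qed auto
  moreover have "sample_points \<omega> \<subseteq> space M"
    using shell_UN by (auto simp: sample_points_def)
  ultimately show ?thesis by (simp add: locfin_def)
qed

lemma sample_points_Int_shell:
  "sample_points \<omega> \<inter> shell j = {snd (\<omega> j) i | i. i < fst (\<omega> j)} \<inter> shell j"
proof (intro equalityI subsetI)
  fix x assume "x \<in> sample_points \<omega> \<inter> shell j"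
  then obtain l i where "i < fst (\<omega> l)" "x = snd (\<omega> l) i" "x \<in> shell l" "x \<in> shell j"
    by (auto simp: sample_points_def)
  moreover then have "l = j" using shell_disjoint[of l j] by blast
  ultimately show "x \<in> {snd (\<omega> j) i | i. i < fst (\<omega> j)} \<inter> shell j" by auto
qed (auto simp: sample_points_def)

lemma sample_points_void:
  assumes "A \<subseteq> X K"
  shows "sample_points \<omega> \<inter> A = {} \<longleftrightarrow> (\<forall>j\<in>{..K}. \<forall>i<fst (\<omega> j). snd (\<omega> j) i \<notin> A \<inter> shell j)"
proof
  assume R: "\<forall>j\<in>{..K}. \<forall>i<fst (\<omega> j). snd (\<omega> j) i \<notin> A \<inter> shell j"
  show "sample_points \<omega> \<inter> A = {}"
  proof (rule ccontr)
    assume "sample_points \<omega> \<inter> A \<noteq> {}"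
    then obtain j i where "i < fst (\<omega> j)" "snd (\<omega> j) i \<in> shell j" "snd (\<omega> j) i \<in> A"
      by (auto simp: sample_points_def)
    moreover then have "j \<le> K" using X_shell[of K j] assms by blast
    ultimately show False using R by auto
  qed
qed (auto simp: sample_points_def)

definition poisson_points :: "real set measure" where
  "poisson_points = distr (PiM UNIV sample_law) point_sets sample_points"

lemma sample_points_measurable: "sample_points \<in> PiM UNIV sample_law \<rightarrow>\<^sub>M point_sets"
proof (rule measurable_point_setsI)
  fix A assume A: "bdd A"
  then obtain K where K: "A \<subseteq> X K" by (auto simp: bdd_def)
  have AB: "A \<inter> shell j \<in> sets borel" for j
    using M_subset_borel bdd_sets[OF A] shell_sets by blast
  have "{\<omega> \<in> space (PiM UNIV sample_law). sample_points \<omega> \<inter> A = {}} =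
    {\<omega> \<in> space (PiM UNIV sample_law). \<forall>j\<in>{..K}. \<omega> j \<in> {p \<in> space (sample_law j). \<forall>i<fst p. snd p i \<notin> A \<inter> shell j}}"
    unfolding sample_points_void[OF K] by (auto simp: space_PiM)
  also have "\<dots> \<in> sets (PiM UNIV sample_law)"
  proof (rule sets.sets_Collect_finite_All)
    fix j
    show "{\<omega> \<in> space (PiM UNIV sample_law). \<omega> j \<in> {p \<in> space (sample_law j). \<forall>i<fst p. snd p i \<notin> A \<inter> shell j}}
      \<in> sets (PiM UNIV sample_law)"
      using measurable_sets[OF measurable_component_singleton[of j UNIV sample_law] sample_law_void_measurable[OF AB[of j]]]
      by (simp add: vimage_def Int_def conj_commute)
  qed simp
  finally show "{\<omega> \<in> space (PiM UNIV sample_law). sample_points \<omega> \<inter> A = {}} \<in> sets (PiM UNIV sample_law)" .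
qed (rule sample_points_locfin)

text \<open>A bounded set meets only the shells up to some \<open>K\<close>; these are sampled
  independently, so their void probabilities multiply.\<close>

lemma poisson_law_poisson_points: "poisson_law poisson_points"
proof -
  interpret S: product_prob_space sample_law "UNIV :: nat set"
    unfolding product_prob_space_def product_prob_space_axioms_def product_sigma_finite_def
    using prob_space_sample_law prob_space_imp_sigma_finite by blast
  interpret S: prob_space "PiM UNIV sample_law"
    by (intro prob_space_PiM prob_space_sample_law)
  have "measure poisson_points (void A) = exp (- measure M A)" if A: "bdd A" for A
  proof -
    obtain K where K: "A \<subseteq> X K" using A by (auto simp: bdd_def)
    have AB: "A \<inter> shell j \<in> sets borel" for j
      using M_subset_borel bdd_sets[OF A] shell_sets by blast
    have "emeasure poisson_points (void A) = emeasure (PiM UNIV sample_law) (sample_points -` void A \<inter> space (PiM UNIV sample_law))"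
      unfolding poisson_points_def by (rule emeasure_distr[OF sample_points_measurable void_sets[OF A]])
    also have "sample_points -` void A \<inter> space (PiM UNIV sample_law) =
      {\<omega> \<in> space (PiM UNIV sample_law). \<forall>j\<in>{..K}. \<omega> j \<in> {p \<in> space (sample_law j). \<forall>i<fst p. snd p i \<notin> A \<inter> shell j}}"
      using sample_points_void[OF K] sample_points_locfin by (auto simp: space_PiM void_def)
    also have "emeasure (PiM UNIV sample_law) \<dots> = (\<Prod>j\<in>{..K}. emeasure (sample_law j) {p \<in> space (sample_law j). \<forall>i<fst p. snd p i \<notin> A \<inter> shell j})"
      by (rule S.emeasure_PiM_Collect) (use sample_law_void_measurable[OF AB] in auto)
    also have "\<dots> = (\<Prod>j\<in>{..K}. ennreal (exp (- measure M (A \<inter> shell j))))"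
      using bdd_sets[OF A] by (intro prod.cong sample_law_void refl) auto
    also have "\<dots> = ennreal (exp (- (\<Sum>j\<in>{..K}. measure M (A \<inter> shell j))))"
      by (simp add: prod_ennreal exp_sum sum_negf[symmetric])
    also have "(\<Sum>j\<in>{..K}. measure M (A \<inter> shell j)) = measure M (\<Union>j\<in>{..K}. A \<inter> shell j)"
    proof (rule measure_finite_Union[symmetric])
      show "(\<lambda>j. A \<inter> shell j) ` {..K} \<subseteq> sets M" using bdd_sets[OF A] by auto
      show "disjoint_family_on (\<lambda>j. A \<inter> shell j) {..K}"
        using shell_disjoint by (fastforce simp: disjoint_family_on_def)
      show "emeasure M (A \<inter> shell i) \<noteq> \<infinity>" for i
        using bdd_finite[OF bdd_subset[OF A, of "A \<inter> shell i"]] bdd_sets[OF A] by auto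
    qed simp
    also have "(\<Union>j\<in>{..K}. A \<inter> shell j) = A"
    proof (intro equalityI subsetI)
      fix x assume x: "x \<in> A"
      then have "x \<in> space M" using sets.sets_into_space[OF bdd_sets[OF A]] by auto
      then obtain j where "x \<in> shell j" using shell_UN by auto
      moreover then have "j \<le> K" using X_shell[of K j] K x by blast
      ultimately show "x \<in> (\<Union>j\<in>{..K}. A \<inter> shell j)" using x by auto
    qed auto
    finally show ?thesis by (simp add: measure_def)
  qed
  moreover have "prob_space poisson_points"
    unfolding poisson_points_def by (rule S.prob_space_distr[OF sample_points_measurable])
  ultimately show ?thesis
    by (simp add: poisson_law_def poisson_points_def)
qed

text \<open>\<open>X 0\<close> is a single shell, where the number of samples is Poisson by
  construction; almost surely the samples are distinct and inside the shell, so the point set has as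
  many elements there as were sampled.\<close>

lemma poisson_points_count_X0:
  assumes pos: "0 < measure M (X 0)"
  shows "measure poisson_points {c \<in> locfin. num (c \<inter> X 0) = of_nat k} = pmf (poisson_pmf (measure M (X 0))) k"
proof -
  have sh0: "shell 0 = X 0" by (simp add: shell_def disjointed_def)
  interpret L: prob_space "shell_law 0" by (rule prob_space_shell_law)
  interpret RP: prob_space "PiM (UNIV :: nat set) (\<lambda>_. shell_law 0)"
    by (intro prob_space_PiM prob_space_shell_law)
  have "AE x in PiM (UNIV :: nat set) (\<lambda>_. shell_law 0). x a \<noteq> x b" if "a \<noteq> b" for a b :: nat
    using that pos by (intro PiM_coordinates_distinct prob_space_shell_law sets_shell_law shell_law_point) (simp add: sh0)
  then have "AE x in PiM (UNIV :: nat set) (\<lambda>_. shell_law 0). \<forall>a b. a \<noteq> b \<longrightarrow> x a \<noteq> x b"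
    by (simp add: AE_all_countable)
  moreover have "AE x in PiM (UNIV :: nat set) (\<lambda>_. shell_law 0). \<forall>a. x a \<in> X 0"
  proof -
    have "measure (shell_law 0) (X 0) = 1"
      using shell_law_measure[of "X 0" 0] pos by (simp add: sh0)
    then have "AE y in shell_law 0. y \<in> X 0"
      using M_subset_borel[OF X_sets[of 0]] by (intro L.AE_prob_1) (simp add: sets_shell_law)
    then show ?thesis
      unfolding AE_all_countable using AE_PiM_component[of UNIV "\<lambda>_. shell_law 0"] prob_space_shell_law by auto
  qed
  ultimately have "AE x in PiM (UNIV :: nat set) (\<lambda>_. shell_law 0). inj x \<and> range x \<subseteq> X 0"
    by eventually_elim (auto simp: inj_on_def)
  then have "AE p in sample_law 0. inj (snd p) \<and> range (snd p) \<subseteq> X 0"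
  proof -
    assume "AE x in PiM (UNIV :: nat set) (\<lambda>_. shell_law 0). inj x \<and> range x \<subseteq> X 0"
    then obtain N where N: "{x \<in> space (PiM UNIV (\<lambda>_. shell_law 0)). \<not> (inj x \<and> range x \<subseteq> X 0)} \<subseteq> N"
      "emeasure (PiM (UNIV :: nat set) (\<lambda>_. shell_law 0)) N = 0" "N \<in> sets (PiM UNIV (\<lambda>_. shell_law 0))"
      by (rule AE_E)
    show ?thesis
    proof (rule AE_I[where N = "space (measure_pmf (count_law 0)) \<times> N"])
      show "emeasure (sample_law 0) (space (measure_pmf (count_law 0)) \<times> N) = 0"
        unfolding sample_law_def using N by (subst RP.emeasure_pair_measure_Times) auto
    qed (use N(1,3) in \<open>auto simp: sample_law_def space_pair_measure subset_iff\<close>)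
  qed
  then have ae: "AE \<omega> in PiM UNIV sample_law. inj (snd (\<omega> 0)) \<and> range (snd (\<omega> 0)) \<subseteq> X 0"
    by (intro AE_PiM_component prob_space_sample_law) auto
  let ?O = "PiM UNIV sample_law"
  have fst0: "(\<lambda>\<omega>. fst (\<omega> 0)) \<in> ?O \<rightarrow>\<^sub>M count_space UNIV"
  proof -
    have "fst \<in> sample_law 0 \<rightarrow>\<^sub>M count_space UNIV"
      unfolding sample_law_def using measurable_fst by (simp cong: measurable_cong_sets)
    then show ?thesis
      using measurable_compose[OF measurable_component_singleton[of 0 UNIV sample_law]] by simp
  qed
  have cm: "{c \<in> locfin. num (c \<inter> X 0) = of_nat k} \<in> sets point_sets"
    unfolding space_point_sets[symmetric] by measurable
  have "emeasure poisson_points {c \<in> locfin. num (c \<inter> X 0) = of_nat k} =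
    emeasure ?O (sample_points -` {c \<in> locfin. num (c \<inter> X 0) = of_nat k} \<inter> space ?O)"
    unfolding poisson_points_def by (rule emeasure_distr[OF sample_points_measurable cm])
  also have "\<dots> = emeasure ?O {\<omega> \<in> space ?O. fst (\<omega> 0) = k}"
  proof (rule emeasure_eq_AE)
    show "AE \<omega> in ?O. \<omega> \<in> sample_points -` {c \<in> locfin. num (c \<inter> X 0) = of_nat k} \<inter> space ?O \<longleftrightarrow>
        \<omega> \<in> {\<omega> \<in> space ?O. fst (\<omega> 0) = k}"
      using ae
    proof eventually_elim
      case (elim \<omega>)
      have "sample_points \<omega> \<inter> X 0 = snd (\<omega> 0) ` {..<fst (\<omega> 0)}"
        using sample_points_Int_shell[of \<omega> 0] elim by (auto simp: sh0)
      moreover have "card (snd (\<omega> 0) ` {..<fst (\<omega> 0)}) = fst (\<omega> 0)"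
        using elim by (subst card_image) (auto intro: inj_on_subset)
      ultimately show ?case
        using sample_points_locfin by (auto simp: num_eq_of_nat_iff)
    qed
    show "sample_points -` {c \<in> locfin. num (c \<inter> X 0) = of_nat k} \<inter> space ?O \<in> sets ?O"
      by (rule measurable_sets[OF sample_points_measurable cm])
    show "{\<omega> \<in> space ?O. fst (\<omega> 0) = k} \<in> sets ?O"
      using fst0 by measurable
  qed
  also have "\<dots> = emeasure (distr ?O (count_space UNIV) (\<lambda>\<omega>. fst (\<omega> 0))) {k}"
    using fst0 by (subst emeasure_distr) (auto simp: vimage_def Int_def conj_commute)
  also have "distr ?O (count_space UNIV) (\<lambda>\<omega>. fst (\<omega> 0)) = distr (distr ?O (sample_law 0) (\<lambda>\<omega>. \<omega> 0)) (count_space UNIV) fst"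
  proof (subst distr_distr)
    show "fst \<in> sample_law 0 \<rightarrow>\<^sub>M count_space UNIV"
      unfolding sample_law_def using measurable_fst by (simp cong: measurable_cong_sets)
  qed (use measurable_component_singleton[of 0 UNIV sample_law] in \<open>simp_all add: comp_def\<close>)
  also have "distr ?O (sample_law 0) (\<lambda>\<omega>. \<omega> 0) = sample_law 0"
    by (rule distr_PiM_component[OF prob_space_sample_law]) simp
  also have "distr (sample_law 0) (count_space UNIV) fst = distr (sample_law 0) (measure_pmf (count_law 0)) fst"
    by (rule distr_cong) auto
  also have "\<dots> = measure_pmf (count_law 0)"
    unfolding sample_law_def
    by (rule RP.distr_pair_fst)
  finally show ?thesis
    using pos by (simp add: measure_def emeasure_pmf_single count_law_def sh0)
qed

text \<open>Void probabilities do not display the law of a count. The exhaustion is replaced by one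
  that starts with \<open>A\<close>: the process constructed for it has the right count on
  \<open>A\<close>, and by uniqueness \<open>P\<close> is the image of that process under the
  inclusion of \<open>B.locfin\<close> into \<open>locfin\<close>.\<close>

lemma poisson_law_count:
  assumes P: "poisson_law P" and A: "A \<in> sets M" "0 < emeasure M A" "emeasure M A < \<infinity>"
  shows "measure P {c \<in> locfin. num (c \<inter> A) = of_nat k} = pmf (poisson_pmf (measure M A)) k"
proof -
  define Y where "Y K = (if K = 0 then A else A \<union> X (K - 1))" for K
  have pos: "0 < measure M A" using A by (simp add: measure_def enn2real_positive_iff)
  interpret B: bounded_space M Y
  proof
    show "Y K \<in> sets M" for K using A(1) by (auto simp: Y_def)
    show "incseq Y"
      unfolding incseq_Suc_iff
    proof
      fix K show "Y K \<subseteq> Y (Suc K)" using incseq_SucD[OF X_mono, of "K - 1"] by (cases K) (auto simp: Y_def)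
    qed
    show "(\<Union>K. Y K) = space M"
    proof (intro equalityI subsetI)
      fix x assume "x \<in> space M"
      then obtain K where "x \<in> X K" using X_UN by auto
      then have "x \<in> Y (Suc K)" by (simp add: Y_def)
      then show "x \<in> (\<Union>K. Y K)" by blast
    qed (use sets.sets_into_space[OF A(1)] sets.sets_into_space[OF X_sets] in \<open>auto simp: Y_def split: if_splits\<close>)
    show "emeasure M (Y K) < \<infinity>" for K
    proof -
      have "emeasure M (Y K) \<le> emeasure M A + emeasure M (X (K - 1))"
        using emeasure_subadditive[OF A(1) X_sets] by (auto simp: Y_def add_increasing2)
      also have "\<dots> < \<infinity>" using A(3) X_fin by simp
      finally show ?thesis .
    qed
  qed (fact space_borel sets_M points_null)+
  have Y0: "Y 0 = A" by (simp add: Y_def)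
  have XY: "X K \<subseteq> Y (Suc K)" for K by (simp add: Y_def)
  \<comment> \<open>Membership in \<open>B.locfin\<close> also demands finitely many points in
    \<open>A\<close>, so the inclusion can be strict when \<open>A\<close> is in no
    \<open>X K\<close>.\<close>
  have sub: "B.locfin \<subseteq> locfin"
  proof
    fix c assume "c \<in> B.locfin"
    then have c: "c \<subseteq> space M" "\<And>K. finite (c \<inter> Y K)" by (auto simp: B.locfin_def)
    have "finite (c \<inter> X K)" for K
      by (rule finite_subset[OF _ c(2)[of "Suc K"]]) (use XY[of K] in auto)
    with c show "c \<in> locfin" by (simp add: locfin_def)
  qed
  have bdd: "B.bdd E" if "bdd E" for E
    using that XY unfolding bdd_def B.bdd_def by (meson order_trans)
  have vd: "{c \<in> B.locfin. c \<inter> E = {}} = B.void E" for E by (simp add: B.void_def)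
  have idm: "(\<lambda>c. c) \<in> B.point_sets \<rightarrow>\<^sub>M point_sets"
    using sub bdd B.void_sets by (intro measurable_point_setsI) (auto simp: B.space_point_sets vd)
  let ?Q = "B.poisson_points"
  have Q: "B.poisson_law ?Q" by (rule B.poisson_law_poisson_points)
  have sQ: "sets ?Q = sets B.point_sets" and spQ: "space ?Q = B.locfin"
    using Q sets_eq_imp_space_eq[of ?Q B.point_sets] by (auto simp: B.poisson_law_def B.space_point_sets)
  have idm': "(\<lambda>c. c) \<in> ?Q \<rightarrow>\<^sub>M point_sets"
    using idm by (simp cong: measurable_cong_sets add: sQ)
  have "poisson_law (distr ?Q point_sets (\<lambda>c. c))"
    unfolding poisson_law_def
  proof (intro conjI allI impI)
    show "prob_space (distr ?Q point_sets (\<lambda>c. c))"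
      using Q idm' by (intro prob_space.prob_space_distr) (auto simp: B.poisson_law_def)
    fix E assume E: "bdd E"
    have "measure (distr ?Q point_sets (\<lambda>c. c)) (void E) = measure ?Q ((\<lambda>c. c) -` void E \<inter> space ?Q)"
      by (rule measure_distr[OF idm' void_sets[OF E]])
    also have "(\<lambda>c. c) -` void E \<inter> space ?Q = B.void E"
      using sub by (auto simp: void_def B.void_def spQ)
    also have "measure ?Q (B.void E) = exp (- measure M E)"
      using Q bdd[OF E] by (simp add: B.poisson_law_def)
    finally show "measure (distr ?Q point_sets (\<lambda>c. c)) (void E) = exp (- measure M E)" .
  qed simp
  then have PQ: "P = distr ?Q point_sets (\<lambda>c. c)"
    using poisson_law_unique[OF P] by simp
  have cm: "{c \<in> locfin. num (c \<inter> A) = of_nat k} \<in> sets point_sets"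
    unfolding space_point_sets[symmetric] using A(1) by measurable
  have "measure P {c \<in> locfin. num (c \<inter> A) = of_nat k} =
    measure ?Q ((\<lambda>c. c) -` {c \<in> locfin. num (c \<inter> A) = of_nat k} \<inter> space ?Q)"
    unfolding PQ by (rule measure_distr[OF idm' cm])
  also have "(\<lambda>c. c) -` {c \<in> locfin. num (c \<inter> A) = of_nat k} \<inter> space ?Q = {c \<in> B.locfin. num (c \<inter> Y 0) = of_nat k}"
    using sub by (auto simp: Y0 spQ)
  also have "measure ?Q \<dots> = pmf (poisson_pmf (measure M A)) k"
    using B.poisson_points_count_X0[of k] pos by (simp add: Y0)
  finally show ?thesis .
qed

end

section \<open>Poisson suspensions on a space of reals\<close>

lemma restrict_space_whole: "restrict_space M (space M) = M"
proof (rule measure_eqI)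
  show "sets (restrict_space M (space M)) = sets M"
    unfolding sets_restrict_space using sets.sets_into_space[of _ M] by (auto simp: Int_absorb1 image_iff)
  fix A assume "A \<in> sets (restrict_space M (space M))"
  then show "emeasure (restrict_space M (space M)) A = emeasure M A"
    using sets.sets_into_space[of _ M]
    by (intro emeasure_restrict_space) (auto simp: sets_restrict_space)
qed

lemma num_image: "inj_on f S \<Longrightarrow> num (f ` S) = num S"
  by (cases "finite S") (auto simp: num_def card_image finite_image_iff)

lemma emeasure_distr_count_space:
  assumes "x \<in> I \<rightarrow> space M" "A \<in> sets M"
  shows "emeasure (distr (count_space I) M x) A = num {i \<in> I. x i \<in> A}"
proof -
  have "emeasure (distr (count_space I) M x) A = emeasure (count_space I) (x -` A \<inter> I)"
    using assms by (subst emeasure_distr) auto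
  also have "\<dots> = num {i \<in> I. x i \<in> A}"
    unfolding num_def vimage_def Int_def by (cases "finite {i \<in> I. x i \<in> A}") (auto simp: emeasure_count_space conj_commute)
  finally show ?thesis .
qed

definition cfg :: "real measure \<Rightarrow> real set \<Rightarrow> real measure" where
  "cfg M c = distr (count_space c) M (\<lambda>x. x)"

lemma emeasure_cfg:
  assumes "c \<subseteq> space M" "A \<in> sets M"
  shows "emeasure (cfg M c) A = num (c \<inter> A)"
  using emeasure_distr_count_space[of "\<lambda>x. x" c M A] assms unfolding cfg_def by (simp add: subset_iff Int_def)

lemma space_configurations:
  assumes "\<omega> \<in> configurations M"
  obtains I :: "nat set" and x where "x \<in> I \<rightarrow> space M" "\<omega> = distr (count_space I) M x"
  using assms unfolding configurations_def by blast

lemma evaluation_measurable: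
  assumes "A \<in> sets M"
  shows "(\<lambda>\<omega>. emeasure \<omega> A) \<in> borel_measurable (configuration_algebra M)"
proof -
  have "(\<lambda>\<omega>. emeasure \<omega> A) \<in> borel_measurable (vimage_algebra (configurations M) (\<lambda>\<omega>. emeasure \<omega> A) borel)"
    by (rule measurable_vimage_algebra1) simp
  then show ?thesis
    unfolding configuration_algebra_def
    by (intro measurable_SUP1[OF assms]) auto
qed

lemma measurable_configuration_algebraI:
  assumes "\<And>x. x \<in> space N \<Longrightarrow> f x \<in> configurations M"
    and "\<And>A. A \<in> sets M \<Longrightarrow> (\<lambda>x. emeasure (f x) A) \<in> borel_measurable N"
  shows "f \<in> N \<rightarrow>\<^sub>M configuration_algebra M"
  unfolding configuration_algebra_def
proof (rule measurable_SUP2)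
  fix A assume "A \<in> sets M"
  then show "f \<in> N \<rightarrow>\<^sub>M vimage_algebra (configurations M) (\<lambda>\<omega>. emeasure \<omega> A) borel"
    using assms by (intro measurable_vimage_algebra2) auto
qed auto

context bounded_space
begin

section \<open>Measurable enumeration and coding of locally finite sets\<close>

lemma locfin_countable: "c \<in> locfin \<Longrightarrow> countable c"
proof -
  assume c: "c \<in> locfin"
  then have "c = (\<Union>K. c \<inter> X K)" using X_UN by (auto simp: locfin_def)
  moreover have "countable (\<Union>K. c \<inter> X K)"
    using c by (intro countable_UN) (auto simp: locfin_def countable_finite)
  ultimately show ?thesis by simp
qed

lemma finite_Int_shell: "c \<in> locfin \<Longrightarrow> finite (c \<inter> shell j)"
  using finite_int_bdd shell_bdd by blast

definition cnt :: "nat \<Rightarrow> real set \<Rightarrow> nat" where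
  "cnt j c = card (c \<inter> shell j)"

text \<open>Listing the points of a shell in increasing order makes the enumeration canonical, and
  measurable by counting the points below a threshold.\<close>

definition pt :: "nat \<Rightarrow> nat \<Rightarrow> real set \<Rightarrow> real" where
  "pt j k c = (if k < cnt j c then sorted_list_of_set (c \<inter> shell j) ! k else 0)"

lemma Int_shell_eq_pt:
  assumes "c \<in> locfin"
  shows "c \<inter> shell j = (\<lambda>k. pt j k c) ` {..<cnt j c}"
proof -
  have "c \<inter> shell j = set (sorted_list_of_set (c \<inter> shell j))"
    using finite_Int_shell[OF assms] by simp
  also have "\<dots> = (\<lambda>k. sorted_list_of_set (c \<inter> shell j) ! k) ` {..<cnt j c}"
    using nth_image[of "cnt j c" "sorted_list_of_set (c \<inter> shell j)"] by (simp add: cnt_def lessThan_atLeast0)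
  also have "\<dots> = (\<lambda>k. pt j k c) ` {..<cnt j c}"
    by (rule image_cong) (auto simp: pt_def)
  finally show ?thesis .
qed

lemma eq_pt: "c \<in> locfin \<Longrightarrow> c = (\<Union>j. (\<lambda>k. pt j k c) ` {..<cnt j c})"
proof -
  assume c: "c \<in> locfin"
  then have "c = (\<Union>j. c \<inter> shell j)" using shell_UN by (auto simp: locfin_def)
  then show ?thesis unfolding Int_shell_eq_pt[OF c] .
qed

lemma cnt_measurable [measurable]: "cnt j \<in> point_sets \<rightarrow>\<^sub>M count_space UNIV"
proof (rule measurable_count_space_eq_countable[THEN iffD2, OF countableI_type], intro conjI ballI)
  fix n
  have "cnt j -` {n} \<inter> space point_sets = {c \<in> space point_sets. num (c \<inter> shell j) = of_nat n}"
    using finite_Int_shell by (auto simp: space_point_sets cnt_def num_eq_of_nat_iff)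
  also have "\<dots> \<in> sets point_sets" by measurable
  finally show "cnt j -` {n} \<inter> space point_sets \<in> sets point_sets" .
qed auto

lemma pt_measurable [measurable]: "pt j k \<in> borel_measurable point_sets"
proof (rule borel_measurable_iff_le[THEN iffD2], intro allI)
  fix t
  have [measurable]: "shell j \<inter> {..t} \<in> sets M" by (rule Int_borel_M) auto
  have "{c \<in> space point_sets. pt j k c \<le> t} = {c \<in> space point_sets.
    if k < cnt j c then of_nat (Suc k) \<le> num (c \<inter> (shell j \<inter> {..t})) else 0 \<le> t}"
  proof (rule Collect_cong, rule conj_cong[OF refl])
    fix c assume "c \<in> space point_sets"
    then have fin: "finite (c \<inter> shell j)" using finite_Int_shell by (simp add: space_point_sets)
    have "num (c \<inter> (shell j \<inter> {..t})) = of_nat (card (c \<inter> shell j \<inter> {..t}))"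
      using fin by (simp add: num_finite Int_assoc[symmetric])
    then have "of_nat (Suc k) \<le> num (c \<inter> (shell j \<inter> {..t})) \<longleftrightarrow> Suc k \<le> card (c \<inter> shell j \<inter> {..t})"
      by (simp only: of_nat_le_iff)
    then show "pt j k c \<le> t \<longleftrightarrow> (if k < cnt j c then of_nat (Suc k) \<le> num (c \<inter> (shell j \<inter> {..t})) else 0 \<le> t)"
      using sorted_list_nth_le_iff[OF fin, of k t] by (simp add: pt_def cnt_def)
  qed
  also have "\<dots> \<in> sets point_sets" by measurable
  finally show "{c \<in> space point_sets. pt j k c \<le> t} \<in> sets point_sets" .
qed

definition code :: "real set \<Rightarrow> nat \<times> nat \<Rightarrow> real" where
  "code c p = (case snd p of 0 \<Rightarrow> real (cnt (fst p) c) | Suc k \<Rightarrow> pt (fst p) k c)"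

text \<open>Meaningful on all sequences: the floor reads the stored number of points, and the
  intersection with \<open>shell j\<close> enforces local finiteness even for sequences that are not
  codes.\<close>

definition decode :: "(nat \<times> nat \<Rightarrow> real) \<Rightarrow> real set" where
  "decode p = (\<Union>j. (\<lambda>k. p (j, Suc k)) ` {..<nat \<lfloor>p (j, 0)\<rfloor>} \<inter> shell j)"

lemma decode_code: "c \<in> locfin \<Longrightarrow> decode (code c) = c"
proof -
  assume c: "c \<in> locfin"
  have "decode (code c) = (\<Union>j. (\<lambda>k. pt j k c) ` {..<cnt j c} \<inter> shell j)"
    by (simp add: decode_def code_def)
  also have "\<dots> = (\<Union>j. (c \<inter> shell j) \<inter> shell j)"
    by (simp only: Int_shell_eq_pt[OF c])
  also have "\<dots> = c"
    using c shell_UN by (auto simp: locfin_def)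
  finally show ?thesis .
qed

lemma decode_locfin: "decode p \<in> locfin"
proof -
  have "finite (decode p \<inter> X K)" for K
  proof (rule finite_subset)
    show "decode p \<inter> X K \<subseteq> (\<Union>j\<in>{..K}. (\<lambda>k. p (j, Suc k)) ` {..<nat \<lfloor>p (j, 0)\<rfloor>})"
    proof
      fix x assume x: "x \<in> decode p \<inter> X K"
      then obtain j where j: "x \<in> (\<lambda>k. p (j, Suc k)) ` {..<nat \<lfloor>p (j, 0)\<rfloor>}" "x \<in> shell j"
        unfolding decode_def by blast
      then have "j \<le> K" using X_shell[of K j] x by blast
      with j show "x \<in> (\<Union>j\<in>{..K}. (\<lambda>k. p (j, Suc k)) ` {..<nat \<lfloor>p (j, 0)\<rfloor>})" by blast
    qed
  qed auto
  moreover have "decode p \<subseteq> space M"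
    using shell_UN by (auto simp: decode_def)
  ultimately show ?thesis by (simp add: locfin_def)
qed

lemma code_measurable: "code \<in> borel_measurable point_sets"
proof (rule measurable_coordinatewise_then_product)
  fix p :: "nat \<times> nat"
  have "(\<lambda>c. real (cnt j c)) \<in> borel_measurable point_sets" for j by measurable
  then show "(\<lambda>c. code c p) \<in> borel_measurable point_sets"
    unfolding code_def by (cases "snd p") simp_all
qed

lemma decode_measurable: "decode \<in> borel \<rightarrow>\<^sub>M point_sets"
proof (rule measurable_point_setsI)
  fix A assume A: "bdd A"
  have [measurable]: "(\<lambda>p. p q) \<in> borel_measurable (borel :: (nat \<times> nat \<Rightarrow> real) measure)" for q
    by (rule measurable_product_then_coordinatewise) simp
  have [measurable]: "A \<in> sets borel" "shell j \<in> sets borel" for j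
    using M_subset_borel bdd_sets[OF A] shell_sets by auto
  have "{p \<in> space borel. decode p \<inter> A = {}} =
    {p \<in> space borel. \<forall>j k. k < nat \<lfloor>p (j, 0)\<rfloor> \<longrightarrow> p (j, Suc k) \<in> shell j \<longrightarrow> p (j, Suc k) \<notin> A}"
    by (auto simp: decode_def)
  also have "\<dots> \<in> sets borel" by measurable
  finally show "{p \<in> space borel. decode p \<inter> A = {}} \<in> sets borel" .
qed (rule decode_locfin)

text \<open>The coding depends on the sigma-algebra alone, so the same \<open>f\<close> and
  \<open>w\<close> serve every law on it.\<close>

lemma real_coding_point_sets:
  obtains f w where "\<And>P. sets P = sets point_sets \<Longrightarrow> real_coding P f w"
proof -
  obtain u :: "(nat \<times> nat \<Rightarrow> real) \<Rightarrow> real" and v where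
    uv: "u \<in> borel_measurable borel" "v \<in> borel_measurable borel" "\<And>x. v (u x) = x"
    using real_coding_exists by metis
  have "real_coding P (\<lambda>c. u (code c)) (\<lambda>r. decode (v r))" if P: "sets P = sets point_sets" for P
  proof
    show "(\<lambda>c. u (code c)) \<in> borel_measurable P"
      unfolding measurable_cong_sets[OF P refl] by (rule measurable_compose[OF code_measurable uv(1)])
    show "(\<lambda>r. decode (v r)) \<in> borel \<rightarrow>\<^sub>M P"
      unfolding measurable_cong_sets[OF refl P] by (rule measurable_compose[OF uv(2) decode_measurable])
    show "decode (v (u (code c))) = c" if "c \<in> space P" for c
      using that sets_eq_imp_space_eq[OF P] by (simp add: uv(3) decode_code space_point_sets)
  qed
  then show ?thesis by (rule that)
qed

section \<open>Locally finite sets as counting measures\<close>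

lemma cfg_configurations:
  assumes "c \<in> locfin"
  shows "cfg M c \<in> configurations M"
proof -
  have cnt: "countable c" and sub: "c \<subseteq> space M"
    using assms locfin_countable by (auto simp: locfin_def)
  define I where "I = to_nat_on c ` c"
  define x where "x = from_nat_into c"
  have x: "x (to_nat_on c y) = y" if "y \<in> c" for y
    unfolding x_def using cnt that by simp
  have xI: "x \<in> I \<rightarrow> space M" using x sub by (auto simp: I_def)
  have "cfg M c = distr (count_space I) M x"
  proof (rule measure_eqI)
    fix A assume "A \<in> sets (cfg M c)"
    then have A: "A \<in> sets M" by (simp add: cfg_def)
    have "{i \<in> I. x i \<in> A} = to_nat_on c ` (c \<inter> A)" using x by (auto simp: I_def)
    moreover have "inj_on (to_nat_on c) (c \<inter> A)"
      by (rule inj_on_subset[OF inj_on_to_nat_on[OF cnt]]) simp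
    ultimately show "emeasure (cfg M c) A = emeasure (distr (count_space I) M x) A"
      by (simp add: emeasure_cfg[OF sub A] emeasure_distr_count_space[OF xI A] num_image)
  qed (simp add: cfg_def)
  then show ?thesis unfolding configurations_def using xI by blast
qed

lemma cfg_measurable: "cfg M \<in> point_sets \<rightarrow>\<^sub>M configuration_algebra M"
proof (rule measurable_configuration_algebraI)
  fix A assume A: "A \<in> sets M"
  have "emeasure (cfg M c) A = num (c \<inter> A)" if "c \<in> space point_sets" for c
    using that A by (intro emeasure_cfg) (auto simp: space_point_sets locfin_def)
  then show "(\<lambda>c. emeasure (cfg M c) A) \<in> borel_measurable point_sets"
    using num_measurable[OF A] by (simp cong: measurable_cong)
qed (simp add: cfg_configurations space_point_sets)

text \<open>Under \<open>cfg M\<close> the count \<open>num (c \<inter> A)\<close> becomes the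
  evaluation at \<open>A\<close>. Independence follows because such a count is measurable with
  respect to the void events inside \<open>A\<close>.\<close>

lemma poisson_measure_cfg:
  assumes P: "poisson_law P"
  shows "poisson_measure M (distr P (configuration_algebra M) (cfg M))"
proof -
  let ?C = "configuration_algebra M"
  let ?Q = "distr P ?C (cfg M)"
  interpret P: prob_space P using P by (simp add: poisson_law_def)
  have sets: "sets P = sets point_sets" and sp: "space P = locfin"
    using P sets_eq_imp_space_eq[of P point_sets] by (auto simp: poisson_law_def space_point_sets)
  have cm: "cfg M \<in> P \<rightarrow>\<^sub>M ?C"
    unfolding measurable_cong_sets[OF sets refl] by (rule cfg_measurable)
  interpret Q: prob_space ?Q by (rule P.prob_space_distr[OF cm])
  have ev: "(\<lambda>\<omega>. emeasure \<omega> A) \<in> borel_measurable ?Q" if "A \<in> sets M" for A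
    using evaluation_measurable[OF that] by simp
  have pre: "cfg M -` ((\<lambda>\<omega>. emeasure \<omega> A) -` E \<inter> space ?Q) \<inter> space P = (\<lambda>c. num (c \<inter> A)) -` E \<inter> space P"
    if "A \<in> sets M" for A E
    using measurable_space[OF cm] that by (auto simp: sp locfin_def emeasure_cfg)
  have numP: "(\<lambda>c. num (c \<inter> A)) \<in> borel_measurable P" if "A \<in> sets M" for A
    unfolding measurable_cong_sets[OF sets refl] by (rule num_measurable[OF that])
  show ?thesis
    unfolding poisson_measure_def
  proof (intro conjI ballI allI impI)
    show "prob_space ?Q" by (rule Q.prob_space_axioms)
    fix A k assume A: "A \<in> sets M" "0 < emeasure M A \<and> emeasure M A < \<infinity>"
    have "{\<omega> \<in> space ?Q. emeasure \<omega> A = of_nat k} = (\<lambda>\<omega>. emeasure \<omega> A) -` {of_nat k} \<inter> space ?Q" by auto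
    then have "measure ?Q {\<omega> \<in> space ?Q. emeasure \<omega> A = of_nat k} = measure P ((\<lambda>c. num (c \<inter> A)) -` {of_nat k} \<inter> space P)"
      using measurable_sets[OF ev[OF A(1)], of "{of_nat k}"] pre[OF A(1)]
      by (simp add: measure_distr[OF cm])
    also have "(\<lambda>c. num (c \<inter> A)) -` {of_nat k} \<inter> space P = {c \<in> locfin. num (c \<inter> A) = of_nat k}"
      by (auto simp: sp)
    also have "measure P \<dots> = pmf (poisson_pmf (measure M A)) k"
      using poisson_law_count[OF P] A by simp
    finally show "measure ?Q {\<omega> \<in> space ?Q. emeasure \<omega> A = of_nat k} = pmf (poisson_pmf (measure M A)) k" .
  next
    fix A :: "nat \<Rightarrow> real set" and n :: nat
    assume A: "A ` {..<n} \<subseteq> sets M \<and> disjoint_family_on A {..<n}"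
    have "P.indep_sets (\<lambda>i. sigma_sets locfin (voids (A i))) {..<n}"
      using A by (intro poisson_law_indep[OF P]) auto
    then have ind: "P.indep_sets (\<lambda>i. {(\<lambda>c. num (c \<inter> A i)) -` E \<inter> space P | E. E \<in> sets borel}) {..<n}"
    proof (rule P.indep_sets_mono_sets)
      fix i assume "i \<in> {..<n}"
      then have Ai: "A i \<in> sets M" using A by auto
      show "{(\<lambda>c. num (c \<inter> A i)) -` E \<inter> space P | E. E \<in> sets borel} \<subseteq> sigma_sets locfin (voids (A i))"
        using measurable_sets[OF num_measurable_sigma_voids[OF Ai]] voids_subset[of "A i"]
        by (auto simp: sp space_measure_of sets_measure_of)
    qed
    show "Q.indep_vars (\<lambda>_. borel) (\<lambda>i \<omega>. emeasure \<omega> (A i)) {..<n}"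
      unfolding Q.indep_vars_def2
    proof (intro conjI ballI Q.indep_setsI)
      fix i assume "i \<in> {..<n}"
      then show "(\<lambda>\<omega>. emeasure \<omega> (A i)) \<in> borel_measurable ?Q" using A ev by auto
      then show "{(\<lambda>\<omega>. emeasure \<omega> (A i)) -` E \<inter> space ?Q | E. E \<in> sets borel} \<subseteq> Q.events"
        using measurable_sets by blast
    next
      fix Y J assume J: "J \<noteq> {}" "J \<subseteq> {..<n}" "finite J"
        and Y: "\<forall>j\<in>J. Y j \<in> {(\<lambda>\<omega>. emeasure \<omega> (A j)) -` E \<inter> space ?Q | E. E \<in> sets borel}"
      then have "\<forall>j\<in>J. \<exists>E. E \<in> sets borel \<and> Y j = (\<lambda>\<omega>. emeasure \<omega> (A j)) -` E \<inter> space ?Q" by auto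
      then obtain E where E: "\<And>j. j \<in> J \<Longrightarrow> E j \<in> sets borel \<and> Y j = (\<lambda>\<omega>. emeasure \<omega> (A j)) -` E j \<inter> space ?Q"
        by metis
      have Yev: "Y j \<in> sets ?C" if "j \<in> J" for j
      proof -
        have "A j \<in> sets M" using that J A by auto
        then show ?thesis using E[OF that] measurable_sets[OF ev, of "A j" "E j"] by simp
      qed
      have Ypre: "cfg M -` Y j \<inter> space P = (\<lambda>c. num (c \<inter> A j)) -` E j \<inter> space P" if "j \<in> J" for j
      proof -
        have "A j \<in> sets M" using that J A by auto
        from pre[OF this, of "E j"] show ?thesis using E[OF that] by simp
      qed
      have "Q.prob (\<Inter>j\<in>J. Y j) = P.prob (cfg M -` (\<Inter>j\<in>J. Y j) \<inter> space P)"
        using Yev J by (intro measure_distr[OF cm] sets.finite_INT) auto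
      also have "cfg M -` (\<Inter>j\<in>J. Y j) \<inter> space P = (\<Inter>j\<in>J. cfg M -` Y j \<inter> space P)"
        using J by auto
      also have "P.prob \<dots> = (\<Prod>j\<in>J. P.prob (cfg M -` Y j \<inter> space P))"
      proof (rule P.indep_setsD[OF ind J(2,1,3)], rule ballI)
        fix j assume "j \<in> J"
        then show "cfg M -` Y j \<inter> space P \<in> {(\<lambda>c. num (c \<inter> A j)) -` E \<inter> space P | E. E \<in> sets borel}"
          using Ypre[of j] E[of j] by blast
      qed
      also have "\<dots> = (\<Prod>j\<in>J. Q.prob (Y j))"
        using Yev by (intro prod.cong refl measure_distr[OF cm, symmetric])
      finally show "Q.prob (\<Inter>j\<in>J. Y j) = (\<Prod>j\<in>J. Q.prob (Y j))" .
    qed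
  qed simp
qed

lemma cfg_inject:
  assumes "c \<in> locfin" "d \<in> locfin" "cfg M c = cfg M d"
  shows "c = d"
proof (rule set_eqI)
  fix x
  have sub: "c \<subseteq> space M" "d \<subseteq> space M" using assms by (auto simp: locfin_def)
  show "x \<in> c \<longleftrightarrow> x \<in> d"
  proof (cases "x \<in> space M")
    case True
    then have "{x} \<in> sets M" using Int_borel_M[OF sets.top, of "{x}"] by (simp add: Int_absorb1)
    then have "num (c \<inter> {x}) = num (d \<inter> {x})"
      using emeasure_cfg[OF sub(1)] emeasure_cfg[OF sub(2)] assms(3) by metis
    then show ?thesis by (cases "x \<in> c"; cases "x \<in> d") (auto simp: num_def)
  qed (use sub in auto)
qed

text \<open>Configurations without repeated points are recognized by countably many counts:
  finiteness on each \<open>X K\<close> and, at some dyadic level, at most one point per cell. This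
  exhibits the image of \<open>cfg M\<close> as a measurable set, which the isomorphism needs as its
  conull range.\<close>

lemma cfg_image_eq:
  "cfg M ` locfin = {\<omega> \<in> space (configuration_algebra M). \<forall>K. emeasure \<omega> (X K) < \<infinity> \<and>
    (\<exists>m. \<forall>z. emeasure \<omega> (X K \<inter> cell m z) \<le> 1)}" (is "?L = ?R")
proof (intro equalityI subsetI)
  fix \<omega> assume "\<omega> \<in> ?L"
  then obtain c where c: "c \<in> locfin" "\<omega> = cfg M c" by auto
  then have sub: "c \<subseteq> space M" by (simp add: locfin_def)
  have "emeasure \<omega> (X K) < \<infinity>" for K
    using c by (simp add: emeasure_cfg[OF sub] locfin_def num_finite less_top[symmetric])
  moreover have "\<exists>m. \<forall>z. emeasure \<omega> (X K \<inter> cell m z) \<le> 1" for K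
  proof -
    have fin: "finite (c \<inter> X K)" using c by (simp add: locfin_def)
    obtain m where m: "inj_on (\<lambda>x. \<lfloor>x * 2 ^ m\<rfloor>) (c \<inter> X K)" using finite_cells_separate[OF fin] .
    have "emeasure \<omega> (X K \<inter> cell m z) \<le> 1" for z
    proof -
      have "card (c \<inter> (X K \<inter> cell m z)) \<le> 1"
        using m fin by (subst card_le_Suc0_iff_eq[unfolded One_nat_def[symmetric]]) (auto simp: inj_on_def cell_def Int_assoc[symmetric])
      then have "of_nat (card (c \<inter> (X K \<inter> cell m z))) \<le> (of_nat 1 :: ennreal)" by (simp only: of_nat_le_iff)
      then show ?thesis
        using fin c sub by (simp add: emeasure_cfg num_finite Int_assoc[symmetric])
    qed
    then show ?thesis by blast
  qed
  ultimately show "\<omega> \<in> ?R"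
    using c cfg_configurations by (simp add: space_configuration_algebra)
next
  fix \<omega> assume R: "\<omega> \<in> ?R"
  then have "\<omega> \<in> configurations M" by (simp add: space_configuration_algebra)
  then obtain I :: "nat set" and x where x: "x \<in> I \<rightarrow> space M" "\<omega> = distr (count_space I) M x"
    by (rule space_configurations)
  have em: "emeasure \<omega> A = num {i \<in> I. x i \<in> A}" if "A \<in> sets M" for A
    unfolding x(2) by (rule emeasure_distr_count_space[OF x(1) that])
  \<comment> \<open>A repeated point would give a count of at least 2 in its own cell at every
    level.\<close>
  have inj: "inj_on x I"
  proof (rule inj_onI, rule ccontr)
    fix i j assume ij: "i \<in> I" "j \<in> I" "x i = x j" "i \<noteq> j"
    then obtain K where K: "x i \<in> X K" using x(1) X_UN by blast
    obtain m where m: "\<And>z. emeasure \<omega> (X K \<inter> cell m z) \<le> 1" using R by blast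
    define z where "z = \<lfloor>x i * 2 ^ m\<rfloor>"
    have "num {i, j} \<le> num {i \<in> I. x i \<in> X K \<inter> cell m z}"
      unfolding num_def using ij K by (intro emeasure_mono) (auto simp: cell_def z_def)
    also have "\<dots> = emeasure \<omega> (X K \<inter> cell m z)" by (rule em[symmetric]) auto
    also have "\<dots> \<le> 1" by (rule m)
    finally show False using ij(4) by (simp add: num_def)
  qed
  have numx: "num (x ` I \<inter> A) = num {i \<in> I. x i \<in> A}" for A
  proof -
    have "x ` I \<inter> A = x ` {i \<in> I. x i \<in> A}" by auto
    then show ?thesis using num_image[OF inj_on_subset[OF inj, of "{i \<in> I. x i \<in> A}"]] by auto
  qed
  have sub: "x ` I \<subseteq> space M" using x by auto
  have "finite (x ` I \<inter> X K)" for K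
  proof (rule ccontr)
    assume "infinite (x ` I \<inter> X K)"
    then have "emeasure \<omega> (X K) = \<infinity>"
      using em[OF X_sets, of K] numx[of "X K"] by (simp add: num_def)
    then show False using R by (auto simp: less_top[symmetric])
  qed
  then have "x ` I \<in> locfin" using sub by (simp add: locfin_def)
  moreover have "\<omega> = cfg M (x ` I)"
  proof (rule measure_eqI)
    fix A assume "A \<in> sets \<omega>"
    then have "A \<in> sets M" by (simp add: x(2))
    then show "emeasure \<omega> A = emeasure (cfg M (x ` I)) A"
      using em emeasure_cfg[OF sub] numx by simp
  qed (simp add: x(2) cfg_def)
  ultimately show "\<omega> \<in> ?L" by blast
qed

lemma cfg_image_sets: "cfg M ` locfin \<in> sets (configuration_algebra M)"
proof -
  have [measurable]: "(\<lambda>\<omega>. emeasure \<omega> (X K)) \<in> borel_measurable (configuration_algebra M)" for K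
    by (rule evaluation_measurable) simp
  have [measurable]: "(\<lambda>\<omega>. emeasure \<omega> (X K \<inter> cell m z)) \<in> borel_measurable (configuration_algebra M)" for K m z
    by (rule evaluation_measurable) simp
  show ?thesis unfolding cfg_image_eq by measurable
qed

text \<open>\<open>cfg M\<close> is a bijection from the locally finite sets onto a conull set of
  configurations; composed with the coding it carries images of sets to push-forwards of measures.
  Injectivity of \<open>R i\<close> keeps points of an image from merging, so that no multiplicity
  is lost.\<close>

lemma isomorphic_cfg:
  assumes P: "poisson_law P" and fw: "real_coding P f w"
    and R: "\<And>i. R i \<in> M \<rightarrow>\<^sub>M M" "\<And>i. inj_on (R i) (space M)"
    and loc: "\<And>i c. c \<in> locfin \<Longrightarrow> R i ` c \<in> locfin"
  shows "isomorphic_systems (real_coding.copy P f w) (\<lambda>i r. f (R i ` w r))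
    (distr P (configuration_algebra M) (cfg M)) (\<lambda>i. suspended_transformation M (R i))"
proof -
  interpret real_coding P f w by (rule fw)
  let ?C = "configuration_algebra M"
  let ?Q = "distr P ?C (cfg M)"
  interpret P: prob_space P using P by (simp add: poisson_law_def)
  have sets: "sets P = sets point_sets" and sp: "space P = locfin"
    using P sets_eq_imp_space_eq[of P point_sets] by (auto simp: poisson_law_def space_point_sets)
  have cm: "cfg M \<in> P \<rightarrow>\<^sub>M ?C"
    unfolding measurable_cong_sets[OF sets refl] by (rule cfg_measurable)
  interpret Q: prob_space ?Q by (rule P.prob_space_distr[OF cm])
  define \<phi> where "\<phi> r = cfg M (w r)" for r
  define A where "A = space copy"
  define B where "B = cfg M ` locfin"
  have Bs: "B \<in> sets ?C" unfolding B_def by (rule cfg_image_sets)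
  have wl: "w r \<in> locfin" for r using w_space[of r] by (simp add: sp)
  have \<phi>B: "\<phi> r \<in> B" for r using wl by (auto simp: \<phi>_def B_def)
  have inj: "inj_on \<phi> A"
  proof (rule inj_onI)
    fix r s assume "r \<in> A" "s \<in> A" "\<phi> r = \<phi> s"
    then have "w r = w s" by (intro cfg_inject[OF wl wl]) (simp add: \<phi>_def)
    then have "f (w r) = f (w s)" by (rule arg_cong)
    moreover have "f (w r) = r" "f (w s) = s"
      using \<open>r \<in> A\<close> \<open>s \<in> A\<close> unfolding A_def by (simp_all only: f_w)
    ultimately show "r = s" by simp
  qed
  have surj: "\<phi> ` A = B"
  proof
    show "B \<subseteq> \<phi> ` A"
    proof
      fix \<omega> assume "\<omega> \<in> B"
      then obtain c where c: "c \<in> locfin" "\<omega> = cfg M c" by (auto simp: B_def)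
      then have "f c \<in> A" "\<phi> (f c) = \<omega>"
        using f_codes[of c] w_f[of c] by (auto simp: A_def space_copy sp \<phi>_def)
      then show "\<omega> \<in> \<phi> ` A" by blast
    qed
  qed (use \<phi>B in auto)
  have bij: "bij_betw \<phi> A B" using inj surj by (simp add: bij_betw_def)
  have QB: "emeasure ?Q (space ?Q - B) = 0"
  proof -
    have "emeasure ?Q (space ?Q - B) = emeasure P (cfg M -` (space ?Q - B) \<inter> space P)"
      using Bs by (intro emeasure_distr[OF cm]) auto
    also have "cfg M -` (space ?Q - B) \<inter> space P = {}" by (auto simp: B_def sp)
    finally show ?thesis by simp
  qed
  have \<phi>m: "\<phi> \<in> copy \<rightarrow>\<^sub>M ?C"
    unfolding \<phi>_def by (rule measurable_compose[OF w_copy cm])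
  have rA: "restrict_space copy A = copy"
    unfolding A_def by (rule restrict_space_whole)
  have m1: "\<phi> \<in> restrict_space copy A \<rightarrow>\<^sub>M restrict_space ?Q B"
    unfolding rA using \<phi>m \<phi>B by (intro measurable_restrict_space2) auto
  \<comment> \<open>The inverse of \<open>cfg M\<close>. It is measurable because a bounded set is
    void exactly when its count is 0.\<close>
  define c_of where "c_of \<omega> = (THE c. c \<in> locfin \<and> cfg M c = \<omega>)" for \<omega>
  have c_of: "c_of (cfg M c) = c" if "c \<in> locfin" for c
    unfolding c_of_def using that cfg_inject by (intro the_equality) auto
  have c_of_m: "c_of \<in> restrict_space ?Q B \<rightarrow>\<^sub>M P"
    unfolding measurable_cong_sets[OF refl sets]
  proof (rule measurable_point_setsI)
    fix E assume E: "bdd E"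
    have "{\<omega> \<in> space (restrict_space ?Q B). c_of \<omega> \<inter> E = {}} = B \<inter> {\<omega> \<in> space ?C. emeasure \<omega> E = 0}"
    proof -
      have "c_of (cfg M c) \<inter> E = {} \<longleftrightarrow> emeasure (cfg M c) E = 0" if "c \<in> locfin" for c
        using that bdd_sets[OF E] num_eq_of_nat_iff[of "c \<inter> E" 0] finite_int_bdd[OF that E]
        by (auto simp: c_of emeasure_cfg locfin_def)
      then show ?thesis
        using sets.sets_into_space[OF Bs] by (auto simp: space_restrict_space B_def)
    qed
    also have "\<dots> \<in> sets (restrict_space ?Q B)"
    proof -
      have [measurable]: "(\<lambda>\<omega>. emeasure \<omega> E) \<in> borel_measurable ?C"
        using evaluation_measurable[OF bdd_sets[OF E]] .
      have "{\<omega> \<in> space ?C. emeasure \<omega> E = 0} \<in> sets ?C" by measurable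
      then show ?thesis by (auto simp: sets_restrict_space)
    qed
    finally show "{\<omega> \<in> space (restrict_space ?Q B). c_of \<omega> \<inter> E = {}} \<in> sets (restrict_space ?Q B)" .
  qed (auto simp: space_restrict_space B_def c_of)
  have m2: "the_inv_into A \<phi> \<in> restrict_space ?Q B \<rightarrow>\<^sub>M restrict_space copy A"
    unfolding rA
  proof (subst measurable_cong)
    show "(\<lambda>\<omega>. f (c_of \<omega>)) \<in> restrict_space ?Q B \<rightarrow>\<^sub>M copy"
      by (rule measurable_compose[OF c_of_m f_copy])
    fix \<omega> assume "\<omega> \<in> space (restrict_space ?Q B)"
    then obtain c where c: "c \<in> locfin" "\<omega> = cfg M c" by (auto simp: space_restrict_space B_def)
    then have "f c \<in> A" "\<phi> (f c) = \<omega>"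
      using f_codes[of c] w_f[of c] by (auto simp: A_def space_copy sp \<phi>_def)
    then show "the_inv_into A \<phi> \<omega> = f (c_of \<omega>)"
      using the_inv_into_f_f[OF inj, of "f c"] c c_of by simp
  qed
  have dist: "distr (restrict_space copy A) (restrict_space ?Q B) \<phi> = restrict_space ?Q B"
  proof (rule measure_eqI)
    fix E assume "E \<in> sets (distr (restrict_space copy A) (restrict_space ?Q B) \<phi>)"
    then have E: "E \<in> sets (restrict_space ?Q B)" by simp
    then have E': "E \<in> sets ?C" "E \<subseteq> B"
      using Bs by (auto simp: sets_restrict_space)
    have "emeasure (distr (restrict_space copy A) (restrict_space ?Q B) \<phi>) E = emeasure copy (\<phi> -` E \<inter> space copy)"
      using emeasure_distr[OF m1 E] by (simp add: rA)
    also have "\<dots> = emeasure (distr copy P w) (cfg M -` E \<inter> space P)"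
      using measurable_sets[OF cm E'(1)] w_space
      by (subst emeasure_distr[OF w_copy]) (auto simp: \<phi>_def intro!: arg_cong[where f = "emeasure copy"])
    also have "\<dots> = emeasure ?Q E"
      unfolding distr_w by (rule emeasure_distr[OF cm E'(1), symmetric])
    also have "\<dots> = emeasure (restrict_space ?Q B) E"
      using Bs E' by (intro emeasure_restrict_space[symmetric]) auto
    finally show "emeasure (distr (restrict_space copy A) (restrict_space ?Q B) \<phi>) E = emeasure (restrict_space ?Q B) E" .
  qed simp
  have inter: "\<phi> (f (R i ` w r)) = suspended_transformation M (R i) (\<phi> r)" for i r
  proof -
    have Rl: "R i ` w r \<in> locfin" using loc[OF wl] .
    have sub: "w r \<subseteq> space M" "R i ` w r \<subseteq> space M" using wl Rl by (auto simp: locfin_def)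
    have "cfg M (R i ` w r) = distr (cfg M (w r)) M (R i)"
    proof (rule measure_eqI)
      fix E assume "E \<in> sets (cfg M (R i ` w r))"
      then have E: "E \<in> sets M" by (simp add: cfg_def)
      have Rc: "R i \<in> cfg M (w r) \<rightarrow>\<^sub>M M" using R(1)[of i] by (simp add: cfg_def cong: measurable_cong_sets)
      have spc: "space (cfg M (w r)) = space M" by (simp add: cfg_def)
      have "emeasure (distr (cfg M (w r)) M (R i)) E = emeasure (cfg M (w r)) (R i -` E \<inter> space M)"
        using emeasure_distr[OF Rc E] by (simp add: spc)
      also have "\<dots> = num (w r \<inter> (R i -` E \<inter> space M))"
        by (rule emeasure_cfg[OF sub(1) measurable_sets[OF R(1) E]])
      also have "\<dots> = num (R i ` (w r \<inter> (R i -` E \<inter> space M)))"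
        by (intro num_image[symmetric] inj_on_subset[OF R(2)]) auto
      also have "R i ` (w r \<inter> (R i -` E \<inter> space M)) = R i ` w r \<inter> E" using sub by auto
      also have "num \<dots> = emeasure (cfg M (R i ` w r)) E" by (rule emeasure_cfg[OF sub(2) E, symmetric])
      finally show "emeasure (cfg M (R i ` w r)) E = emeasure (distr (cfg M (w r)) M (R i)) E" by simp
    qed (simp add: cfg_def)
    then show ?thesis
      using w_f[of "R i ` w r"] Rl by (simp add: \<phi>_def suspended_transformation_def sp)
  qed
  show ?thesis
    unfolding isomorphic_systems_def
    by (intro exI[of _ \<phi>] exI[of _ A] exI[of _ B] conjI allI)
      (use Bs QB bij m1 m2 dist inter in \<open>auto simp: A_def\<close>)
qed

end

section \<open>Recurrence of actions\<close>

lemma mp_action_measurable: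
  assumes "mp_action M T"
  shows "T g \<in> M \<rightarrow>\<^sub>M M"
proof -
  have [measurable]: "(\<lambda>(g, x). T g x) \<in> borel \<Otimes>\<^sub>M M \<rightarrow>\<^sub>M M"
    using assms by (simp add: mp_action_def)
  have "(\<lambda>x. case (g, x) of (g, x) \<Rightarrow> T g x) \<in> M \<rightarrow>\<^sub>M M" by measurable
  then show ?thesis by simp
qed

lemma mp_action_emeasure:
  assumes "mp_action M T" "A \<in> sets M"
  shows "emeasure M (T g -` A \<inter> space M) = emeasure M A"
  using emeasure_distr[OF mp_action_measurable[OF assms(1)] assms(2), of g] assms(1)
  by (simp add: mp_action_def)

lemma mp_action_measure:
  assumes "mp_action M T" "A \<in> sets M"
  shows "measure M (T g -` A \<inter> space M) = measure M A"
  using mp_action_emeasure[OF assms] by (simp add: measure_def)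

lemma mp_action_space:
  assumes "mp_action M T" "x \<in> space M"
  shows "T g x \<in> space M"
  using measurable_space[OF mp_action_measurable[OF assms(1)] assms(2)] .

lemma mp_action_add:
  assumes "mp_action M T" "x \<in> space M"
  shows "T (g + h) x = T g (T h x)"
  using assms by (simp add: mp_action_def)

lemma mp_action_minus:
  assumes "mp_action M T" "x \<in> space M"
  shows "T (- g) (T g x) = x" "T g (T (- g) x) = x"
  using mp_action_add[OF assms, of "- g" g] mp_action_add[OF assms, of g "- g"] assms
  by (auto simp: mp_action_def)

lemma mp_action_inj: "mp_action M T \<Longrightarrow> inj_on (T g) (space M)"
  by (metis inj_onI mp_action_minus(1))

lemma mp_action_funpow:
  assumes "mp_action M T" "x \<in> space M"
  shows "(T g ^^ n) x = T (real n *\<^sub>R g) x"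
proof (induction n)
  case 0
  then show ?case using assms by (simp add: mp_action_def)
next
  case (Suc n)
  have "(T g ^^ Suc n) x = T g (T (real n *\<^sub>R g) x)" using Suc by simp
  also have "\<dots> = T (g + real n *\<^sub>R g) x" by (rule mp_action_add[OF assms, symmetric])
  finally show ?case by (simp add: scaleR_left_distrib add.commute)
qed

section \<open>Rigidity and zero entropy from returns to the identity\<close>

definition recurrent_along :: "'a measure \<Rightarrow> (nat \<Rightarrow> 'a \<Rightarrow> 'a) \<Rightarrow> bool" where
  "recurrent_along M S \<longleftrightarrow>
    (\<forall>B\<in>sets M. (\<lambda>k. measure M (sym_diff B (S k -` B \<inter> space M))) \<longlonglongrightarrow> 0)"

lemma recurrent_along_diff:
  assumes "prob_space M" "\<And>k. S k \<in> M \<rightarrow>\<^sub>M M" "recurrent_along M S" "B \<in> sets M"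
  shows "(\<lambda>k. measure M (B - (S k -` B \<inter> space M))) \<longlonglongrightarrow> 0"
proof (rule tendsto_sandwich[OF _ _ tendsto_const])
  interpret prob_space M by fact
  show "(\<lambda>k. measure M (sym_diff B (S k -` B \<inter> space M))) \<longlonglongrightarrow> 0"
    using assms(3,4) by (simp add: recurrent_along_def)
  show "\<forall>\<^sub>F k in sequentially. measure M (B - (S k -` B \<inter> space M)) \<le> measure M (sym_diff B (S k -` B \<inter> space M))"
    using assms(4) measurable_sets[OF assms(2) assms(4)]
    by (intro always_eventually allI finite_measure_mono) auto
qed simp

text \<open>Rigidity is stated with images under iterates and recurrence with preimages under group
  elements. Invariance of the measure converts one into the other: the intersection of
  \<open>B\<close> with its image misses from \<open>B\<close> as much mass as the intersection with
  its preimage does.\<close>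

lemma recurrent_rigid:
  assumes N: "prob_space N" and V: "mp_action N V"
    and n: "filterlim n at_top sequentially"
    and rec: "recurrent_along N (\<lambda>k. V (real (n k) *\<^sub>R g))"
  shows "rigid N (V g)"
  unfolding rigid_def
proof (intro exI[of _ n] conjI n ballI)
  interpret prob_space N by fact
  fix B assume B: "B \<in> sets N"
  let ?h = "\<lambda>k. real (n k) *\<^sub>R g"
  have sub: "B \<subseteq> space N" using sets.sets_into_space[OF B] .
  have m: "V h -` B \<inter> space N \<in> sets N" for h
    by (rule measurable_sets[OF mp_action_measurable[OF V] B])
  have "measure N (B \<inter> (V g ^^ n k) ` B) = measure N B - measure N (B - (V (?h k) -` B \<inter> space N))" for k
  proof -
    have im: "(V g ^^ n k) ` B = V (?h k) ` B"
      using sub mp_action_funpow[OF V] by (intro image_cong) auto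
    have pre: "V (?h k) -` (B \<inter> V (?h k) ` B) \<inter> space N = B \<inter> (V (?h k) -` B \<inter> space N)"
      using sub mp_action_inj[OF V, of "?h k"] by (auto dest: inj_onD)
    have "V (?h k) ` B = V (- ?h k) -` B \<inter> space N"
    proof (intro equalityI subsetI)
      fix x assume "x \<in> V (?h k) ` B"
      then show "x \<in> V (- ?h k) -` B \<inter> space N"
        using sub mp_action_minus(1)[OF V] mp_action_space[OF V] by auto
    next
      fix x assume "x \<in> V (- ?h k) -` B \<inter> space N"
      then show "x \<in> V (?h k) ` B"
        using mp_action_minus(2)[OF V, of x "?h k"] by (intro image_eqI[of _ _ "V (- ?h k) x"]) auto
    qed
    then have "B \<inter> V (?h k) ` B \<in> sets N" using B m by auto
    then have "measure N (B \<inter> V (?h k) ` B) = measure N (B \<inter> (V (?h k) -` B \<inter> space N))"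
      using mp_action_measure[OF V, of _ "?h k"] pre by metis
    also have "\<dots> = measure N B - measure N (B - (V (?h k) -` B \<inter> space N))"
      using finite_measure_Diff'[OF B m[of "?h k"]] by simp
    finally show ?thesis by (simp only: im)
  qed
  then have "(\<lambda>k. measure N (B \<inter> (V g ^^ n k) ` B)) =
      (\<lambda>k. measure N B - measure N (B - (V (?h k) -` B \<inter> space N)))" by (simp add: fun_eq_iff)
  also have "\<dots> \<longlonglongrightarrow> measure N B - 0"
    by (intro tendsto_intros recurrent_along_diff[OF N mp_action_measurable[OF V] rec B])
  finally show "(\<lambda>k. measure N (B \<inter> (V g ^^ n k) ` B)) \<longlonglongrightarrow> measure N B" by simp
qed

lemma mp_action_distr: "mp_action M T \<Longrightarrow> distr M M (T g) = M"
  by (simp add: mp_action_def)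

text \<open>A return time \<open>n k\<close> links each index to the one \<open>n k\<close> steps
  earlier; only the first \<open>n k\<close> indices start a chain, a vanishing proportion.\<close>

lemma recurrent_transformation_entropy:
  assumes N: "prob_space N" and V: "mp_action N V"
    and n: "\<And>k. 0 < n k"
    and rec: "recurrent_along N (\<lambda>k. V (real (n k) *\<^sub>R g))"
  shows "transformation_entropy N (V g) = 0"
  unfolding transformation_entropy_def
proof (rule prob_space.ks_entropy_eq_0[OF N])
  have eq: "(V g ^^ i) \<in> N \<rightarrow>\<^sub>M N \<and> distr N N (V g ^^ i) = N" for i
  proof -
    have "(V g ^^ i) \<in> N \<rightarrow>\<^sub>M N \<longleftrightarrow> V (real i *\<^sub>R g) \<in> N \<rightarrow>\<^sub>M N"
      by (rule measurable_cong) (rule mp_action_funpow[OF V])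
    moreover have "distr N N (V g ^^ i) = distr N N (V (real i *\<^sub>R g))"
      by (rule distr_cong) (auto intro: mp_action_funpow[OF V])
    ultimately show ?thesis using mp_action_measurable[OF V] mp_action_distr[OF V] by metis
  qed
  then show "(V g ^^ i) \<in> N \<rightarrow>\<^sub>M N" "distr N N (V g ^^ i) = N" for i by auto
  show "(V g ^^ i) y = (V g ^^ n k) ((V g ^^ (i - n k)) y)" if "i \<in> {n k..}" for i k y
    using that funpow_add[of "n k" "i - n k" "V g"] by simp
  show "real (i - n k) < real i" if "i \<in> {n k..}" for i k
    using that n[of k] by simp
  fix A assume A: "A \<in> sets N"
  have "(V g ^^ n k) -` A \<inter> space N = V (real (n k) *\<^sub>R g) -` A \<inter> space N" for k
    using mp_action_funpow[OF V] by auto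
  then show "(\<lambda>k. measure N (A - ((V g ^^ n k) -` A \<inter> space N))) \<longlonglongrightarrow> 0"
    using recurrent_along_diff[OF N mp_action_measurable[OF V] rec A] by simp
next
  fix k
  have "{i \<in> {..<m}. \<not> (i \<in> {n k..} \<and> i - n k \<in> {..<m})} \<subseteq> {..<n k}" for m by auto
  then have le: "card {i \<in> {..<m}. \<not> (i \<in> {n k..} \<and> i - n k \<in> {..<m})} \<le> n k" for m
    using card_mono[OF finite_lessThan] by fastforce
  show "(\<lambda>m. real (card {i \<in> {..<m}. \<not> (i \<in> {n k..} \<and> i - n k \<in> {..<m})}) / real (card {..<m})) \<longlonglongrightarrow> 0"
  proof (rule tendsto_sandwich[OF _ _ tendsto_const])
    show "(\<lambda>m. real (n k) / real m) \<longlonglongrightarrow> 0" by real_asymp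
    show "\<forall>\<^sub>F m in sequentially. real (card {i \<in> {..<m}. \<not> (i \<in> {n k..} \<and> i - n k \<in> {..<m})}) / real (card {..<m})
        \<le> real (n k) / real m"
      using le by (intro always_eventually allI) (auto intro!: divide_right_mono)
  qed simp
qed simp

definition int_box :: "nat \<Rightarrow> (real^'n) set" where
  "int_box n = {v. \<forall>i. v $ i \<in> real ` {..<n}}"

lemma int_box_eq: "int_box n = (\<lambda>f. \<chi> i. real (f i)) ` (PiE UNIV (\<lambda>_. {..<n}))"
proof (intro equalityI subsetI)
  fix v :: "real^'n" assume "v \<in> int_box n"
  then have "\<forall>i. \<exists>m. m < n \<and> v $ i = real m" by (auto simp: int_box_def)
  then obtain f where "\<And>i. f i < n \<and> v $ i = real (f i)" by metis
  then show "v \<in> (\<lambda>f. \<chi> i. real (f i)) ` (PiE UNIV (\<lambda>_. {..<n}))"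
    by (intro image_eqI[of _ _ f]) (auto simp: vec_eq_iff)
qed (auto simp: int_box_def PiE_def Pi_def)

lemma finite_int_box: "finite (int_box n :: (real^'n) set)"
  unfolding int_box_eq by (intro finite_imageI finite_PiE) auto

lemma card_int_box: "card (int_box n :: (real^'n) set) = n ^ CARD('n)"
proof -
  have "inj_on (\<lambda>f. (\<chi> i. real (f i)) :: real^'n) (PiE UNIV (\<lambda>_. {..<n}))"
    by (auto simp: inj_on_def vec_eq_iff)
  then show ?thesis
    unfolding int_box_eq by (simp add: card_image card_PiE)
qed

text \<open>The box \<open>int_box (n - m)\<close>, moved by the positive part of \<open>h\<close>,
  lies both in the large box and in its translate by \<open>h\<close>.\<close>

lemma card_int_box_shift:
  fixes h :: "real^'n"
  assumes "\<And>i. h $ i \<in> \<int>" "\<And>i. \<bar>h $ i\<bar> \<le> real m" "m \<le> n"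
  shows "card {v \<in> int_box n. v - h \<notin> int_box n} \<le> n ^ CARD('n) - (n - m) ^ CARD('n)"
proof -
  define c where "c = (\<chi> i. max (h $ i) 0)"
  have hz: "\<exists>z::int. h $ i = of_int z \<and> \<bar>z\<bar> \<le> int m" for i
  proof -
    obtain z where z: "h $ i = of_int z" using assms(1)[of i] by (auto elim: Ints_cases)
    have "\<bar>of_int z :: real\<bar> \<le> real m" using assms(2)[of i] z by simp
    then have "\<bar>z\<bar> \<le> int m" by linarith
    with z show ?thesis by blast
  qed
  have sub: "(\<lambda>w. w + c) ` int_box (n - m) \<subseteq> {v \<in> int_box n. v - h \<in> int_box n}"
  proof clarify
    fix w :: "real^'n" assume w: "w \<in> int_box (n - m)"
    have "(w + c) $ i \<in> real ` {..<n} \<and> (w + c - h) $ i \<in> real ` {..<n}" for i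
    proof -
      obtain k where k: "w $ i = real k" "k < n - m" using w by (auto simp: int_box_def)
      obtain z where z: "h $ i = of_int z" "\<bar>z\<bar> \<le> int m" using hz by blast
      have e: "(w + c) $ i = real (k + nat (max z 0))" "(w + c - h) $ i = real (k + nat (max (- z) 0))"
        using k z by (auto simp: c_def max_def)
      have "k + nat (max z 0) < n" "k + nat (max (- z) 0) < n"
        using k z assms(3) by linarith+
      then show ?thesis unfolding e by (intro conjI imageI) simp_all
    qed
    then show "w + c \<in> int_box n \<and> w + c - h \<in> int_box n" by (auto simp: int_box_def)
  qed
  have "(n - m) ^ CARD('n) = card ((\<lambda>w. w + c) ` (int_box (n - m)))"
    by (subst card_image) (auto simp: inj_on_def card_int_box)
  also have "\<dots> \<le> card {v \<in> int_box n. v - h \<in> int_box n}"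
    by (rule card_mono[OF _ sub]) (simp add: finite_int_box)
  finally have 1: "(n - m) ^ CARD('n) \<le> card {v \<in> int_box n. v - h \<in> int_box n}" .
  have "card (int_box n :: (real^'n) set) = card {v \<in> int_box n. v - h \<in> int_box n} + card {v \<in> int_box n. v - h \<notin> int_box n}"
    using finite_int_box[of n, where ?'n = 'n]
    by (subst card_Un_disjoint[symmetric]) (auto intro!: arg_cong[where f = card])
  then show ?thesis using 1 by (simp add: card_int_box)
qed

text \<open>The predecessor of \<open>v\<close> is \<open>v - h k\<close>, and the inner product
  with \<open>h k\<close> strictly decreases in this step. Chains start at the box points whose
  predecessor is outside the box, a boundary layer of vanishing proportion.\<close>

lemma recurrent_action_entropy:
  fixes V :: "real^'n \<Rightarrow> 'a \<Rightarrow> 'a" and h :: "nat \<Rightarrow> real^'n"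
  assumes N: "prob_space N" and V: "mp_action N V"
    and h: "\<And>k i. h k $ i \<in> \<int>" "\<And>k. h k \<noteq> 0"
    and rec: "recurrent_along N (\<lambda>k. V (h k))"
  shows "action_entropy N V = 0"
  unfolding action_entropy_def int_box_def[symmetric]
proof (rule prob_space.ks_entropy_eq_0[OF N, where B = "\<lambda>k. UNIV" and rank = "\<lambda>k v. v \<bullet> h k" and p = "\<lambda>k v. v - h k" and h = h])
  show "V g \<in> N \<rightarrow>\<^sub>M N" "distr N N (V g) = N" for g
    using mp_action_measurable[OF V] mp_action_distr[OF V] by auto
  show "V g y = V (h k) (V (g - h k) y)" if "y \<in> space N" for g k y
    using mp_action_add[OF V that, of "h k" "g - h k"] by simp
  show "(v - h k) \<bullet> h k < v \<bullet> h k" for k v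
    using h(2)[of k] by (simp add: inner_diff_left)
  show "(\<lambda>k. measure N (A - (V (h k) -` A \<inter> space N))) \<longlonglongrightarrow> 0" if "A \<in> sets N" for A
    by (rule recurrent_along_diff[OF N mp_action_measurable[OF V] rec that])
next
  fix k
  let ?d = "CARD('n)"
  define m where "m = nat \<lceil>norm (h k)\<rceil>"
  have hm: "\<bar>h k $ i\<bar> \<le> real m" for i
  proof -
    have "\<bar>h k $ i\<bar> \<le> norm (h k)" by (rule component_le_norm_cart)
    also have "\<dots> \<le> real m" unfolding m_def by linarith
    finally show ?thesis .
  qed
  show "(\<lambda>n. real (card {v \<in> int_box n. \<not> (v \<in> UNIV \<and> v - h k \<in> int_box n)}) / real (card (int_box n :: (real^'n) set))) \<longlonglongrightarrow> 0"
  proof (rule tendsto_sandwich[OF _ _ tendsto_const])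
    have "(\<lambda>n. real m / real n) \<longlonglongrightarrow> 0" by real_asymp
    then have "(\<lambda>n. 1 - (1 - real m / real n) ^ ?d) \<longlonglongrightarrow> 1 - (1 - 0) ^ ?d"
      by (intro tendsto_intros)
    then show "(\<lambda>n. 1 - (1 - real m / real n) ^ ?d) \<longlonglongrightarrow> 0" by simp
    have "real (card {v \<in> int_box n. v - h k \<notin> int_box n}) / real (card (int_box n :: (real^'n) set)) \<le> 1 - (1 - real m / real n) ^ ?d"
      if n: "m < n" for n
    proof -
      have "real (card {v \<in> int_box n. v - h k \<notin> int_box n}) \<le> real (n ^ ?d - (n - m) ^ ?d)"
        unfolding of_nat_le_iff using h(1)[of k] hm n by (intro card_int_box_shift) simp_all
      also have "\<dots> = real n ^ ?d - (real n - real m) ^ ?d"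
        using n by (subst of_nat_diff) (auto intro!: power_mono)
      finally have "real (card {v \<in> int_box n. v - h k \<notin> int_box n}) / real n ^ ?d \<le> (real n ^ ?d - (real n - real m) ^ ?d) / real n ^ ?d"
        by (rule divide_right_mono) simp
      also have "\<dots> = 1 - ((real n - real m) / real n) ^ ?d"
        using n unfolding power_divide by (simp add: diff_divide_distrib)
      also have "(real n - real m) / real n = 1 - real m / real n"
        using n by (simp add: diff_divide_distrib)
      finally show ?thesis by (simp add: card_int_box)
    qed
    then show "\<forall>\<^sub>F n in sequentially. real (card {v \<in> int_box n. \<not> (v \<in> UNIV \<and> v - h k \<in> int_box n)}) / real (card (int_box n :: (real^'n) set))
        \<le> 1 - (1 - real m / real n) ^ ?d"
      by (intro eventually_mono[OF eventually_gt_at_top[of m]]) simp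
  qed simp
qed (rule finite_int_box)

text \<open>The sets with this property for all \<open>K\<close> form a sigma-algebra. For a union,
  the tail \<open>R n\<close> is small in two consecutive windows, and \<open>dom\<close> bounds its
  preimage in one window by the tail in the next, uniformly in \<open>k\<close>. The windows stand
  in for finiteness of the whole measure.\<close>

lemma measure_symdiff_tendsto_0:
  fixes S :: "nat \<Rightarrow> 'a \<Rightarrow> 'a" and X :: "nat \<Rightarrow> 'a set"
  assumes S: "\<And>k. S k \<in> M \<rightarrow>\<^sub>M M"
    and X: "\<And>K. X K \<in> sets M" "\<And>K. emeasure M (X K) < \<infinity>"
    and dom: "\<And>k K A. A \<in> sets M \<Longrightarrow> measure M (S k -` A \<inter> X K) \<le> measure M (A \<inter> X (Suc K))"
    and G: "sets M = sigma_sets (space M) G"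
    and base: "\<And>A K. A \<in> G \<Longrightarrow> (\<lambda>k. measure M (sym_diff A (S k -` A \<inter> space M) \<inter> X K)) \<longlonglongrightarrow> 0"
    and A: "A \<in> sets M"
  shows "(\<lambda>k. measure M (sym_diff A (S k -` A \<inter> space M) \<inter> X K)) \<longlonglongrightarrow> 0"
proof -
  have Xs: "X K \<subseteq> space M" for K using sets.sets_into_space[OF X(1)] .
  have fin: "B \<inter> X K \<in> fmeasurable M" if "B \<in> sets M" for B K
  proof (rule fmeasurableI2[of "X K"])
    show "X K \<in> fmeasurable M" using X by (simp add: fmeasurable_def)
  qed (use that X in auto)
  have pre: "S k -` B \<inter> space M \<in> sets M" if "B \<in> sets M" for B k
    by (rule measurable_sets[OF S that])
  have "A \<in> sigma_sets (space M) G" using A G by simp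
  then have "\<forall>K. (\<lambda>k. measure M (sym_diff A (S k -` A \<inter> space M) \<inter> X K)) \<longlonglongrightarrow> 0"
  proof induction
    case (Basic A)
    then show ?case using base by blast
  next
    case Empty
    then show ?case by simp
  next
    case (Compl A)
    then have "A \<subseteq> space M" using G sets.sets_into_space by metis
    then have "sym_diff (space M - A) (S k -` (space M - A) \<inter> space M) = sym_diff A (S k -` A \<inter> space M)" for k
      using measurable_space[OF S[of k]] by auto
    then show ?case using Compl by simp
  next
    case (Union B)
    have B: "B i \<in> sets M" for i using Union(1) G by simp
    define U where "U = (\<Union>i. B i)"
    define R where "R n = U - (\<Union>i<n. B i)" for n
    have U: "U \<in> sets M" and R: "R n \<in> sets M" for n using B by (auto simp: U_def R_def)
    show ?case
    proof
      fix K
      show "(\<lambda>k. measure M (sym_diff (\<Union>i. B i) (S k -` (\<Union>i. B i) \<inter> space M) \<inter> X K)) \<longlonglongrightarrow> 0"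
        unfolding U_def[symmetric]
      proof (rule tendstoI)
        fix e :: real assume e: "0 < e"
        have lim: "(\<lambda>n. measure M (R n \<inter> X L)) \<longlonglongrightarrow> 0" for L
        proof -
          have "(\<lambda>n. measure M (R n \<inter> X L)) \<longlonglongrightarrow> measure M (\<Inter>n. R n \<inter> X L)"
            using R fin[OF R] X
            by (intro Lim_measure_decseq) (auto simp: decseq_def R_def fmeasurable_def less_top)
          also have "(\<Inter>n. R n \<inter> X L) = {}" by (auto simp: R_def U_def)
          finally show ?thesis by simp
        qed
        have "\<forall>\<^sub>F n in sequentially. measure M (R n \<inter> X K) < e / 3 \<and> measure M (R n \<inter> X (Suc K)) < e / 3"
          using e by (intro eventually_conj order_tendstoD(2)[OF lim]) auto
        then obtain n where n: "measure M (R n \<inter> X K) < e / 3" "measure M (R n \<inter> X (Suc K)) < e / 3"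
          by (auto simp: eventually_sequentially)
        let ?D = "\<lambda>i k. sym_diff (B i) (S k -` B i \<inter> space M) \<inter> X K"
        have "(\<lambda>k. \<Sum>i<n. measure M (?D i k)) \<longlonglongrightarrow> 0"
          using Union.IH tendsto_sum[of "{..<n}" "\<lambda>i k. measure M (?D i k)" "\<lambda>_. 0"] by simp
        then have "\<forall>\<^sub>F k in sequentially. (\<Sum>i<n. measure M (?D i k)) < e / 3"
          using e by (intro order_tendstoD(2)) auto
        then show "\<forall>\<^sub>F k in sequentially. dist (measure M (sym_diff U (S k -` U \<inter> space M) \<inter> X K)) 0 < e"
        proof eventually_elim
          case (elim k)
          have D: "?D i k \<in> fmeasurable M" for i using B pre by (intro fin) auto
          have RK: "R n \<inter> X K \<in> fmeasurable M" "S k -` R n \<inter> space M \<inter> X K \<in> fmeasurable M"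
            using R pre by (auto intro!: fin)
          have UD: "(\<Union>i<n. ?D i k) \<in> fmeasurable M" using D by (intro fmeasurable.finite_UN) auto
          have "sym_diff U (S k -` U \<inter> space M) \<inter> X K \<subseteq>
            (\<Union>i<n. ?D i k) \<union> ((R n \<inter> X K) \<union> (S k -` R n \<inter> space M \<inter> X K))"
            using Xs unfolding R_def U_def by blast
          then have "measure M (sym_diff U (S k -` U \<inter> space M) \<inter> X K) \<le>
            measure M ((\<Union>i<n. ?D i k) \<union> ((R n \<inter> X K) \<union> (S k -` R n \<inter> space M \<inter> X K)))"
            using U pre RK UD X by (intro measure_mono_fmeasurable) auto
          also have "\<dots> \<le> measure M (\<Union>i<n. ?D i k) + measure M ((R n \<inter> X K) \<union> (S k -` R n \<inter> space M \<inter> X K))"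
            using UD RK by (intro measure_Un_le) auto
          also have "\<dots> \<le> (\<Sum>i<n. measure M (?D i k)) + (measure M (R n \<inter> X K) + measure M (S k -` R n \<inter> space M \<inter> X K))"
            using D RK by (intro add_mono measure_UNION_le measure_Un_le) auto
          also have "measure M (S k -` R n \<inter> space M \<inter> X K) \<le> measure M (R n \<inter> X (Suc K))"
          proof -
            have "S k -` R n \<inter> space M \<inter> X K = S k -` R n \<inter> X K" using Xs by auto
            then show ?thesis using dom[OF R[of n], of k K] by simp
          qed
          finally show ?case using n elim by (simp add: dist_real_def)
        qed
      qed
    qed
  qed
  then show ?thesis by blast
qed

section \<open>Suspended actions\<close>

text \<open>\<open>T_X\<close> keeps bounded sets bounded, so that the image of every locally finite
  set, not only of almost every one, is locally finite.\<close>

locale bounded_action = bounded_space M X for M X +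
  fixes T :: "real^'n \<Rightarrow> real \<Rightarrow> real"
  assumes act: "mp_action M T"
    and T_X: "\<exists>L. T g ` X K \<subseteq> X L"
begin

lemma T_space: "x \<in> space M \<Longrightarrow> T g x \<in> space M"
  by (rule mp_action_space[OF act])

lemma T_minus: "x \<in> space M \<Longrightarrow> T (- g) (T g x) = x" "x \<in> space M \<Longrightarrow> T g (T (- g) x) = x"
  using mp_action_minus[OF act] by auto

lemma locfin_image: "c \<in> locfin \<Longrightarrow> T g ` c \<in> locfin"
proof -
  assume c: "c \<in> locfin"
  have sub: "c \<subseteq> space M" using c by (simp add: locfin_def)
  have "finite (T g ` c \<inter> X K)" for K
  proof -
    obtain L where L: "T (- g) ` X K \<subseteq> X L" using T_X by blast
    have "T g ` c \<inter> X K \<subseteq> T g ` (c \<inter> X L)"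
    proof
      fix y assume "y \<in> T g ` c \<inter> X K"
      then obtain x where x: "x \<in> c" "y = T g x" "y \<in> X K" by auto
      then have "x = T (- g) y" using T_minus(1)[of x g] sub by auto
      then show "y \<in> T g ` (c \<inter> X L)" using x L by auto
    qed
    moreover have "finite (c \<inter> X L)" using c by (simp add: locfin_def)
    ultimately show ?thesis by (meson finite_imageI finite_subset)
  qed
  then show ?thesis using sub T_space by (auto simp: locfin_def)
qed

lemma bdd_vimage: "bdd A \<Longrightarrow> bdd (T g -` A \<inter> space M)"
proof -
  assume A: "bdd A"
  then obtain K where K: "A \<subseteq> X K" by (auto simp: bdd_def)
  obtain L where L: "T (- g) ` X K \<subseteq> X L" using T_X by blast
  have "T g -` A \<inter> space M \<subseteq> X L"
  proof
    fix x assume x: "x \<in> T g -` A \<inter> space M"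
    then have "T (- g) (T g x) \<in> X L" using K L by auto
    then show "x \<in> X L" using T_minus(1)[of x g] x by simp
  qed
  then show ?thesis
    using measurable_sets[OF mp_action_measurable[OF act] bdd_sets[OF A]] by (auto simp: bdd_def)
qed

lemma image_Int_empty_iff:
  "c \<subseteq> space M \<Longrightarrow> T g ` c \<inter> A = {} \<longleftrightarrow> c \<inter> (T g -` A \<inter> space M) = {}"
  by auto

lemma image_void: "{c \<in> locfin. T g ` c \<inter> A = {}} = void (T g -` A \<inter> space M)"
  unfolding void_def by (rule Collect_cong) (auto simp: locfin_def)

lemma measure_vimage: "bdd A \<Longrightarrow> measure M (T g -` A \<inter> space M) = measure M A"
  by (rule mp_action_measure[OF act bdd_sets])

end

section \<open>The suspended action on locally finite sets\<close>

locale poisson_suspension = bounded_action M X T for M X and T :: "real^'n \<Rightarrow> real \<Rightarrow> real" +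
  fixes P :: "real set measure"
  assumes P: "poisson_law P"
begin

sublocale prob_space P using P by (simp add: poisson_law_def)

lemma sets_P: "sets P = sets point_sets"
  using P by (simp add: poisson_law_def)

lemma space_P: "space P = locfin"
  using sets_eq_imp_space_eq[OF sets_P] by (simp add: space_point_sets)

lemma prob_void: "bdd A \<Longrightarrow> prob (void A) = exp (- measure M A)"
  using P by (simp add: poisson_law_def)

definition act_sets :: "real^'n \<Rightarrow> real set \<Rightarrow> real set" where
  "act_sets g c = T g ` c"

text \<open>Joint measurability comes from the enumeration: the image of a set misses
  \<open>A\<close> iff the image of each of its countably many listed points does, and each of these
  conditions is jointly measurable.\<close>

lemma act_sets_measurable_pair: "(\<lambda>(g, c). act_sets g c) \<in> borel \<Otimes>\<^sub>M P \<rightarrow>\<^sub>M P"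
  unfolding measurable_cong_sets[OF refl sets_P]
proof (rule measurable_point_setsI)
  let ?N = "borel \<Otimes>\<^sub>M P :: ((real^'n) \<times> real set) measure"
  fix q assume "q \<in> space ?N"
  then show "(case q of (g, c) \<Rightarrow> act_sets g c) \<in> locfin"
    using locfin_image by (auto simp: space_pair_measure space_P act_sets_def)
next
  let ?N = "borel \<Otimes>\<^sub>M P :: ((real^'n) \<times> real set) measure"
  fix A assume A: "bdd A"
  show "{q \<in> space ?N. (case q of (g, c) \<Rightarrow> act_sets g c) \<inter> A = {}} \<in> sets ?N"
  proof (cases "space M = {}")
    case True
    have "{q \<in> space ?N. (case q of (g, c) \<Rightarrow> act_sets g c) \<inter> A = {}} = space ?N"
      using True by (auto simp: space_pair_measure space_P locfin_def act_sets_def)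
    then show ?thesis by simp
  next
    case False
    then obtain x0 where x0: "x0 \<in> space M" by blast
    \<comment> \<open>\<open>x0\<close> replaces the default value 0 of \<open>pt\<close>, which
      need not lie in \<open>space M\<close>.\<close>
    define pt' where "pt' j k c = (if k < cnt j c then pt j k c else x0)" for j k c
    have pt': "pt j k c \<in> space M" if "c \<in> locfin" "k < cnt j c" for j k c
      using Int_shell_eq_pt[OF that(1), of j] that by (auto simp: locfin_def)
    have [measurable]: "cnt j \<in> P \<rightarrow>\<^sub>M count_space UNIV" "pt j k \<in> borel_measurable P" for j k
      unfolding measurable_cong_sets[OF sets_P refl] by (rule cnt_measurable pt_measurable)+
    have pm: "pt' j k \<in> P \<rightarrow>\<^sub>M M" for j k
      unfolding measurable_cong_sets[OF refl sets_M]
    proof (rule measurable_restrict_space2)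
      show "pt' j k \<in> space P \<rightarrow> space M" using pt' x0 by (auto simp: pt'_def space_P)
      show "pt' j k \<in> borel_measurable P" unfolding pt'_def by measurable
    qed
    have [measurable]: "(\<lambda>(g, x). T g x) \<in> borel \<Otimes>\<^sub>M M \<rightarrow>\<^sub>M M"
      using act by (simp add: mp_action_def)
    have [measurable]: "(\<lambda>q. T (fst q) (pt' j k (snd q))) \<in> ?N \<rightarrow>\<^sub>M M" for j k
    proof -
      note [measurable] = pm
      have "(\<lambda>q. case (fst q, pt' j k (snd q)) of (g, x) \<Rightarrow> T g x) \<in> ?N \<rightarrow>\<^sub>M M" by measurable
      then show ?thesis by simp
    qed
    have [measurable]: "A \<in> sets M" by (rule bdd_sets[OF A])
    have "{q \<in> space ?N. (case q of (g, c) \<Rightarrow> act_sets g c) \<inter> A = {}} =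
      {q \<in> space ?N. \<forall>j k. k < cnt j (snd q) \<longrightarrow> T (fst q) (pt' j k (snd q)) \<notin> A}"
    proof (rule Collect_cong, rule conj_cong[OF refl])
      fix q assume "q \<in> space ?N"
      then have "snd q \<in> locfin" by (auto simp: space_pair_measure space_P)
      note eq_pt[OF this]
      from arg_cong[OF this, of "\<lambda>c. T (fst q) ` c"]
      have "T (fst q) ` snd q = (\<Union>j. (\<lambda>k. T (fst q) (pt j k (snd q))) ` {..<cnt j (snd q)})"
        unfolding image_UN image_image .
      then show "(case q of (g, c) \<Rightarrow> act_sets g c) \<inter> A = {} \<longleftrightarrow>
          (\<forall>j k. k < cnt j (snd q) \<longrightarrow> T (fst q) (pt' j k (snd q)) \<notin> A)"
        by (auto simp: act_sets_def pt'_def case_prod_beta)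
    qed
    also have "\<dots> \<in> sets ?N" by measurable
    finally show ?thesis .
  qed
qed

text \<open>Void events pull back to void events of sets of the same measure, so the image law has
  the void probabilities of \<open>P\<close>, and uniqueness of the Poisson law gives
  invariance.\<close>

lemma mp_action_act_sets: "mp_action P act_sets"
proof -
  have Sg: "act_sets g \<in> P \<rightarrow>\<^sub>M P" for g
  proof -
    note [measurable] = act_sets_measurable_pair
    have "(\<lambda>c. case (g, c) of (g, c) \<Rightarrow> act_sets g c) \<in> P \<rightarrow>\<^sub>M P" by measurable
    then show ?thesis by simp
  qed
  have "distr P P (act_sets g) = P" for g
  proof (rule poisson_law_unique[OF _ P])
    show "poisson_law (distr P P (act_sets g))"
      unfolding poisson_law_def
    proof (intro conjI allI impI)
      show "prob_space (distr P P (act_sets g))" by (rule prob_space_distr[OF Sg])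
      fix A assume A: "bdd A"
      have "measure (distr P P (act_sets g)) (void A) = prob (act_sets g -` void A \<inter> space P)"
        using void_sets[OF A] by (intro measure_distr[OF Sg]) (simp add: sets_P)
      also have "act_sets g -` void A \<inter> space P = void (T g -` A \<inter> space M)"
        unfolding image_void[symmetric] using locfin_image by (auto simp: act_sets_def void_def space_P)
      also have "prob \<dots> = exp (- measure M A)"
        using prob_void[OF bdd_vimage[OF A]] measure_vimage[OF A] by simp
      finally show "measure (distr P P (act_sets g)) (void A) = exp (- measure M A)" .
    qed (simp add: sets_P)
  qed
  moreover have "act_sets 0 c = c" if "c \<in> locfin" for c
  proof -
    have "T 0 ` c = (\<lambda>x. x) ` c"
      using act that by (intro image_cong refl) (auto simp: mp_action_def locfin_def)
    then show ?thesis by (simp add: act_sets_def)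
  qed
  moreover have "act_sets (g + h) c = act_sets g (act_sets h c)" if "c \<in> locfin" for g h c
    unfolding act_sets_def image_image
  proof (rule image_cong[OF refl])
    fix x assume "x \<in> c"
    then show "T (g + h) x = T g (T h x)"
      using that by (intro mp_action_add[OF act]) (auto simp: locfin_def)
  qed
  ultimately show ?thesis
    using act_sets_measurable_pair by (simp add: mp_action_def space_P)
qed

text \<open>The void events of \<open>A\<close> and of its preimage differ only on configurations
  that hit the symmetric difference, an event of probability \<open>1 - exp (- m)\<close> with
  \<open>m\<close> its measure. Convergence then passes from these generators to all events.\<close>

lemma recurrent_act_sets:
  assumes h: "\<And>A. bdd A \<Longrightarrow> (\<lambda>k. measure M (sym_diff A (T (h k) -` A \<inter> space M))) \<longlonglongrightarrow> 0"
  shows "recurrent_along P (\<lambda>k. act_sets (h k))"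
  unfolding recurrent_along_def
proof
  note Sg = mp_action_measurable[OF mp_action_act_sets]
  fix B assume B: "B \<in> sets P"
  have "(\<lambda>k. prob (sym_diff B (act_sets (h k) -` B \<inter> space P) \<inter> space P)) \<longlonglongrightarrow> 0"
  proof (rule measure_symdiff_tendsto_0[where X = "\<lambda>_. space P" and G = "voids (space M)"])
    show "sets P = sigma_sets (space P) (voids (space M))"
      by (simp add: sets_P sets_point_sets space_P)
    show "prob (act_sets (h k) -` E \<inter> space P) \<le> prob (E \<inter> space P)" if "E \<in> events" for k E
      using mp_action_measure[OF mp_action_act_sets that] sets.sets_into_space[OF that] by (simp add: Int_absorb2)
    fix E assume "E \<in> voids (space M)"
    then obtain A where A: "bdd A" "E = void A" by (auto simp: voids_def)
    let ?D = "\<lambda>k. sym_diff A (T (h k) -` A \<inter> space M)"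
    have bD: "bdd (?D k)" for k
      using bdd_Un[OF A(1) bdd_vimage[OF A(1), of "h k"]] bdd_sets[OF A(1)] bdd_sets[OF bdd_vimage[OF A(1), of "h k"]]
      by (elim bdd_subset) auto
    have "act_sets (h k) -` E \<inter> space P = void (T (h k) -` A \<inter> space M)" for k
      unfolding image_void[symmetric] A(2) using locfin_image by (auto simp: act_sets_def void_def space_P)
    then have "sym_diff E (act_sets (h k) -` E \<inter> space P) \<inter> space P \<subseteq> space P - void (?D k)" for k
      unfolding A(2) by (auto simp: void_def space_P)
    then have le: "prob (sym_diff E (act_sets (h k) -` E \<inter> space P) \<inter> space P) \<le> 1 - exp (- measure M (?D k))" for k
    proof -
      assume sub: "\<And>k. sym_diff E (act_sets (h k) -` E \<inter> space P) \<inter> space P \<subseteq> space P - void (?D k)"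
      have "void (?D k) \<in> events" using void_sets[OF bD[of k]] by (simp add: sets_P)
      then have "prob (space P - void (?D k)) = 1 - exp (- measure M (?D k))" "space P - void (?D k) \<in> events"
        using prob_compl prob_void[OF bD[of k]] by auto
      then show ?thesis using finite_measure_mono[OF sub[of k]] by simp
    qed
    have "(\<lambda>k. 1 - exp (- measure M (?D k))) \<longlonglongrightarrow> 1 - exp (- 0)"
      by (intro tendsto_intros h A(1))
    then have lim: "(\<lambda>k. 1 - exp (- measure M (?D k))) \<longlonglongrightarrow> 0" by simp
    show "(\<lambda>k. prob (sym_diff E (act_sets (h k) -` E \<inter> space P) \<inter> space P)) \<longlonglongrightarrow> 0"
      by (rule tendsto_sandwich[OF _ _ tendsto_const lim]) (use le in \<open>auto intro!: always_eventually\<close>)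
  qed (use Sg B in \<open>auto simp: emeasure_space_1\<close>)
  then show "(\<lambda>k. prob (sym_diff B (act_sets (h k) -` B \<inter> space P))) \<longlonglongrightarrow> 0"
  proof -
    assume *: "(\<lambda>k. prob (sym_diff B (act_sets (h k) -` B \<inter> space P) \<inter> space P)) \<longlonglongrightarrow> 0"
    have "sym_diff B (act_sets (h k) -` B \<inter> space P) \<inter> space P = sym_diff B (act_sets (h k) -` B \<inter> space P)" for k
      using sets.sets_into_space[OF B] by blast
    with * show ?thesis by (simp only:)
  qed
qed

text \<open>Missing or hitting pairwise disjoint sets of measure \<open>l\<close> are independent
  alternatives, with probabilities \<open>exp (- l)\<close> and
  \<open>1 - exp (- l)\<close>.\<close>

lemma prob_pattern_le:
  assumes E: "\<And>i. i \<in> I \<Longrightarrow> bdd (E i)" "\<And>i. i \<in> I \<Longrightarrow> measure M (E i) = l" "disjoint_family_on E I"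
    and I: "finite I"
  shows "prob {c \<in> locfin. \<forall>i\<in>I. (c \<inter> E i = {}) \<longleftrightarrow> b i} \<le> max (exp (- l)) (1 - exp (- l)) ^ card I"
proof (cases "I = {}")
  case False
  have ind: "indep_sets (\<lambda>i. sigma_sets locfin (voids (E i))) I"
    using E bdd_sets by (intro poisson_law_indep[OF P]) auto
  define Y where "Y i = (if b i then void (E i) else locfin - void (E i))" for i
  have vs: "void (E i) \<in> sigma_sets locfin (voids (E i))" if "i \<in> I" for i
    using E(1)[OF that] by (intro sigma_sets.Basic) (auto simp: voids_def)
  have Y: "Y i \<in> sigma_sets locfin (voids (E i))" if "i \<in> I" for i
    using vs[OF that] by (auto simp: Y_def intro: sigma_sets.Compl)
  have "{c \<in> locfin. \<forall>i\<in>I. (c \<inter> E i = {}) \<longleftrightarrow> b i} = (\<Inter>i\<in>I. Y i)"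
  proof (intro equalityI subsetI)
    fix c assume c: "c \<in> (\<Inter>i\<in>I. Y i)"
    have "c \<in> locfin \<and> ((c \<inter> E i = {}) \<longleftrightarrow> b i)" if "i \<in> I" for i
      using INT_D[OF c that] by (cases "b i") (auto simp: Y_def void_def)
    then show "c \<in> {c \<in> locfin. \<forall>i\<in>I. (c \<inter> E i = {}) \<longleftrightarrow> b i}" using False by blast
  qed (auto simp: Y_def void_def)
  then have "prob {c \<in> locfin. \<forall>i\<in>I. (c \<inter> E i = {}) \<longleftrightarrow> b i} = (\<Prod>i\<in>I. prob (Y i))"
    using indep_setsD[OF ind subset_refl False I] Y by simp
  also have "\<dots> \<le> (\<Prod>i\<in>I. max (exp (- l)) (1 - exp (- l)))"
  proof (rule prod_mono)
    fix i assume i: "i \<in> I"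
    have "prob (Y i) = (if b i then exp (- l) else 1 - exp (- l))"
      using prob_void[OF E(1)[OF i]] E(2)[OF i] prob_compl[of "void (E i)"] void_sets[OF E(1)[OF i]]
      by (simp add: Y_def space_P sets_P)
    then have "prob (Y i) \<le> max (exp (- l)) (1 - exp (- l))" by simp
    then show "0 \<le> prob (Y i) \<and> prob (Y i) \<le> max (exp (- l)) (1 - exp (- l))"
      by (intro conjI measure_nonneg)
  qed
  finally show ?thesis by simp
qed simp

end

locale coded_suspension = poisson_suspension M X T P + real_coding P f w
  for M X and T :: "real^'n \<Rightarrow> real \<Rightarrow> real" and P f w
begin

definition V :: "real^'n \<Rightarrow> real \<Rightarrow> real" where
  "V g r = f (act_sets g (w r))"

lemma mp_action_V: "mp_action copy V"
  unfolding V_def[abs_def] by (rule mp_action_copy[OF mp_action_act_sets])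

lemma prob_space_N: "prob_space copy"
  by (rule prob_space_copy) unfold_locales

lemma poisson_action_V:
  assumes "nonatomic M" "emeasure M (space M) = \<infinity>"
  shows "poisson_action copy V"
  unfolding poisson_action_def
proof (intro conjI exI[of _ M] exI[of _ T] exI[of _ "distr P (configuration_algebra M) (cfg M)"])
  show "sigma_finite_measure M"
    using X_fin X_UN X_sets by unfold_locales (auto intro!: exI[of _ "range X"] simp: less_top[symmetric])
  show "standard_borel M"
    by (rule standard_borel_subset_real[OF space_borel sets_M])
  show "isomorphic_systems copy V (distr P (configuration_algebra M) (cfg M)) (\<lambda>g. suspended_transformation M (T g))"
    unfolding V_def[abs_def] act_sets_def
    by (rule isomorphic_cfg[OF P real_coding_axioms mp_action_measurable[OF act] mp_action_inj[OF act] locfin_image])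
qed (use assms standard_borel_copy prob_space_N mp_action_V act poisson_measure_cfg[OF P] in auto)

lemma measure_copy: "A \<in> sets copy \<Longrightarrow> measure copy A = prob (f -` A \<inter> space P)"
  by (simp add: measure_def emeasure_copy)

lemma w_V: "w (V g r) = act_sets g (w r)"
  unfolding V_def using w_f mp_action_space[OF mp_action_act_sets w_space] by blast

lemma recurrent_V:
  assumes "\<And>A. bdd A \<Longrightarrow> (\<lambda>k. measure M (sym_diff A (T (h k) -` A \<inter> space M))) \<longlonglongrightarrow> 0"
  shows "recurrent_along copy (\<lambda>k. V (h k))"
  unfolding recurrent_along_def
proof
  fix B assume B: "B \<in> sets copy"
  let ?B = "f -` B \<inter> space P"
  have fB: "?B \<in> sets P" by (rule measurable_sets[OF f_copy B])
  have "measure copy (sym_diff B (V (h k) -` B \<inter> space copy)) = prob (sym_diff ?B (act_sets (h k) -` ?B \<inter> space P))" for k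
  proof -
    have "V (h k) -` B \<inter> space copy \<in> sets copy"
      by (rule measurable_sets[OF mp_action_measurable[OF mp_action_V] B])
    then have "measure copy (sym_diff B (V (h k) -` B \<inter> space copy)) =
        prob (f -` (sym_diff B (V (h k) -` B \<inter> space copy)) \<inter> space P)"
      using B by (intro measure_copy) auto
    also have "f -` (sym_diff B (V (h k) -` B \<inter> space copy)) \<inter> space P = sym_diff ?B (act_sets (h k) -` ?B \<inter> space P)"
      using f_codes mp_action_space[OF mp_action_act_sets] by (auto simp: V_def w_f space_copy)
    finally show ?thesis .
  qed
  then show "(\<lambda>k. measure copy (sym_diff B (V (h k) -` B \<inter> space copy))) \<longlonglongrightarrow> 0"
    using recurrent_act_sets[OF assms] fB unfolding recurrent_along_def by (simp only:)
qed

text \<open>The partition recording which of the first \<open>m\<close> sets \<open>E j\<close> are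
  hit has, after \<open>n\<close> steps, atoms that prescribe \<open>n * m\<close> independent
  alternatives, hence of probability at most \<open>(q ^ m) ^ n\<close>. As \<open>m\<close> is
  free, the entropy exceeds every bound.\<close>

lemma transformation_entropy_V_infinite:
  assumes E: "\<And>j. bdd (E j)" "\<And>j. measure M (E j) = l" "0 < l"
    and disj: "disjoint_family (\<lambda>(i :: nat, j :: nat). T (real i *\<^sub>R g) -` E j \<inter> space M)"
  shows "transformation_entropy copy (V g) = \<infinity>"
proof (rule prob_space.transformation_entropy_infinite[OF prob_space_N])
  have eq: "(V g ^^ i) r = V (real i *\<^sub>R g) r" if "r \<in> space copy" for i r
    by (rule mp_action_funpow[OF mp_action_V that])
  show "(V g ^^ i) \<in> copy \<rightarrow>\<^sub>M copy" for i
    using mp_action_measurable[OF mp_action_V] by (simp add: eq cong: measurable_cong)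
  fix a :: real
  define q where "q = max (exp (- l)) (1 - exp (- l))"
  have q: "0 < q" "q < 1" using E(3) by (auto simp: q_def less_max_iff_disj)
  define m where "m = Suc (nat \<lceil>a / (- ln q)\<rceil>)"
  have "a / (- ln q) \<le> real m" unfolding m_def by linarith
  then have "a \<le> - ln (q ^ m)"
    using q by (simp add: ln_realpow field_simps)
  \<comment> \<open>\<open>set_encode\<close> turns the set of hit indices into a natural number, as
    the partitions in \<open>ks_entropy\<close> demand.\<close>
  moreover define Z where "Z r = set_encode {j \<in> {..<m}. w r \<inter> E j \<noteq> {}}" for r
  have "simple_function copy Z"
    unfolding simple_function_def
  proof (intro conjI ballI)
    have "Z ` space copy \<subseteq> set_encode ` Pow {..<m}" by (auto simp: Z_def)
    then show "finite (Z ` space copy)" by (rule finite_subset) simp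
    have [measurable]: "Measurable.pred copy (\<lambda>r. w r \<inter> E j = {})" for j
    proof -
      have "{r \<in> space copy. w r \<inter> E j = {}} = w -` void (E j) \<inter> space copy"
        using w_space by (auto simp: void_def space_P)
      then show ?thesis
        using measurable_sets[OF w_copy, of "void (E j)"] void_sets[OF E(1)] by (simp add: pred_def sets_P)
    qed
    have Zeq: "Z r = z \<longleftrightarrow> (\<exists>S\<in>Pow {..<m}. set_encode S = z \<and> (\<forall>j\<in>{..<m}. (w r \<inter> E j \<noteq> {}) \<longleftrightarrow> j \<in> S))" for r z
    proof
      assume "Z r = z"
      then show "\<exists>S\<in>Pow {..<m}. set_encode S = z \<and> (\<forall>j\<in>{..<m}. (w r \<inter> E j \<noteq> {}) \<longleftrightarrow> j \<in> S)"
        by (intro bexI[of _ "{j \<in> {..<m}. w r \<inter> E j \<noteq> {}}"]) (auto simp: Z_def)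
    next
      assume "\<exists>S\<in>Pow {..<m}. set_encode S = z \<and> (\<forall>j\<in>{..<m}. (w r \<inter> E j \<noteq> {}) \<longleftrightarrow> j \<in> S)"
      then obtain S where S: "S \<subseteq> {..<m}" "set_encode S = z" "\<And>j. j < m \<Longrightarrow> (w r \<inter> E j \<noteq> {}) \<longleftrightarrow> j \<in> S"
        by auto
      then have "{j \<in> {..<m}. w r \<inter> E j \<noteq> {}} = S" by auto
      then show "Z r = z" using S(2) by (simp only: Z_def)
    qed
    fix z
    have "{r \<in> space copy. Z r = z} \<in> sets copy"
      unfolding Zeq by measurable
    then show "Z -` {z} \<inter> space copy \<in> sets copy"
      by (simp add: vimage_def Int_def conj_commute)
  qed
  moreover have "measure copy {r \<in> space copy. \<forall>i<n. Z ((V g ^^ i) r) = v i} \<le> (q ^ m) ^ n" for n and v :: "nat \<Rightarrow> nat"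
  proof -
    define F where "F = (\<lambda>(i :: nat, j :: nat). T (real i *\<^sub>R g) -` E j \<inter> space M)"
    let ?I = "{..<n} \<times> {..<m}"
    let ?Y = "{c \<in> locfin. \<forall>p\<in>?I. (c \<inter> F p = {}) \<longleftrightarrow> snd p \<notin> set_decode (v (fst p))}"
    have Fb: "bdd (F p)" and Fm: "measure M (F p) = l" for p
      using bdd_vimage[OF E(1)] measure_vimage[OF E(1)] E(2) by (auto simp: F_def split: prod.splits)
    have Ys: "?Y \<in> sets P"
    proof -
      have [measurable]: "Measurable.pred P (\<lambda>c. c \<inter> F p = {})" for p
        using void_sets[OF Fb[of p]] by (simp add: pred_def void_def space_P sets_P)
      have "{c \<in> space P. \<forall>p\<in>?I. (c \<inter> F p = {}) \<longleftrightarrow> snd p \<notin> set_decode (v (fst p))} \<in> sets P" by measurable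
      then show ?thesis by (simp add: space_P)
    qed
    have "{r \<in> space copy. \<forall>i<n. Z ((V g ^^ i) r) = v i} \<subseteq> w -` ?Y \<inter> space copy"
    proof
      fix r assume r: "r \<in> {r \<in> space copy. \<forall>i<n. Z ((V g ^^ i) r) = v i}"
      have wr: "w r \<in> locfin" "w r \<subseteq> space M" using w_space[of r] by (auto simp: space_P locfin_def)
      have "(w r \<inter> F (i, j) = {}) \<longleftrightarrow> j \<notin> set_decode (v i)" if "i < n" "j < m" for i j
      proof -
        have "v i = Z (V (real i *\<^sub>R g) r)" using r eq that by auto
        then have "set_decode (v i) = {j \<in> {..<m}. act_sets (real i *\<^sub>R g) (w r) \<inter> E j \<noteq> {}}"
          unfolding Z_def w_V by simp
        then show ?thesis
          using image_Int_empty_iff[OF wr(2)] that by (auto simp: F_def act_sets_def)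
      qed
      then show "r \<in> w -` ?Y \<inter> space copy" using r wr by auto
    qed
    then have "measure copy {r \<in> space copy. \<forall>i<n. Z ((V g ^^ i) r) = v i} \<le> measure copy (w -` ?Y \<inter> space copy)"
      using measurable_sets[OF w_copy Ys] by (intro finite_measure.finite_measure_mono prob_space.finite_measure[OF prob_space_N])
    also have "\<dots> = prob ?Y"
      using measure_distr[OF w_copy Ys] by (simp add: distr_w)
    also have "\<dots> \<le> q ^ card ?I"
      unfolding q_def by (rule prob_pattern_le[OF Fb Fm]) (use disj in \<open>auto simp: F_def disjoint_family_on_def\<close>)
    also have "\<dots> = (q ^ m) ^ n" by (simp add: power_mult[symmetric] mult.commute)
    finally show ?thesis .
  qed
  ultimately show "\<exists>q>0. a \<le> - ln q \<and> (\<exists>Z :: real \<Rightarrow> nat. simple_function copy Z \<and>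
      (\<forall>n v. measure copy {r \<in> space copy. \<forall>i<n. Z ((V g ^^ i) r) = v i} \<le> q ^ n))"
    using q by (intro exI[of _ "q ^ m"]) auto
qed

lemma bounded_space_restrict:
  assumes W: "W \<in> sets M"
  shows "bounded_space (restrict_space M W) (\<lambda>K. X K \<inter> W)"
proof -
  have WM: "W \<subseteq> space M" using sets.sets_into_space[OF W] .
  have sp: "space (restrict_space M W) = W" using WM by (auto simp: space_restrict_space)
  show ?thesis
  proof
    show "space (restrict_space M W) \<in> sets borel" unfolding sp by (rule M_subset_borel[OF W])
    have "sets (restrict_space M W) = (\<inter>) W ` (\<inter>) (space M) ` sets borel"
      unfolding sets_restrict_space sets_M ..
    also have "\<dots> = (\<inter>) W ` sets borel"
      unfolding image_image using WM by (intro image_cong) auto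
    finally show "sets (restrict_space M W) = sets (restrict_space borel (space (restrict_space M W)))"
      unfolding sp by (simp add: sets_restrict_space)
    show "X K \<inter> W \<in> sets (restrict_space M W)" for K
      unfolding sets_restrict_space by (rule image_eqI[OF _ X_sets[of K]]) auto
    show "incseq (\<lambda>K. X K \<inter> W)" using X_mono by (auto simp: incseq_def)
    show "(\<Union>K. X K \<inter> W) = space (restrict_space M W)" unfolding sp using X_UN WM by auto
    show "emeasure (restrict_space M W) (X K \<inter> W) < \<infinity>" for K
    proof -
      have "emeasure (restrict_space M W) (X K \<inter> W) = emeasure M (X K \<inter> W)"
        using W by (intro emeasure_restrict_space) auto
      also have "\<dots> \<le> emeasure M (X K)" by (intro emeasure_mono) auto
      also have "\<dots> < \<infinity>" by (rule X_fin)
      finally show ?thesis .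
    qed
    show "emeasure (restrict_space M W) {x} = 0" if "x \<in> space (restrict_space M W)" for x
      using that points_null[of x] W WM unfolding sp by (subst emeasure_restrict_space) auto
  qed
qed

end

context coded_suspension
begin

text \<open>The domain \<open>W\<close> splits the space into the disjoint sets \<open>D n\<close>
  of points that are in \<open>W\<close> at time \<open>n\<close>. The parts of a configuration in
  the \<open>D n\<close>, each carried into \<open>W\<close>, are independent Poisson sets of the
  same law, and the action of \<open>g\<close> shifts their sequence. \<open>proper\<close> makes
  every sequence of parts glue to a locally finite set, so that the isomorphism is a bijection of
  whole spaces.\<close>

lemma bernoulli_V:
  assumes W: "W \<in> sets M"
    and orbit: "\<And>x. x \<in> space M \<Longrightarrow> \<exists>!n::int. T (real_of_int n *\<^sub>R g) x \<in> W"
    and proper: "\<And>K. finite {n::int. \<exists>x\<in>X K. T (real_of_int n *\<^sub>R g) x \<in> W}"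
  shows "bernoulli copy (V g)"
proof -
  let ?R = "restrict_space M W"
  interpret W: bounded_space ?R "\<lambda>K. X K \<inter> W"
    by (rule bounded_space_restrict[OF W])
  have WM: "W \<subseteq> space M" using sets.sets_into_space[OF W] .
  have spW: "space ?R = W" using WM by (auto simp: space_restrict_space)
  define Q where "Q = W.poisson_points"
  have Q: "W.poisson_law Q" unfolding Q_def by (rule W.poisson_law_poisson_points)
  have sQ: "sets Q = sets W.point_sets" and spQ: "space Q = W.locfin"
    using Q sets_eq_imp_space_eq[of Q W.point_sets] by (auto simp: W.poisson_law_def W.space_point_sets)
  obtain f' w' where "real_coding Q f' w'"
    using W.real_coding_point_sets sQ by metis
  then interpret C: real_coding Q f' w' .
  define K where "K = C.copy"
  have pK: "prob_space K"
    unfolding K_def using Q by (intro C.prob_space_copy) (simp add: W.poisson_law_def)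
  define tt where "tt n x = T (real_of_int n *\<^sub>R g) x" for n and x :: real
  have tt_fun: "tt n = T (real_of_int n *\<^sub>R g)" for n by (simp add: tt_def fun_eq_iff)
  have tt0: "tt 0 x = x" if "x \<in> space M" for x using act that by (simp add: tt_def mp_action_def)
  have tt_add: "tt (m + n) x = tt m (tt n x)" if "x \<in> space M" for m n x
    using mp_action_add[OF act that] by (simp add: tt_def scaleR_left_distrib)
  have tt_minus: "tt (- n) (tt n x) = x" "tt n (tt (- n) x) = x" if "x \<in> space M" for n x
    using T_minus[OF that, of "real_of_int n *\<^sub>R g"] by (auto simp: tt_def)
  have tt_sp: "tt n x \<in> space M" if "x \<in> space M" for n x using T_space[OF that] by (simp add: tt_def)
  have uniq: "m = n" if "x \<in> space M" "tt m x \<in> W" "tt n x \<in> W" for m n x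
    using orbit[OF that(1)] that by (auto simp: tt_def)
  define D where "D n = tt n -` W \<inter> space M" for n
  have D: "D n \<in> sets M" for n
    unfolding D_def tt_def by (rule measurable_sets[OF mp_action_measurable[OF act] W])
  have Ddisj: "disjoint_family D"
    unfolding disjoint_family_on_def using uniq by (auto simp: D_def)
  define comp where "comp n c = tt n ` c \<inter> W" for n c
  have Wbdd: "bdd B" if "W.bdd B" for B
    using that W unfolding W.bdd_def bdd_def by (auto simp: sets_restrict_space)
  have bddW: "W.bdd (B \<inter> W)" if "bdd B" for B
    using that unfolding W.bdd_def bdd_def by (auto simp: sets_restrict_space)
  have compl: "comp n c \<in> W.locfin" if "c \<in> locfin" for n c
  proof -
    have "tt n ` c \<in> locfin" using locfin_image[OF that] by (simp add: tt_def)
    then have "finite (tt n ` c \<inter> X K)" for K by (simp add: locfin_def)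
    moreover have "comp n c \<inter> (X K \<inter> W) \<subseteq> tt n ` c \<inter> X K" for K by (auto simp: comp_def)
    ultimately have "finite (comp n c \<inter> (X K \<inter> W))" for K by (meson finite_subset)
    then show ?thesis
      unfolding W.locfin_def spW by (simp add: comp_def)
  qed
  have comp_void: "{c \<in> locfin. comp n c \<inter> B = {}} = void (tt n -` B \<inter> space M)" if "B \<subseteq> W" for n B
  proof -
    have "comp n c \<inter> B = tt n ` c \<inter> B" for c using that by (auto simp: comp_def)
    then show ?thesis unfolding tt_fun image_void[symmetric] by simp
  qed
  have pre_bdd: "bdd (tt n -` B \<inter> space M)" if "bdd B" for n B
    using bdd_vimage[OF that] by (simp add: tt_fun)
  have compm: "comp n \<in> sigma locfin (voids (D n)) \<rightarrow>\<^sub>M Q" for n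
    unfolding measurable_cong_sets[OF refl sQ]
  proof (rule W.measurable_point_setsI)
    have sp: "space (sigma locfin (voids (D n))) = locfin" by (rule space_measure_of[OF voids_subset])
    show "comp n c \<in> W.locfin" if "c \<in> space (sigma locfin (voids (D n)))" for c
      using that compl unfolding sp by blast
    fix B assume B: "W.bdd B"
    have BW: "B \<subseteq> W" using W.bdd_sets[OF B] sets.sets_into_space spW by blast
    have "void (tt n -` B \<inter> space M) \<in> voids (D n)"
      unfolding voids_def D_def using pre_bdd[OF Wbdd[OF B]] BW by blast
    then show "{c \<in> space (sigma locfin (voids (D n))). comp n c \<inter> B = {}} \<in> sets (sigma locfin (voids (D n)))"
      unfolding sp comp_void[OF BW] sets_measure_of[OF voids_subset] by (rule sigma_sets.Basic)
  qed
  have compP: "comp n \<in> P \<rightarrow>\<^sub>M Q" for n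
  proof -
    have "sets (sigma locfin (voids (D n))) \<subseteq> sets P"
      unfolding sets_measure_of[OF voids_subset] sets_P
      by (rule sigma_voids_subset[OF sets.sets_into_space[OF D]])
    moreover have "space (sigma locfin (voids (D n))) = space P"
      by (simp add: space_measure_of[OF voids_subset] space_P)
    ultimately show ?thesis
      using compm[of n] by (auto simp: measurable_def)
  qed
  have law: "distr P Q (comp n) = Q" for n
  proof (rule W.poisson_law_unique[OF _ Q])
    show "W.poisson_law (distr P Q (comp n))"
      unfolding W.poisson_law_def
    proof (intro conjI allI impI)
      show "prob_space (distr P Q (comp n))" by (rule prob_space_distr[OF compP])
      fix B assume B: "W.bdd B"
      have BW: "B \<subseteq> W" using W.bdd_sets[OF B] sets.sets_into_space spW by blast
      have "measure (distr P Q (comp n)) (W.void B) = prob (comp n -` W.void B \<inter> space P)"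
        using W.void_sets[OF B] by (intro measure_distr[OF compP]) (simp add: sQ)
      also have "comp n -` W.void B \<inter> space P = void (tt n -` B \<inter> space M)"
        unfolding comp_void[OF BW, symmetric] using compl by (auto simp: W.void_def space_P)
      also have "prob \<dots> = exp (- measure M B)"
        using prob_void[OF pre_bdd[OF Wbdd[OF B]]] measure_vimage[OF Wbdd[OF B]] by (simp add: tt_fun)
      also have "measure M B = measure ?R B"
        using W BW by (intro measure_restrict_space[symmetric]) auto
      finally show "measure (distr P Q (comp n)) (W.void B) = exp (- measure ?R B)" .
    qed (simp add: sQ)
  qed
  define G where "G n c = f' (comp n c)" for n c
  have fQK: "f' \<in> Q \<rightarrow>\<^sub>M K" unfolding K_def by (rule C.f_copy)
  have GP: "G n \<in> P \<rightarrow>\<^sub>M K" for n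
    unfolding G_def by (rule measurable_compose[OF compP fQK])
  have Glaw: "distr P K (G n) = K" for n
  proof -
    have "distr P K (G n) = distr (distr P Q (comp n)) K f'"
      by (subst distr_distr[OF fQK compP]) (simp add: G_def[abs_def] Fun.comp_def)
    also have "\<dots> = K" unfolding law K_def by (rule C.distr_f)
    finally show ?thesis .
  qed
  \<comment> \<open>\<open>comp n\<close> is measurable with respect to the void events inside
    \<open>D n\<close>, and the \<open>D n\<close> are disjoint.\<close>
  have Gind: "indep_vars (\<lambda>_. K) G UNIV"
    unfolding indep_vars_def2
  proof (intro conjI ballI GP)
    have "indep_sets (\<lambda>n. sigma_sets locfin (voids (D n))) UNIV"
      by (rule poisson_law_indep[OF P D]) (use Ddisj in auto)
    then show "indep_sets (\<lambda>n. {G n -` A \<inter> space P | A. A \<in> sets K}) UNIV"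
    proof (rule indep_sets_mono_sets)
      fix n :: int
      have "G n \<in> sigma locfin (voids (D n)) \<rightarrow>\<^sub>M K"
        unfolding G_def by (rule measurable_compose[OF compm fQK])
      from measurable_sets[OF this]
      show "{G n -` A \<inter> space P | A. A \<in> sets K} \<subseteq> sigma_sets locfin (voids (D n))"
        by (auto simp: space_P space_measure_of[OF voids_subset] sets_measure_of[OF voids_subset])
    qed
  qed
  let ?N = "PiM (UNIV :: int set) (\<lambda>_. K)"
  define \<phi> where "\<phi> r = (\<lambda>n. G n (w r))" for r
  have "distr P ?N (\<lambda>c. \<lambda>n\<in>UNIV. G n c) = PiM UNIV (\<lambda>n. distr P K (G n))"
    using Gind GP by (subst (asm) indep_vars_iff_distr_eq_PiM) auto
  then have GN: "distr P ?N (\<lambda>c n. G n c) = ?N"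
    unfolding Glaw by (simp add: restrict_def)
  have GNm: "(\<lambda>c n. G n c) \<in> P \<rightarrow>\<^sub>M ?N"
    by (rule measurable_PiM_single') (use GP measurable_space[OF GP] in auto)
  have \<phi>m: "\<phi> \<in> copy \<rightarrow>\<^sub>M ?N"
    unfolding \<phi>_def by (rule measurable_compose[OF w_copy GNm])
  have \<phi>law: "distr copy ?N \<phi> = ?N"
  proof -
    have "distr copy ?N \<phi> = distr (distr copy P w) ?N (\<lambda>c n. G n c)"
      by (subst distr_distr[OF GNm w_copy]) (simp add: \<phi>_def[abs_def] Fun.comp_def)
    then show ?thesis by (simp only: distr_w GN)
  qed
  \<comment> \<open>The inverse of the decomposition, defined on all sequences because
    \<open>w'\<close> decodes every real to a locally finite subset of \<open>W\<close>.\<close>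
  define glue where "glue x = (\<Union>n. tt (- n) ` w' (x n))" for x :: "int \<Rightarrow> real"
  have w'l: "w' r \<in> W.locfin" for r using C.w_space[of r] by (simp add: spQ)
  have w'W: "w' r \<subseteq> W" for r using w'l[of r] by (simp add: W.locfin_def spW)
  have glue_loc: "glue x \<in> locfin" for x
  proof -
    have sub: "glue x \<subseteq> space M" using w'W WM tt_sp by (fastforce simp: glue_def)
    have "finite (glue x \<inter> X K)" for K
    proof -
      \<comment> \<open>Only at these finitely many times can a glued part contribute points to
        \<open>X K\<close>.\<close>
      let ?n = "{n::int. \<exists>x\<in>X K. T (real_of_int n *\<^sub>R g) x \<in> W}"
      have "glue x \<inter> X K \<subseteq> (\<Union>n\<in>?n. tt (- n) ` w' (x n) \<inter> X K)"
      proof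
        fix y assume y: "y \<in> glue x \<inter> X K"
        then obtain n z where z: "z \<in> w' (x n)" "y = tt (- n) z" by (auto simp: glue_def)
        have "z \<in> space M" "z \<in> W" using z w'W WM by auto
        then have "tt n y \<in> W" using tt_minus(2)[of z n] z by simp
        then have "n \<in> ?n" using y by (auto simp: tt_def)
        then show "y \<in> (\<Union>n\<in>?n. tt (- n) ` w' (x n) \<inter> X K)" using z y by auto
      qed
      moreover have "finite (tt (- n) ` w' (x n) \<inter> X K)" for n
      proof -
        have "w' (x n) \<in> locfin"
          unfolding locfin_def
        proof (intro CollectI conjI allI)
          show "w' (x n) \<subseteq> space M" using w'W WM by blast
          fix L
          have "w' (x n) \<inter> X L = w' (x n) \<inter> (X L \<inter> W)" using w'W by auto
          then show "finite (w' (x n) \<inter> X L)" using w'l[of "x n"] by (simp add: W.locfin_def)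
        qed
        then have "tt (- n) ` w' (x n) \<in> locfin" unfolding tt_def by (rule locfin_image)
        then show ?thesis by (simp add: locfin_def)
      qed
      ultimately show ?thesis using proper[of K] by (meson finite_UN_I finite_subset)
    qed
    then show ?thesis using sub by (simp add: locfin_def)
  qed
  have glue_comp: "glue (\<lambda>n. G n c) = c" if c: "c \<in> locfin" for c
  proof -
    have cM: "c \<subseteq> space M" using c by (simp add: locfin_def)
    have wG: "w' (G n c) = comp n c" for n
      unfolding G_def using C.w_f[of "comp n c"] compl[OF c] by (simp add: spQ)
    show ?thesis
      unfolding glue_def wG
    proof (intro equalityI subsetI)
      fix y assume "y \<in> (\<Union>n. tt (- n) ` comp n c)"
      then obtain n z where z: "z \<in> c" "y = tt (- n) (tt n z)" by (auto simp: comp_def)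
      then show "y \<in> c" using tt_minus(1)[of z n] cM by auto
    next
      fix y assume y: "y \<in> c"
      then obtain n where n: "tt n y \<in> W" using orbit[of y] cM by (auto simp: tt_def)
      have "y = tt (- n) (tt n y)" using tt_minus(1)[of y n] cM y by auto
      then show "y \<in> (\<Union>n. tt (- n) ` comp n c)" using n y unfolding comp_def by blast
    qed
  qed
  have comp_glue: "comp n (glue x) = w' (x n)" for n x
  proof (intro equalityI subsetI)
    fix y assume "y \<in> comp n (glue x)"
    then obtain m z where z: "z \<in> w' (x m)" "y = tt n (tt (- m) z)" "y \<in> W"
      by (auto simp: comp_def glue_def)
    have zM: "z \<in> space M" "z \<in> W" using z w'W WM by auto
    have "tt (n + - m) z \<in> W" using z(2,3) tt_add[OF zM(1), of n "- m"] by simp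
    moreover have "tt 0 z \<in> W" using tt0[OF zM(1)] zM by simp
    ultimately have "n + - m = 0" by (rule uniq[OF zM(1)])
    then have "n = m" by simp
    then show "y \<in> w' (x n)" using z tt_minus(2)[OF zM(1), of n] by simp
  next
    fix y assume y: "y \<in> w' (x n)"
    then have "y \<in> W" "y \<in> space M" using w'W WM by auto
    then show "y \<in> comp n (glue x)"
      unfolding comp_def glue_def using tt_minus(2)[of y n] y by force
  qed
  have gluem: "glue \<in> ?N \<rightarrow>\<^sub>M P"
    unfolding measurable_cong_sets[OF refl sets_P]
  proof (rule measurable_point_setsI[OF glue_loc])
    fix A assume A: "bdd A"
    have "{x \<in> space ?N. glue x \<inter> A = {}} = {x \<in> space ?N. \<forall>n. w' (x n) \<in> W.void ((tt (- n) -` A \<inter> space M) \<inter> W)}"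
    proof -
      have "tt (- n) ` w' r \<inter> A = {} \<longleftrightarrow> w' r \<in> W.void ((tt (- n) -` A \<inter> space M) \<inter> W)" for n r
        using w'l[of r] w'W[of r] WM by (auto simp: W.void_def)
      moreover have "glue x \<inter> A = {} \<longleftrightarrow> (\<forall>n. tt (- n) ` w' (x n) \<inter> A = {})" for x
        by (auto simp: glue_def)
      ultimately show ?thesis by simp
    qed
    also have "\<dots> \<in> sets ?N"
    proof -
      have "(\<lambda>x. w' (x n)) \<in> ?N \<rightarrow>\<^sub>M Q" for n
        using measurable_compose[OF measurable_component_singleton[of n UNIV "\<lambda>_. K"] C.w_copy[folded K_def]] by simp
      note w'm = measurable_sets[OF this]
      have "{x \<in> space ?N. w' (x n) \<in> S} \<in> sets ?N" if "S \<in> sets Q" for n S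
      proof -
        have "{x \<in> space ?N. w' (x n) \<in> S} = (\<lambda>x. w' (x n)) -` S \<inter> space ?N" by auto
        with w'm[OF that, of n] show ?thesis by simp
      qed
      moreover have "W.void ((tt (- n) -` A \<inter> space M) \<inter> W) \<in> sets Q" for n
        unfolding sQ by (rule W.void_sets[OF bddW[OF pre_bdd[OF A]]])
      ultimately have "{x \<in> space ?N. w' (x n) \<in> W.void ((tt (- n) -` A \<inter> space M) \<inter> W)} \<in> sets ?N" for n
        by blast
      then show ?thesis by (intro sets.sets_Collect_countable_All) simp
    qed
    finally show "{x \<in> space ?N. glue x \<inter> A = {}} \<in> sets ?N" .
  qed
  define \<psi> where "\<psi> x = f (glue x)" for x
  have \<psi>m: "\<psi> \<in> ?N \<rightarrow>\<^sub>M copy"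
    unfolding \<psi>_def by (rule measurable_compose[OF gluem f_copy])
  have wl: "w r \<in> locfin" for r using w_space[of r] by (simp add: space_P)
  have \<psi>\<phi>: "\<psi> (\<phi> r) = r" if "r \<in> space copy" for r
    unfolding \<psi>_def \<phi>_def using glue_comp[OF wl] f_w[OF that] by simp
  have \<phi>\<psi>: "\<phi> (\<psi> x) = x" if x: "x \<in> space ?N" for x
  proof
    fix n
    have "x n \<in> space K" using x by (auto simp: space_PiM)
    then have "f' (w' (x n)) = x n" unfolding K_def by (rule C.f_w)
    then show "\<phi> (\<psi> x) n = x n"
      unfolding \<psi>_def \<phi>_def G_def using w_f[of "glue x"] glue_loc by (simp add: space_P comp_glue)
  qed
  have \<phi>sp: "\<phi> r \<in> space ?N" if "r \<in> space copy" for r using measurable_space[OF \<phi>m that] .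
  have \<psi>sp: "\<psi> x \<in> space copy" if "x \<in> space ?N" for x using measurable_space[OF \<psi>m that] .
  have bij: "bij_betw \<phi> (space copy) (space ?N)"
    by (rule bij_betwI[where g = \<psi>]) (use \<psi>\<phi> \<phi>\<psi> \<phi>sp \<psi>sp in auto)
  have shift: "\<phi> (V g r) n = \<phi> r (n + 1)" for r n
  proof -
    have sub: "w r \<subseteq> space M" using wl by (simp add: locfin_def)
    have "tt n ` act_sets g (w r) = tt (n + 1) ` w r"
      unfolding act_sets_def image_image
    proof (rule image_cong[OF refl])
      fix x assume "x \<in> w r"
      then show "tt n (T g x) = tt (n + 1) x"
        using tt_add[of x n 1] sub by (auto simp: tt_def[of 1])
    qed
    then show ?thesis by (simp add: \<phi>_def G_def comp_def w_V)
  qed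
  have "the_inv_into (space copy) \<phi> \<in> ?N \<rightarrow>\<^sub>M copy"
  proof (subst measurable_cong)
    show "the_inv_into (space copy) \<phi> x = \<psi> x" if "x \<in> space ?N" for x
      using the_inv_into_f_eq[of \<phi> "space copy" "\<psi> x" x] bij \<phi>\<psi>[OF that] \<psi>sp[OF that]
      by (simp add: bij_betw_def)
  qed (rule \<psi>m)
  then have "isomorphic_systems copy (\<lambda>_::unit. V g) ?N (\<lambda>_ x i. x (i + 1))"
    unfolding isomorphic_systems_def
    by (intro exI[of _ \<phi>] exI[of _ "space copy"] exI[of _ "space ?N"])
      (use bij \<phi>m \<phi>law shift in \<open>auto simp: restrict_space_whole fun_eq_iff\<close>)
  moreover have "standard_borel K" unfolding K_def by (rule C.standard_borel_copy)
  ultimately show ?thesis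
    unfolding bernoulli_def using pK by blast
qed

end

section \<open>Restricted products of circles\<close>

text \<open>For \<open>l = 0\<close> the convention \<open>t / 0 = 0\<close> makes \<open>wrap 0\<close> the identity, so that a line counts as a
  circle of length \<open>0\<close>.\<close>

definition wrap :: "nat \<Rightarrow> real \<Rightarrow> real" where
  "wrap l t = t - real l * of_int \<lfloor>t / real l + 1/2\<rfloor>"

definition fundamental :: "nat \<Rightarrow> real set" where
  "fundamental l = {t. l = 0 \<or> - real l / 2 \<le> t \<and> t < real l / 2}"

lemma wrap_0 [simp]: "wrap 0 t = t"
  by (simp add: wrap_def)

lemma wrap_measurable [measurable]: "wrap l \<in> borel_measurable borel"
  unfolding wrap_def[abs_def] by measurable

lemma fundamental_borel [measurable]: "fundamental l \<in> sets borel"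
proof -
  have "fundamental l = {t \<in> space borel. l = 0 \<or> - real l / 2 \<le> t \<and> t < real l / 2}"
    by (simp add: fundamental_def)
  also have "\<dots> \<in> sets borel" by measurable
  finally show ?thesis .
qed

lemma wrap_shift: "wrap l (t + real l * of_int k) = wrap l t"
proof (cases "l = 0")
  case False
  then have "(t + real l * of_int k) / real l + 1/2 = t / real l + 1/2 + of_int k"
    by (simp add: field_simps)
  then have "\<lfloor>(t + real l * of_int k) / real l + 1/2\<rfloor> = \<lfloor>t / real l + 1/2\<rfloor> + k"
    by (simp only: floor_add_int)
  then show ?thesis by (simp add: wrap_def algebra_simps)
qed simp

lemma wrap_add_wrap [simp]: "wrap l (wrap l s + t) = wrap l (s + t)" "wrap l (s + wrap l t) = wrap l (s + t)"
proof -
  have *: "wrap l (wrap l s + t) = wrap l (s + t)" for s t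
    using wrap_shift[of l "s + t" "- \<lfloor>s / real l + 1/2\<rfloor>"] by (simp add: wrap_def[of l s] algebra_simps)
  show "wrap l (wrap l s + t) = wrap l (s + t)" by (rule *)
  show "wrap l (s + wrap l t) = wrap l (s + t)" using *[of t s] by (simp add: add.commute)
qed

lemma wrap_fundamental: "wrap l t \<in> fundamental l"
proof (cases "l = 0")
  case False
  then have "0 < real l" by simp
  moreover have "t / real l + 1/2 - 1 < of_int \<lfloor>t / real l + 1/2\<rfloor>" "of_int \<lfloor>t / real l + 1/2\<rfloor> \<le> t / real l + 1/2"
    by linarith+
  ultimately have "real l * (t / real l + 1/2 - 1) < real l * of_int \<lfloor>t / real l + 1/2\<rfloor>"
    "real l * of_int \<lfloor>t / real l + 1/2\<rfloor> \<le> real l * (t / real l + 1/2)"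
    by (simp_all only: mult_strict_left_mono mult_left_mono less_imp_le)
  moreover have "real l * (t / real l + 1/2 - 1) = t - real l / 2" "real l * (t / real l + 1/2) = t + real l / 2"
    using False by (simp_all add: field_simps)
  ultimately show ?thesis
    unfolding fundamental_def wrap_def by simp
qed (simp add: fundamental_def)

lemma wrap_of_fundamental: "t \<in> fundamental l \<Longrightarrow> wrap l t = t"
proof (cases "l = 0")
  case False
  assume "t \<in> fundamental l"
  then have "0 \<le> t / real l + 1/2" "t / real l + 1/2 < 1"
    using False by (auto simp: fundamental_def field_simps)
  then have "\<lfloor>t / real l + 1/2\<rfloor> = 0" by linarith
  then show ?thesis by (simp add: wrap_def)
qed simp

text \<open>\<open>\<bar>wrap l t\<bar>\<close> is the distance from \<open>t\<close> to the
  multiples of \<open>l\<close>, which explains this bound and the following ones.\<close>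

lemma abs_wrap_le: "\<bar>wrap l t\<bar> \<le> \<bar>t\<bar>"
proof (cases "t \<in> fundamental l")
  case True
  then show ?thesis by (simp add: wrap_of_fundamental)
next
  case False
  then have "real l / 2 \<le> \<bar>t\<bar>" by (auto simp: fundamental_def)
  moreover have "\<bar>wrap l t\<bar> \<le> real l / 2"
    using wrap_fundamental[of l t] False by (auto simp: fundamental_def)
  ultimately show ?thesis by linarith
qed

lemma abs_wrap_add_le: "\<bar>wrap l (s + t)\<bar> \<le> \<bar>wrap l s\<bar> + \<bar>wrap l t\<bar>"
proof -
  have "\<bar>wrap l (s + t)\<bar> = \<bar>wrap l (wrap l s + wrap l t)\<bar>" by simp
  also have "\<dots> \<le> \<bar>wrap l s + wrap l t\<bar>" by (rule abs_wrap_le)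
  finally show ?thesis by linarith
qed

lemma abs_wrap_minus: "\<bar>wrap l (- t)\<bar> = \<bar>wrap l t\<bar>"
proof -
  have *: "\<bar>wrap l (- t)\<bar> \<le> \<bar>wrap l t\<bar>" for t
  proof -
    have "wrap l (- t) = wrap l (- wrap l t)"
      using wrap_shift[of l "- t" "\<lfloor>t / real l + 1/2\<rfloor>"] by (simp add: wrap_def[of l t])
    also have "\<bar>\<dots>\<bar> \<le> \<bar>- wrap l t\<bar>" by (rule abs_wrap_le)
    finally show ?thesis by simp
  qed
  show ?thesis using *[of t] *[of "- t"] by simp
qed

lemma abs_wrap_le_dist: "\<bar>wrap l t\<bar> \<le> \<bar>t - real l * of_int k\<bar>"
  using abs_wrap_le[of l "t + real l * of_int (- k)"] wrap_shift[of l t "- k"] by simp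

text \<open>The point \<open>t\<close> is at distance at least \<open>c\<close> from 0, and the
  upper bound on \<open>\<bar>t\<bar>\<close> keeps it equally far from all other multiples of
  \<open>l\<close>.\<close>

lemma abs_wrap_ge:
  assumes "c \<le> \<bar>t\<bar>" "\<bar>t\<bar> \<le> real l - c"
  shows "c \<le> \<bar>wrap l t\<bar>"
proof -
  define k where "k = \<lfloor>t / real l + 1/2\<rfloor>"
  have w: "wrap l t = t - real l * of_int k" by (simp add: wrap_def k_def)
  show ?thesis
  proof (cases "k = 0")
    case False
    then have "1 \<le> \<bar>of_int k :: real\<bar>" by linarith
    then have "real l \<le> \<bar>real l * of_int k\<bar>"
      using mult_left_mono[of 1 "\<bar>of_int k :: real\<bar>" "real l"] by (simp add: abs_mult)
    then show ?thesis using assms unfolding w by linarith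
  qed (use assms w in simp)
qed

declare One_nat_def [simp del]

section \<open>Length measure on one unit cell and its rotations\<close>

definition unit_law :: "real measure" where
  "unit_law = restrict_space lborel (fundamental 1)"

lemma space_unit_law: "space unit_law = fundamental 1"
  by (simp add: unit_law_def space_restrict_space)

lemma fundamental_1: "fundamental 1 = {-1/2..<1/2}"
  by (auto simp: fundamental_def)

lemma sets_unit_law: "A \<in> sets unit_law \<longleftrightarrow> A \<in> sets borel \<and> A \<subseteq> fundamental 1"
  unfolding unit_law_def by (subst sets_restrict_space_iff) auto

lemma emeasure_unit_law: "A \<in> sets unit_law \<Longrightarrow> emeasure unit_law A = emeasure lborel A"
  unfolding unit_law_def by (intro emeasure_restrict_space) (auto simp: sets_restrict_space)

lemma prob_space_unit_law: "prob_space unit_law"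
proof
  have "emeasure unit_law (space unit_law) = emeasure lborel {-1/2..<1/2::real}"
    unfolding fundamental_1[symmetric] space_unit_law[symmetric] by (rule emeasure_unit_law) simp
  also have "\<dots> = 1" by simp
  finally show "emeasure unit_law (space unit_law) = 1" .
qed

lemma unit_law_borel: "f \<in> borel_measurable borel \<Longrightarrow> f \<in> borel_measurable unit_law"
  unfolding unit_law_def by (rule measurable_restrict_space1) simp

lemma emeasure_lborel_shift:
  assumes "A \<in> sets (borel :: real measure)"
  shows "emeasure lborel {u. u + c \<in> A} = emeasure lborel A"
proof -
  have "emeasure lborel A = emeasure (distr lborel borel ((+) c)) A"
    by (simp add: lborel_distr_plus)
  also have "\<dots> = emeasure lborel {u. u + c \<in> A}"
    using assms by (subst emeasure_distr) (auto simp: vimage_def add.commute)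
  finally show ?thesis by simp
qed

lemma floor_half_unique: "v - of_int k \<in> fundamental 1 \<longleftrightarrow> k = \<lfloor>v + 1/2\<rfloor>"
  unfolding fundamental_1 by (auto simp: floor_eq_iff) linarith+

text \<open>A rotation exchanges intervals: on \<open>S k\<close>, where the carry is
  \<open>k\<close>, it is a translation onto \<open>R k\<close>, and the sets \<open>R k\<close>
  partition \<open>B\<close>.\<close>

lemma unit_law_rotation:
  "distr unit_law unit_law (\<lambda>u. wrap 1 (u + t)) = unit_law"
proof (rule measure_eqI)
  have m: "(\<lambda>u. wrap 1 (u + t)) \<in> unit_law \<rightarrow>\<^sub>M unit_law"
  proof -
    have "(\<lambda>u. wrap 1 (u + t)) \<in> borel_measurable unit_law"
      by (rule unit_law_borel) measurable
    then show ?thesis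
      unfolding unit_law_def using wrap_fundamental by (intro measurable_restrict_space2) (auto simp: unit_law_def)
  qed
  fix B assume "B \<in> sets (distr unit_law unit_law (\<lambda>u. wrap 1 (u + t)))"
  then have Bs: "B \<in> sets unit_law" by simp
  then have B: "B \<in> sets borel" "B \<subseteq> fundamental 1" by (auto simp: sets_unit_law)
  define S where "S k = {u \<in> fundamental 1. u + (t - of_int k) \<in> B}" for k :: int
  define R where "R k = {v \<in> B. v + (of_int k - t) \<in> fundamental 1}" for k :: int
  have [measurable]: "B \<in> sets borel" by (rule B(1))
  have Ss: "S k \<in> sets borel" for k
  proof -
    have "S k = {u \<in> space borel. u \<in> fundamental 1 \<and> u + (t - of_int k) \<in> B}" by (simp add: S_def)
    also have "\<dots> \<in> sets borel" by measurable
    finally show ?thesis .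
  qed
  have Rs: "R k \<in> sets borel" for k
  proof -
    have "R k = {v \<in> space borel. v \<in> B \<and> v + (of_int k - t) \<in> fundamental 1}" by (simp add: R_def)
    also have "\<dots> \<in> sets borel" by measurable
    finally show ?thesis .
  qed
  have w: "wrap 1 (u + t) = u + (t - of_int \<lfloor>u + t + 1/2\<rfloor>)" for u by (simp add: wrap_def)
  have pre: "(\<lambda>u. wrap 1 (u + t)) -` B \<inter> space unit_law = (\<Union>k. S k)"
  proof (intro equalityI subsetI)
    fix u assume "u \<in> (\<lambda>u. wrap 1 (u + t)) -` B \<inter> space unit_law"
    then show "u \<in> (\<Union>k. S k)"
      by (intro UN_I[of "\<lfloor>u + t + 1/2\<rfloor>"]) (auto simp: S_def space_unit_law w)
  next
    fix u assume "u \<in> (\<Union>k. S k)"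
    then obtain k where k: "u \<in> fundamental 1" "u + (t - of_int k) \<in> B" by (auto simp: S_def)
    then have "u + t - of_int k \<in> fundamental 1" using B(2) by (auto simp: algebra_simps)
    then have "k = \<lfloor>u + t + 1/2\<rfloor>" by (simp only: floor_half_unique)
    then show "u \<in> (\<lambda>u. wrap 1 (u + t)) -` B \<inter> space unit_law"
      using k by (simp add: w space_unit_law)
  qed
  have Sdisj: "disjoint_family S"
    unfolding disjoint_family_on_def
  proof (intro ballI impI)
    fix m n :: int assume "m \<noteq> n"
    have "False" if "u \<in> S m" "u \<in> S n" for u
    proof -
      have "u + t - of_int m \<in> fundamental 1" "u + t - of_int n \<in> fundamental 1"
        using that B(2) by (auto simp: S_def algebra_simps)
      then show False using \<open>m \<noteq> n\<close> by (simp only: floor_half_unique)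
    qed
    then show "S m \<inter> S n = {}" by blast
  qed
  have Runion: "(\<Union>k. R k) = B" and Rdisj: "disjoint_family R"
  proof -
    have *: "v + (of_int k - t) \<in> fundamental 1 \<longleftrightarrow> k = - \<lfloor>v - t + 1/2\<rfloor>" for v k
      using floor_half_unique[of "v - t" "- k"] by (auto simp: algebra_simps)
    show "(\<Union>k. R k) = B" unfolding R_def * by auto
    show "disjoint_family R" unfolding R_def * disjoint_family_on_def by auto
  qed
  have SR: "emeasure lborel (S k) = emeasure lborel (R k)" for k
  proof -
    have "S k = {u. u + (t - of_int k) \<in> R k}" by (auto simp: S_def R_def)
    then show ?thesis using emeasure_lborel_shift[OF Rs[of k], of "t - of_int k"] by simp
  qed
  have sum: "emeasure lborel (\<Union>k. A k) = (\<integral>\<^sup>+k. emeasure lborel (A k) \<partial>count_space UNIV)"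
    if "\<And>k. A k \<in> sets borel" "disjoint_family A" for A :: "int \<Rightarrow> real set"
    using that by (intro emeasure_UN_countable) auto
  have "emeasure (distr unit_law unit_law (\<lambda>u. wrap 1 (u + t))) B = emeasure unit_law (\<Union>k. S k)"
    by (simp add: emeasure_distr[OF m Bs] pre)
  also have "\<dots> = emeasure lborel (\<Union>k. S k)"
    using Ss by (intro emeasure_unit_law) (auto simp: sets_unit_law S_def)
  also have "\<dots> = emeasure lborel (\<Union>k. R k)"
    by (simp add: sum[OF Ss Sdisj] sum[OF Rs Rdisj] SR)
  also have "\<dots> = emeasure unit_law B"
    by (simp add: Runion emeasure_unit_law[OF Bs])
  finally show "emeasure (distr unit_law unit_law (\<lambda>u. wrap 1 (u + t))) B = emeasure unit_law B" .
qed simp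

text \<open>For odd \<open>l\<close> the interval from \<open>- l / 2\<close> to
  \<open>l / 2\<close> is a union of unit cells centred at integers, so reduction modulo
  \<open>l\<close> moves cells as wholes and leaves the position \<open>u\<close> inside a cell
  unchanged.\<close>

lemma wrap_odd:
  assumes "l = 0 \<or> odd l" "u \<in> fundamental 1"
  shows "wrap l (u + of_int z) = u + wrap l (of_int z)" "wrap l (of_int z) \<in> \<int>"
proof -
  show int: "wrap l (of_int z) \<in> \<int>" unfolding wrap_def by auto
  show "wrap l (u + of_int z) = u + wrap l (of_int z)"
  proof (cases "l = 0")
    case False
    obtain k where k: "wrap l (of_int z) = of_int k" using int by (auto elim: Ints_cases)
    obtain m where m: "l = 2 * m + 1" using assms(1) False by (auto elim: oddE)
    have "of_int k \<in> fundamental l" using wrap_fundamental[of l "of_int z"] k by simp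
    then have "- (2 * int m + 1) \<le> 2 * k" "2 * k < 2 * int m + 1"
      using False m unfolding fundamental_def mem_Collect_eq by linarith+
    then have "- int m \<le> k" "k \<le> int m" by linarith+
    then have "- real m \<le> of_int k" "of_int k \<le> real m" by linarith+
    then have "u + of_int k \<in> fundamental l"
      using assms(2) m by (auto simp: fundamental_def)
    then have "wrap l (u + of_int k) = u + of_int k" by (rule wrap_of_fundamental)
    then show ?thesis using k wrap_add_wrap(2)[of l u "of_int z"] by simp
  qed simp
qed

declare One_nat_def [simp]
lemma nn_integral_count_space_le:
  fixes f :: "'a \<Rightarrow> ennreal"
  assumes "countable S" "\<And>F. finite F \<Longrightarrow> F \<subseteq> S \<Longrightarrow> sum f F \<le> C"
  shows "(\<integral>\<^sup>+x. f x \<partial>count_space S) \<le> C"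
proof (cases "finite S")
  case True
  then show ?thesis using assms(2)[OF True] by (simp add: nn_integral_count_space_finite)
next
  case False
  have bij: "bij_betw (from_nat_into S) UNIV S"
    using bij_betw_from_nat_into[OF assms(1) False] .
  have "(\<integral>\<^sup>+x. f x \<partial>count_space S) = (\<integral>\<^sup>+n. f (from_nat_into S n) \<partial>count_space UNIV)"
    by (rule nn_integral_bij_count_space[OF bij, symmetric])
  also have "\<dots> = (\<Sum>n. f (from_nat_into S n))" by (rule nn_integral_count_space_nat)
  also have "\<dots> \<le> C"
  proof (rule suminf_le_const)
    fix n
    have "inj_on (from_nat_into S) {..<n}" using bij by (auto simp: bij_betw_def intro: inj_on_subset)
    then have "(\<Sum>k<n. f (from_nat_into S k)) = sum f (from_nat_into S ` {..<n})"
      by (simp add: sum.reindex)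
    also have "\<dots> \<le> C" using bij by (intro assms(2)) (auto simp: bij_betw_def)
    finally show "(\<Sum>k<n. f (from_nat_into S k)) \<le> C" .
  qed simp
  finally show ?thesis .
qed

text \<open>A function of finite support is determined by the finite set of pairs of an argument and
  its nonzero value.\<close>

lemma countable_finite_support:
  "countable {s :: 'i::countable \<Rightarrow> int. finite {i. s i \<noteq> 0}}" (is "countable ?A")
proof -
  let ?g = "\<lambda>s :: 'i \<Rightarrow> int. {(i, s i) | i. s i \<noteq> 0}"
  have "inj_on ?g ?A"
  proof (rule inj_onI)
    fix s t :: "'i \<Rightarrow> int" assume e: "?g s = ?g t"
    show "s = t"
    proof
      fix i
      have "(i, s i) \<in> ?g s \<longleftrightarrow> (i, s i) \<in> ?g t" "(i, t i) \<in> ?g s \<longleftrightarrow> (i, t i) \<in> ?g t" using e by simp_all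
      then show "s i = t i" by (cases "s i = 0"; cases "t i = 0") auto
    qed
  qed
  moreover have "countable (?g ` ?A)"
  proof (rule countable_subset[OF _ countable_Collect_finite])
    show "?g ` ?A \<subseteq> {S. finite S}"
    proof clarify
      fix s :: "'i \<Rightarrow> int" assume "finite {i. s i \<noteq> 0}"
      moreover have "?g s = (\<lambda>i. (i, s i)) ` {i. s i \<noteq> 0}" by auto
      ultimately show "finite (?g s)" by simp
    qed
  qed
  ultimately show ?thesis by (rule countable_image_inj_on[rotated])
qed

text \<open>For odd \<open>L i\<close> the unit intervals around the integers tile the interval from \<open>- L i / 2\<close> to \<open>L i / 2\<close>.\<close>

locale torus_product =
  fixes L :: "'i::countable \<Rightarrow> nat" and a :: "'i \<Rightarrow> real" and bound :: real
  assumes L_odd: "L i = 0 \<or> odd (L i)"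
    and a_pos: "0 < a i"
    and a_sum: "finite F \<Longrightarrow> sum a F \<le> bound"
begin

text \<open>The slack \<open>K * a i\<close> beyond the unit interval is summable over
  \<open>i\<close>, which keeps the measure finite; a translation bounded by multiples of
  \<open>a i\<close> increases it to another slack of the same form, which keeps the union of the
  tubes invariant.\<close>

definition tube :: "nat \<Rightarrow> ('i \<Rightarrow> real) set" where
  "tube K = {x. \<forall>i. x i \<in> fundamental (L i) \<and> \<bar>x i\<bar> \<le> 1/2 + real K * a i}"

definition carrier :: "('i \<Rightarrow> real) set" where
  "carrier = (\<Union>K. tube K)"

definition base :: "('i \<Rightarrow> real) measure" where
  "base = PiM UNIV (\<lambda>_. unit_law)"

text \<open>Indices of the unit cells that carry \<open>vol\<close>; in all but finitely many
  coordinates the cell is the one around 0.\<close>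

definition cells :: "('i \<Rightarrow> int) set" where
  "cells = {s. finite {i. s i \<noteq> 0} \<and> (\<forall>i. of_int (s i) \<in> fundamental (L i))}"

definition place :: "('i \<Rightarrow> real) \<Rightarrow> ('i \<Rightarrow> int) \<Rightarrow> 'i \<Rightarrow> real" where
  "place y s = (\<lambda>i. y i + of_int (s i))"

text \<open>The infinite product of the length measures of the circles, relative to the unit intervals
  around \<open>0\<close>: the points with coordinates in the unit cells \<open>s\<close> carry a copy of the
  product of the length measures on unit intervals.\<close>

definition vol :: "('i \<Rightarrow> real) measure" where
  "vol = distr (base \<Otimes>\<^sub>M count_space cells) (restrict_space borel carrier) (\<lambda>(y, s). place y s)"

definition translate :: "('i \<Rightarrow> real) \<Rightarrow> ('i \<Rightarrow> real) \<Rightarrow> 'i \<Rightarrow> real" where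
  "translate t x = (\<lambda>i. wrap (L i) (x i + t i))"

lemma coord_measurable [measurable]: "(\<lambda>x. x i) \<in> borel_measurable (borel :: ('i \<Rightarrow> real) measure)"
  by (rule measurable_product_then_coordinatewise) simp

lemma tube_borel [measurable]: "tube K \<in> sets borel"
proof -
  have "tube K = {x \<in> space borel. \<forall>i. x i \<in> fundamental (L i) \<and> \<bar>x i\<bar> \<le> 1/2 + real K * a i}"
    by (simp add: tube_def)
  also have "\<dots> \<in> sets borel" by measurable
  finally show ?thesis .
qed

lemma carrier_borel [measurable]: "carrier \<in> sets borel"
  unfolding carrier_def by measurable

lemma tube_mono: "K \<le> J \<Longrightarrow> tube K \<subseteq> tube J"
  unfolding tube_def using a_pos
  by (auto intro: order_trans mult_right_mono less_imp_le add_left_mono)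

lemma tube_carrier: "tube K \<subseteq> carrier"
  by (auto simp: carrier_def)

lemma carrier_fundamental: "x \<in> carrier \<Longrightarrow> x i \<in> fundamental (L i)"
  by (auto simp: carrier_def tube_def)

lemma space_vol: "space vol = carrier"
  by (simp add: vol_def space_restrict_space)

lemma sets_vol: "sets vol = sets (restrict_space borel carrier)"
  by (simp add: vol_def)

lemma sets_vol_iff: "A \<in> sets vol \<longleftrightarrow> A \<in> sets borel \<and> A \<subseteq> carrier"
  unfolding sets_vol by (subst sets_restrict_space_iff) auto

lemma tube_vol [measurable]: "tube K \<in> sets vol"
  by (simp add: sets_vol_iff tube_carrier)

lemma prob_space_base: "prob_space base"
  unfolding base_def by (intro prob_space_PiM prob_space_unit_law)

lemma space_base: "y \<in> space base \<longleftrightarrow> (\<forall>i. y i \<in> fundamental 1)"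
  by (auto simp: base_def space_PiM space_unit_law)

lemma base_coord: "(\<lambda>y. y i) \<in> base \<rightarrow>\<^sub>M unit_law"
  unfolding base_def by (rule measurable_component_singleton) simp

lemma base_coord_borel [measurable]: "(\<lambda>y. y i) \<in> borel_measurable base"
  using measurable_compose[OF base_coord unit_law_borel[of "\<lambda>u. u"]] by simp

lemma base_cylinder:
  assumes "finite J" "\<And>i. i \<in> J \<Longrightarrow> A i \<in> sets unit_law"
  shows "emeasure base {y \<in> space base. \<forall>i\<in>J. y i \<in> A i} = (\<Prod>i\<in>J. emeasure unit_law (A i))"
proof -
  interpret unit: prob_space unit_law by (rule prob_space_unit_law)
  interpret product_prob_space "\<lambda>_. unit_law" "UNIV :: 'i set" by unfold_locales
  show ?thesis unfolding base_def using assms by (intro emeasure_PiM_Collect) auto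
qed

lemma countable_cells: "countable cells"
  by (rule countable_subset[OF _ countable_finite_support]) (auto simp: cells_def)

lemma place_fundamental:
  assumes "u \<in> fundamental 1" "of_int z \<in> fundamental (L i)"
  shows "u + of_int z \<in> fundamental (L i)"
  using wrap_odd(1)[OF L_odd assms(1), of i z] wrap_of_fundamental[OF assms(2)]
    wrap_fundamental[of "L i" "u + of_int z"] by simp

lemma place_carrier:
  assumes "y \<in> space base" "s \<in> cells"
  shows "place y s \<in> carrier"
proof -
  have y: "y i \<in> fundamental 1" for i using assms(1) by (simp add: space_base)
  have fin: "finite {i. s i \<noteq> 0}" using assms(2) by (simp add: cells_def)
  \<comment> \<open>Dominates all quotients of \<open>\<bar>s i\<bar>\<close> by \<open>a i\<close>,
    of which only finitely many are nonzero.\<close>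
  define K where "K = nat \<lceil>\<Sum>i\<in>{i. s i \<noteq> 0}. \<bar>of_int (s i)\<bar> / a i\<rceil>"
  have "\<bar>place y s i\<bar> \<le> 1/2 + real K * a i" for i
  proof -
    have "\<bar>y i\<bar> \<le> 1/2" using y[of i] unfolding fundamental_1 by auto
    moreover have "\<bar>of_int (s i)\<bar> \<le> real K * a i"
    proof (cases "s i = 0")
      case False
      have "\<bar>of_int (s i)\<bar> / a i \<le> (\<Sum>i\<in>{i. s i \<noteq> 0}. \<bar>of_int (s i)\<bar> / a i)"
        using False fin a_pos by (intro member_le_sum[of i _ "\<lambda>i. \<bar>of_int (s i)\<bar> / a i"]) (auto intro: less_imp_le divide_nonneg_pos)
      also have "\<dots> \<le> real K" unfolding K_def by linarith
      finally show ?thesis using a_pos[of i] by (simp add: field_simps)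
    qed (use a_pos[of i] in simp)
    ultimately show ?thesis unfolding place_def by linarith
  qed
  moreover have "place y s i \<in> fundamental (L i)" for i
    unfolding place_def using y assms(2) by (intro place_fundamental) (auto simp: cells_def)
  ultimately show ?thesis unfolding carrier_def tube_def by blast
qed

lemma place_measurable:
  "(\<lambda>(y, s). place y s) \<in> base \<Otimes>\<^sub>M count_space cells \<rightarrow>\<^sub>M restrict_space borel carrier"
proof (rule measurable_restrict_space2)
  show "(\<lambda>(y, s). place y s) \<in> space (base \<Otimes>\<^sub>M count_space cells) \<rightarrow> carrier"
    using place_carrier by (auto simp: space_pair_measure)
  show "(\<lambda>(y, s). place y s) \<in> borel_measurable (base \<Otimes>\<^sub>M count_space cells)"
  proof (rule measurable_coordinatewise_then_product)
    fix i
    have [measurable]: "(\<lambda>s. real_of_int (s i)) \<in> borel_measurable (count_space cells)" by simp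
    have "(\<lambda>q. fst q i + real_of_int (snd q i)) \<in> borel_measurable (base \<Otimes>\<^sub>M count_space cells)" by measurable
    then show "(\<lambda>q. (case q of (y, s) \<Rightarrow> place y s) i) \<in> borel_measurable (base \<Otimes>\<^sub>M count_space cells)"
      by (simp add: place_def case_prod_beta)
  qed
qed

lemma sigma_finite_cells: "sigma_finite_measure (count_space cells)"
  by (rule sigma_finite_measure_count_space_countable[OF countable_cells])

text \<open>Integrates, over the positions \<open>y\<close> inside a cell, the number of cells in
  which \<open>y\<close> falls into \<open>A\<close>. Invariance under translations is proved in
  this form.\<close>

lemma emeasure_vol:
  assumes "A \<in> sets vol"
  shows "emeasure vol A = (\<integral>\<^sup>+y. num {s \<in> cells. place y s \<in> A} \<partial>base)"
proof -
  let ?N = "base \<Otimes>\<^sub>M count_space cells"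
  let ?Y = "(\<lambda>(y, s). place y s) -` A \<inter> space ?N"
  have Y: "?Y \<in> sets ?N" using assms by (intro measurable_sets[OF place_measurable]) (simp add: sets_vol)
  have "emeasure vol A = emeasure ?N ?Y"
    unfolding vol_def using assms by (intro emeasure_distr[OF place_measurable]) (simp add: sets_vol)
  also have "\<dots> = (\<integral>\<^sup>+y. emeasure (count_space cells) (Pair y -` ?Y) \<partial>base)"
    by (rule sigma_finite_measure.emeasure_pair_measure_alt[OF sigma_finite_cells Y])
  also have "\<dots> = (\<integral>\<^sup>+y. num {s \<in> cells. place y s \<in> A} \<partial>base)"
  proof (rule nn_integral_cong)
    fix y assume y: "y \<in> space base"
    have eq: "Pair y -` ?Y = {s \<in> cells. place y s \<in> A}" using y by (auto simp: space_pair_measure)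
    show "emeasure (count_space cells) (Pair y -` ?Y) = num {s \<in> cells. place y s \<in> A}"
      unfolding eq num_def by (cases "finite {s \<in> cells. place y s \<in> A}") (auto simp: emeasure_count_space)
  qed
  finally show ?thesis .
qed

text \<open>The other order of integration, cell by cell, is the one suited to estimates.\<close>

lemma emeasure_vol':
  assumes "A \<in> sets vol"
  shows "emeasure vol A = (\<integral>\<^sup>+s. emeasure base {y \<in> space base. place y s \<in> A} \<partial>count_space cells)"
proof -
  let ?N = "base \<Otimes>\<^sub>M count_space cells"
  let ?Y = "(\<lambda>(y, s). place y s) -` A \<inter> space ?N"
  interpret pair_sigma_finite base "count_space cells"
    using sigma_finite_cells prob_space_imp_sigma_finite[OF prob_space_base] by (simp add: pair_sigma_finite_def)
  have Y: "?Y \<in> sets ?N" using assms by (intro measurable_sets[OF place_measurable]) (simp add: sets_vol)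
  have "emeasure vol A = emeasure ?N ?Y"
    unfolding vol_def using assms by (intro emeasure_distr[OF place_measurable]) (simp add: sets_vol)
  also have "\<dots> = (\<integral>\<^sup>+s. emeasure base ((\<lambda>y. (y, s)) -` ?Y) \<partial>count_space cells)"
    by (rule emeasure_pair_measure_alt2[OF Y])
  also have "\<dots> = (\<integral>\<^sup>+s. emeasure base {y \<in> space base. place y s \<in> A} \<partial>count_space cells)"
    by (rule nn_integral_cong) (auto simp: space_pair_measure intro!: arg_cong[where f = "emeasure base"])
  finally show ?thesis .
qed

text \<open>In coordinate \<open>i\<close> the parts of the cells inside the tube have total length
  at most \<open>1 + 2 * K * a i\<close>. A finite sum over cells is dominated by the expansion of
  the product of these totals, and \<open>1 + t \<le> exp t\<close> bounds the product by
  \<open>exp (2 * K * bound)\<close>.\<close>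

lemma emeasure_tube_finite: "emeasure vol (tube K) < \<infinity>"
proof -
  define q where "q i z = {u \<in> fundamental 1. \<bar>u + of_int z\<bar> \<le> 1/2 + real K * a i}" for i and z :: int
  have qs: "q i z \<in> sets borel" for i z
  proof -
    have "q i z = {u \<in> space borel. u \<in> fundamental 1 \<and> \<bar>u + of_int z\<bar> \<le> 1/2 + real K * a i}" by (simp add: q_def)
    also have "\<dots> \<in> sets borel" by measurable
    finally show ?thesis .
  qed
  have qu: "q i z \<in> sets unit_law" for i z using qs by (auto simp: sets_unit_law q_def)
  have q_sum: "(\<Sum>z\<in>Z. emeasure unit_law (q i z)) \<le> ennreal (1 + 2 * real K * a i)" if "finite Z" for i Z
  proof -
    \<comment> \<open>The part of cell \<open>z\<close> inside the tube, translated to its true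
      place; these parts are disjoint subsets of one interval.\<close>
    define I where "I z = {v. v + of_int (- z) \<in> q i z}" for z :: int
    have Is: "I z \<in> sets borel" for z
    proof -
      have "(\<lambda>v. v + real_of_int (- z)) \<in> borel_measurable borel" by measurable
      from measurable_sets[OF this qs[of i z]] show ?thesis by (simp add: I_def vimage_def)
    qed
    have "(\<Sum>z\<in>Z. emeasure unit_law (q i z)) = (\<Sum>z\<in>Z. emeasure lborel (I z))"
      unfolding I_def emeasure_lborel_shift[OF qs] using emeasure_unit_law[OF qu] by simp
    also have "\<dots> = emeasure lborel (\<Union>z\<in>Z. I z)"
    proof (rule sum_emeasure)
      show "I ` Z \<subseteq> sets lborel" using Is by auto
      show "disjoint_family_on I Z"
        unfolding disjoint_family_on_def
      proof (intro ballI impI)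
        fix m n :: int assume "m \<noteq> n"
        have False if "v \<in> I m" "v \<in> I n" for v
        proof -
          have "v - of_int m \<in> fundamental 1" "v - of_int n \<in> fundamental 1"
            using that by (simp_all add: I_def q_def)
          then show False using \<open>m \<noteq> n\<close> by (simp only: floor_half_unique)
        qed
        then show "I m \<inter> I n = {}" by blast
      qed
    qed (rule that)
    also have "\<dots> \<le> emeasure lborel {- (1/2 + real K * a i)..1/2 + real K * a i}"
      by (rule emeasure_mono) (auto simp: I_def q_def)
    also have "\<dots> = ennreal (1 + 2 * real K * a i)"
      using a_pos[of i] by (subst emeasure_lborel_Icc) (auto simp: algebra_simps)
    finally show ?thesis .
  qed
  have "emeasure vol (tube K) \<le> ennreal (exp (2 * real K * bound))"
    unfolding emeasure_vol'[OF tube_vol]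
  proof (rule nn_integral_count_space_le[OF countable_cells])
    fix F assume F: "finite F" "F \<subseteq> cells"
    define J where "J = (\<Union>s\<in>F. {i. s i \<noteq> 0})"
    have J: "finite J" unfolding J_def using F by (auto simp: cells_def)
    define Z where "Z i = (\<lambda>s. s i) ` F" for i :: 'i
    have Z: "finite (Z i)" for i using F by (simp add: Z_def)
    have inj: "inj_on (\<lambda>s. restrict s J) F"
    proof (rule inj_onI)
      fix s t assume st: "s \<in> F" "t \<in> F" "restrict s J = restrict t J"
      show "s = t"
      proof
        fix i show "s i = t i"
        proof (cases "i \<in> J")
          case True
          then show ?thesis using fun_cong[OF st(3), of i] by simp
        next
          case False
          then have "s i = 0" "t i = 0" using st by (auto simp: J_def)
          then show ?thesis by simp
        qed
      qed
    qed
    have "(\<Sum>s\<in>F. emeasure base {y \<in> space base. place y s \<in> tube K}) \<le>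
        (\<Sum>s\<in>F. \<Prod>i\<in>J. emeasure unit_law (q i (restrict s J i)))"
    proof (rule sum_mono)
      fix s assume "s \<in> F"
      have "emeasure base {y \<in> space base. place y s \<in> tube K} \<le> emeasure base {y \<in> space base. \<forall>i\<in>J. y i \<in> q i (s i)}"
      proof (rule emeasure_mono)
        have "{y \<in> space base. \<forall>i\<in>J. y i \<in> q i (s i)} = {y \<in> space base. \<forall>i\<in>J. y i \<in> q i (s i)}" ..
        note [measurable] = qs
        show "{y \<in> space base. \<forall>i\<in>J. y i \<in> q i (s i)} \<in> sets base" using J by measurable
      qed (auto simp: tube_def place_def q_def space_base)
      also have "\<dots> = (\<Prod>i\<in>J. emeasure unit_law (q i (s i)))"
        by (rule base_cylinder[OF J qu])
      finally show "emeasure base {y \<in> space base. place y s \<in> tube K} \<le> (\<Prod>i\<in>J. emeasure unit_law (q i (restrict s J i)))"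
        by simp
    qed
    also have "\<dots> = (\<Sum>s\<in>(\<lambda>s. restrict s J) ` F. \<Prod>i\<in>J. emeasure unit_law (q i (s i)))"
      by (simp add: sum.reindex[OF inj])
    also have "\<dots> \<le> (\<Sum>s\<in>PiE J Z. \<Prod>i\<in>J. emeasure unit_law (q i (s i)))"
      by (rule sum_mono2) (auto simp: Z_def J F intro!: finite_PiE)
    also have "\<dots> = (\<Prod>i\<in>J. \<Sum>z\<in>Z i. emeasure unit_law (q i z))"
      using J Z by (intro prod_sum_PiE[symmetric]) auto
    also have "\<dots> \<le> (\<Prod>i\<in>J. ennreal (exp (2 * real K * a i)))"
    proof (rule prod_mono_ennreal)
      fix i
      have "(\<Sum>z\<in>Z i. emeasure unit_law (q i z)) \<le> ennreal (1 + 2 * real K * a i)" by (rule q_sum[OF Z])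
      also have "\<dots> \<le> ennreal (exp (2 * real K * a i))" by (intro ennreal_leI exp_ge_add_one_self)
      finally show "(\<Sum>z\<in>Z i. emeasure unit_law (q i z)) \<le> ennreal (exp (2 * real K * a i))" .
    qed
    also have "\<dots> = ennreal (exp (2 * real K * sum a J))"
      by (simp add: prod_ennreal exp_sum[OF J, symmetric] sum_distrib_left)
    also have "\<dots> \<le> ennreal (exp (2 * real K * bound))"
      using a_sum[OF J] by (intro ennreal_leI) (simp add: mult_left_mono)
    finally show "(\<Sum>s\<in>F. emeasure base {y \<in> space base. place y s \<in> tube K}) \<le> ennreal (exp (2 * real K * bound))" .
  qed
  also have "\<dots> < \<infinity>" by simp
  finally show ?thesis .
qed

lemma emeasure_hyperplane: "emeasure vol {x \<in> carrier. x i = c} = 0"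
proof -
  have A: "{x \<in> carrier. x i = c} \<in> sets vol"
  proof -
    have "{x \<in> space borel. x \<in> carrier \<and> x i = c} \<in> sets borel" by measurable
    then show ?thesis by (auto simp: sets_vol_iff)
  qed
  have "emeasure base {y \<in> space base. place y s \<in> {x \<in> carrier. x i = c}} = 0" if "s \<in> cells" for s
  proof -
    let ?p = "{c - of_int (s i)} \<inter> fundamental 1"
    have p: "?p \<in> sets unit_law" by (auto simp: sets_unit_law)
    have "emeasure base {y \<in> space base. place y s \<in> {x \<in> carrier. x i = c}} \<le> emeasure base {y \<in> space base. \<forall>i\<in>{i}. y i \<in> ?p}"
    proof (rule emeasure_mono)
      show "{y \<in> space base. \<forall>i\<in>{i}. y i \<in> ?p} \<in> sets base" by measurable
    qed (auto simp: place_def space_base)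
    also have "\<dots> = emeasure unit_law ?p"
      using base_cylinder[of "{i}" "\<lambda>_. ?p"] p by simp
    also have "\<dots> \<le> emeasure lborel {c - of_int (s i)}"
      unfolding emeasure_unit_law[OF p] by (rule emeasure_mono) auto
    finally show ?thesis by simp
  qed
  then have "(\<integral>\<^sup>+s. emeasure base {y \<in> space base. place y s \<in> {x \<in> carrier. x i = c}} \<partial>count_space cells) = (\<integral>\<^sup>+s. 0 \<partial>count_space cells)"
    by (intro nn_integral_cong) simp
  then show ?thesis unfolding emeasure_vol'[OF A] by simp
qed

lemma emeasure_point: "emeasure vol {x} = 0"
proof (cases "x \<in> carrier")
  case True
  have "{x' \<in> carrier. x' undefined = x undefined} \<in> sets vol"
  proof -
    have "{x' \<in> space borel. x' \<in> carrier \<and> x' undefined = x undefined} \<in> sets borel" by measurable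
    then show ?thesis by (auto simp: sets_vol_iff)
  qed
  then have "emeasure vol {x} \<le> emeasure vol {x' \<in> carrier. x' undefined = x undefined}"
    using True by (intro emeasure_mono) auto
  then show ?thesis by (simp add: emeasure_hyperplane)
next
  case False
  then show ?thesis by (intro emeasure_notin_sets) (auto simp: sets_vol_iff)
qed

text \<open>A line, that is a coordinate of length 0, gives infinitely many cells, and each cell
  carries mass 1.\<close>

lemma emeasure_carrier_infinite:
  assumes "L i = 0"
  shows "emeasure vol carrier = \<infinity>"
proof -
  interpret prob_space base by (rule prob_space_base)
  have "infinite cells"
  proof
    assume fin: "finite cells"
    have "range (\<lambda>z::int. (\<lambda>_. 0)(i := z)) \<subseteq> cells"
      using assms by (auto simp: cells_def fundamental_def finite_subset[of _ "{i}"])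
    then have "finite (range (\<lambda>z::int. (\<lambda>_. 0 :: int)(i := z)))" using fin by (rule finite_subset)
    moreover have "inj (\<lambda>z::int. (\<lambda>_. 0 :: int)(i := z))" by (auto simp: inj_on_def fun_eq_iff split: if_splits)
    ultimately show False using finite_imageD infinite_UNIV_int by blast
  qed
  moreover have "{s \<in> cells. place y s \<in> carrier} = cells" if "y \<in> space base" for y
    using place_carrier[OF that] by auto
  ultimately have "num {s \<in> cells. place y s \<in> carrier} = \<infinity>" if "y \<in> space base" for y
    using that by (simp add: num_def)
  then have "(\<integral>\<^sup>+y. num {s \<in> cells. place y s \<in> carrier} \<partial>base) = (\<integral>\<^sup>+y. \<infinity> \<partial>base)"
    by (intro nn_integral_cong)
  moreover have "carrier \<in> sets vol" by (simp add: sets_vol_iff)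
  ultimately have "emeasure vol carrier = (\<integral>\<^sup>+y. \<infinity> \<partial>base)"
    by (simp only: emeasure_vol)
  then show ?thesis by (simp add: emeasure_space_1)
qed

section \<open>Translations of the restricted product\<close>

lemma translate_fundamental: "translate t x i \<in> fundamental (L i)"
  by (simp add: translate_def wrap_fundamental)

lemma translate_tube:
  assumes "x \<in> tube K" "\<And>i. \<bar>wrap (L i) (t i)\<bar> \<le> real C * a i"
  shows "translate t x \<in> tube (K + C)"
proof -
  have "\<bar>translate t x i\<bar> \<le> 1/2 + real (K + C) * a i" for i
  proof -
    have "\<bar>translate t x i\<bar> \<le> \<bar>wrap (L i) (x i)\<bar> + \<bar>wrap (L i) (t i)\<bar>"
      unfolding translate_def by (rule abs_wrap_add_le)
    also have "\<bar>wrap (L i) (x i)\<bar> \<le> \<bar>x i\<bar>" by (rule abs_wrap_le)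
    also have "\<bar>x i\<bar> \<le> 1/2 + real K * a i" using assms(1) by (simp add: tube_def)
    finally show ?thesis using assms(2)[of i] by (simp add: algebra_simps)
  qed
  then show ?thesis using translate_fundamental by (simp add: tube_def)
qed

text \<open>Ensures that \<open>carrier\<close> is preserved and, by summability of
  \<open>a\<close>, that almost every point changes its cell in only finitely many
  coordinates.\<close>

definition moderate :: "('i \<Rightarrow> real) \<Rightarrow> bool" where
  "moderate t \<longleftrightarrow> (\<exists>C::nat. \<forall>i. \<bar>t i\<bar> \<le> real C * a i)"

lemma moderate_wrap: "moderate t \<Longrightarrow> \<exists>C::nat. \<forall>i. \<bar>wrap (L i) (t i)\<bar> \<le> real C * a i"
  unfolding moderate_def using abs_wrap_le order_trans by blast

lemma translate_carrier:
  assumes "moderate t" "x \<in> carrier"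
  shows "translate t x \<in> carrier"
proof -
  obtain C :: nat where "\<And>i. \<bar>wrap (L i) (t i)\<bar> \<le> real C * a i" using moderate_wrap[OF assms(1)] by blast
  moreover obtain K where "x \<in> tube K" using assms(2) by (auto simp: carrier_def)
  ultimately have "translate t x \<in> tube (K + C)" by (intro translate_tube)
  then show ?thesis using tube_carrier by blast
qed

lemma translate_translate: "translate s (translate t x) = translate (\<lambda>i. s i + t i) x"
  by (simp add: translate_def fun_eq_iff algebra_simps)

lemma translate_0: "x \<in> carrier \<Longrightarrow> translate (\<lambda>i. 0) x = x"
  by (simp add: translate_def fun_eq_iff wrap_of_fundamental carrier_fundamental)

lemma translate_minus: "x \<in> carrier \<Longrightarrow> translate (\<lambda>i. - t i) (translate t x) = x"
  by (simp add: translate_translate translate_0)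

lemma translate_measurable:
  assumes "moderate t"
  shows "translate t \<in> vol \<rightarrow>\<^sub>M vol"
  unfolding measurable_cong_sets[OF sets_vol sets_vol]
proof (rule measurable_restrict_space3)
  show "translate t \<in> borel \<rightarrow>\<^sub>M borel"
    unfolding translate_def[abs_def] by (rule measurable_coordinatewise_then_product) measurable
qed (use translate_carrier[OF assms] in auto)

definition base_shift :: "('i \<Rightarrow> real) \<Rightarrow> ('i \<Rightarrow> real) \<Rightarrow> 'i \<Rightarrow> real" where
  "base_shift t y = (\<lambda>i. wrap 1 (y i + t i))"

lemma base_shift_measurable: "base_shift t \<in> base \<rightarrow>\<^sub>M base"
proof -
  have "(\<lambda>y. wrap 1 (y i + t i)) \<in> base \<rightarrow>\<^sub>M unit_law" for i
  proof -
    have "(\<lambda>y. wrap 1 (y i + t i)) \<in> borel_measurable base" by measurable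
    then show ?thesis
      unfolding unit_law_def using wrap_fundamental by (intro measurable_restrict_space2) auto
  qed
  then show ?thesis
    unfolding base_shift_def[abs_def] base_def
    by (intro measurable_PiM_single') (auto simp: space_unit_law wrap_fundamental)
qed

lemma base_shift_distr: "distr base base (base_shift t) = base"
proof -
  interpret unit: prob_space unit_law by (rule prob_space_unit_law)
  interpret product_prob_space "\<lambda>_. unit_law" "UNIV :: 'i set" by unfold_locales
  have "distr base base (base_shift t) = PiM UNIV (\<lambda>_. unit_law)"
  proof (rule PiM_eq)
    fix J :: "'i set" and F assume J: "finite J" "J \<subseteq> UNIV" and F: "\<And>j. j \<in> J \<Longrightarrow> F j \<in> sets unit_law"
    have rot: "(\<lambda>u. wrap 1 (u + c)) \<in> unit_law \<rightarrow>\<^sub>M unit_law" for c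
    proof -
      have "(\<lambda>u. wrap 1 (u + c)) \<in> borel_measurable unit_law"
        by (rule unit_law_borel) measurable
      then show ?thesis
        unfolding unit_law_def using wrap_fundamental by (intro measurable_restrict_space2) (auto simp: unit_law_def)
    qed
    define E where "E j = (\<lambda>u. wrap 1 (u + t j)) -` F j \<inter> space unit_law" for j
    have E: "E j \<in> sets unit_law" if "j \<in> J" for j
      unfolding E_def by (rule measurable_sets[OF rot F[OF that]])
    have emb: "prod_emb UNIV (\<lambda>_. unit_law) J (Pi\<^sub>E J F) \<in> sets base"
      unfolding base_def using J F by (intro sets_PiM_I) auto
    have "emeasure (distr base base (base_shift t)) (prod_emb UNIV (\<lambda>_. unit_law) J (Pi\<^sub>E J F)) =
      emeasure base (base_shift t -` prod_emb UNIV (\<lambda>_. unit_law) J (Pi\<^sub>E J F) \<inter> space base)"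
      by (rule emeasure_distr[OF base_shift_measurable emb])
    also have "base_shift t -` prod_emb UNIV (\<lambda>_. unit_law) J (Pi\<^sub>E J F) \<inter> space base = {y \<in> space base. \<forall>j\<in>J. y j \<in> E j}"
      by (auto simp: prod_emb_def E_def base_shift_def space_base space_unit_law PiE_iff wrap_fundamental)
    also have "emeasure base \<dots> = (\<Prod>j\<in>J. emeasure unit_law (E j))"
      by (rule base_cylinder[OF J(1) E])
    also have "\<dots> = (\<Prod>j\<in>J. emeasure unit_law (F j))"
    proof (rule prod.cong[OF refl])
      fix j assume "j \<in> J"
      then show "emeasure unit_law (E j) = emeasure unit_law (F j)"
        using emeasure_distr[OF rot F, of j "t j"] unit_law_rotation[of "t j"] by (simp add: E_def)
    qed
    finally show "emeasure (distr base base (base_shift t)) (prod_emb UNIV (\<lambda>_. unit_law) J (Pi\<^sub>E J F)) = (\<Prod>j\<in>J. emeasure unit_law (F j))" .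
  qed (simp add: base_def)
  then show ?thesis by (simp add: base_def)
qed

text \<open>The carry is nonzero only if \<open>u + c\<close> leaves the unit interval, which
  confines \<open>u\<close> to an interval of length \<open>\<bar>c\<bar>\<close> at one
  end.\<close>

lemma emeasure_unit_carry: "emeasure unit_law {u \<in> fundamental 1. \<lfloor>u + c + 1/2\<rfloor> \<noteq> 0} \<le> ennreal \<bar>c\<bar>"
proof -
  have A: "{u \<in> fundamental 1. \<lfloor>u + c + 1/2\<rfloor> \<noteq> 0} \<in> sets unit_law"
  proof -
    have "{u \<in> space borel. u \<in> fundamental 1 \<and> \<lfloor>u + c + 1/2\<rfloor> \<noteq> 0} \<in> sets borel" by measurable
    then show ?thesis by (auto simp: sets_unit_law)
  qed
  have carry: "\<lfloor>u + c + 1/2\<rfloor> = 0" if "u + c \<in> fundamental 1" for u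
    using floor_half_unique[of "u + c" 0] that by simp
  show ?thesis
  proof (cases "0 \<le> c")
    case True
    have "emeasure unit_law {u \<in> fundamental 1. \<lfloor>u + c + 1/2\<rfloor> \<noteq> 0} \<le> emeasure lborel {1/2 - c..1/2}"
      unfolding emeasure_unit_law[OF A]
    proof (rule emeasure_mono)
      show "{u \<in> fundamental 1. \<lfloor>u + c + 1/2\<rfloor> \<noteq> 0} \<subseteq> {1/2 - c..1/2}"
      proof
        fix u assume u: "u \<in> {u \<in> fundamental 1. \<lfloor>u + c + 1/2\<rfloor> \<noteq> 0}"
        then have "u + c \<notin> fundamental 1" using carry by auto
        with u True show "u \<in> {1/2 - c..1/2}" unfolding fundamental_1 by auto
      qed
    qed simp
    then show ?thesis using True by simp
  next
    case False
    have "emeasure unit_law {u \<in> fundamental 1. \<lfloor>u + c + 1/2\<rfloor> \<noteq> 0} \<le> emeasure lborel {-1/2..-1/2 - c}"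
      unfolding emeasure_unit_law[OF A]
    proof (rule emeasure_mono)
      show "{u \<in> fundamental 1. \<lfloor>u + c + 1/2\<rfloor> \<noteq> 0} \<subseteq> {-1/2..-1/2 - c}"
      proof
        fix u assume u: "u \<in> {u \<in> fundamental 1. \<lfloor>u + c + 1/2\<rfloor> \<noteq> 0}"
        then have "u + c \<notin> fundamental 1" using carry by auto
        with u False show "u \<in> {-1/2..-1/2 - c}" unfolding fundamental_1 by auto
      qed
    qed simp
    then show ?thesis using False by simp
  qed
qed

text \<open>Borel-Cantelli: coordinate \<open>i\<close> changes its cell with probability at most
  \<open>\<bar>t i\<bar> \<le> C * a i\<close>, a summable bound.\<close>

lemma AE_finite_carry:
  assumes t: "moderate t"
  shows "AE y in base. finite {i. \<lfloor>y i + t i + 1/2\<rfloor> \<noteq> 0}"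
proof -
  interpret prob_space base by (rule prob_space_base)
  obtain C :: nat where C: "\<And>i. \<bar>t i\<bar> \<le> real C * a i" using t by (auto simp: moderate_def)
  define A where "A i = {y \<in> space base. \<lfloor>y i + t i + 1/2\<rfloor> \<noteq> 0}" for i
  have As: "A i \<in> sets base" for i unfolding A_def by measurable
  have Am: "measure base (A i) \<le> real C * a i" for i
  proof -
    let ?p = "{u \<in> fundamental 1. \<lfloor>u + t i + 1/2\<rfloor> \<noteq> 0}"
    have p: "?p \<in> sets unit_law"
    proof -
      have "{u \<in> space borel. u \<in> fundamental 1 \<and> \<lfloor>u + t i + 1/2\<rfloor> \<noteq> 0} \<in> sets borel" by measurable
      then show ?thesis by (auto simp: sets_unit_law)
    qed
    have "A i = {y \<in> space base. \<forall>j\<in>{i}. y j \<in> ?p}" by (auto simp: A_def space_base)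
    then have "emeasure base (A i) = emeasure unit_law ?p"
      using base_cylinder[of "{i}" "\<lambda>_. ?p"] p by simp
    also have "\<dots> \<le> ennreal \<bar>t i\<bar>" by (rule emeasure_unit_carry)
    also have "\<dots> \<le> ennreal (real C * a i)" by (intro ennreal_leI C)
    finally show ?thesis using a_pos[of i] by (simp add: emeasure_eq_measure)
  qed
  define B where "B n = (if n \<in> range (to_nat :: 'i \<Rightarrow> nat) then A (from_nat n) else {})" for n
  have "AE y in base. \<forall>\<^sub>F n in sequentially. y \<in> space base - B n"
  proof (rule borel_cantelli_AE1)
    show "B n \<in> sets base" for n using As by (simp add: B_def)
    show "emeasure base (B n) < \<infinity>" for n by (simp add: emeasure_eq_measure less_top[symmetric])
    show "summable (\<lambda>n. measure base (B n))"
    proof (rule summableI_nonneg_bounded)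
      fix n
      let ?I = "{i :: 'i. to_nat i < n}"
      have fin: "finite ?I" by (rule finite_imageD[of to_nat]) (auto intro: finite_subset[of _ "{..<n}"])
      have "(\<Sum>k<n. measure base (B k)) = (\<Sum>k\<in>to_nat ` ?I. measure base (B k))"
        by (rule sum.mono_neutral_right) (auto simp: B_def)
      also have "\<dots> = (\<Sum>i\<in>?I. measure base (A i))"
        by (subst sum.reindex) (auto simp: B_def inj_on_def)
      also have "\<dots> \<le> (\<Sum>i\<in>?I. real C * a i)" by (rule sum_mono[OF Am])
      also have "\<dots> \<le> real C * bound"
        using a_sum[OF fin] by (simp add: sum_distrib_left[symmetric] mult_left_mono)
      finally show "(\<Sum>k<n. measure base (B k)) \<le> real C * bound" .
    qed simp
  qed
  then show ?thesis
  proof (rule AE_mp, intro AE_I2 impI)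
    fix y assume y: "y \<in> space base" "\<forall>\<^sub>F n in sequentially. y \<in> space base - B n"
    then obtain N where N: "\<And>n. n \<ge> N \<Longrightarrow> y \<notin> B n" by (auto simp: eventually_sequentially)
    have "{i. \<lfloor>y i + t i + 1/2\<rfloor> \<noteq> 0} \<subseteq> {i. to_nat i < N}"
    proof
      fix i assume "i \<in> {i. \<lfloor>y i + t i + 1/2\<rfloor> \<noteq> 0}"
      then have "y \<in> B (to_nat i)" using y(1) by (simp add: B_def A_def)
      then show "i \<in> {i. to_nat i < N}" using N[of "to_nat i"] by fastforce
    qed
    moreover have "finite {i :: 'i. to_nat i < N}"
      by (rule finite_imageD[of to_nat]) (auto intro: finite_subset[of _ "{..<N}"])
    ultimately show "finite {i. \<lfloor>y i + t i + 1/2\<rfloor> \<noteq> 0}" by (rule finite_subset)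
  qed
qed

text \<open>Addition in the product of the groups of integers modulo \<open>L i\<close>, with
  representatives in \<open>fundamental (L i)\<close>. The floor only changes the type, as its
  argument is an integer.\<close>

definition cell_shift :: "('i \<Rightarrow> int) \<Rightarrow> ('i \<Rightarrow> int) \<Rightarrow> 'i \<Rightarrow> int" where
  "cell_shift r s = (\<lambda>i. \<lfloor>wrap (L i) (of_int (r i + s i))\<rfloor>)"

lemma cell_shift: "of_int (cell_shift r s i) = wrap (L i) (of_int (r i + s i))"
  using wrap_odd(2)[OF L_odd, of 0 i "r i + s i"] by (auto simp: cell_shift_def fundamental_def elim: Ints_cases)

lemma cell_shift_cells:
  assumes "finite {i. r i \<noteq> 0}" "s \<in> cells"
  shows "cell_shift r s \<in> cells"
proof -
  have "{i. cell_shift r s i \<noteq> 0} \<subseteq> {i. r i \<noteq> 0} \<union> {i. s i \<noteq> 0}"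
  proof
    fix i assume "i \<in> {i. cell_shift r s i \<noteq> 0}"
    then have "wrap (L i) (of_int (r i + s i)) \<noteq> 0" using cell_shift[of r s i] by simp
    then have "real_of_int (r i + s i) \<noteq> 0" using abs_wrap_le[of "L i" 0] by force
    then have "r i + s i \<noteq> 0" by simp
    then show "i \<in> {i. r i \<noteq> 0} \<union> {i. s i \<noteq> 0}" by auto
  qed
  then show ?thesis
    using assms unfolding cells_def by (auto simp: cell_shift wrap_fundamental intro: finite_subset)
qed

lemma cell_shift_bij:
  assumes "finite {i. r i \<noteq> 0}"
  shows "bij_betw (cell_shift r) cells cells"
proof (rule bij_betwI[where g = "cell_shift (\<lambda>i. - r i)"])
  have inv: "cell_shift (\<lambda>i. - r' i) (cell_shift r' s) = s" if "s \<in> cells" for r' s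
  proof
    fix i
    have "real_of_int (cell_shift (\<lambda>i. - r' i) (cell_shift r' s) i) = wrap (L i) (- of_int (r' i) + wrap (L i) (of_int (r' i + s i)))"
      unfolding cell_shift by (simp add: cell_shift)
    also have "\<dots> = wrap (L i) (- of_int (r' i) + of_int (r' i + s i))" by (rule wrap_add_wrap(2))
    also have "\<dots> = of_int (s i)"
      using that by (simp add: cells_def wrap_of_fundamental)
    finally show "cell_shift (\<lambda>i. - r' i) (cell_shift r' s) i = s i" by simp
  qed
  show "cell_shift (\<lambda>i. - r i) (cell_shift r s) = s" if "s \<in> cells" for s by (rule inv[OF that])
  show "cell_shift r (cell_shift (\<lambda>i. - r i) s) = s" if "s \<in> cells" for s
    using inv[OF that, of "\<lambda>i. - r i"] by simp
qed (use assms cell_shift_cells in auto)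

text \<open>A translation is a skew product: a rotation of the positions inside the unit cells and,
  over it, addition of the carries to the cell indices.\<close>

lemma translate_place:
  "translate t (place y s) = place (base_shift t y) (cell_shift (\<lambda>i. \<lfloor>y i + t i + 1/2\<rfloor>) s)"
proof
  fix i
  let ?r = "\<lfloor>y i + t i + 1/2\<rfloor>"
  have b: "base_shift t y i = y i + t i - of_int ?r" by (simp add: base_shift_def wrap_def)
  have "translate t (place y s) i = wrap (L i) (base_shift t y i + of_int (?r + s i))"
    unfolding b by (simp add: translate_def place_def algebra_simps)
  also have "\<dots> = base_shift t y i + wrap (L i) (of_int (?r + s i))"
    by (rule wrap_odd(1)[OF L_odd]) (simp only: base_shift_def wrap_fundamental)
  finally show "translate t (place y s) i = place (base_shift t y) (cell_shift (\<lambda>i. \<lfloor>y i + t i + 1/2\<rfloor>) s) i"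
    by (simp only: place_def cell_shift)
qed

text \<open>For almost every \<open>y\<close> there are finitely many carries, so that the cell
  indices are permuted and the number of cells over \<open>y\<close> equals that over
  \<open>base_shift t y\<close>; the rotation \<open>base_shift t\<close> preserves
  \<open>base\<close>.\<close>

lemma translate_distr:
  assumes t: "moderate t"
  shows "distr vol vol (translate t) = vol"
proof (rule measure_eqI)
  fix A assume "A \<in> sets (distr vol vol (translate t))"
  then have A: "A \<in> sets vol" by simp
  let ?A = "translate t -` A \<inter> space vol"
  have A': "?A \<in> sets vol" by (rule measurable_sets[OF translate_measurable[OF t] A])
  define G where "G y = num {s \<in> cells. place y s \<in> A}" for y
  have "(\<lambda>y. \<integral>\<^sup>+s. indicator A (place y s) \<partial>count_space cells) \<in> borel_measurable base"
  proof -
    interpret sigma_finite_measure "count_space cells" by (rule sigma_finite_cells)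
    have "(\<lambda>q. indicator A (case q of (y, s) \<Rightarrow> place y s) :: ennreal) \<in> borel_measurable (base \<Otimes>\<^sub>M count_space cells)"
      using A by (intro measurable_compose[OF place_measurable] borel_measurable_indicator) (simp add: sets_vol)
    then show ?thesis by (intro borel_measurable_nn_integral) (simp add: case_prod_beta)
  qed
  moreover have "(\<integral>\<^sup>+s. indicator A (place y s) \<partial>count_space cells) = G y" for y
  proof -
    have "(\<integral>\<^sup>+s. indicator A (place y s) \<partial>count_space cells) = (\<integral>\<^sup>+s. indicator {s \<in> cells. place y s \<in> A} s \<partial>count_space cells)"
      by (intro nn_integral_cong) (auto simp: indicator_def)
    also have "\<dots> = emeasure (count_space cells) {s \<in> cells. place y s \<in> A}" by simp
    also have "\<dots> = G y" unfolding G_def num_def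
      by (cases "finite {s \<in> cells. place y s \<in> A}") (auto simp: emeasure_count_space)
    finally show ?thesis .
  qed
  ultimately have Gm: "G \<in> borel_measurable base" by simp
  have "emeasure (distr vol vol (translate t)) A = emeasure vol ?A"
    by (rule emeasure_distr[OF translate_measurable[OF t] A])
  also have "\<dots> = (\<integral>\<^sup>+y. num {s \<in> cells. place y s \<in> ?A} \<partial>base)" by (rule emeasure_vol[OF A'])
  also have "\<dots> = (\<integral>\<^sup>+y. G (base_shift t y) \<partial>base)"
  proof (rule nn_integral_cong_AE)
    show "AE y in base. num {s \<in> cells. place y s \<in> ?A} = G (base_shift t y)"
      using AE_finite_carry[OF t]
    proof (rule AE_mp, intro AE_I2 impI)
      fix y assume y: "y \<in> space base" "finite {i. \<lfloor>y i + t i + 1/2\<rfloor> \<noteq> 0}"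
      let ?\<beta> = "cell_shift (\<lambda>i. \<lfloor>y i + t i + 1/2\<rfloor>)"
      have bij: "bij_betw ?\<beta> cells cells" by (rule cell_shift_bij) (use y in simp)
      have "{s \<in> cells. place y s \<in> ?A} = {s \<in> cells. place (base_shift t y) (?\<beta> s) \<in> A}"
        using place_carrier[OF y(1)] by (auto simp: space_vol translate_place)
      moreover have "{s \<in> cells. place (base_shift t y) s \<in> A} = ?\<beta> ` {s \<in> cells. place (base_shift t y) (?\<beta> s) \<in> A}"
        using bij_betw_imp_surj_on[OF bij] by auto
      moreover have "inj_on ?\<beta> {s \<in> cells. place (base_shift t y) (?\<beta> s) \<in> A}"
        using bij by (auto simp: bij_betw_def intro: inj_on_subset)
      ultimately show "num {s \<in> cells. place y s \<in> ?A} = G (base_shift t y)"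
        unfolding G_def by (simp add: num_image)
    qed
  qed
  also have "\<dots> = (\<integral>\<^sup>+y. G y \<partial>distr base base (base_shift t))"
    by (rule nn_integral_distr[symmetric, OF base_shift_measurable]) (use Gm in \<open>simp add: base_shift_distr\<close>)
  also have "\<dots> = emeasure vol A" by (simp add: base_shift_distr G_def emeasure_vol[OF A])
  finally show "emeasure (distr vol vol (translate t)) A = emeasure vol A" .
qed simp

lemma emeasure_translate:
  "moderate t \<Longrightarrow> A \<in> sets vol \<Longrightarrow> emeasure vol (translate t -` A \<inter> carrier) = emeasure vol A"
  using emeasure_distr[OF translate_measurable, of t A] translate_distr[of t] by (simp add: space_vol)

section \<open>Small translations are close to the identity\<close>

lemma sets_vol_sigma: "sets vol = sigma_sets carrier {{x \<in> carrier. x i \<le> c} | i c. True}"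
proof
  let ?G = "{{x \<in> carrier. x i \<le> c} | i c. True}"
  have GP: "?G \<subseteq> Pow carrier" by auto
  show "sigma_sets carrier ?G \<subseteq> sets vol"
    unfolding space_vol[symmetric]
  proof (rule sets.sigma_sets_subset, clarify)
    fix i c
    have "{x \<in> space borel. x \<in> carrier \<and> x i \<le> c} \<in> sets borel" by measurable
    then show "{x \<in> space vol. x i \<le> c} \<in> sets vol" by (auto simp: sets_vol_iff space_vol)
  qed
  have "(\<lambda>x. x) \<in> borel_measurable (sigma carrier ?G)"
  proof (rule measurable_coordinatewise_then_product, rule borel_measurable_iff_le[THEN iffD2], intro allI)
    fix i c
    have "{x \<in> carrier. x i \<le> c} \<in> ?G" by blast
    then show "{x \<in> space (sigma carrier ?G). x i \<le> c} \<in> sets (sigma carrier ?G)"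
      unfolding space_measure_of[OF GP] sets_measure_of[OF GP] by (rule sigma_sets.Basic)
  qed
  note im = measurable_sets[OF this, unfolded space_measure_of[OF GP] sets_measure_of[OF GP]]
  show "sets vol \<subseteq> sigma_sets carrier ?G"
  proof
    fix A assume "A \<in> sets vol"
    then have A: "A \<in> sets borel" "A \<subseteq> carrier" by (auto simp: sets_vol_iff)
    then have "(\<lambda>x. x) -` A \<inter> carrier = A" by auto
    with im[OF A(1)] show "A \<in> sigma_sets carrier ?G" by simp
  qed
qed

text \<open>Inside a tube, which has finite measure, the strips decrease to part of two hyperplanes,
  and hyperplanes are null.\<close>

lemma measure_near_tendsto_0:
  fixes e :: "nat \<Rightarrow> real"
  assumes e: "e \<longlonglongrightarrow> 0"
  shows "(\<lambda>k. measure vol {x \<in> tube K. \<bar>\<bar>x i\<bar> - c\<bar> \<le> e k}) \<longlonglongrightarrow> 0"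
proof -
  define N where "N d = {x \<in> tube K. \<bar>\<bar>x i\<bar> - c\<bar> \<le> d}" for d :: real
  have Ns: "N d \<in> sets vol" for d
  proof -
    have "{x \<in> space borel. x \<in> tube K \<and> \<bar>\<bar>x i\<bar> - c\<bar> \<le> d} \<in> sets borel" by measurable
    then show ?thesis using tube_carrier by (auto simp: sets_vol_iff N_def)
  qed
  have Nf: "N d \<in> fmeasurable vol" for d
    by (rule fmeasurableI2[of "tube K"]) (use Ns emeasure_tube_finite in \<open>auto simp: N_def fmeasurable_def\<close>)
  have "(\<lambda>n. measure vol (N (1 / Suc n))) \<longlonglongrightarrow> measure vol (\<Inter>n. N (1 / Suc n))"
  proof (rule Lim_measure_decseq)
    show "decseq (\<lambda>n. N (1 / Suc n))"
      unfolding decseq_def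
    proof (intro allI impI subsetI)
      fix m n x assume "m \<le> n" "x \<in> N (1 / Suc n)"
      moreover then have "1 / real (Suc n) \<le> 1 / real (Suc m)" by (intro divide_left_mono) auto
      ultimately show "x \<in> N (1 / Suc m)" by (auto simp: N_def)
    qed
    show "emeasure vol (N (1 / Suc n)) \<noteq> \<infinity>" for n using Nf[of "1 / Suc n"] by (auto simp: fmeasurable_def)
  qed (use Ns in auto)
  also have "measure vol (\<Inter>n. N (1 / Suc n)) = 0"
  proof -
    have H: "{x \<in> carrier. x i = d} \<in> null_sets vol" for d
    proof -
      have "{x \<in> space borel. x \<in> carrier \<and> x i = d} \<in> sets borel" by measurable
      then have "{x \<in> carrier. x i = d} \<in> sets vol" by (auto simp: sets_vol_iff)
      then show ?thesis using emeasure_hyperplane by (intro null_setsI) auto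
    qed
    have "(\<Inter>n. N (1 / Suc n)) \<subseteq> {x \<in> carrier. x i = c} \<union> {x \<in> carrier. x i = - c}"
    proof
      fix x assume x: "x \<in> (\<Inter>n. N (1 / Suc n))"
      have "\<bar>\<bar>x i\<bar> - c\<bar> \<le> 0"
      proof (rule field_le_epsilon)
        fix d :: real assume "0 < d"
        then obtain n where n: "inverse (real (Suc n)) < d" using reals_Archimedean by blast
        have "\<bar>\<bar>x i\<bar> - c\<bar> \<le> 1 / real (Suc n)" using x by (auto simp: N_def)
        then show "\<bar>\<bar>x i\<bar> - c\<bar> \<le> 0 + d" using n by (simp add: inverse_eq_divide)
      qed
      then have "\<bar>x i\<bar> = c" by simp
      moreover have "x \<in> carrier" using x tube_carrier by (auto simp: N_def)
      ultimately show "x \<in> {x \<in> carrier. x i = c} \<union> {x \<in> carrier. x i = - c}" by auto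
    qed
    moreover have "{x \<in> carrier. x i = c} \<union> {x \<in> carrier. x i = - c} \<in> null_sets vol"
      by (intro null_sets.Un H)
    ultimately have "(\<Inter>n. N (1 / Suc n)) \<in> null_sets vol"
      by (rule null_sets_subset[rotated -1]) (use Ns in auto)
    then show ?thesis by (simp add: null_setsD1 measure_def)
  qed
  finally have lim: "(\<lambda>n. measure vol (N (1 / Suc n))) \<longlonglongrightarrow> 0" .
  show ?thesis
    unfolding N_def[symmetric]
  proof (rule tendstoI)
    fix d :: real assume "0 < d"
    then have "\<forall>\<^sub>F n in sequentially. measure vol (N (1 / Suc n)) < d"
      using order_tendstoD(2)[OF lim] by blast
    then obtain n where n: "measure vol (N (1 / Suc n)) < d" by (auto simp: eventually_sequentially)
    have "\<forall>\<^sub>F k in sequentially. e k < 1 / Suc n"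
      by (rule order_tendstoD(2)[OF e]) simp
    then show "\<forall>\<^sub>F k in sequentially. dist (measure vol (N (e k))) 0 < d"
    proof eventually_elim
      case (elim k)
      have "measure vol (N (e k)) \<le> measure vol (N (1 / Suc n))"
        using elim Ns Nf by (intro measure_mono_fmeasurable) (auto simp: N_def)
      then show ?case using n by simp
    qed
  qed
qed

text \<open>Half-spaces \<open>x i \<le> c\<close> generate, so they suffice. A small rotation of
  coordinate \<open>i\<close> changes membership only for \<open>\<bar>x i\<bar>\<close> near
  \<open>\<bar>c\<bar>\<close> or near \<open>L i / 2\<close>, where the circle is cut open. As
  tubes are moved into the next tube, one window controls a set that lies in a tube.\<close>

lemma translate_recurrent:
  fixes t :: "nat \<Rightarrow> 'i \<Rightarrow> real" and e :: "nat \<Rightarrow> real"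
  assumes t: "\<And>k. moderate (t k)" and e: "e \<longlonglongrightarrow> 0" "\<And>k. e k \<le> 1"
    and te: "\<And>k i. \<bar>wrap (L i) (t k i)\<bar> \<le> e k * a i"
    and A: "A \<in> sets vol" "A \<subseteq> tube J"
  shows "(\<lambda>k. measure vol (sym_diff A (translate (t k) -` A \<inter> space vol))) \<longlonglongrightarrow> 0"
proof -
  have tube: "translate (t k) x \<in> tube (Suc K)" if "x \<in> tube K" for x K k
  proof -
    have "\<bar>wrap (L i) (t k i)\<bar> \<le> real 1 * a i" for i
    proof -
      have "e k * a i \<le> 1 * a i" using e(2)[of k] a_pos[of i] by (intro mult_right_mono) auto
      then show ?thesis using te[of i k] by simp
    qed
    from translate_tube[OF that this] show ?thesis by simp
  qed
  have tube': "x \<in> tube (Suc K)" if "x \<in> carrier" "translate (t k) x \<in> tube K" for x K k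
  proof -
    have "\<bar>wrap (L i) (- t k i)\<bar> \<le> real 1 * a i" for i
    proof -
      have "e k * a i \<le> 1 * a i" using e(2)[of k] a_pos[of i] by (intro mult_right_mono) auto
      then show ?thesis using te[of i k] by (simp add: abs_wrap_minus)
    qed
    from translate_tube[OF that(2) this] show ?thesis using translate_minus[OF that(1)] by simp
  qed
  have lim: "(\<lambda>k. measure vol (sym_diff A (translate (t k) -` A \<inter> space vol) \<inter> tube (Suc J))) \<longlonglongrightarrow> 0"
  proof (rule measure_symdiff_tendsto_0[OF translate_measurable[OF t] tube_vol emeasure_tube_finite])
    fix k K B assume B: "B \<in> sets vol"
    have Bt: "B \<inter> tube (Suc K) \<in> sets vol" using B by auto
    have BF: "B \<inter> tube (Suc K) \<in> fmeasurable vol"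
      by (rule fmeasurableI2[of "tube (Suc K)"]) (use Bt emeasure_tube_finite in \<open>auto simp: fmeasurable_def\<close>)
    have "measure vol (translate (t k) -` B \<inter> tube K) \<le> measure vol (translate (t k) -` (B \<inter> tube (Suc K)) \<inter> space vol)"
    proof (rule measure_mono_fmeasurable)
      show "translate (t k) -` (B \<inter> tube (Suc K)) \<inter> space vol \<in> fmeasurable vol"
        using measurable_sets[OF translate_measurable[OF t] Bt, of k] BF emeasure_translate[OF t Bt, of k]
        by (simp add: fmeasurable_def space_vol)
      have "translate (t k) -` B \<inter> tube K = (translate (t k) -` B \<inter> space vol) \<inter> tube K"
        using tube_carrier by (auto simp: space_vol)
      then show "translate (t k) -` B \<inter> tube K \<in> sets vol"
        using measurable_sets[OF translate_measurable[OF t] B, of k] by auto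
      show "translate (t k) -` B \<inter> tube K \<subseteq> translate (t k) -` (B \<inter> tube (Suc K)) \<inter> space vol"
        using tube tube_carrier[of K] by (auto simp: space_vol)
    qed
    also have "\<dots> = measure vol (B \<inter> tube (Suc K))"
      using emeasure_translate[OF t Bt, of k] by (simp add: measure_def space_vol)
    finally show "measure vol (translate (t k) -` B \<inter> tube K) \<le> measure vol (B \<inter> tube (Suc K))" .
  next
    show "sets vol = sigma_sets (space vol) {{x \<in> carrier. x i \<le> c} | i c. True}"
      unfolding space_vol by (rule sets_vol_sigma)
    fix B K assume "B \<in> {{x \<in> carrier. x i \<le> c} | i c. True}"
    then obtain i c where B: "B = {x \<in> carrier. x i \<le> c}" by blast
    define d where "d k = e k * a i" for k
    have d: "d \<longlonglongrightarrow> 0" unfolding d_def using tendsto_mult_right[OF e(1), of "a i"] by simp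
    define N where "N b k = {x \<in> tube K. \<bar>\<bar>x i\<bar> - b\<bar> \<le> d k}" for b k
    have Nf: "N b k \<in> fmeasurable vol" for b k
    proof (rule fmeasurableI2[of "tube K"])
      have "{x \<in> space borel. x \<in> tube K \<and> \<bar>\<bar>x i\<bar> - b\<bar> \<le> d k} \<in> sets borel" by measurable
      then show "N b k \<in> sets vol" using tube_carrier by (auto simp: sets_vol_iff N_def)
    qed (use emeasure_tube_finite in \<open>auto simp: N_def fmeasurable_def\<close>)
    have Bs: "B \<in> sets vol" unfolding sets_vol_sigma B by (rule sigma_sets.Basic) blast
    have sub: "sym_diff B (translate (t k) -` B \<inter> space vol) \<inter> tube K \<subseteq> N \<bar>c\<bar> k \<union> N (real (L i) / 2) k" for k
    proof
      fix x assume x: "x \<in> sym_diff B (translate (t k) -` B \<inter> space vol) \<inter> tube K"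
      define \<tau> where "\<tau> = wrap (L i) (t k i)"
      have \<tau>: "\<bar>\<tau>\<bar> \<le> d k" using te by (simp add: \<tau>_def d_def)
      have xf: "x i \<in> fundamental (L i)" using x by (simp add: tube_def)
      have tr: "translate (t k) x i = wrap (L i) (x i + \<tau>)" by (simp add: translate_def \<tau>_def)
      have xc: "x \<in> carrier" using x tube_carrier by auto
      have diff: "(x i \<le> c) \<noteq> (translate (t k) x i \<le> c)"
        using x xc translate_carrier[OF t xc, of k] by (auto simp: B space_vol)
      show "x \<in> N \<bar>c\<bar> k \<union> N (real (L i) / 2) k"
      proof (cases "x i + \<tau> \<in> fundamental (L i)")
        case True
        then have "\<bar>x i - c\<bar> \<le> \<bar>\<tau>\<bar>" using diff unfolding tr by (auto simp: wrap_of_fundamental)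
        then have "\<bar>\<bar>x i\<bar> - \<bar>c\<bar>\<bar> \<le> d k" using \<tau> by linarith
        then show ?thesis using x by (auto simp: N_def)
      next
        case False
        then have "\<bar>\<bar>x i\<bar> - real (L i) / 2\<bar> \<le> \<bar>\<tau>\<bar>" using xf by (auto simp: fundamental_def)
        then show ?thesis using x \<tau> by (auto simp: N_def)
      qed
    qed
    have le: "measure vol (sym_diff B (translate (t k) -` B \<inter> space vol) \<inter> tube K) \<le> measure vol (N \<bar>c\<bar> k) + measure vol (N (real (L i) / 2) k)" for k
    proof -
      have "measure vol (sym_diff B (translate (t k) -` B \<inter> space vol) \<inter> tube K) \<le> measure vol (N \<bar>c\<bar> k \<union> N (real (L i) / 2) k)"
        using measurable_sets[OF translate_measurable[OF t] Bs, of k] Bs sub Nf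
        by (intro measure_mono_fmeasurable) auto
      also have "\<dots> \<le> measure vol (N \<bar>c\<bar> k) + measure vol (N (real (L i) / 2) k)"
        using Nf by (intro measure_Un_le) (auto simp: fmeasurable_def)
      finally show ?thesis .
    qed
    have "(\<lambda>k. measure vol (N \<bar>c\<bar> k) + measure vol (N (real (L i) / 2) k)) \<longlonglongrightarrow> 0 + 0"
      unfolding N_def by (intro tendsto_add measure_near_tendsto_0 d)
    then have lim: "(\<lambda>k. measure vol (N \<bar>c\<bar> k) + measure vol (N (real (L i) / 2) k)) \<longlonglongrightarrow> 0" by simp
    show "(\<lambda>k. measure vol (sym_diff B (translate (t k) -` B \<inter> space vol) \<inter> tube K)) \<longlonglongrightarrow> 0"
      by (rule tendsto_sandwich[OF _ _ tendsto_const lim]) (use le in \<open>auto intro!: always_eventually\<close>)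
  qed (rule A(1))
  have "sym_diff A (translate (t k) -` A \<inter> space vol) \<inter> tube (Suc J) = sym_diff A (translate (t k) -` A \<inter> space vol)" for k
    using A(2) tube_mono[of J "Suc J"] tube'[of _ k J] by (auto simp: space_vol)
  then show ?thesis using lim by (simp only:)
qed

end

section \<open>Translation actions\<close>

text \<open>On a subset of finite positive measure the distribution function is continuous, because
  points are null, so by the intermediate value theorem a half-line cuts off exactly half of the
  mass.\<close>

lemma nonatomic_if_points_null:
  fixes M :: "real measure"
  assumes "space M \<in> sets borel" "sets M = sets (restrict_space borel (space M))"
    and "sigma_finite_measure M" and null: "\<And>x. x \<in> space M \<Longrightarrow> emeasure M {x} = 0"
  shows "nonatomic M"
  unfolding nonatomic_def
proof (intro ballI impI)
  interpret sigma_finite_measure M by fact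
  fix A assume A: "A \<in> sets M" "0 < emeasure M A"
  have Int_borel: "B \<inter> C \<in> sets M" if "B \<in> sets M" "C \<in> sets borel" for B C
  proof -
    have "B \<in> (\<inter>) (space M) ` sets borel" using that(1) unfolding assms(2) sets_restrict_space .
    then obtain D where "D \<in> sets borel" "B = space M \<inter> D" by blast
    then have "B \<inter> C = space M \<inter> (D \<inter> C)" "D \<inter> C \<in> sets borel" using that(2) by auto
    then have "B \<inter> C \<in> (\<inter>) (space M) ` sets borel" by (rule image_eqI)
    then show ?thesis unfolding assms(2) sets_restrict_space .
  qed
  have A0: "\<exists>B\<in>sets M. B \<subseteq> A \<and> 0 < emeasure M B \<and> emeasure M B < \<infinity>"
  proof (cases "emeasure M A < \<infinity>")
    case True
    then show ?thesis using A by blast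
  next
    case False
    then have "emeasure M A = \<infinity>" by (simp add: less_top[symmetric])
    then obtain B where B: "B \<in> sets M" "B \<subseteq> A" "emeasure M B < \<infinity>" "ennreal 1 < emeasure M B"
      by (rule approx_PInf_emeasure_with_finite[OF A(1)])
    have "0 < emeasure M B" by (rule le_less_trans[OF zero_le B(4)])
    then show ?thesis using B by blast
  qed
  then obtain B where B: "B \<in> sets M" "B \<subseteq> A" "0 < emeasure M B" "emeasure M B < \<infinity>" by blast
  define \<nu> where "\<nu> = distr (density M (indicator B)) borel (\<lambda>x. x)"
  have idm: "(\<lambda>x. x) \<in> borel_measurable (density M (indicator B))"
    using measurable_restrict_space1[of "\<lambda>x. x" borel borel "space M"]
    by (simp cong: measurable_cong_sets add: assms(2))
  have \<nu>: "emeasure \<nu> C = emeasure M (B \<inter> C)" if "C \<in> sets borel" for C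
  proof -
    have "emeasure \<nu> C = emeasure (density M (indicator B)) (C \<inter> space M)"
      unfolding \<nu>_def using that by (subst emeasure_distr[OF idm]) auto
    also have "\<dots> = (\<integral>\<^sup>+x. indicator B x * indicator (C \<inter> space M) x \<partial>M)"
      using B Int_borel[OF sets.top that] by (intro emeasure_density) (auto simp: Int_commute)
    also have "\<dots> = (\<integral>\<^sup>+x. indicator (B \<inter> C) x \<partial>M)"
      by (intro nn_integral_cong) (auto simp: indicator_def)
    also have "\<dots> = emeasure M (B \<inter> C)" using Int_borel[OF B(1) that] by simp
    finally show ?thesis .
  qed
  have [simp]: "sets \<nu> = sets borel" "space \<nu> = UNIV" by (simp_all add: \<nu>_def)
  have tot: "emeasure \<nu> UNIV = emeasure M B" using \<nu>[of UNIV] by simp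
  interpret finite_borel_measure \<nu>
  proof (rule finite_borel_measure.intro[OF finite_measureI finite_borel_measure_axioms.intro])
    show "emeasure \<nu> (space \<nu>) \<noteq> \<infinity>" using tot B(4) by simp
  qed simp
  have cont: "continuous_on UNIV (cdf \<nu>)"
  proof (rule continuous_at_imp_continuous_on, intro ballI)
    fix x
    have "emeasure M (B \<inter> {x}) = 0"
    proof (cases "x \<in> B")
      case True
      then have "x \<in> space M" using sets.sets_into_space[OF B(1)] by auto
      then show ?thesis using null[of x] True by (simp add: Int_absorb1)
    qed simp
    then show "isCont (cdf \<nu>) x"
      unfolding isCont_cdf using \<nu>[of "{x}"] by (simp add: measure_def)
  qed
  define m where "m = measure \<nu> UNIV"
  have m: "0 < m" "emeasure M B = ennreal m"
  proof -
    show "emeasure M B = ennreal m" using tot by (simp add: m_def emeasure_eq_measure)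
    then have "0 < ennreal m" using B(3) by simp
    then show "0 < m" by (simp only: ennreal_less_zero_iff)
  qed
  have "\<forall>\<^sub>F x in at_bot. cdf \<nu> x < m / 2"
    by (rule order_tendstoD(2)[OF cdf_lim_at_bot]) (use m in simp)
  then obtain x1 where x1: "cdf \<nu> x1 < m / 2" by (auto simp: eventually_at_bot_linorder)
  have "\<forall>\<^sub>F x in at_top. m / 2 < cdf \<nu> x"
    using order_tendstoD(1)[OF cdf_lim_at_top, of "m / 2"] m by (simp add: m_def)
  then obtain x2 where x2: "m / 2 < cdf \<nu> x2" by (auto simp: eventually_at_top_linorder)
  have "x1 \<le> x2"
    using cdf_nondecreasing[of x2 x1] x1 x2 by (cases "x1 \<le> x2") auto
  then obtain x where x: "cdf \<nu> x = m / 2"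
    using IVT'[of "cdf \<nu>" x1 "m / 2" x2] x1 x2 cont by (auto intro: continuous_on_subset)
  have "emeasure M (B \<inter> {..x}) = ennreal (cdf \<nu> x)"
    using \<nu>[of "{..x}"] by (simp add: cdf_def emeasure_eq_measure)
  then have "emeasure M (B \<inter> {..x}) = ennreal (m / 2)" unfolding x .
  moreover have "ennreal (m / 2) < ennreal m" "0 < ennreal (m / 2)"
    using m(1) by (simp_all add: ennreal_less_iff)
  moreover have "emeasure M B \<le> emeasure M A" using A B by (intro emeasure_mono) auto
  ultimately show "\<exists>C\<in>sets M. C \<subseteq> A \<and> 0 < emeasure M C \<and> emeasure M C < emeasure M A"
    using B m Int_borel[OF B(1), of "{..x}"] by (intro bexI[of _ "B \<inter> {..x}"]) auto
qed

text \<open>The coordinate \<open>ax\<close> is a line on which the group acts trivially.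
  Translations along it commute with the action and supply infinitely many copies of a piece of the
  fundamental domain.\<close>

locale torus_action = torus_product L a bound
  for L :: "'i::countable \<Rightarrow> nat" and a bound +
  fixes l :: "real^'n \<Rightarrow> 'i \<Rightarrow> real" and ax :: 'i
  assumes l_add: "l (g + h) i = l g i + l h i"
    and l_scale: "l (c *\<^sub>R g) i = c * l g i"
    and l_le: "\<bar>l g i\<bar> \<le> a i * norm g"
    and L_ax: "L ax = 0" and l_ax: "l g ax = 0"
begin

definition act :: "real^'n \<Rightarrow> ('i \<Rightarrow> real) \<Rightarrow> 'i \<Rightarrow> real" where
  "act g = translate (l g)"

lemma moderate_l: "moderate (l g)"
  unfolding moderate_def
proof (intro exI allI)
  fix i
  have "norm g \<le> real (nat \<lceil>norm g\<rceil>)" by linarith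
  then have "a i * norm g \<le> a i * real (nat \<lceil>norm g\<rceil>)"
    using a_pos[of i] by (intro mult_left_mono) auto
  then show "\<bar>l g i\<bar> \<le> real (nat \<lceil>norm g\<rceil>) * a i" using l_le[of g i] by (simp add: mult.commute)
qed

lemma act_carrier: "x \<in> carrier \<Longrightarrow> act g x \<in> carrier"
  unfolding act_def by (rule translate_carrier[OF moderate_l])

lemma act_add: "act (g + h) x = act g (act h x)"
  unfolding act_def translate_translate by (rule arg_cong[where f = "\<lambda>t. translate t x"]) (simp add: l_add fun_eq_iff)

lemma act_0: "x \<in> carrier \<Longrightarrow> act 0 x = x"
proof -
  assume x: "x \<in> carrier"
  have "l 0 = (\<lambda>i. 0)" using l_scale[of 0 0] by (simp add: fun_eq_iff)
  then show ?thesis using translate_0[OF x] by (simp add: act_def)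
qed

lemma l_measurable [measurable]: "(\<lambda>g. l g i) \<in> borel_measurable borel"
proof -
  have "bounded_linear (\<lambda>g. l g i)"
    by (rule bounded_linear_intro[of _ "a i"]) (use l_add l_scale l_le in \<open>auto simp: mult.commute\<close>)
  then show ?thesis
    by (intro borel_measurable_continuous_onI linear_continuous_on)
qed

lemma mp_action_act: "mp_action vol act"
  unfolding mp_action_def
proof (intro conjI allI ballI)
  show "(\<lambda>(g, x). act g x) \<in> borel \<Otimes>\<^sub>M vol \<rightarrow>\<^sub>M vol"
    unfolding measurable_cong_sets[OF refl sets_vol]
  proof (rule measurable_restrict_space2)
    show "(\<lambda>(g, x). act g x) \<in> space (borel \<Otimes>\<^sub>M vol) \<rightarrow> carrier"
      using act_carrier by (auto simp: space_pair_measure space_vol)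
    show "(\<lambda>(g, x). act g x) \<in> borel_measurable (borel \<Otimes>\<^sub>M vol)"
    proof (rule measurable_coordinatewise_then_product)
      fix i
      have [measurable]: "(\<lambda>x. x i) \<in> borel_measurable vol"
        unfolding measurable_cong_sets[OF sets_vol refl]
        by (rule measurable_restrict_space1) (rule coord_measurable)
      have "(\<lambda>q. wrap (L i) (snd q i + l (fst q) i)) \<in> borel_measurable (borel \<Otimes>\<^sub>M vol)" by measurable
      then show "(\<lambda>q. (case q of (g, x) \<Rightarrow> act g x) i) \<in> borel_measurable (borel \<Otimes>\<^sub>M vol)"
        by (simp add: act_def translate_def case_prod_beta)
    qed
  qed
  show "distr vol vol (act g) = vol" for g
    unfolding act_def by (rule translate_distr[OF moderate_l])
qed (auto simp: act_0 act_add space_vol)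

section \<open>A fundamental domain for a dispersive element\<close>

definition dispersive :: "real^'n \<Rightarrow> bool" where
  "dispersive g \<longleftrightarrow> (\<forall>K::nat. \<exists>m::nat. \<forall>n\<ge>m. \<exists>i. 1 + 2 * real K * a i < \<bar>wrap (L i) (real n * l g i)\<bar>)"

definition side :: "real \<Rightarrow> 'i \<Rightarrow> real" where
  "side z = (\<lambda>i. if i = ax then z else 0)"

lemma moderate_side: "moderate (side z)"
  unfolding moderate_def
proof (intro exI allI)
  fix i
  have "\<bar>z\<bar> / a ax \<le> real (nat \<lceil>\<bar>z\<bar> / a ax\<rceil>)" by linarith
  then have "\<bar>z\<bar> \<le> real (nat \<lceil>\<bar>z\<bar> / a ax\<rceil>) * a ax"
    using a_pos[of ax] by (simp only: pos_divide_le_eq)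
  then show "\<bar>side z i\<bar> \<le> real (nat \<lceil>\<bar>z\<bar> / a ax\<rceil>) * a i"
    using a_pos[of i] by (auto simp: side_def)
qed

text \<open>Leaving out the coordinate \<open>ax\<close> makes these sets, and the fundamental domain built from them,
  invariant under the translations along \<open>ax\<close>.\<close>

definition tube' :: "nat \<Rightarrow> ('i \<Rightarrow> real) set" where
  "tube' K = {x \<in> carrier. \<forall>i. i \<noteq> ax \<longrightarrow> \<bar>x i\<bar> \<le> 1/2 + real K * a i}"

lemma tube'_vol [measurable]: "tube' K \<in> sets vol"
proof -
  have "{x \<in> space borel. x \<in> carrier \<and> (\<forall>i. i \<noteq> ax \<longrightarrow> \<bar>x i\<bar> \<le> 1/2 + real K * a i)} \<in> sets borel" by measurable
  then show ?thesis by (auto simp: sets_vol_iff tube'_def)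
qed

lemma tube_tube': "tube K \<subseteq> tube' K"
  using tube_carrier by (auto simp: tube'_def tube_def)

lemma tube'_mono: "J \<le> K \<Longrightarrow> tube' J \<subseteq> tube' K"
  unfolding tube'_def using a_pos by (auto intro: order_trans add_left_mono mult_right_mono less_imp_le)

definition pow :: "real^'n \<Rightarrow> int \<Rightarrow> ('i \<Rightarrow> real) \<Rightarrow> 'i \<Rightarrow> real" where
  "pow g n = act (real_of_int n *\<^sub>R g)"

lemma pow_add: "pow g (m + n) x = pow g m (pow g n x)"
  by (simp add: pow_def scaleR_left_distrib act_add)

lemma pow_0: "x \<in> carrier \<Longrightarrow> pow g 0 x = x"
  by (simp add: pow_def act_0)

lemma pow_carrier: "x \<in> carrier \<Longrightarrow> pow g n x \<in> carrier"
  by (simp add: pow_def act_carrier)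

lemma pow_coord: "pow g n x i = wrap (L i) (x i + of_int n * l g i)"
  by (simp add: pow_def act_def translate_def l_scale)

lemma pow_side:
  "pow g n (translate (side z) x) i = (if i = ax then pow g n x ax + z else pow g n x i)"
  by (auto simp: pow_coord translate_def side_def L_ax)

lemma side_tube': "x \<in> carrier \<Longrightarrow> pow g n (translate (side z) x) \<in> tube' K \<longleftrightarrow> pow g n x \<in> tube' K"
  using pow_carrier translate_carrier[OF moderate_side] by (auto simp: tube'_def pow_side)

lemma pow_measurable [measurable]: "pow g n \<in> vol \<rightarrow>\<^sub>M vol"
  unfolding pow_def by (rule mp_action_measurable[OF mp_action_act])

text \<open>In each coordinate other than \<open>ax\<close>, two points of \<open>tube' K\<close>
  are at circle distance at most \<open>1 + 2 * K * a i\<close>, so a larger displacement moves the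
  tube off itself. The displaced coordinate is not \<open>ax\<close>, on which the action is
  trivial, and \<open>abs_wrap_minus\<close> covers negative \<open>n\<close>.\<close>

lemma dispersive_bound:
  assumes "dispersive g"
  obtains m :: int where "\<And>x n. x \<in> tube' K \<Longrightarrow> pow g n x \<in> tube' K \<Longrightarrow> \<bar>n\<bar> < m"
proof -
  obtain m :: nat where m: "\<And>n. n \<ge> m \<Longrightarrow> \<exists>i. 1 + 2 * real K * a i < \<bar>wrap (L i) (real n * l g i)\<bar>"
    using assms unfolding dispersive_def by blast
  have "\<bar>n\<bar> < int m" if x: "x \<in> tube' K" "pow g n x \<in> tube' K" for x n
  proof (rule ccontr)
    assume "\<not> \<bar>n\<bar> < int m"
    then obtain i where i: "1 + 2 * real K * a i < \<bar>wrap (L i) (real (nat \<bar>n\<bar>) * l g i)\<bar>"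
      using m[of "nat \<bar>n\<bar>"] by (metis le_nat_iff linorder_not_le abs_ge_zero nat_int)
    have abs: "\<bar>wrap (L i) (real (nat \<bar>n\<bar>) * l g i)\<bar> = \<bar>wrap (L i) (of_int n * l g i)\<bar>"
      using abs_wrap_minus[of "L i" "of_int n * l g i"] by (cases "0 \<le> n") auto
    have io: "i \<noteq> ax"
    proof
      assume "i = ax"
      then have "1 + 2 * real K * a i < 0" using i by (simp add: L_ax l_ax)
      moreover have "0 \<le> 2 * real K * a i" using a_pos[of i] by simp
      ultimately show False by linarith
    qed
    have "\<bar>wrap (L i) (of_int n * l g i)\<bar> = \<bar>wrap (L i) ((x i + of_int n * l g i) + - x i)\<bar>" by simp
    also have "\<dots> \<le> \<bar>wrap (L i) (x i + of_int n * l g i)\<bar> + \<bar>wrap (L i) (- x i)\<bar>" by (rule abs_wrap_add_le)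
    also have "\<bar>wrap (L i) (- x i)\<bar> \<le> \<bar>x i\<bar>" using abs_wrap_le[of "L i" "- x i"] by simp
    also have "\<bar>x i\<bar> \<le> 1/2 + real K * a i" using x(1) io by (simp add: tube'_def)
    also have "\<bar>wrap (L i) (x i + of_int n * l g i)\<bar> \<le> 1/2 + real K * a i"
      unfolding pow_coord[symmetric] using x(2) io by (simp add: tube'_def del: pow_coord)
    finally show False using i abs by simp
  qed
  then show ?thesis by (rule that)
qed

text \<open>Selects from each orbit its last visit to the smallest \<open>tube' K\<close> that the
  orbit meets; a last visit exists because a dispersive element brings a point to a given tube only
  finitely often.\<close>

definition transversal :: "real^'n \<Rightarrow> ('i \<Rightarrow> real) set" where
  "transversal g = {x \<in> carrier. \<exists>K. x \<in> tube' K \<and> (\<forall>n::nat. 0 < n \<longrightarrow> pow g (int n) x \<notin> tube' K)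
    \<and> (\<forall>J<K. \<forall>n. pow g n x \<notin> tube' J)}"

lemma transversal_vol: "transversal g \<in> sets vol"
proof -
  define Q where "Q n K = pow g n -` tube' K \<inter> space vol" for n K
  have Q: "Q n K \<in> sets vol" for n K
    unfolding Q_def by (rule measurable_sets[OF pow_measurable tube'_vol])
  have "transversal g = (\<Union>K. (tube' K - (\<Union>n\<in>{0<..}. Q (int n) K)) - (\<Union>J\<in>{..<K}. \<Union>n. Q n J))"
  proof (rule set_eqI)
    fix x
    show "x \<in> transversal g \<longleftrightarrow>
      x \<in> (\<Union>K. (tube' K - (\<Union>n\<in>{0<..}. Q (int n) K)) - (\<Union>J\<in>{..<K}. \<Union>n. Q n J))"
    proof (cases "x \<in> carrier")
      case True
      have "x \<in> Q n K \<longleftrightarrow> pow g n x \<in> tube' K" for n K using True by (simp add: Q_def space_vol)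
      then have "x \<in> transversal g \<longleftrightarrow> (\<exists>K. x \<in> tube' K \<and> (\<forall>n::nat. 0 < n \<longrightarrow> x \<notin> Q (int n) K) \<and> (\<forall>J<K. \<forall>n. x \<notin> Q n J))"
        using True by (simp add: transversal_def)
      also have "\<dots> \<longleftrightarrow> x \<in> (\<Union>K. (tube' K - (\<Union>n\<in>{0<..}. Q (int n) K)) - (\<Union>J\<in>{..<K}. \<Union>n. Q n J))"
      proof -
        have "x \<in> (\<Union>n\<in>{0<..}. Q (int n) K) \<longleftrightarrow> \<not> (\<forall>n::nat. 0 < n \<longrightarrow> x \<notin> Q (int n) K)" for K
          unfolding UN_iff greaterThan_iff by blast
        moreover have "x \<in> (\<Union>J\<in>{..<K}. \<Union>n. Q n J) \<longleftrightarrow> \<not> (\<forall>J<K. \<forall>n. x \<notin> Q n J)" for K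
          unfolding UN_iff lessThan_iff by blast
        ultimately show ?thesis by (simp only: UN_iff Diff_iff not_not bex_UNIV conj_assoc)
      qed
      finally show ?thesis .
    qed (simp add: transversal_def tube'_def)
  qed
  also have "\<dots> \<in> sets vol"
    by (intro sets.countable_UN'' sets.Diff tube'_vol Q countableI_type)
  finally show ?thesis .
qed

lemma transversal_side:
  assumes "x \<in> carrier"
  shows "translate (side z) x \<in> transversal g \<longleftrightarrow> x \<in> transversal g"
proof -
  have "translate (side z) x \<in> tube' K \<longleftrightarrow> x \<in> tube' K" for K
    using side_tube'[OF assms, of g 0] pow_0[OF assms] pow_0[OF translate_carrier[OF moderate_side assms]] by simp
  then show ?thesis
    using side_tube'[OF assms] translate_carrier[OF moderate_side assms] assms by (simp add: transversal_def)
qed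

text \<open>\<open>S\<close> is the set of times spent in the smallest tube that the orbit meets; it
  is nonempty and, by dispersion, finite, and its maximum is the time sought.\<close>

lemma transversal_unique:
  assumes "dispersive g" "x \<in> carrier"
  shows "\<exists>!n. pow g n x \<in> transversal g"
proof -
  have ex: "\<exists>K n. pow g n x \<in> tube' K"
    using assms(2) tube_tube' pow_0[OF assms(2), of g] unfolding carrier_def by (metis UN_E subsetD)
  define K where "K = (LEAST K. \<exists>n. pow g n x \<in> tube' K)"
  have K: "\<exists>n. pow g n x \<in> tube' K" unfolding K_def by (rule LeastI_ex[OF ex])
  have Kmin: "pow g n x \<notin> tube' J" if "J < K" for J n
    using not_less_Least[of J "\<lambda>K. \<exists>n. pow g n x \<in> tube' K"] that unfolding K_def by blast
  obtain n0 where n0: "pow g n0 x \<in> tube' K" using K by blast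
  obtain m where m: "\<And>x n. x \<in> tube' K \<Longrightarrow> pow g n x \<in> tube' K \<Longrightarrow> \<bar>n\<bar> < m"
    using dispersive_bound[OF assms(1)] by blast
  define S where "S = {n. pow g n x \<in> tube' K}"
  have "S \<subseteq> {n0 - m..n0 + m}"
  proof
    fix n assume "n \<in> S"
    then have "pow g (n - n0) (pow g n0 x) \<in> tube' K"
      using pow_add[of g "n - n0" n0 x] by (simp add: S_def)
    then show "n \<in> {n0 - m..n0 + m}" using m[OF n0, of "n - n0"] by auto
  qed
  then have fin: "finite S" by (rule finite_subset) simp
  have ne: "S \<noteq> {}" using n0 by (auto simp: S_def)
  have iff: "pow g n x \<in> transversal g \<longleftrightarrow> n = Max S" for n
  proof
    assume "pow g n x \<in> transversal g"
    then obtain K' where K': "pow g n x \<in> tube' K'"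
      "\<And>k::nat. 0 < k \<Longrightarrow> pow g (int k) (pow g n x) \<notin> tube' K'"
      "\<And>J k. J < K' \<Longrightarrow> pow g k (pow g n x) \<notin> tube' J"
      by (auto simp: transversal_def)
    have "K' = K"
    proof (rule linorder_cases[of K' K])
      assume "K < K'"
      then show ?thesis using K'(3)[of K "n0 - n"] n0 pow_add[of g "n0 - n" n x] by simp
    qed (use Kmin K'(1) in auto)
    then have "n \<in> S" using K'(1) by (simp add: S_def)
    moreover have "k \<le> n" if "k \<in> S" for k
    proof (rule ccontr)
      assume "\<not> k \<le> n"
      then have "pow g (int (nat (k - n))) (pow g n x) \<in> tube' K"
        using pow_add[of g "k - n" n x] that by (simp add: S_def)
      then show False using K'(2)[of "nat (k - n)"] \<open>\<not> k \<le> n\<close> \<open>K' = K\<close> by simp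
    qed
    ultimately show "n = Max S" using fin by (intro Max_eqI[symmetric]) auto
  next
    assume n: "n = Max S"
    have "pow g n x \<in> tube' K" using Max_in[OF fin ne] n by (simp add: S_def)
    moreover have "pow g (int k) (pow g n x) \<notin> tube' K" if "0 < k" for k :: nat
    proof
      assume "pow g (int k) (pow g n x) \<in> tube' K"
      then have "int k + n \<in> S" using pow_add[of g "int k" n x] by (simp add: S_def)
      then show False using Max_ge[OF fin, of "int k + n"] n that by simp
    qed
    moreover have "pow g k (pow g n x) \<notin> tube' J" if "J < K" for J k
      using Kmin[OF that, of "k + n"] pow_add[of g k n x] by simp
    ultimately show "pow g n x \<in> transversal g"
      using pow_carrier[OF assms(2)] unfolding transversal_def by blast
  qed
  then show ?thesis by (intro ex1I[of _ "Max S"]) simp_all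
qed

text \<open>The representative of a point of \<open>tube K\<close> sits in a tube no larger than
  \<open>tube' K\<close>, so both lie in \<open>tube' K\<close> and dispersion bounds the time
  between them.\<close>

lemma transversal_proper:
  assumes "dispersive g"
  shows "finite {n. \<exists>x\<in>tube K. pow g n x \<in> transversal g}"
proof -
  obtain m where m: "\<And>x n. x \<in> tube' K \<Longrightarrow> pow g n x \<in> tube' K \<Longrightarrow> \<bar>n\<bar> < m"
    using dispersive_bound[OF assms] by blast
  have "{n. \<exists>x\<in>tube K. pow g n x \<in> transversal g} \<subseteq> {- m..m}"
  proof
    fix n assume "n \<in> {n. \<exists>x\<in>tube K. pow g n x \<in> transversal g}"
    then obtain x where x: "x \<in> tube K" "pow g n x \<in> transversal g" by blast
    then obtain K' where K': "pow g n x \<in> tube' K'" "\<And>J k. J < K' \<Longrightarrow> pow g k (pow g n x) \<notin> tube' J"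
      by (auto simp: transversal_def)
    have xK: "x \<in> tube' K" "x \<in> carrier" using x tube_tube' tube_carrier by auto
    have "K' \<le> K"
    proof (rule ccontr)
      assume "\<not> K' \<le> K"
      then show False using K'(2)[of K "- n"] xK pow_add[of g "- n" n x] pow_0[of x g] by simp
    qed
    then have "pow g n x \<in> tube' K" using K'(1) tube'_mono by blast
    then have "\<bar>n\<bar> < m" by (rule m[OF xK(1)])
    then show "n \<in> {- m..m}" by auto
  qed
  then show ?thesis by (rule finite_subset) simp
qed

text \<open>The transversal is cut into slabs \<open>D z\<close> of thickness 1 along
  \<open>ax\<close>. They have equal measure, as the transversal is invariant along
  \<open>ax\<close>, and it is positive, since otherwise countably many null sets would cover the
  space. The part of \<open>D 0\<close> in a suitable tube, moved along \<open>ax\<close> by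
  \<open>j\<close>, is \<open>E j\<close>.\<close>

lemma transversal_pieces:
  assumes g: "dispersive g"
  obtains E r where "\<And>j::nat. E j \<in> sets vol" "\<And>j. \<exists>K. E j \<subseteq> tube K" "0 < r" "\<And>j. measure vol (E j) = r"
    "disjoint_family (\<lambda>(i::nat, j). act (real i *\<^sub>R g) -` E j \<inter> carrier)"
proof -
  define D where "D z = {x \<in> transversal g. -1/2 \<le> x ax - of_int z \<and> x ax - of_int z < 1/2}" for z :: int
  have oint: "(\<lambda>x. x ax) \<in> borel_measurable vol"
    unfolding measurable_cong_sets[OF sets_vol refl] by (rule measurable_restrict_space1) (rule coord_measurable)
  have Ds: "D z \<in> sets vol" for z
  proof -
    note [measurable] = oint transversal_vol
    have "D z = {x \<in> space vol. x \<in> transversal g \<and> -1/2 \<le> x ax - of_int z \<and> x ax - of_int z < 1/2}"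
      by (auto simp: D_def transversal_def space_vol)
    also have "\<dots> \<in> sets vol" by measurable
    finally show ?thesis .
  qed
  have shift: "translate (side (of_int k)) -` D (z + k) \<inter> carrier = D z" for k z
  proof (intro equalityI subsetI)
    fix x assume "x \<in> translate (side (of_int k)) -` D (z + k) \<inter> carrier"
    then show "x \<in> D z" using transversal_side[of x "of_int k" g] by (auto simp: D_def translate_def side_def L_ax)
  next
    fix x assume x: "x \<in> D z"
    then have "x \<in> carrier" by (simp add: D_def transversal_def)
    with x show "x \<in> translate (side (of_int k)) -` D (z + k) \<inter> carrier"
      using transversal_side[of x "of_int k" g] by (auto simp: D_def translate_def side_def L_ax)
  qed
  have Dm: "emeasure vol (D z) = emeasure vol (D 0)" for z
    using emeasure_translate[OF moderate_side Ds[of "0 + z"], of "of_int z"] shift[of z 0] by simp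
  have "\<exists>K. 0 < emeasure vol (D 0 \<inter> tube K)"
  proof (rule ccontr)
    assume "\<not> (\<exists>K. 0 < emeasure vol (D 0 \<inter> tube K))"
    then have nK: "D 0 \<inter> tube K \<in> null_sets vol" for K using Ds by (intro null_setsI) (auto simp: not_less)
    have "D 0 = (\<Union>K. D 0 \<inter> tube K)" by (auto simp: D_def transversal_def carrier_def)
    then have "D 0 \<in> null_sets vol" using null_sets_UN[of "\<lambda>K. D 0 \<inter> tube K" vol] nK by simp
    then have "D z \<in> null_sets vol" for z using Dm[of z] Ds by (intro null_setsI) auto
    then have "(\<Union>z. D z) \<in> null_sets vol" by (intro null_sets_UN')  auto
    moreover have "(\<Union>z. D z) = transversal g"
    proof (intro equalityI subsetI)
      fix x assume "x \<in> transversal g"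
      then have "x \<in> D \<lfloor>x ax + 1/2\<rfloor>" unfolding D_def by simp linarith
      then show "x \<in> (\<Union>z. D z)" by blast
    qed (auto simp: D_def)
    ultimately have sn: "transversal g \<in> null_sets vol" by simp
    have "pow g n -` transversal g \<inter> carrier \<in> null_sets vol" for n
    proof (rule null_setsI)
      show "emeasure vol (pow g n -` transversal g \<inter> carrier) = 0"
        unfolding pow_def act_def emeasure_translate[OF moderate_l transversal_vol] using sn by (rule null_setsD1)
      show "pow g n -` transversal g \<inter> carrier \<in> sets vol"
        unfolding space_vol[symmetric] by (rule measurable_sets[OF pow_measurable transversal_vol])
    qed
    then have "(\<Union>n. pow g n -` transversal g \<inter> carrier) \<in> null_sets vol" by (intro null_sets_UN') auto
    moreover have "(\<Union>n. pow g n -` transversal g \<inter> carrier) = carrier"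
    proof (intro equalityI subsetI)
      fix x assume "x \<in> carrier"
      then obtain n where "pow g n x \<in> transversal g" using transversal_unique[OF g] by metis
      then show "x \<in> (\<Union>n. pow g n -` transversal g \<inter> carrier)" using \<open>x \<in> carrier\<close> by blast
    qed blast
    ultimately show False using emeasure_carrier_infinite[OF L_ax] by auto
  qed
  then obtain K where K: "0 < emeasure vol (D 0 \<inter> tube K)" by blast
  define E where "E j = translate (side (- real j)) -` (D 0 \<inter> tube K) \<inter> carrier" for j :: nat
  define r where "r = measure vol (D 0 \<inter> tube K)"
  have DK: "D 0 \<inter> tube K \<in> sets vol" using Ds by auto
  have fin: "emeasure vol (D 0 \<inter> tube K) < \<infinity>"
    using emeasure_mono[of "D 0 \<inter> tube K" "tube K" vol] emeasure_tube_finite[of K] by (simp add: le_less_trans)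
  have ED: "E j \<subseteq> D (int j)" for j
  proof -
    have "translate (side (- real j)) -` D 0 \<inter> carrier = D (int j)" using shift[of "- int j" "int j"] by simp
    then show ?thesis by (auto simp: E_def)
  qed
  show ?thesis
  proof (rule that[of E r])
    show "E j \<in> sets vol" for j
      unfolding E_def space_vol[symmetric] by (rule measurable_sets[OF translate_measurable[OF moderate_side] DK])
    show "0 < r" using K fin by (simp add: r_def measure_def enn2real_positive_iff)
    show "measure vol (E j) = r" for j
      unfolding E_def r_def measure_def emeasure_translate[OF moderate_side DK] ..
    show "\<exists>K. E j \<subseteq> tube K" for j
    proof -
      obtain C :: nat where C: "\<And>i. \<bar>wrap (L i) (side (real j) i)\<bar> \<le> real C * a i"
        using moderate_wrap[OF moderate_side] by blast
      have "E j \<subseteq> tube (K + C)"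
      proof
        fix x assume x: "x \<in> E j"
        then have t: "translate (side (- real j)) x \<in> tube K" and xc: "x \<in> carrier" by (auto simp: E_def)
        have "(\<lambda>i. - side (- real j) i) = side (real j)" by (simp add: side_def fun_eq_iff)
        then have "translate (side (real j)) (translate (side (- real j)) x) = x"
          using translate_minus[OF xc, of "side (- real j)"] by simp
        then show "x \<in> tube (K + C)" using translate_tube[OF t C] by simp
      qed
      then show ?thesis by blast
    qed
    show "disjoint_family (\<lambda>(i::nat, j). act (real i *\<^sub>R g) -` E j \<inter> carrier)"
      unfolding disjoint_family_on_def
    proof (intro ballI impI, rule ccontr)
      fix p p' :: "nat \<times> nat"
      assume *: "p \<noteq> p'" "(case p of (i, j) \<Rightarrow> act (real i *\<^sub>R g) -` E j \<inter> carrier) \<inter>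
        (case p' of (i, j) \<Rightarrow> act (real i *\<^sub>R g) -` E j \<inter> carrier) \<noteq> {}"
      obtain i j i' j' where p: "p = (i, j)" "p' = (i', j')" by (cases p, cases p')
      have ne: "(i, j) \<noteq> (i', j')" using * p by simp
      obtain x where x: "x \<in> carrier" "pow g (int i) x \<in> E j" "pow g (int i') x \<in> E j'"
        using * unfolding p by (auto simp: pow_def)
      then have D: "pow g (int i) x \<in> D (int j)" "pow g (int i') x \<in> D (int j')" using ED by blast+
      then have "pow g (int i) x \<in> transversal g" "pow g (int i') x \<in> transversal g" by (auto simp: D_def)
      then have "int i = int i'" using transversal_unique[OF g x(1)] by blast
      then have i: "i = i'" by simp
      moreover have "j = j'" using D i by (simp add: D_def)
      ultimately show False using ne by simp
    qed
  qed
qed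

section \<open>Transfer of the action and its suspension to the reals\<close>

definition returning :: "(nat \<Rightarrow> real^'n) \<Rightarrow> bool" where
  "returning h \<longleftrightarrow> (\<exists>e. e \<longlonglongrightarrow> 0 \<and> (\<forall>k. e k \<le> 1) \<and> (\<forall>k i. \<bar>wrap (L i) (l (h k) i)\<bar> \<le> e k * a i))"

text \<open>Two codings are stacked: \<open>u\<close> for the points of the restricted product and
  \<open>f\<close> for the locally finite sets over its copy. The proof carries the fundamental
  domain, the pieces \<open>E j\<close> and the returns through \<open>u\<close>.\<close>

lemma realization:
  "\<exists>(N :: real measure) (V :: real^'n \<Rightarrow> real \<Rightarrow> real). prob_space N \<and> mp_action N V \<and> poisson_action N V \<and>
    (\<forall>g. dispersive g \<longrightarrow> bernoulli N (V g) \<and> transformation_entropy N (V g) = \<infinity>) \<and>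
    (\<forall>h. returning h \<longrightarrow> recurrent_along N (\<lambda>k. V (h k)))"
proof -
  obtain u :: "('i \<Rightarrow> real) \<Rightarrow> real" and v where
    uv: "u \<in> borel_measurable borel" "v \<in> borel_measurable borel" "\<And>x. v (u x) = x"
    using real_coding_exists by metis
  \<comment> \<open>The zero sequence is a default value in \<open>carrier\<close>, so that the left
    inverse is defined on all reals.\<close>
  define q where "q r = (if v r \<in> carrier then v r else (\<lambda>_. 0))" for r
  have zero: "(\<lambda>_. 0) \<in> carrier"
  proof -
    have "(\<lambda>_. 0) \<in> tube 0" using a_pos by (auto simp: tube_def fundamental_def)
    then show ?thesis using tube_carrier by blast
  qed
  interpret C: real_coding vol u q
  proof
    show "u \<in> borel_measurable vol"
      unfolding measurable_cong_sets[OF sets_vol refl] by (rule measurable_restrict_space1[OF uv(1)])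
    have "q \<in> borel_measurable borel"
      unfolding q_def using uv(2) by measurable
    then show "q \<in> borel \<rightarrow>\<^sub>M vol"
      unfolding measurable_cong_sets[OF refl sets_vol] using zero
      by (intro measurable_restrict_space2) (auto simp: q_def)
    show "q (u x) = x" if "x \<in> space vol" for x
      using that by (simp add: q_def uv(3) space_vol)
  qed
  define M where "M = C.copy"
  define X where "X K = u ` tube K" for K
  define T where "T g r = u (act g (q r))" for g r
  have spM: "space M = u ` carrier"
  proof
    show "space M \<subseteq> u ` carrier"
      using C.f_w C.w_space unfolding M_def space_vol by (metis image_eqI subsetI)
    show "u ` carrier \<subseteq> space M"
      using C.f_codes unfolding M_def C.space_copy space_vol by auto
  qed
  have emM: "emeasure M A = emeasure vol (u -` A \<inter> carrier)" if "A \<in> sets M" for A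
    using C.emeasure_copy that by (simp add: M_def space_vol)
  have qu: "q (u x) = x" if "x \<in> carrier" for x using C.w_f that by (simp add: space_vol)
  have Tu: "T g (u x) = u (act g x)" if "x \<in> carrier" for g x by (simp add: T_def qu[OF that])
  have inj_u: "inj_on u carrier" by (rule inj_on_inverseI[of _ q]) (rule qu)
  interpret B: bounded_space M X
  proof
    show "space M \<in> sets borel" unfolding M_def C.space_copy by (rule C.codes_borel)
    show "sets M = sets (restrict_space borel (space M))"
      unfolding M_def by (simp add: C.sets_copy C.space_copy)
    show "X K \<in> sets M" for K unfolding X_def M_def by (rule C.f_image_sets(1)[OF tube_vol])
    show "incseq X" unfolding X_def incseq_def using tube_mono by blast
    show "(\<Union>K. X K) = space M" unfolding X_def spM carrier_def by blast
    show "emeasure M (X K) < \<infinity>" for K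
      unfolding X_def M_def C.f_image_sets(2)[OF tube_vol] by (rule emeasure_tube_finite)
    show "emeasure M {x} = 0" if "x \<in> space M" for x
    proof -
      from that spM have "x \<in> u ` carrier" by simp
      then obtain y where y: "y \<in> carrier" "x = u y" by blast
      have "{y} \<in> sets vol" using y by (simp add: sets_vol_iff)
      from C.f_image_sets(2)[OF this] show ?thesis by (simp add: y M_def emeasure_point)
    qed
  qed
  have actT: "mp_action M T"
    unfolding M_def T_def[abs_def] by (rule C.mp_action_copy[OF mp_action_act])
  interpret B: bounded_action M X T
  proof
    show "mp_action M T" by (rule actT)
    show "\<exists>J. T g ` X K \<subseteq> X J" for g K
    proof -
      obtain C :: nat where C: "\<And>i. \<bar>wrap (L i) (l g i)\<bar> \<le> real C * a i"
        using moderate_wrap[OF moderate_l] by blast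
      have "T g ` X K \<subseteq> X (K + C)"
        unfolding X_def using translate_tube[OF _ C] Tu tube_carrier by (fastforce simp: act_def)
      then show ?thesis by blast
    qed
  qed
  obtain f w where fw: "\<And>P. sets P = sets B.point_sets \<Longrightarrow> real_coding P f w"
    using B.real_coding_point_sets by metis
  define P where "P = B.poisson_points"
  have PP: "B.poisson_law P" unfolding P_def by (rule B.poisson_law_poisson_points)
  interpret S: coded_suspension M X T P f w
  proof -
    interpret R: real_coding P f w by (rule fw) (use PP in \<open>simp add: B.poisson_law_def\<close>)
    show "coded_suspension M X T P f w" by unfold_locales (rule PP)
  qed
  have vimage_sets: "u -` A \<inter> carrier \<in> sets vol" if "A \<in> sets M" for A
    using measurable_sets[OF C.f_copy, of A] that by (simp add: M_def space_vol)
  have "sigma_finite_measure M"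
    using B.X_fin B.X_UN B.X_sets by unfold_locales (auto intro!: exI[of _ "range X"] simp: less_top[symmetric])
  then have na: "nonatomic M"
    by (intro nonatomic_if_points_null B.space_borel B.sets_M B.points_null)
  have inf: "emeasure M (space M) = \<infinity>"
  proof -
    have "carrier \<in> sets vol" by (simp add: sets_vol_iff)
    from C.f_image_sets(2)[OF this] show ?thesis
      unfolding spM by (simp add: M_def emeasure_carrier_infinite[OF L_ax])
  qed
  have pa: "poisson_action S.copy S.V" by (rule S.poisson_action_V[OF na inf])
  have disp: "bernoulli S.copy (S.V g) \<and> transformation_entropy S.copy (S.V g) = \<infinity>" if g: "dispersive g" for g
  proof
    have Tn: "T (real_of_int n *\<^sub>R g) (u x) \<in> u ` transversal g \<longleftrightarrow> pow g n x \<in> transversal g" if "x \<in> carrier" for n x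
    proof -
      have sub: "transversal g \<subseteq> carrier" by (auto simp: transversal_def)
      show ?thesis
        unfolding Tu[OF that] pow_def[symmetric] by (rule inj_on_image_mem_iff[OF inj_u pow_carrier[OF that] sub])
    qed
    show "bernoulli S.copy (S.V g)"
    proof (rule S.bernoulli_V[where W = "u ` transversal g"])
      show "u ` transversal g \<in> sets M" unfolding M_def by (rule C.f_image_sets(1)[OF transversal_vol])
      show "\<exists>!n. T (real_of_int n *\<^sub>R g) x \<in> u ` transversal g" if x: "x \<in> space M" for x
      proof -
        obtain y where "y \<in> carrier" "x = u y" using x spM by auto
        then show ?thesis using transversal_unique[OF g] by (simp add: Tn)
      qed
      show "finite {n. \<exists>x\<in>X K. T (real_of_int n *\<^sub>R g) x \<in> u ` transversal g}" for K
      proof -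
        have "{n. \<exists>x\<in>X K. T (real_of_int n *\<^sub>R g) x \<in> u ` transversal g} = {n. \<exists>x\<in>tube K. pow g n x \<in> transversal g}"
          unfolding X_def using Tn tube_carrier by blast
        then show ?thesis using transversal_proper[OF g] by simp
      qed
    qed
    obtain E r where E: "\<And>j::nat. E j \<in> sets vol" "\<And>j. \<exists>K. E j \<subseteq> tube K" "0 < r" "\<And>j. measure vol (E j) = r"
      "disjoint_family (\<lambda>(i::nat, j). act (real i *\<^sub>R g) -` E j \<inter> carrier)"
      using transversal_pieces[OF g] by metis
    show "transformation_entropy S.copy (S.V g) = \<infinity>"
    proof (rule S.transformation_entropy_V_infinite[where E = "\<lambda>j. u ` E j" and l = r])
      show "B.bdd (u ` E j)" for j
        unfolding B.bdd_def X_def using C.f_image_sets(1)[OF E(1)] E(2)[of j] by (auto simp: M_def)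
      show "measure M (u ` E j) = r" for j
        using C.f_image_sets(2)[OF E(1)[of j]] E(4)[of j] by (simp add: measure_def M_def)
      have "T (real i *\<^sub>R g) -` (u ` E j) \<inter> space M = u ` (act (real i *\<^sub>R g) -` E j \<inter> carrier)" for i j :: nat
      proof -
        have Ec: "E j \<subseteq> carrier" using E(1)[of j] by (simp add: sets_vol_iff)
        have "T (real i *\<^sub>R g) (u x) \<in> u ` E j \<longleftrightarrow> act (real i *\<^sub>R g) x \<in> E j" if "x \<in> carrier" for x
          unfolding Tu[OF that] by (rule inj_on_image_mem_iff[OF inj_u act_carrier[OF that] Ec])
        then show ?thesis unfolding spM by auto
      qed
      then have *: "(\<lambda>(i :: nat, j). T (real i *\<^sub>R g) -` u ` E j \<inter> space M) = (\<lambda>p. u ` ((\<lambda>(i::nat, j). act (real i *\<^sub>R g) -` E j \<inter> carrier) p))"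
        by (auto simp: fun_eq_iff)
      show "disjoint_family (\<lambda>(i :: nat, j). T (real i *\<^sub>R g) -` u ` E j \<inter> space M)"
        unfolding * disjoint_family_on_def
      proof (intro ballI impI)
        fix p p' :: "nat \<times> nat" assume "p \<noteq> p'"
        let ?F = "\<lambda>p. case p of (i :: nat, j) \<Rightarrow> act (real i *\<^sub>R g) -` E j \<inter> carrier"
        have Fc: "?F p \<subseteq> carrier" for p by (auto split: prod.splits)
        from \<open>p \<noteq> p'\<close> have "(case p of (i, j) \<Rightarrow> act (real i *\<^sub>R g) -` E j \<inter> carrier) \<inter> (case p' of (i, j) \<Rightarrow> act (real i *\<^sub>R g) -` E j \<inter> carrier) = {}"
          using E(5) unfolding disjoint_family_on_def by blast
        then show "u ` (case p of (i, j) \<Rightarrow> act (real i *\<^sub>R g) -` E j \<inter> carrier) \<inter> u ` (case p' of (i, j) \<Rightarrow> act (real i *\<^sub>R g) -` E j \<inter> carrier) = {}"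
          unfolding inj_on_image_Int[OF inj_u Fc Fc, symmetric] by (rule arg_cong[where f = "(`) u", THEN trans]) simp
      qed
    qed (rule E(3))
  qed
  have ret: "recurrent_along S.copy (\<lambda>k. S.V (h k))" if h: "returning h" for h
  proof (rule S.recurrent_V)
    fix A assume A: "B.bdd A"
    obtain e where e: "e \<longlonglongrightarrow> 0" "\<And>k. e k \<le> 1" "\<And>k i. \<bar>wrap (L i) (l (h k) i)\<bar> \<le> e k * a i"
      using h by (auto simp: returning_def)
    let ?A = "u -` A \<inter> carrier"
    have As: "A \<in> sets M" by (rule B.bdd_sets[OF A])
    obtain K where "A \<subseteq> X K" using A by (auto simp: B.bdd_def)
    then have AK: "?A \<subseteq> tube K"
      unfolding X_def using inj_u tube_carrier by (fastforce dest: inj_onD)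
    have lim: "(\<lambda>k. measure vol (sym_diff ?A (translate (l (h k)) -` ?A \<inter> space vol))) \<longlonglongrightarrow> 0"
      by (rule translate_recurrent[OF moderate_l e vimage_sets[OF As] AK])
    have "measure M (sym_diff A (T (h k) -` A \<inter> space M)) = measure vol (sym_diff ?A (translate (l (h k)) -` ?A \<inter> space vol))" for k
    proof -
      have Ts: "T (h k) -` A \<inter> space M \<in> sets M" by (rule measurable_sets[OF mp_action_measurable[OF actT] As])
      have "u -` (sym_diff A (T (h k) -` A \<inter> space M)) \<inter> carrier = sym_diff ?A (translate (l (h k)) -` ?A \<inter> space vol)"
      proof (rule set_eqI)
        fix x
        show "x \<in> u -` (sym_diff A (T (h k) -` A \<inter> space M)) \<inter> carrier \<longleftrightarrow>
            x \<in> sym_diff ?A (translate (l (h k)) -` ?A \<inter> space vol)"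
        proof (cases "x \<in> carrier")
          case True
          then have "u x \<in> space M" using spM by blast
          then show ?thesis
            using True Tu[OF True, of "h k"] act_carrier[OF True, of "h k"] by (simp add: space_vol act_def)
        qed (simp add: space_vol)
      qed
      then show ?thesis
        using emM[of "sym_diff A (T (h k) -` A \<inter> space M)"] As Ts by (simp add: measure_def)
    qed
    then show "(\<lambda>k. measure M (sym_diff A (T (h k) -` A \<inter> space M))) \<longlonglongrightarrow> 0"
      using lim by (simp only:)
  qed
  show ?thesis
    using S.prob_space_N S.mp_action_V pa disp ret by blast
qed

end

section \<open>Directions and scales\<close>

text \<open>Simultaneous approximation over an arbitrary finite index set. The explicit bound on
  \<open>q\<close> matters, because later scales are chosen in terms of it.\<close>

lemma Dirichlet_finite:
  fixes \<theta> :: "'a \<Rightarrow> real"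
  assumes "finite A" "0 < N"
  obtains q :: nat where "0 < q" "q \<le> N ^ card A" "\<And>x. x \<in> A \<Longrightarrow> \<exists>p::int. \<bar>real q * \<theta> x - of_int p\<bar> < 1 / real N"
proof -
  obtain f where f: "bij_betw f {0..<card A} A" using ex_bij_betw_nat_finite[OF assms(1)] by blast
  obtain q p where qp: "0 < q" "q \<le> int (N ^ card A)"
    "\<And>i. i < card A \<Longrightarrow> \<bar>of_int q * \<theta> (f i) - of_int (p i)\<bar> < 1 / real N"
    using Dirichlet_approx_simult[OF assms(2), of "card A" "\<lambda>i. \<theta> (f i)"] by metis
  have "\<exists>p::int. \<bar>real (nat q) * \<theta> x - of_int p\<bar> < 1 / real N" if "x \<in> A" for x
  proof -
    have "x \<in> f ` {0..<card A}" using f \<open>x \<in> A\<close> by (simp add: bij_betw_def)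
    then obtain i where "i < card A" "x = f i" by auto
    then show ?thesis using qp(1) qp(3)[of i] by auto
  qed
  moreover have "0 < nat q" "nat q \<le> N ^ card A" using qp(1,2) by linarith+
  ultimately show ?thesis by (intro that) auto
qed

section \<open>Cones and the component orthogonal to a direction\<close>

definition perp :: "real^'n \<Rightarrow> real^'n \<Rightarrow> real^'n" where
  "perp e g = g - (g \<bullet> e) *\<^sub>R e"

lemma perp_add: "perp e (g + h) = perp e g + perp e h"
  by (simp add: perp_def inner_add_left scaleR_left_distrib)

lemma perp_scale: "perp e (c *\<^sub>R g) = c *\<^sub>R perp e g"
  by (simp add: perp_def scaleR_right_diff_distrib)

lemma perp_self: "norm e = 1 \<Longrightarrow> perp e (c *\<^sub>R e) = 0"
  by (simp add: perp_def dot_square_norm)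

lemma norm_perp_le:
  assumes "norm e = 1"
  shows "norm (perp e g) \<le> norm g"
proof -
  have "e \<bullet> e = 1" using assms by (simp add: dot_square_norm)
  then have "(norm (perp e g))\<^sup>2 = (norm g)\<^sup>2 - (g \<bullet> e)\<^sup>2"
    unfolding power2_norm_eq_inner perp_def
    by (simp add: inner_diff_left inner_diff_right inner_commute power2_eq_square)
  then have "(norm (perp e g))\<^sup>2 \<le> (norm g)\<^sup>2" by simp
  then show ?thesis by (rule power2_le_imp_le) simp
qed

text \<open>On the unit sphere \<open>perp e\<close> vanishes only at multiples of \<open>e\<close>,
  and these lie in \<open>U\<close>; on the compact set that remains outside \<open>U\<close> its
  norm has a positive minimum. Homogeneity extends the bound to all vectors outside the
  cone.\<close>

lemma cone_gap:
  fixes U :: "(real^'n) set"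
  assumes U: "open U" "\<And>x t. x \<in> U \<Longrightarrow> t \<noteq> 0 \<Longrightarrow> t *\<^sub>R x \<in> U" and e: "e \<in> U" "norm e = 1"
  shows "\<exists>\<delta>>0. \<delta> \<le> 1 \<and> (\<forall>g. g \<noteq> 0 \<and> g \<notin> U \<longrightarrow> \<delta> * norm g \<le> norm (perp e g))"
proof -
  let ?K = "sphere 0 1 - U"
  have scale: "(1 / norm g) *\<^sub>R g \<in> ?K" if "g \<noteq> 0" "g \<notin> U" for g
  proof -
    have "(1 / norm g) *\<^sub>R g \<notin> U"
    proof
      assume "(1 / norm g) *\<^sub>R g \<in> U"
      then have "norm g *\<^sub>R ((1 / norm g) *\<^sub>R g) \<in> U" using that(1) by (rule_tac U(2)) simp_all
      then show False using that by simp
    qed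
    then show ?thesis using that(1) by simp
  qed
  show ?thesis
  proof (cases "?K = {}")
    case True
    then have "g \<in> U" if "g \<noteq> 0" for g using scale that by blast
    then show ?thesis by (intro exI[of _ "1::real"] conjI) auto
  next
    case False
    have "compact ?K" using U(1) by (intro compact_diff) auto
    moreover have "continuous_on ?K (\<lambda>x. norm (perp e x))"
      unfolding perp_def by (intro continuous_intros)
    ultimately obtain x where x: "x \<in> ?K" "\<And>y. y \<in> ?K \<Longrightarrow> norm (perp e x) \<le> norm (perp e y)"
      using continuous_attains_inf[of ?K "\<lambda>x. norm (perp e x)"] False by blast
    define \<delta> where "\<delta> = norm (perp e x)"
    have "perp e x \<noteq> 0"
    proof
      assume "perp e x = 0"
      then have xe: "x = (x \<bullet> e) *\<^sub>R e" by (simp add: perp_def)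
      moreover have "x \<noteq> 0" using x by auto
      ultimately have "x \<bullet> e \<noteq> 0" by auto
      then have "x \<in> U" using U(2)[OF e(1)] xe by metis
      then show False using x by simp
    qed
    then have "0 < \<delta>" by (simp add: \<delta>_def)
    moreover have "\<delta> \<le> 1" using norm_perp_le[OF e(2), of x] x by (simp add: \<delta>_def)
    moreover have "\<delta> * norm g \<le> norm (perp e g)" if g: "g \<noteq> 0" "g \<notin> U" for g
    proof -
      have "\<delta> \<le> norm (perp e ((1 / norm g) *\<^sub>R g))" unfolding \<delta>_def by (rule x(2)[OF scale[OF g]])
      also have "\<dots> = norm (perp e g) / norm g" by (simp add: perp_scale)
      finally show ?thesis using g by (simp add: field_simps)
    qed
    ultimately show ?thesis by blast
  qed
qed

lemma span_singleton_scale: "t \<noteq> 0 \<Longrightarrow> span {t *\<^sub>R x} = span {x :: real^'n}"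
  using span_image_scale[of "{x}" "\<lambda>_. t"] by simp

lemma line_unit_vector:
  assumes "\<theta> \<in> lines"
  obtains e :: "real^'n" where "norm e = 1" "\<theta> = span {e}"
proof -
  have th: "subspace \<theta>" "dim \<theta> = 1" using assms by (auto simp: lines_def)
  obtain B where B: "B \<subseteq> \<theta>" "independent B" "\<theta> \<subseteq> span B" "card B = dim \<theta>" using basis_exists by blast
  then obtain b where b: "B = {b}" using th by (auto simp: card_1_singleton_iff)
  then have b0: "b \<noteq> 0" using B by auto
  have "\<theta> = span {b}" using B b th span_subspace by blast
  also have "\<dots> = span {(1 / norm b) *\<^sub>R b}" using b0 by (intro span_singleton_scale[symmetric]) simp
  finally show ?thesis using b0 by (intro that[of "(1 / norm b) *\<^sub>R b"]) auto
qed

text \<open>A vector outside the union leaves some cone and, as the cones decrease, all later ones,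
  so \<open>cone_gap\<close> applies from that index on.\<close>

lemma directions_from_cones:
  fixes U :: "nat \<Rightarrow> (real^'n) set"
  assumes U: "\<And>m. open (U m)" "\<And>m x t. x \<in> U m \<Longrightarrow> t \<noteq> 0 \<Longrightarrow> t *\<^sub>R x \<in> U m"
    and dec: "\<And>m x. x \<in> U (Suc m) \<Longrightarrow> x \<in> U m"
    and e: "\<And>m. e m \<in> U m" "\<And>m. norm (e m) = 1"
    and out: "\<And>g. g \<noteq> 0 \<Longrightarrow> g \<notin> \<Union>\<Delta> \<Longrightarrow> \<exists>m. g \<notin> U m"
  shows "\<exists>\<delta>. (\<forall>m. 0 < \<delta> m \<and> \<delta> m \<le> 1) \<and>
    (\<forall>g. g \<noteq> 0 \<and> g \<notin> \<Union>\<Delta> \<longrightarrow> (\<exists>M. \<forall>m\<ge>M. \<delta> m * norm g \<le> norm (perp (e m) g)))"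
proof -
  have "\<exists>\<delta>>0. \<delta> \<le> 1 \<and> (\<forall>g. g \<noteq> 0 \<and> g \<notin> U m \<longrightarrow> \<delta> * norm g \<le> norm (perp (e m) g))" for m
    using cone_gap[OF U(1)[of m] U(2)[of _ m] e(1)[of m] e(2)[of m]] by simp
  then obtain \<delta> where \<delta>: "\<And>m. 0 < \<delta> m \<and> \<delta> m \<le> 1"
    "\<And>m g. g \<noteq> 0 \<Longrightarrow> g \<notin> U m \<Longrightarrow> \<delta> m * norm g \<le> norm (perp (e m) g)" by metis
  have "\<exists>M. \<forall>m\<ge>M. \<delta> m * norm g \<le> norm (perp (e m) g)" if g: "g \<noteq> 0" "g \<notin> \<Union>\<Delta>" for g
  proof -
    obtain M where M: "g \<notin> U M" using out[OF g] by blast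
    have "g \<notin> U m" if "M \<le> m" for m
      using that M dec by (induction m rule: dec_induct) blast+
    then show ?thesis using \<delta>(2)[OF g(1)] by blast
  qed
  then show ?thesis using \<delta>(1) by (intro exI[of _ \<delta>]) blast
qed

text \<open>The decreasing open sets whose intersection is \<open>\<Delta>\<close> lift to open
  cones. When \<open>\<Delta>\<close> is empty it offers no lines as directions, and cones with
  empty intersection are built by hand; for these two different coordinates are used, which is where
  the dimension enters.\<close>

lemma directions_exist:
  fixes \<Delta> D :: "(real^'n) set set"
  assumes dim: "2 \<le> CARD('n)" and \<Delta>: "gdelta_in projective_space \<Delta>" and D: "D \<subseteq> \<Delta>" "countable D"
  obtains e \<delta> where "\<And>m::nat. norm (e m) = 1" "\<And>m. 0 < \<delta> m" "\<And>m. \<delta> m \<le> 1"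
    "\<And>g. g \<noteq> 0 \<Longrightarrow> g \<notin> \<Union>\<Delta> \<Longrightarrow> \<exists>M. \<forall>m\<ge>M. \<delta> m * norm g \<le> norm (perp (e m) g)"
    "\<And>\<theta> k. \<theta> \<in> D \<Longrightarrow> \<exists>m\<ge>k. \<theta> = span {e m}"
proof -
  have "\<exists>e. (\<forall>m::nat. norm (e m) = 1) \<and> (\<forall>\<theta>\<in>D. \<forall>k. \<exists>m\<ge>k. \<theta> = span {e m}) \<and>
    (\<exists>\<delta>. (\<forall>m. 0 < \<delta> m \<and> \<delta> m \<le> 1) \<and>
      (\<forall>g. g \<noteq> 0 \<and> g \<notin> \<Union>\<Delta> \<longrightarrow> (\<exists>M. \<forall>m\<ge>M. \<delta> m * norm g \<le> norm (perp (e m) g))))"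
  proof (cases "\<Delta> = {}")
    case True
    have "\<exists>i j :: 'n. i \<noteq> j"
    proof (rule ccontr)
      assume "\<not> (\<exists>i j :: 'n. i \<noteq> j)"
      then have "(UNIV :: 'n set) = {undefined}" by auto
      then have "CARD('n) = card {undefined :: 'n}" by simp
      then show False using dim by simp
    qed
    then obtain i j :: 'n where ij: "i \<noteq> j" by blast
    \<comment> \<open>Sectors that shrink to the axis \<open>i\<close> but avoid it, so that nothing
      lies in all of them; \<open>z m\<close> is a vector inside the sector of index
      \<open>m\<close>.\<close>
    define U where "U m = {x :: real^'n. 0 < \<bar>x $ j\<bar> \<and> \<bar>x $ j\<bar> * real (Suc m) < \<bar>x $ i\<bar>}" for m
    define z where "z m = axis i 1 + axis j (1 / real (m + 2))" for m
    define e where "e m = (1 / norm (z m)) *\<^sub>R z m" for m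
    have zi: "z m $ i = 1" and zj: "z m $ j = 1 / real (m + 2)" for m
      using ij by (simp_all add: z_def axis_def)
    have z0: "z m \<noteq> 0" for m using zi[of m] by auto
    have Us: "t *\<^sub>R x \<in> U m" if "x \<in> U m" "t \<noteq> 0" for m x t
      using that by (auto simp: U_def abs_mult mult.assoc intro!: mult_strict_left_mono)
    have "z m \<in> U m" for m unfolding U_def mem_Collect_eq zi zj by (simp add: field_simps)
    then have eU: "e m \<in> U m" for m unfolding e_def using z0 by (intro Us) auto
    have e1: "norm (e m) = 1" for m using z0 by (simp add: e_def)
    have "\<exists>\<delta>. (\<forall>m. 0 < \<delta> m \<and> \<delta> m \<le> 1) \<and>
      (\<forall>g. g \<noteq> 0 \<and> g \<notin> \<Union>\<Delta> \<longrightarrow> (\<exists>M. \<forall>m\<ge>M. \<delta> m * norm g \<le> norm (perp (e m) g)))"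
    proof (rule directions_from_cones[where U = U])
      show "open (U m)" for m
        unfolding U_def by (intro open_Collect_conj open_Collect_less continuous_intros)
      show "x \<in> U m" if "x \<in> U (Suc m)" for m x
      proof -
        have "\<bar>x $ j\<bar> * real (Suc m) \<le> \<bar>x $ j\<bar> * real (Suc (Suc m))" by (intro mult_left_mono) auto
        also have "\<dots> < \<bar>x $ i\<bar>" using \<open>x \<in> U (Suc m)\<close> unfolding U_def by simp
        finally show ?thesis using \<open>x \<in> U (Suc m)\<close> unfolding U_def by simp
      qed
      show "\<exists>m. g \<notin> U m" for g
      proof (cases "g $ j = 0")
        case False
        obtain m where "\<bar>g $ i\<bar> / \<bar>g $ j\<bar> < real m" using reals_Archimedean2 by blast
        then have "\<bar>g $ i\<bar> < \<bar>g $ j\<bar> * real m" using False by (simp add: field_simps)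
        also have "\<dots> \<le> \<bar>g $ j\<bar> * real (Suc m)" by (intro mult_left_mono) auto
        finally show ?thesis unfolding U_def by (intro exI[of _ m]) auto
      qed (simp add: U_def)
    qed (use Us eU e1 in auto)
    then show ?thesis using e1 True D by (intro exI[of _ e]) auto
  next
    case False
    obtain C :: "nat \<Rightarrow> (real^'n) set set" where
      C: "\<And>m. openin projective_space (C m)" "\<And>m. C (Suc m) \<subseteq> C m" "\<Inter>(range C) = \<Delta>"
      using \<Delta> unfolding gdelta_in_descending by blast
    define S where "S = (if D = {} then \<Delta> else D)"
    \<comment> \<open>\<open>prod_decode\<close> lists every line of \<open>D\<close> infinitely
      often; if \<open>D\<close> is empty, one line of \<open>\<Delta>\<close> is used
      throughout.\<close>
    define \<theta> where "\<theta> m = (if D = {} then (SOME t. t \<in> \<Delta>) else from_nat_into D (fst (prod_decode m)))" for m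
    have \<theta>\<Delta>: "\<theta> m \<in> \<Delta>" for m
      using False D from_nat_into[of D] some_in_eq[of \<Delta>] by (auto simp: \<theta>_def)
    have lines: "\<Delta> \<subseteq> lines"
      using gdelta_in_subset[OF \<Delta>] by (simp add: topspace_projective_space)
    have "\<exists>e. norm e = 1 \<and> \<theta> m = span {e}" for m
      using line_unit_vector[of "\<theta> m"] \<theta>\<Delta> lines by (metis subsetD)
    then obtain e where e: "\<And>m. norm (e m) = 1" "\<And>m. \<theta> m = span {e m}" by metis
    define U where "U m = {x \<in> - {0}. span {x} \<in> C m}" for m
    have "\<exists>m\<ge>k. t = span {e m}" if t: "t \<in> D" for t k
    proof -
      obtain i where i: "from_nat_into D i = t" using from_nat_into_surj[OF D(2) t] by blast
      have "D \<noteq> {}" using t by auto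
      then have "\<theta> (prod_encode (i, k)) = t" by (simp add: \<theta>_def i)
      then show ?thesis using e(2)[of "prod_encode (i, k)"] le_prod_encode_2[of k i] by auto
    qed
    moreover have "\<exists>\<delta>. (\<forall>m. 0 < \<delta> m \<and> \<delta> m \<le> 1) \<and>
      (\<forall>g. g \<noteq> 0 \<and> g \<notin> \<Union>\<Delta> \<longrightarrow> (\<exists>M. \<forall>m\<ge>M. \<delta> m * norm g \<le> norm (perp (e m) g)))"
    proof (rule directions_from_cones[where U = U])
      show "open (U m)" for m
      proof -
        have "openin (top_of_set (- {0})) (U m)" using C(1)[of m] by (simp add: openin_projective_space U_def)
        moreover have "open (- {0 :: real^'n})" by (simp add: open_Compl)
        ultimately show ?thesis using openin_open_eq by blast
      qed
      show "t *\<^sub>R x \<in> U m" if "x \<in> U m" "t \<noteq> 0" for m x t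
        using that by (auto simp: U_def span_singleton_scale)
      show "x \<in> U m" if "x \<in> U (Suc m)" for m x using that C(2) by (auto simp: U_def)
      show "e m \<in> U m" for m
      proof -
        have "span {e m} \<in> C m" using \<theta>\<Delta>[of m] e(2)[of m] C(3) by auto
        moreover have "e m \<noteq> 0" using e(1)[of m] by auto
        ultimately show ?thesis by (simp add: U_def)
      qed
      show "\<exists>m. g \<notin> U m" if "g \<noteq> 0" "g \<notin> \<Union>\<Delta>" for g
      proof -
        have "g \<in> span {g}" by (simp add: span_base)
        then have "span {g} \<notin> \<Delta>" using that(2) by blast
        then show ?thesis using C(3) by (auto simp: U_def)
      qed
    qed (rule e(1))
    ultimately show ?thesis using e(1) by (intro exI[of _ e]) blast
  qed
  then obtain e \<delta> where "\<forall>m::nat. norm (e m) = 1" "\<forall>\<theta>\<in>D. \<forall>k. \<exists>m\<ge>k. \<theta> = span {e m}"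
    "\<forall>m. 0 < \<delta> m \<and> \<delta> m \<le> 1" "\<forall>g. g \<noteq> 0 \<and> g \<notin> \<Union>\<Delta> \<longrightarrow> (\<exists>M. \<forall>m\<ge>M. \<delta> m * norm g \<le> norm (perp (e m) g))"
    by blast
  then show ?thesis by (intro that[of e \<delta>]) auto
qed

lemma abs_component_perp_le: "norm e = 1 \<Longrightarrow> \<bar>perp e g $ b\<bar> \<le> norm g"
  using component_le_norm_cart[of "perp e g" b] norm_perp_le[of e g] by linarith

text \<open>The bound \<open>H\<close> is needed for the choice of the scales \<open>r j\<close> with \<open>j > m\<close>, which must not depend on the
  return itself.\<close>

definition returns :: "(nat \<Rightarrow> real^'n) \<Rightarrow> nat \<Rightarrow> (nat \<Rightarrow> real) \<Rightarrow> (nat \<Rightarrow> nat) \<Rightarrow> real \<Rightarrow> bool" where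
  "returns e m r L H \<longleftrightarrow>
    (\<forall>g\<in>span {e m}. norm g \<le> real m \<longrightarrow> (\<exists>n. m \<le> n \<and> 0 < n \<and> real n * norm g \<le> H \<and>
      (\<forall>j<m. \<forall>b. \<bar>wrap (L j) (perp (e j) (real n *\<^sub>R g) $ b / r j)\<bar> \<le> (1/2) ^ j / real (Suc m)))) \<and>
    (\<exists>h. h \<noteq> 0 \<and> (\<forall>i. h $ i \<in> \<int>) \<and> norm h \<le> H \<and>
      (\<forall>j<m. \<forall>b. \<bar>wrap (L j) (perp (e j) h $ b / r j)\<bar> \<le> (1/2) ^ j / real (Suc m)) \<and>
      (\<forall>b. \<bar>perp (e m) h $ b / r m\<bar> \<le> (1/2) ^ m / real (Suc m)))"

text \<open>For a multiple of \<open>e m\<close>, Dirichlet's theorem brings all coordinates of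
  index below \<open>m\<close> close to full turns. For the lattice vector it is applied to these
  coordinates of \<open>e m\<close> together with the components of \<open>e m\<close>: then
  \<open>q *\<^sub>R e m\<close> differs from an integer vector \<open>h\<close> by a short vector
  \<open>k\<close>, whose effect is small for large \<open>N\<close>.\<close>

lemma returns_exists:
  fixes e :: "nat \<Rightarrow> real^'n"
  assumes e: "\<And>m. norm (e m) = 1" and r: "\<And>j. 0 < r j" and L: "\<And>j. 0 < L j"
  shows "\<exists>H. returns e m r L H"
proof -
  let ?d = "real CARD('n)"
  \<comment> \<open>Solves for \<open>N\<close> in the requirement that the total error
    \<open>L j / N + d / (N * r j)\<close>, with \<open>d\<close> the dimension, be at most
    \<open>(1/2) ^ j / Suc m\<close>.\<close>
  define c where "c j = (real (L j) + ?d / r j) * (real (Suc m) * 2 ^ j)" for j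
  have c0: "0 \<le> c j" for j using r[of j] by (simp add: c_def)
  \<comment> \<open>The dimension is added so that the rounding error \<open>k\<close> is shorter
    than 1, which shows that \<open>h\<close> is not 0.\<close>
  define N where "N = nat \<lceil>(\<Sum>j\<le>m. c j) + ?d + 1\<rceil>"
  have Nr: "(\<Sum>j\<le>m. c j) + ?d + 1 \<le> real N" unfolding N_def by linarith
  have cN: "c j \<le> real N" if "j \<le> m" for j
    using member_le_sum[of j "{..m}" c] c0 that Nr by simp
  have s0: "0 \<le> (\<Sum>j\<le>m. c j)" using c0 by (simp add: sum_nonneg)
  have dN: "?d < real N" using Nr s0 by linarith
  then have N0: "0 < N" using of_nat_0_le_iff[of "CARD('n)"] by linarith
  have small: "real (L j) / real N + ?d / (real N * r j) \<le> (1/2) ^ j / real (Suc m)" if "j \<le> m" for j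
  proof -
    have "real (L j) / real N + ?d / (real N * r j) = (real (L j) + ?d / r j) / real N"
      by (simp add: add_divide_distrib)
    also have "\<dots> = c j / (real N * (real (Suc m) * 2 ^ j))" by (simp add: c_def)
    also have "\<dots> \<le> real N / (real N * (real (Suc m) * 2 ^ j))"
      using cN[OF that] N0 by (intro divide_right_mono) auto
    also have "\<dots> = (1/2) ^ j / real (Suc m)" using N0 by (simp add: power_one_over divide_simps del: of_nat_Suc)
    finally show ?thesis .
  qed
  have pos: "0 \<le> ?d / (real N * r j)" "0 \<le> real (L j) / real N" for j using r[of j] N0 by auto
  have wr: "\<bar>wrap (L j) (real q * x + y)\<bar> \<le> real (L j) / real N + \<bar>y\<bar>"
    if ex: "\<exists>p::int. \<bar>real q * (x / real (L j)) - of_int p\<bar> < 1 / real N" for j q x y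
  proof -
    obtain p :: int where p: "\<bar>real q * (x / real (L j)) - of_int p\<bar> < 1 / real N" using ex by blast
    have L0: "0 < real (L j)" using L[of j] by simp
    have "\<bar>wrap (L j) (real q * x + y)\<bar> \<le> \<bar>real q * x + y - real (L j) * of_int p\<bar>" by (rule abs_wrap_le_dist)
    also have "\<dots> \<le> \<bar>real q * x - real (L j) * of_int p\<bar> + \<bar>y\<bar>" by linarith
    also have "real q * x - real (L j) * of_int p = real (L j) * (real q * (x / real (L j)) - of_int p)"
      using L0 by (simp add: field_simps)
    also have "\<bar>\<dots>\<bar> \<le> real (L j) * (1 / real N)"
      unfolding abs_mult using p L0 by (simp add: mult_left_mono less_imp_le del: times_divide_eq_right)
    finally show ?thesis by simp
  qed
  let ?A = "{..<m} \<times> (UNIV :: 'n set)"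
  let ?B = "?A <+> (UNIV :: 'n set)"
  \<comment> \<open>In the first bound \<open>real m\<close> stands for \<open>norm g\<close>; in
    the second one, 1 stands for the rounding error.\<close>
  define H where "H = max (real (max m 1 * N ^ card ?A) * real m) (real (N ^ card ?B) + 1)"
  have first: "\<exists>n. m \<le> n \<and> 0 < n \<and> real n * norm g \<le> H \<and>
      (\<forall>j<m. \<forall>b. \<bar>wrap (L j) (perp (e j) (real n *\<^sub>R g) $ b / r j)\<bar> \<le> (1/2) ^ j / real (Suc m))"
    if g: "norm g \<le> real m" for g
  proof -
    \<comment> \<open>Approximating for the multiple \<open>max m 1\<close> of \<open>g\<close>
      forces the return time \<open>max m 1 * q\<close> to be at least \<open>m\<close>.\<close>
    define x where "x j b = real (max m 1) * (perp (e j) g $ b / r j)" for j b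
    obtain q :: nat where q: "0 < q" "q \<le> N ^ card ?A"
      "\<And>p. p \<in> ?A \<Longrightarrow> \<exists>z::int. \<bar>real q * (case p of (j, b) \<Rightarrow> x j b / real (L j)) - of_int z\<bar> < 1 / real N"
      using Dirichlet_finite[of ?A N "\<lambda>(j, b). x j b / real (L j)"] N0 by auto
    define n where "n = max m 1 * q"
    have "real n * norm g \<le> real (max m 1 * N ^ card ?A) * real m"
      unfolding n_def using q(2) g by (intro mult_mono of_nat_mono mult_le_mono2) simp_all
    then have "real n * norm g \<le> H" by (simp add: H_def)
    moreover have "\<bar>wrap (L j) (perp (e j) (real n *\<^sub>R g) $ b / r j)\<bar> \<le> (1/2) ^ j / real (Suc m)" if "j < m" for j b
    proof -
      have "perp (e j) (real n *\<^sub>R g) $ b / r j = real q * x j b + 0"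
        by (simp add: perp_scale n_def x_def)
      then have "\<bar>wrap (L j) (perp (e j) (real n *\<^sub>R g) $ b / r j)\<bar> \<le> real (L j) / real N"
        using wr[of q "x j b" j 0] q(3)[of "(j, b)"] that by simp
      then show ?thesis using small[of j] pos(1)[of j] that by linarith
    qed
    moreover have "m \<le> n" "0 < n" using q(1) by (auto simp: n_def max_def)
    ultimately show ?thesis by blast
  qed
  define y where "y p = (case p of Inl (j, b) \<Rightarrow> (perp (e j) (e m) $ b / r j) / real (L j) | Inr b \<Rightarrow> e m $ b)"
    for p :: "(nat \<times> 'n) + 'n"
  obtain q :: nat where q: "0 < q" "q \<le> N ^ card ?B"
    "\<And>p. p \<in> ?B \<Longrightarrow> \<exists>z::int. \<bar>real q * y p - of_int z\<bar> < 1 / real N"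
    using Dirichlet_finite[of ?B N y] N0 by (auto simp: finite_Plus_iff)
  have "\<exists>z::int. \<bar>real q * e m $ b - of_int z\<bar> < 1 / real N" for b
    using q(3)[OF InrI, of b] by (simp add: y_def)
  then obtain z :: "'n \<Rightarrow> int" where z: "\<And>b. \<bar>real q * e m $ b - of_int (z b)\<bar> < 1 / real N" by metis
  define h :: "real^'n" where "h = (\<chi> b. real_of_int (z b))"
  define k where "k = h - real q *\<^sub>R e m"
  have "norm k \<le> (\<Sum>b\<in>UNIV. \<bar>k $ b\<bar>)" by (rule norm_le_l1_cart)
  also have "\<dots> \<le> (\<Sum>b\<in>(UNIV :: 'n set). 1 / real N)"
    using z by (intro sum_mono) (simp add: k_def h_def abs_minus_commute less_imp_le)
  finally have nk: "norm k \<le> ?d / real N" by simp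
  have dN1: "?d / real N < 1" using dN N0 by simp
  have hk: "h = real q *\<^sub>R e m + k" by (simp add: k_def)
  have nq: "norm (real q *\<^sub>R e m) = real q" using e[of m] by simp
  have "h \<noteq> 0"
  proof
    assume "h = 0"
    then have "norm k = real q" using hk nq by (metis add_eq_0_iff norm_minus_cancel)
    then show False using nk dN1 q(1) by linarith
  qed
  moreover have "\<forall>i. h $ i \<in> \<int>" by (simp add: h_def)
  moreover have "norm h \<le> H"
  proof -
    have "norm h \<le> real q + norm k" unfolding hk using norm_triangle_ineq[of "real q *\<^sub>R e m" k] nq by linarith
    moreover have "real q \<le> real (N ^ card ?B)" using q(2) by (simp only: of_nat_le_iff)
    ultimately show ?thesis using nk dN1 unfolding H_def by linarith
  qed
  moreover have kj: "\<bar>perp (e j) k $ b / r j\<bar> \<le> ?d / (real N * r j)" for j b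
  proof -
    have "\<bar>perp (e j) k $ b / r j\<bar> \<le> norm k / r j"
      using abs_component_perp_le[OF e, of j k b] r[of j] by (simp add: divide_right_mono)
    also have "\<dots> \<le> (?d / real N) / r j" using nk r[of j] by (intro divide_right_mono) auto
    finally show ?thesis by simp
  qed
  moreover have "\<bar>wrap (L j) (perp (e j) h $ b / r j)\<bar> \<le> (1/2) ^ j / real (Suc m)" if j: "j < m" for j b
  proof -
    have "perp (e j) h $ b / r j = real q * (perp (e j) (e m) $ b / r j) + perp (e j) k $ b / r j"
      by (simp add: hk perp_add perp_scale add_divide_distrib)
    then have "\<bar>wrap (L j) (perp (e j) h $ b / r j)\<bar> \<le> real (L j) / real N + \<bar>perp (e j) k $ b / r j\<bar>"
      using wr[of q "perp (e j) (e m) $ b / r j" j "perp (e j) k $ b / r j"] q(3)[OF InlI, of "(j, b)"] j by (simp add: y_def)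
    then show ?thesis using kj[of j b] small[of j] j by linarith
  qed
  moreover have "\<bar>perp (e m) h $ b / r m\<bar> \<le> (1/2) ^ m / real (Suc m)" for b
  proof -
    have "perp (e m) h = perp (e m) k" by (simp add: hk perp_add perp_self[OF e])
    then show ?thesis using kj[of m b] small[of m] pos(2)[of m] by (metis add_increasing order_refl order_trans)
  qed
  ultimately show ?thesis
    unfolding returns_def using first by (intro exI[of _ H]) blast
qed

lemma returns_cong:
  assumes "\<And>j. j \<le> m \<Longrightarrow> r j = r' j" "\<And>j. j < m \<Longrightarrow> L j = L' j"
  shows "returns e m r L H \<longleftrightarrow> returns e m r' L' H"
  unfolding returns_def using assms by (simp cong: conj_cong)

text \<open>Dependent choice of pairs of sequences: at stage \<open>m\<close> the entries
  \<open>r j\<close> with \<open>j \<le> m\<close> and \<open>L j\<close> with \<open>j < m\<close>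
  are final, the others are placeholders. By \<open>returns_cong\<close> the returns of level
  \<open>m\<close> see only final entries, so they survive all later changes.\<close>

lemma scales_exist:
  fixes e :: "nat \<Rightarrow> real^'n"
  assumes e: "\<And>m. norm (e m) = 1"
  obtains r L H where "\<And>m. 2 ^ m \<le> r m" "\<And>m. odd (L m)" "\<And>m. returns e m r L (H m)"
    "\<And>m j. m < j \<Longrightarrow> 2 ^ j * real (Suc m) * H m \<le> r j"
    "\<And>m. c m * r (Suc m) / r m + 3 \<le> real (L m)"
proof -
  define P :: "nat \<Rightarrow> (nat \<Rightarrow> real) \<times> (nat \<Rightarrow> nat) \<Rightarrow> bool" where
    "P m s \<longleftrightarrow> (\<forall>j. 0 < fst s j) \<and> 2 ^ m \<le> fst s m \<and> (\<forall>j. odd (snd s j))" for m s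
  define Q :: "nat \<Rightarrow> (nat \<Rightarrow> real) \<times> (nat \<Rightarrow> nat) \<Rightarrow> (nat \<Rightarrow> real) \<times> (nat \<Rightarrow> nat) \<Rightarrow> bool" where
    "Q m s s' \<longleftrightarrow> (\<forall>j\<le>m. fst s' j = fst s j) \<and> (\<forall>j<m. snd s' j = snd s j) \<and>
      2 * fst s m \<le> fst s' (Suc m) \<and> c m * fst s' (Suc m) / fst s m + 3 \<le> real (snd s' m) \<and>
      (\<exists>H. returns e m (fst s) (snd s) H \<and> 2 ^ Suc m * real (Suc m) * H \<le> fst s' (Suc m))" for m s s'
  have "\<exists>f. \<forall>m. P m (f m) \<and> Q m (f m) (f (Suc m))"
  proof (rule dependent_nat_choice)
    show "\<exists>s. P 0 s" by (rule exI[of _ "(\<lambda>_. 1, \<lambda>_. 1)"]) (simp add: P_def)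
  next
    fix s m assume s: "P m s"
    have "0 < snd s j" for j using s odd_pos by (simp add: P_def)
    then obtain H where H: "returns e m (fst s) (snd s) H"
      using returns_exists[of e "fst s" "snd s" m] e s by (auto simp: P_def)
    define r' where "r' = max (2 * fst s m) (2 ^ Suc m * real (Suc m) * H)"
    \<comment> \<open>Twice a natural number plus 1, to make the length odd.\<close>
    define L' where "L' = 2 * nat \<lceil>c m * r' / fst s m + 3\<rceil> + 1"
    have L': "c m * r' / fst s m + 3 \<le> real L'" unfolding L'_def by linarith
    have r': "2 * fst s m \<le> r'" "2 ^ Suc m * real (Suc m) * H \<le> r'" by (simp_all add: r'_def)
    have pos: "0 < fst s m" "2 ^ m \<le> fst s m" using s by (simp_all add: P_def)
    have "P (Suc m) ((fst s)(Suc m := r'), (snd s)(m := L'))"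
    proof -
      have "0 < r'" using r'(1) pos(1) by linarith
      moreover have "2 ^ Suc m \<le> r'" using r'(1) pos(2) by simp
      ultimately show ?thesis using s by (simp add: P_def L'_def)
    qed
    moreover have "Q m s ((fst s)(Suc m := r'), (snd s)(m := L'))"
      using H r' L' by (auto simp: Q_def)
    ultimately show "\<exists>s'. P (Suc m) s' \<and> Q m s s'" by blast
  qed
  then obtain f where f: "\<And>m. P m (f m)" "\<And>m. Q m (f m) (f (Suc m))" by metis
  define r where "r m = fst (f m) m" for m
  define L where "L m = snd (f (Suc m)) m" for m
  have rj: "fst (f k) j = r j" if "j \<le> k" for j k
    using that
  proof (induction k rule: dec_induct)
    case (step k)
    then show ?case using f(2)[of k] by (simp add: Q_def)
  qed (simp add: r_def)
  have Lj: "snd (f k) j = L j" if "j < k" for j k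
    using Suc_leI[OF that]
  proof (induction k rule: dec_induct)
    case (step k)
    then show ?case using f(2)[of k] by (simp add: Q_def)
  qed (simp add: L_def)
  have "\<exists>H. returns e m r L H \<and> 2 ^ Suc m * real (Suc m) * H \<le> r (Suc m)" for m
    using f(2)[of m] returns_cong[of m "fst (f m)" r "snd (f m)" L e] rj Lj by (auto simp: Q_def)
  then obtain H where H: "\<And>m. returns e m r L (H m)" "\<And>m. 2 ^ Suc m * real (Suc m) * H m \<le> r (Suc m)" by metis
  \<comment> \<open>Doubling lets the bound for \<open>r (Suc m)\<close> imply the bounds for all
    later \<open>r j\<close>.\<close>
  have double: "2 * r m \<le> r (Suc m)" for m using f(2)[of m] rj by (simp add: Q_def)
  have "2 ^ j * real (Suc m) * H m \<le> r j" if "m < j" for m j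
    using Suc_leI[OF that]
  proof (induction j rule: dec_induct)
    case (step j)
    then have "2 * (2 ^ j * real (Suc m) * H m) \<le> 2 * r j" by simp
    then show ?case using double[of j] by (simp del: of_nat_Suc)
  qed (rule H(2))
  moreover have "2 ^ m \<le> r m" for m using f(1)[of m] by (simp add: P_def r_def)
  moreover have "odd (L m)" for m using f(1)[of "Suc m"] by (simp add: P_def L_def)
  moreover have "c m * r (Suc m) / r m + 3 \<le> real (L m)" for m using f(2)[of m] by (simp add: Q_def r_def L_def)
  ultimately show ?thesis using that H(1) by blast
qed

section \<open>Escape of vectors outside the cones\<close>

lemma component_ge_norm:
  fixes v :: "real^'n"
  obtains b where "norm v / real CARD('n) \<le> \<bar>v $ b\<bar>"
proof -
  have "\<exists>b. norm v / real CARD('n) \<le> \<bar>v $ b\<bar>"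
  proof (rule ccontr)
    assume "\<nexists>b. norm v / real CARD('n) \<le> \<bar>v $ b\<bar>"
    then have "(\<Sum>b\<in>UNIV. \<bar>v $ b\<bar>) < (\<Sum>b\<in>(UNIV :: 'n set). norm v / real CARD('n))"
      by (intro sum_strict_mono) (auto simp: not_le)
    then show False using norm_le_l1_cart[of v] by simp
  qed
  then show ?thesis using that by blast
qed

text \<open>\<open>R m\<close> is the length from which a multiple of \<open>g\<close> displaces
  some coordinate of index \<open>m\<close> by at least 3. If
  \<open>R m \<le> n * norm g < R (Suc m)\<close>, that displacement is also at most
  \<open>L m - 3\<close> by the choice of \<open>L m\<close>, so wrapping around the circle cannot
  undo it.\<close>

lemma some_coordinate_escapes:
  fixes e :: "nat \<Rightarrow> real^'n"
  assumes e: "\<And>m. norm (e m) = 1" and \<delta>: "\<And>m. 0 < \<delta> m" "\<And>m. \<delta> m \<le> 1"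
    and r: "\<And>m. 2 ^ m \<le> r m"
    and L: "\<And>m. 3 * real CARD('n) / \<delta> (Suc m) * r (Suc m) / r m + 3 \<le> real (L m)"
    and g: "g \<noteq> 0" "\<And>m. M \<le> m \<Longrightarrow> \<delta> m * norm g \<le> norm (perp (e m) g)"
  shows "\<exists>n0. \<forall>n\<ge>n0. \<exists>m\<ge>M. \<exists>b. 3 \<le> \<bar>wrap (L m) (real n * (perp (e m) g $ b / r m))\<bar>"
proof -
  define R where "R m = 3 * real CARD('n) / \<delta> m * r m" for m
  have r0: "0 < r m" for m using r[of m] by (smt (verit) zero_less_power)
  have "1 \<le> real CARD('n)" by (simp add: Suc_le_eq)
  then have R: "2 ^ m \<le> R m" for m
  proof -
    assume d: "1 \<le> real CARD('n)"
    have "1 * r m \<le> 3 * real CARD('n) / \<delta> m * r m"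
    proof (intro mult_right_mono)
      have "1 * \<delta> m \<le> 3 * real CARD('n)" using \<delta>(2)[of m] d by linarith
      then show "1 \<le> 3 * real CARD('n) / \<delta> m" using \<delta>(1)[of m] by (subst pos_le_divide_eq)
    qed (use r0[of m] in simp)
    then show ?thesis using r[of m] by (simp add: R_def)
  qed
  obtain n0 where n0: "R M / norm g < real n0" using reals_Archimedean2 by blast
  have "\<exists>m\<ge>M. \<exists>b. 3 \<le> \<bar>wrap (L m) (real n * (perp (e m) g $ b / r m))\<bar>" if n: "n0 \<le> n" for n
  proof -
    have "R M < real n0 * norm g" using n0 g(1) by (simp add: field_simps)
    also have "\<dots> \<le> real n * norm g" using n by (intro mult_right_mono) auto
    finally have 0: "\<not> real n * norm g < R (M + 0)" by simp
    \<comment> \<open>\<open>R\<close> need not be monotone, so the least index at which it exceeds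
      \<open>n * norm g\<close> is taken; \<open>R m \<ge> 2 ^ m\<close> shows that there is
      one.\<close>
    obtain k where "real n * norm g < 2 ^ k" using real_arch_pow[of 2] by auto
    also have "\<dots> \<le> 2 ^ (M + k)" by (intro power_increasing) auto
    also have "\<dots> \<le> R (M + k)" by (rule R)
    finally obtain i where i: "\<And>i'. i' < i \<Longrightarrow> \<not> real n * norm g < R (M + i')" "real n * norm g < R (M + i)"
      using ex_least_nat_le[of "\<lambda>i. real n * norm g < R (M + i)" k] by blast
    then obtain i' where i': "i = Suc i'" using 0 by (cases i) auto
    define m where "m = M + i'"
    have m: "M \<le> m" "R m \<le> real n * norm g" "real n * norm g < R (Suc m)"
      using i i' by (auto simp: m_def not_less)
    define v where "v = perp (e m) (real n *\<^sub>R g)"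
    obtain b where b: "norm v / real CARD('n) \<le> \<bar>v $ b\<bar>" by (rule component_ge_norm)
    have "3 * real CARD('n) * r m = \<delta> m * R m" using \<delta>(1)[of m] by (simp add: R_def)
    also have "\<dots> \<le> \<delta> m * (real n * norm g)" using m(2) \<delta>(1)[of m] by (intro mult_left_mono) auto
    also have "\<dots> = real n * (\<delta> m * norm g)" by simp
    also have "\<dots> \<le> real n * norm (perp (e m) g)" by (intro mult_left_mono g(2) m(1)) simp
    also have "\<dots> = norm v" by (simp add: v_def perp_scale)
    finally have "3 * r m \<le> norm v / real CARD('n)" by (simp add: field_simps)
    then have "3 * r m \<le> \<bar>v $ b\<bar>" using b by linarith
    then have lo: "3 \<le> \<bar>v $ b / r m\<bar>" using r0[of m] by (simp add: pos_le_divide_eq)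
    have "\<bar>v $ b\<bar> \<le> real n * norm g" using abs_component_perp_le[OF e, of m "real n *\<^sub>R g" b] by (simp add: v_def)
    then have "\<bar>v $ b / r m\<bar> \<le> R (Suc m) / r m" using m(3) r0[of m] by (simp add: field_simps)
    also have "\<dots> \<le> real (L m) - 3" using L[of m] by (simp add: R_def)
    finally have "3 \<le> \<bar>wrap (L m) (v $ b / r m)\<bar>" by (intro abs_wrap_ge lo)
    then show ?thesis using m(1) by (intro exI[of _ m] conjI exI[of _ b]) (auto simp: v_def perp_scale)
  qed
  then show ?thesis by blast
qed

text \<open>\<open>None\<close> contributes 1, and each of the \<open>CARD('n)\<close> components a
  geometric series with sum 2.\<close>

lemma geometric_block_sum:
  fixes F :: "(nat \<times> 'n::finite) option set"
  assumes "finite F"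
  shows "(\<Sum>i\<in>F. case i of None \<Rightarrow> 1 | Some (m, b) \<Rightarrow> (1/2) ^ m) \<le> 1 + 2 * real CARD('n)"
proof -
  let ?a = "\<lambda>i :: (nat \<times> 'n) option. case i of None \<Rightarrow> 1 | Some (m, b) \<Rightarrow> (1/2 :: real) ^ m"
  have "finite ((fst \<circ> the) ` F)" using assms by simp
  then obtain n where n: "(fst \<circ> the) ` F \<subseteq> {..<n}" using finite_nat_iff_bounded by blast
  let ?G = "{..<n} \<times> (UNIV :: 'n set)"
  have "F \<subseteq> insert None (Some ` ?G)"
  proof
    fix i assume "i \<in> F"
    then have "fst (the i) < n" using n by auto
    then show "i \<in> insert None (Some ` ?G)" by (cases i) (auto simp: image_iff)
  qed
  then have "sum ?a F \<le> sum ?a (insert None (Some ` ?G))"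
    by (intro sum_mono2) (auto split: option.split)
  also have "\<dots> = 1 + (\<Sum>(m, b)\<in>?G. (1/2) ^ m)" by (simp add: sum.reindex)
  also have "(\<Sum>(m, b)\<in>?G. (1/2 :: real) ^ m) = real CARD('n) * (\<Sum>m<n. (1/2) ^ m)"
    by (simp add: sum.cartesian_product[symmetric] sum_distrib_left)
  also have "(\<Sum>m<n. (1/2 :: real) ^ m) \<le> 2" by (simp add: sum_gp_strict)
  finally show ?thesis by (simp add: mult_left_mono mult.commute)
qed

section \<open>Assembly of the action from directions and scales\<close>

theorem proposition5p8:
  fixes \<Delta> D :: "(real^'n) set set"
  assumes "2 \<le> CARD('n)"
    and "gdelta_in projective_space \<Delta>"
    and "D \<subseteq> \<Delta>" and "countable D"
  shows "\<exists>(N :: real measure) (V :: real^'n \<Rightarrow> real \<Rightarrow> real).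
    poisson_action N V \<and> action_entropy N V = 0 \<and>
    (\<forall>g. g \<noteq> 0 \<and> g \<notin> (\<Union>\<theta>\<in>\<Delta>. \<theta>) \<longrightarrow>
      bernoulli N (V g) \<and> transformation_entropy N (V g) = \<infinity>) \<and>
    (\<forall>g \<in> (\<Union>\<theta>\<in>D. \<theta>). rigid N (V g) \<and> transformation_entropy N (V g) = 0)"
proof -
  obtain e :: "nat \<Rightarrow> real^'n" and \<delta> where e: "\<And>m. norm (e m) = 1" and \<delta>: "\<And>m. 0 < \<delta> m" "\<And>m. \<delta> m \<le> 1"
    and gap: "\<And>g. g \<noteq> 0 \<Longrightarrow> g \<notin> \<Union>\<Delta> \<Longrightarrow> \<exists>M. \<forall>m\<ge>M. \<delta> m * norm g \<le> norm (perp (e m) g)"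
    and D: "\<And>\<theta> k. \<theta> \<in> D \<Longrightarrow> \<exists>m\<ge>k. \<theta> = span {e m}"
    by (rule directions_exist[OF assms]) metis
  obtain r :: "nat \<Rightarrow> real" and L H where r: "\<And>m. 2 ^ m \<le> r m" and L: "\<And>m. odd (L m)" and H: "\<And>m. returns e m r L (H m)"
    and rH: "\<And>m j. m < j \<Longrightarrow> 2 ^ j * real (Suc m) * H m \<le> r j"
    and L_ge: "\<And>m. 3 * real CARD('n) / \<delta> (Suc m) * r (Suc m) / r m + 3 \<le> real (L m)"
    by (rule scales_exist[where e = e and c = "\<lambda>m. 3 * real CARD('n) / \<delta> (Suc m)", OF e]) metis
  have r0: "0 < r m" for m using r[of m] by (smt (verit) zero_less_power)
  \<comment> \<open>The index \<open>None\<close> is the line, and \<open>Some (m, b)\<close> is the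
    circle for component \<open>b\<close> at scale \<open>m\<close>.\<close>
  define L' :: "(nat \<times> 'n) option \<Rightarrow> nat" where "L' i = (case i of None \<Rightarrow> 0 | Some (m, b) \<Rightarrow> L m)" for i
  define a :: "(nat \<times> 'n) option \<Rightarrow> real" where "a i = (case i of None \<Rightarrow> 1 | Some (m, b) \<Rightarrow> (1/2) ^ m)" for i
  define l :: "real^'n \<Rightarrow> (nat \<times> 'n) option \<Rightarrow> real" where
    "l g i = (case i of None \<Rightarrow> 0 | Some (m, b) \<Rightarrow> perp (e m) g $ b / r m)" for g i
  note defs = L'_def a_def l_def
  interpret torus_action L' a "1 + 2 * real CARD('n)" l None
  proof
    show "L' i = 0 \<or> odd (L' i)" for i using L by (auto simp: defs split: option.split)
    show "0 < a i" for i by (auto simp: defs split: option.split)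
    show "sum a F \<le> 1 + 2 * real CARD('n)" if "finite F" for F
      using geometric_block_sum[OF that] by (simp add: a_def[abs_def])
    show "l (g + h) i = l g i + l h i" for g h i
      by (auto simp: defs perp_add add_divide_distrib split: option.split)
    show "l (c *\<^sub>R g) i = c * l g i" for c g i by (auto simp: defs perp_scale split: option.split)
    show "\<bar>l g i\<bar> \<le> a i * norm g" for g i
    proof (cases i)
      case (Some p)
      obtain m b where p: "p = (m, b)" by force
      have "\<bar>perp (e m) g $ b / r m\<bar> \<le> norm g / r m"
        using abs_component_perp_le[OF e, of m g b] r0[of m] by (simp add: divide_right_mono)
      also have "\<dots> \<le> norm g / 2 ^ m" using r[of m] by (intro divide_left_mono) (auto simp: r0)
      finally show ?thesis using Some p by (simp add: defs power_one_over)
    qed (simp add: defs)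
  qed (simp_all add: defs)
  have dispersive: "dispersive g" if g: "g \<noteq> 0" "g \<notin> (\<Union>\<theta>\<in>\<Delta>. \<theta>)" for g
    unfolding dispersive_def
  proof
    fix K :: nat
    have "g \<notin> \<Union>\<Delta>" using g(2) by simp
    then obtain M where M: "\<And>m. M \<le> m \<Longrightarrow> \<delta> m * norm g \<le> norm (perp (e m) g)" using gap[OF g(1)] by blast
    define M' where "M' = max M K"
    have "\<exists>n0. \<forall>n\<ge>n0. \<exists>m\<ge>M'. \<exists>b. 3 \<le> \<bar>wrap (L m) (real n * (perp (e m) g $ b / r m))\<bar>"
      using M by (intro some_coordinate_escapes[OF e \<delta> r L_ge g(1)]) (simp add: M'_def)
    then obtain n0 where n0: "\<And>n. n0 \<le> n \<Longrightarrow> \<exists>m\<ge>M'. \<exists>b. 3 \<le> \<bar>wrap (L m) (real n * (perp (e m) g $ b / r m))\<bar>"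
      by blast
    have "\<exists>i. 1 + 2 * real K * a i < \<bar>wrap (L' i) (real n * l g i)\<bar>" if n: "n0 \<le> n" for n
    proof -
      obtain m b where m: "M' \<le> m" "3 \<le> \<bar>wrap (L m) (real n * (perp (e m) g $ b / r m))\<bar>" using n0[OF n] by blast
      \<comment> \<open>For \<open>m \<ge> K\<close> the slack \<open>2 * K * (1/2) ^ m\<close> is
        below 2, so a displacement of 3 exceeds the threshold in \<open>dispersive\<close>.\<close>
      have "real K < 2 ^ K" by (rule of_nat_less_two_power)
      also have "\<dots> \<le> 2 ^ m" using m(1) by (intro power_increasing) (auto simp: M'_def)
      finally have "real K * (1/2) ^ m < 1" by (simp add: power_one_over field_simps)
      then have "1 + 2 * real K * a (Some (m, b)) < 3" by (simp add: defs)
      then show ?thesis using m(2) by (intro exI[of _ "Some (m, b)"]) (simp add: defs)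
    qed
    then show "\<exists>m. \<forall>n\<ge>m. \<exists>i. 1 + 2 * real K * a i < \<bar>wrap (L' i) (real n * l g i)\<bar>" by blast
  qed
  \<comment> \<open>For each \<open>k\<close> some level \<open>m \<ge> k\<close> is allowed instead
    of \<open>k\<close> itself, because a given line is spanned by \<open>e m\<close> only for
    certain \<open>m\<close>.\<close>
  have returning: "returning h"
    if h: "\<And>k. \<exists>m\<ge>k. norm (h k) \<le> H m \<and>
      (\<forall>j<m. \<forall>b. \<bar>wrap (L j) (perp (e j) (h k) $ b / r j)\<bar> \<le> (1/2) ^ j / real (Suc m)) \<and>
      (\<forall>b. \<bar>perp (e m) (h k) $ b / r m\<bar> \<le> (1/2) ^ m / real (Suc m))" for h
    unfolding returning_def
  proof (intro exI[of _ "\<lambda>k. 1 / real (Suc k)"] conjI allI)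
    show "(\<lambda>k. 1 / real (Suc k)) \<longlonglongrightarrow> 0" by real_asymp
    show "1 / real (Suc k) \<le> 1" for k by simp
    fix k i
    obtain m where m: "k \<le> m" "norm (h k) \<le> H m"
      "\<And>j b. j < m \<Longrightarrow> \<bar>wrap (L j) (perp (e j) (h k) $ b / r j)\<bar> \<le> (1/2) ^ j / real (Suc m)"
      "\<And>b. \<bar>perp (e m) (h k) $ b / r m\<bar> \<le> (1/2) ^ m / real (Suc m)" using h[of k] by blast
    show "\<bar>wrap (L' i) (l (h k) i)\<bar> \<le> 1 / real (Suc k) * a i"
    proof (cases i)
      case (Some p)
      obtain j b where p: "p = (j, b)" by force
      have "\<bar>wrap (L j) (perp (e j) (h k) $ b / r j)\<bar> \<le> (1/2) ^ j / real (Suc m)"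
      proof (cases j m rule: linorder_cases)
        case less
        then show ?thesis by (rule m(3))
      next
        case equal
        then show ?thesis using abs_wrap_le[of "L m" "perp (e m) (h k) $ b / r m"] m(4)[of b] by simp
      next
        case greater
        \<comment> \<open>The scales beyond \<open>m\<close> were chosen after \<open>H m\<close>,
          so here the displacement itself is small.\<close>
        have "\<bar>wrap (L j) (perp (e j) (h k) $ b / r j)\<bar> \<le> \<bar>perp (e j) (h k) $ b / r j\<bar>" by (rule abs_wrap_le)
        also have "\<dots> \<le> H m / r j"
          using abs_component_perp_le[OF e, of j "h k" b] m(2) r0[of j] by (simp add: divide_right_mono)
        also have "\<dots> \<le> (1/2) ^ j / real (Suc m)"
          using rH[OF greater] r0[of j] by (simp add: power_one_over field_simps del: of_nat_Suc)
        finally show ?thesis .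
      qed
      also have "\<dots> \<le> (1/2) ^ j / real (Suc k)" using m(1) by (intro divide_left_mono) auto
      finally show ?thesis using Some p by (simp add: defs del: of_nat_Suc)
    qed (simp add: defs)
  qed
  obtain N :: "real measure" and V :: "real^'n \<Rightarrow> real \<Rightarrow> real" where
    N: "prob_space N" "mp_action N V" "poisson_action N V"
    and off: "\<And>g. dispersive g \<Longrightarrow> bernoulli N (V g) \<and> transformation_entropy N (V g) = \<infinity>"
    and rec: "\<And>h. returning h \<Longrightarrow> recurrent_along N (\<lambda>k. V (h k))"
    using realization by blast
  have "\<exists>h. h \<noteq> 0 \<and> (\<forall>i. h $ i \<in> \<int>) \<and> norm h \<le> H k \<and>
      (\<forall>j<k. \<forall>b. \<bar>wrap (L j) (perp (e j) h $ b / r j)\<bar> \<le> (1/2) ^ j / real (Suc k)) \<and>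
      (\<forall>b. \<bar>perp (e k) h $ b / r k\<bar> \<le> (1/2) ^ k / real (Suc k))" for k
    using H[of k] unfolding returns_def by blast
  then obtain h where h: "\<And>k. h k \<noteq> 0" "\<And>k i. h k $ i \<in> \<int>" "\<And>k. norm (h k) \<le> H k \<and>
      (\<forall>j<k. \<forall>b. \<bar>wrap (L j) (perp (e j) (h k) $ b / r j)\<bar> \<le> (1/2) ^ j / real (Suc k)) \<and>
      (\<forall>b. \<bar>perp (e k) (h k) $ b / r k\<bar> \<le> (1/2) ^ k / real (Suc k))" by metis
  have "returning h" using h(3) by (intro returning) blast
  then have zero: "action_entropy N V = 0" by (intro recurrent_action_entropy[OF N(1,2) h(2,1)] rec)
  have "rigid N (V g) \<and> transformation_entropy N (V g) = 0" if g: "g \<in> \<theta>" "\<theta> \<in> D" for g \<theta>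
  proof -
    have "\<exists>n. k \<le> n \<and> 0 < n \<and> (\<exists>m\<ge>k. norm (real n *\<^sub>R g) \<le> H m \<and>
      (\<forall>j<m. \<forall>b. \<bar>wrap (L j) (perp (e j) (real n *\<^sub>R g) $ b / r j)\<bar> \<le> (1/2) ^ j / real (Suc m)) \<and>
      (\<forall>b. \<bar>perp (e m) (real n *\<^sub>R g) $ b / r m\<bar> \<le> (1/2) ^ m / real (Suc m)))" for k
    proof -
      \<comment> \<open>The level must also be at least \<open>norm g\<close>, as
        \<open>returns\<close> treats only multiples of \<open>e m\<close> of norm at most
        \<open>m\<close>.\<close>
      obtain m where m: "max k (nat \<lceil>norm g\<rceil>) \<le> m" "\<theta> = span {e m}" using D[OF g(2)] by blast
      have "norm g \<le> real m" using m(1) by linarith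
      then obtain n where n: "m \<le> n" "0 < n" "real n * norm g \<le> H m"
        "\<And>j b. j < m \<Longrightarrow> \<bar>wrap (L j) (perp (e j) (real n *\<^sub>R g) $ b / r j)\<bar> \<le> (1/2) ^ j / real (Suc m)"
        using H[of m] g(1) m(2) unfolding returns_def by blast
      \<comment> \<open>Since \<open>g\<close> lies on the line of \<open>e m\<close>, the circles
        of index \<open>m\<close> do not move at all.\<close>
      obtain t where "g = t *\<^sub>R e m" using g(1) m(2) by (auto simp: span_singleton)
      then have "perp (e m) (real n *\<^sub>R g) = 0" using perp_self[OF e, of m "real n * t"] by simp
      then show ?thesis using n m(1) by (intro exI[of _ n] conjI exI[of _ m]) auto
    qed
    then obtain n where n: "\<And>k. k \<le> n k" "\<And>k. 0 < n k" "\<And>k. \<exists>m\<ge>k. norm (real (n k) *\<^sub>R g) \<le> H m \<and>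
      (\<forall>j<m. \<forall>b. \<bar>wrap (L j) (perp (e j) (real (n k) *\<^sub>R g) $ b / r j)\<bar> \<le> (1/2) ^ j / real (Suc m)) \<and>
      (\<forall>b. \<bar>perp (e m) (real (n k) *\<^sub>R g) $ b / r m\<bar> \<le> (1/2) ^ m / real (Suc m))" by metis
    have rec_g: "recurrent_along N (\<lambda>k. V (real (n k) *\<^sub>R g))" by (intro rec returning n(3))
    have "filterlim n at_top sequentially" using n(1) by (intro filterlim_at_top_mono[OF filterlim_ident]) auto
    then show ?thesis
      using recurrent_rigid[OF N(1,2) _ rec_g] recurrent_transformation_entropy[OF N(1,2) n(2) rec_g] by blast
  qed
  then show ?thesis using N(3) zero off dispersive by (intro exI[of _ N] exI[of _ V]) blast
qed

end
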